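(* Let $A,B\subset M$ be unital inclusions of $\sigma$-finite von Neumann algebras with expectation. Assume that $A$ and $B$ are of type $\mathrm{III}$. Fix a faithful normal conditional expectation $E_B\colon M\to B$ and let $e_B$ be its Jones projection. Then the following conditions are equivalent. (1) $A\preceq_M B$. (2) There exists no net $(u_i)_{i\in I}$ of unitaries in $\mathcal U(A)$ such that $E_B(b^*u_ia)\to 0$ in the strong topology for all $a,b\in M$. (3) There exists no ucp map $\Psi$ on the basic construction $\langle M,B\rangle$ such that: $\Psi$ is a limit, in the topology of pointwise $\sigma$-weak convergence, of convex combinations of maps $\mathrm{Ad}(u)$ with $u\in\mathcal U(A)$; the restriction $\Psi|_M$ is normal; and $\Psi(ae_Bb^* )=0$ for all $a,b\in M$.
   Context: An inclusion $A\subset M$ (possibly non-unital, with unit $1_A$ of $A$) is *with expectation* if there is a faithful normal conditional expectation from $1_AM1_A$ onto $A$. $\langle M,B\rangle$ is the basic construction: the von Neumann algebra on the standard space $L^2(M)$ generated by $M$ and $e_B$, equal to $(JBJ)'$ where $J$ is the modular conjugation; the Jones projection $e_B$ is defined by $e_Bx\xi_\varphi=E_B(x)\xi_\varphi$ where $\varphi$ is a faithful normal state on $M$ with $\varphi\circ E_B=\varphi$ and $\xi_\varphi$ is its vector in the positive cone. $\mathrm{Ad}(u)(T)=uTu^*$; ucp = unital completely positive. Definition of $A\preceq_M B$ (for $M$ $\sigma$-finite, $A,B\subset M$ possibly non-unital von Neumann subalgebras with expectation): there exist a separable Hilbert space $H$ with a fixed minimal projection $e_{1,1}\in\mathbb B(H)$,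 a projection $f\in B\mathbin{\overline\otimes}\mathbb B(H)$, a unital normal $*$-homomorphism $\pi\colon A\to f(B\mathbin{\overline\otimes}\mathbb B(H))f$ such that $\pi(A)\subset f(B\mathbin{\overline\otimes}\mathbb B(H))f$ is with expectation, and a nonzero partial isometry $w\in(1_A\otimes e_{1,1})(M\mathbin{\overline\otimes}\mathbb B(H))f$ with $w\pi(a)=(a\otimes e_{1,1})w$ for all $a\in A$. *)

theory Defs
  imports "HOL-Analysis.Analysis"
begin

section \<open>Complex Hilbert spaces\<close>

class scaleC =
  fixes scaleC :: "complex \<Rightarrow> 'a \<Rightarrow> 'a" (infixr \<open>*\<^sub>C\<close> 75)

class complex_vector = scaleC + real_vector +
  assumes scaleC_add_right: "c *\<^sub>C (x + y) = c *\<^sub>C x + c *\<^sub>C y"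
    and scaleC_add_left: "(c + d) *\<^sub>C x = c *\<^sub>C x + d *\<^sub>C x"
    and scaleC_scaleC: "c *\<^sub>C d *\<^sub>C x = (c * d) *\<^sub>C x"
    and scaleC_of_real: "of_real r *\<^sub>C x = r *\<^sub>R x"

text \<open>The complex inner product is conjugate-linear in its first argument. Positive definiteness
  is inherited from the real inner product, which is its real part.\<close>

class complex_inner = complex_vector + real_inner +
  fixes cinner :: "'a \<Rightarrow> 'a \<Rightarrow> complex"
  assumes cinner_commute: "cinner x y = cnj (cinner y x)"
    and cinner_add_right: "cinner x (y + z) = cinner x y + cinner x z"
    and cinner_scaleC_right: "cinner x (c *\<^sub>C y) = c * cinner x y"
    and Re_cinner: "Re (cinner x y) = inner x y"

class complex_hilbert = complex_inner + complete_space

instantiation complex :: complex_hilbert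
begin
definition scaleC_complex :: "complex \<Rightarrow> complex \<Rightarrow> complex" where "scaleC_complex c x = c * x"
definition cinner_complex :: "complex \<Rightarrow> complex \<Rightarrow> complex" where "cinner_complex x y = cnj x * y"
instance
  by standard (auto simp: scaleC_complex_def cinner_complex_def algebra_simps inner_complex_def
      complex_eq_iff)
end

lemma cinner_add_left: "cinner (x + y) z = cinner x z + cinner y (z :: 'a :: complex_inner)"
  by (metis cinner_add_right cinner_commute complex_cnj_add)

lemma cinner_scaleC_left: "cinner (c *\<^sub>C x) y = cnj c * cinner x (y :: 'a :: complex_inner)"
  by (metis cinner_scaleC_right cinner_commute complex_cnj_mult)

lemma scaleC_one: "1 *\<^sub>C x = (x :: 'a :: complex_vector)"
  using scaleC_of_real[of 1 x] by simp

lemma scaleC_zero_left: "0 *\<^sub>C x = (0 :: 'a :: complex_vector)"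
  using scaleC_of_real[of 0 x] by simp

lemma scaleC_zero_right: "c *\<^sub>C 0 = (0 :: 'a :: complex_vector)"
  using scaleC_add_right[of c 0 "0::'a"] by simp

lemma scaleC_scaleR: "c *\<^sub>C (r *\<^sub>R x) = r *\<^sub>R (c *\<^sub>C (x :: 'a :: complex_vector))"
  by (metis scaleC_of_real scaleC_scaleC mult.commute)

lemma scaleC_minus_right: "c *\<^sub>C (- x) = - (c *\<^sub>C (x :: 'a :: complex_vector))"
  using scaleC_scaleR[of c "-1" x] by simp

lemma scaleC_diff_right: "c *\<^sub>C (x - y) = c *\<^sub>C x - c *\<^sub>C (y :: 'a :: complex_vector)"
  using scaleC_add_right[of c x "- y"] by (simp add: scaleC_minus_right)

lemma cinner_self: "cinner x x = of_real ((norm (x :: 'a :: complex_inner))\<^sup>2)"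
proof -
  have "Im (cinner x x) = 0"
    using arg_cong[OF cinner_commute[of x x], of Im] by simp
  then show ?thesis
    by (simp add: complex_eq_iff Re_cinner power2_norm_eq_inner)
qed

lemma norm_scaleC: "norm (c *\<^sub>C x) = cmod c * norm (x :: 'a :: complex_inner)"
proof -
  have "complex_of_real ((norm (c *\<^sub>C x))\<^sup>2) = of_real ((cmod c * norm x)\<^sup>2)"
    unfolding cinner_self[symmetric] cinner_scaleC_left cinner_scaleC_right
    by (simp add: cinner_self power_mult_distrib mult.assoc[symmetric])
      (simp add: complex_norm_square mult.commute flip: of_real_power)
  then have "(norm (c *\<^sub>C x))\<^sup>2 = (cmod c * norm x)\<^sup>2"
    using of_real_eq_iff by blast
  then show ?thesis by (simp add: power2_eq_iff_nonneg)
qed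

lemma norm_cinner_le: "cmod (cinner x y) \<le> 2 * (norm x * norm (y :: 'a :: complex_inner))"
proof -
  have "Im (cinner x y) = - inner x (\<i> *\<^sub>C y)"
    unfolding Re_cinner[symmetric] cinner_scaleC_right by simp
  then have "\<bar>Im (cinner x y)\<bar> \<le> norm x * norm y"
    using Cauchy_Schwarz_ineq2[of x "\<i> *\<^sub>C y"] by (simp add: norm_scaleC)
  moreover have "\<bar>Re (cinner x y)\<bar> \<le> norm x * norm y"
    unfolding Re_cinner by (rule Cauchy_Schwarz_ineq2)
  ultimately show ?thesis
    using cmod_le[of "cinner x y"] by linarith
qed


section \<open>Square summable sequences and Hilbert space tensor products\<close>

text \<open>\<open>'h l2seq\<close> is the Hilbert space of square summable sequences in \<open>'h\<close>;
  \<open>complex l2seq\<close> is the separable Hilbert space $\ell^2$. The space \<open>'h l2seq\<close> serves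
  as the Hilbert space tensor product of \<open>'h\<close> with $\ell^2$, see \<open>tensor_vec\<close>.\<close>

typedef (overloaded) 'h l2seq = "{f :: nat \<Rightarrow> 'h :: complex_inner. summable (\<lambda>n. (norm (f n))\<^sup>2)}"
  morphisms l2_nth Abs_l2seq
  by (rule exI[of _ "\<lambda>_. 0"]) simp

setup_lifting type_definition_l2seq

lemma summable_l2_add:
  fixes f g :: "nat \<Rightarrow> 'h :: real_inner"
  assumes "summable (\<lambda>n. (norm (f n))\<^sup>2)" "summable (\<lambda>n. (norm (g n))\<^sup>2)"
  shows "summable (\<lambda>n. (norm (f n + g n))\<^sup>2)"
proof (rule summable_comparison_test')
  show "summable (\<lambda>n. 2 * (norm (f n))\<^sup>2 + 2 * (norm (g n))\<^sup>2)"
    by (intro summable_add summable_mult assms)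
  fix n
  have "(norm (f n + g n))\<^sup>2 \<le> (norm (f n) + norm (g n))\<^sup>2"
    by (intro power_mono norm_triangle_ineq norm_ge_zero)
  also have "\<dots> \<le> 2 * (norm (f n))\<^sup>2 + 2 * (norm (g n))\<^sup>2"
    using zero_le_power2[of "norm (f n) - norm (g n)"] by (simp add: power2_sum power2_diff)
  finally show "norm ((norm (f n + g n))\<^sup>2) \<le> 2 * (norm (f n))\<^sup>2 + 2 * (norm (g n))\<^sup>2"
    by simp
qed

lemma summable_l2_cinner:
  fixes f g :: "nat \<Rightarrow> 'h :: complex_inner"
  assumes "summable (\<lambda>n. (norm (f n))\<^sup>2)" "summable (\<lambda>n. (norm (g n))\<^sup>2)"
  shows "summable (\<lambda>n. cinner (f n) (g n))"
proof (rule summable_comparison_test')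
  show "summable (\<lambda>n. (norm (f n))\<^sup>2 + (norm (g n))\<^sup>2)"
    by (intro summable_add assms)
  fix n
  show "norm (cinner (f n) (g n)) \<le> (norm (f n))\<^sup>2 + (norm (g n))\<^sup>2"
    using norm_cinner_le[of "f n" "g n"] zero_le_power2[of "norm (f n) - norm (g n)"]
    by (simp add: power2_diff)
qed

lemma summable_l2_inner:
  fixes f g :: "nat \<Rightarrow> 'h :: complex_inner"
  assumes "summable (\<lambda>n. (norm (f n))\<^sup>2)" "summable (\<lambda>n. (norm (g n))\<^sup>2)"
  shows "summable (\<lambda>n. inner (f n) (g n))"
  using summable_Re[OF summable_l2_cinner[OF assms]] by (simp add: Re_cinner)

instantiation l2seq :: (complex_inner) complex_inner
begin

lift_definition zero_l2seq :: "'a l2seq" is "\<lambda>_. 0" by simp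
lift_definition plus_l2seq :: "'a l2seq \<Rightarrow> 'a l2seq \<Rightarrow> 'a l2seq" is "\<lambda>f g n. f n + g n"
  by (rule summable_l2_add)
lift_definition uminus_l2seq :: "'a l2seq \<Rightarrow> 'a l2seq" is "\<lambda>f n. - f n" by simp
lift_definition minus_l2seq :: "'a l2seq \<Rightarrow> 'a l2seq \<Rightarrow> 'a l2seq" is "\<lambda>f g n. f n - g n"
  using summable_l2_add[of _ "\<lambda>n. - _ n"] by simp
lift_definition scaleR_l2seq :: "real \<Rightarrow> 'a l2seq \<Rightarrow> 'a l2seq" is "\<lambda>r f n. r *\<^sub>R f n"
  by (simp add: power_mult_distrib summable_mult)
lift_definition scaleC_l2seq :: "complex \<Rightarrow> 'a l2seq \<Rightarrow> 'a l2seq" is "\<lambda>c f n. c *\<^sub>C f n"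
  by (simp add: norm_scaleC power_mult_distrib summable_mult)
definition inner_l2seq :: "'a l2seq \<Rightarrow> 'a l2seq \<Rightarrow> real" where
  "inner_l2seq f g = (\<Sum>n. inner (l2_nth f n) (l2_nth g n))"
definition cinner_l2seq :: "'a l2seq \<Rightarrow> 'a l2seq \<Rightarrow> complex" where
  "cinner_l2seq f g = (\<Sum>n. cinner (l2_nth f n) (l2_nth g n))"
definition norm_l2seq :: "'a l2seq \<Rightarrow> real" where "norm_l2seq f = sqrt (inner f f)"
definition sgn_l2seq :: "'a l2seq \<Rightarrow> 'a l2seq" where "sgn_l2seq f = scaleR (inverse (norm f)) f"
definition dist_l2seq :: "'a l2seq \<Rightarrow> 'a l2seq \<Rightarrow> real" where "dist_l2seq f g = norm (f - g)"
definition uniformity_l2seq :: "('a l2seq \<times> 'a l2seq) filter" where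
  "uniformity_l2seq = (INF e\<in>{0<..}. principal {(x, y). dist x y < e})"
definition open_l2seq :: "'a l2seq set \<Rightarrow> bool" where
  "open_l2seq U \<longleftrightarrow> (\<forall>x\<in>U. eventually (\<lambda>(x', y). x' = x \<longrightarrow> y \<in> U) uniformity)"

lemma l2_nth_summable: "summable (\<lambda>n. (norm (l2_nth f n))\<^sup>2)"
  using l2_nth[of f] by simp

lemmas l2_sums = summable_l2_inner[OF l2_nth_summable l2_nth_summable]
  summable_l2_cinner[OF l2_nth_summable l2_nth_summable]

instance
proof
  fix f g h :: "'a l2seq" and r s :: real and c d :: complex
  show "f + g + h = f + (g + h)" by transfer (simp add: add.assoc)
  show "f + g = g + f" by transfer (simp add: add.commute)
  show "0 + f = f" by transfer simp
  show "- f + f = 0" by transfer simp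
  show "f - g = f + - g" by transfer simp
  show "r *\<^sub>R (f + g) = r *\<^sub>R f + r *\<^sub>R g" by transfer (simp add: scaleR_add_right)
  show "(r + s) *\<^sub>R f = r *\<^sub>R f + s *\<^sub>R f" by transfer (simp add: scaleR_add_left)
  show "r *\<^sub>R s *\<^sub>R f = (r * s) *\<^sub>R f" by transfer simp
  show "1 *\<^sub>R f = f" by transfer simp
  show "c *\<^sub>C (f + g) = c *\<^sub>C f + c *\<^sub>C g" by transfer (simp add: scaleC_add_right)
  show "(c + d) *\<^sub>C f = c *\<^sub>C f + d *\<^sub>C f" by transfer (simp add: scaleC_add_left)
  show "c *\<^sub>C d *\<^sub>C f = (c * d) *\<^sub>C f" by transfer (simp add: scaleC_scaleC)
  show "complex_of_real r *\<^sub>C f = r *\<^sub>R f" by transfer (simp add: scaleC_of_real)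
  show "dist f g = norm (f - g)" by (rule dist_l2seq_def)
  show "sgn f = scaleR (inverse (norm f)) f" by (rule sgn_l2seq_def)
  show "uniformity = (INF e\<in>{0<..}. principal {(x :: 'a l2seq, y). dist x y < e})"
    by (rule uniformity_l2seq_def)
  show "open U \<longleftrightarrow> (\<forall>x\<in>U. eventually (\<lambda>(x', y). x' = x \<longrightarrow> y \<in> U) uniformity)"
    for U :: "'a l2seq set"
    by (rule open_l2seq_def)
  show "inner f g = inner g f" by (simp add: inner_l2seq_def inner_commute)
  show "inner (f + g) h = inner f h + inner g h"
    unfolding inner_l2seq_def by (simp add: plus_l2seq.rep_eq inner_add_left suminf_add l2_sums)
  show "inner (r *\<^sub>R f) g = r * inner f g"
    unfolding inner_l2seq_def by (simp add: scaleR_l2seq.rep_eq suminf_mult l2_sums)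
  show "0 \<le> inner f f"
    unfolding inner_l2seq_def by (intro suminf_nonneg l2_sums) simp
  show "inner f f = 0 \<longleftrightarrow> f = 0"
  proof
    assume "inner f f = 0"
    then have "inner (l2_nth f n) (l2_nth f n) = 0" for n
      unfolding inner_l2seq_def using suminf_eq_zero_iff[OF l2_sums(1)[of f f]] by simp
    then show "f = 0" by transfer (auto simp: fun_eq_iff)
  qed (simp add: inner_l2seq_def zero_l2seq.rep_eq)
  show "norm f = sqrt (inner f f)" by (rule norm_l2seq_def)
  show "cinner f g = cnj (cinner g f)"
    unfolding cinner_l2seq_def
    by (subst bounded_linear.suminf[OF bounded_linear_cnj l2_sums(2)])
      (simp flip: cinner_commute)
  show "cinner f (g + h) = cinner f g + cinner f h"
    unfolding cinner_l2seq_def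
    by (simp add: plus_l2seq.rep_eq cinner_add_right suminf_add l2_sums)
  show "cinner f (c *\<^sub>C g) = c * cinner f g"
    unfolding cinner_l2seq_def
    by (simp add: scaleC_l2seq.rep_eq cinner_scaleC_right suminf_mult l2_sums)
  show "Re (cinner f g) = inner f g"
    unfolding cinner_l2seq_def inner_l2seq_def
    by (subst Re_suminf) (simp_all add: l2_sums Re_cinner)
qed

end

lemma l2seq_norm_power2: "(norm f)\<^sup>2 = (\<Sum>n. (norm (l2_nth f n))\<^sup>2)"
  by (simp add: power2_norm_eq_inner inner_l2seq_def)

lemma sum_norm_l2_nth_le: "finite S \<Longrightarrow> (\<Sum>n\<in>S. (norm (l2_nth f n))\<^sup>2) \<le> (norm f)\<^sup>2"
  unfolding l2seq_norm_power2 by (rule sum_le_suminf[OF l2_nth_summable]) auto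

lemma norm_l2_nth_le: "norm (l2_nth f n) \<le> norm f"
  by (rule power2_le_imp_le) (use sum_norm_l2_nth_le[of "{n}" f] in simp_all)

instance l2seq :: (complex_hilbert) complex_hilbert
proof
  fix X :: "nat \<Rightarrow> 'a l2seq" assume X: "Cauchy X"
  have "Cauchy (\<lambda>i. l2_nth (X i) n)" for n
  proof (rule metric_CauchyI)
    fix e :: real assume "0 < e"
    then obtain N where N: "\<forall>i\<ge>N. \<forall>j\<ge>N. dist (X i) (X j) < e"
      using metric_CauchyD[OF X] by blast
    have "dist (l2_nth (X i) n) (l2_nth (X j) n) \<le> dist (X i) (X j)" for i j
      using norm_l2_nth_le[of "X i - X j" n] by (simp add: dist_norm minus_l2seq.rep_eq)
    then show "\<exists>N. \<forall>i\<ge>N. \<forall>j\<ge>N. dist (l2_nth (X i) n) (l2_nth (X j) n) < e"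
      using N by (meson le_less_trans)
  qed
  then have "\<forall>n. \<exists>l. (\<lambda>i. l2_nth (X i) n) \<longlonglongrightarrow> l"
    by (blast intro: Cauchy_convergent[unfolded convergent_def])
  then obtain L where L: "\<And>n. (\<lambda>i. l2_nth (X i) n) \<longlonglongrightarrow> L n" by metis
  have bound: "(\<Sum>n<k. (norm (l2_nth (X i) n - L n))\<^sup>2) \<le> e\<^sup>2"
    if N: "\<forall>i\<ge>N. \<forall>j\<ge>N. dist (X i) (X j) < e" and i: "i \<ge> N" for e N i k
  proof (rule tendsto_upperbound)
    show "(\<lambda>j. \<Sum>n<k. (norm (l2_nth (X i) n - l2_nth (X j) n))\<^sup>2)
        \<longlonglongrightarrow> (\<Sum>n<k. (norm (l2_nth (X i) n - L n))\<^sup>2)"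
      by (intro tendsto_intros L)
    have "(\<Sum>n<k. (norm (l2_nth (X i) n - l2_nth (X j) n))\<^sup>2) \<le> e\<^sup>2" if "j \<ge> N" for j
    proof -
      have "(\<Sum>n<k. (norm (l2_nth (X i) n - l2_nth (X j) n))\<^sup>2) \<le> (norm (X i - X j))\<^sup>2"
        using sum_norm_l2_nth_le[of "{..<k}" "X i - X j"] by (simp add: minus_l2seq.rep_eq)
      also have "\<dots> \<le> e\<^sup>2"
        using N i that by (intro power_mono) (auto simp: dist_norm less_imp_le)
      finally show ?thesis .
    qed
    then show "\<forall>\<^sub>F j in sequentially.
        (\<Sum>n<k. (norm (l2_nth (X i) n - l2_nth (X j) n))\<^sup>2) \<le> e\<^sup>2"
      by (auto simp: eventually_sequentially)
  qed simp
  have sum: "summable (\<lambda>n. (norm (l2_nth (X i) n - L n))\<^sup>2)"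
    if "\<forall>i\<ge>N. \<forall>j\<ge>N. dist (X i) (X j) < e" "i \<ge> N" for e N i
    by (rule summableI_nonneg_bounded[where x = "e\<^sup>2"]) (auto intro: bound[OF that])
  obtain N where N: "\<forall>i\<ge>N. \<forall>j\<ge>N. dist (X i) (X j) < 1"
    using metric_CauchyD[OF X, of 1] by auto
  have "summable (\<lambda>n. (norm (l2_nth (X N) n + - (l2_nth (X N) n - L n)))\<^sup>2)"
    by (intro summable_l2_add) (use sum[OF N] in \<open>simp_all add: l2_nth_summable norm_minus_commute\<close>)
  then have "l2_nth (Abs_l2seq L) = L"
    by (intro Abs_l2seq_inverse) simp
  then obtain Y where Y: "l2_nth Y = L" by blast
  have "X \<longlonglongrightarrow> Y"
  proof (rule metric_LIMSEQ_I)
    fix r :: real assume r: "0 < r"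
    then obtain N where N: "\<forall>i\<ge>N. \<forall>j\<ge>N. dist (X i) (X j) < r / 2"
      using metric_CauchyD[OF X, of "r / 2"] by auto
    have "dist (X i) Y < r" if i: "i \<ge> N" for i
    proof -
      have "(norm (X i - Y))\<^sup>2 \<le> (r / 2)\<^sup>2"
        unfolding l2seq_norm_power2
        using bound[OF N i] sum[OF N i]
        by (intro suminf_le_const) (simp_all add: minus_l2seq.rep_eq Y)
      then have "norm (X i - Y) \<le> r / 2"
        by (rule power2_le_imp_le) (use r in simp)
      then show ?thesis using r by (simp add: dist_norm)
    qed
    then show "\<exists>N. \<forall>i\<ge>N. dist (X i) Y < r" by blast
  qed
  then show "convergent X" by (auto simp: convergent_def)
qed

text \<open>The elementary tensor of \<open>x\<close> and \<open>y\<close>. By \<open>cinner_tensor_vec\<close> and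
  \<open>tensor_vec_total\<close> these have the inner products of elementary tensors and span a dense subspace.\<close>

lift_definition tensor_vec :: "'h :: complex_inner \<Rightarrow> complex l2seq \<Rightarrow> 'h l2seq"
  is "\<lambda>x y n. y n *\<^sub>C x"
  by (simp add: norm_scaleC power_mult_distrib summable_mult2)

lemma cinner_tensor_vec:
  "cinner (tensor_vec x y) (tensor_vec x' y') = cinner x x' * cinner y y'"
proof -
  have "cinner (tensor_vec x y) (tensor_vec x' y')
      = (\<Sum>n. cinner x x' * cinner (l2_nth y n) (l2_nth y' n))"
    by (simp add: cinner_l2seq_def tensor_vec.rep_eq cinner_scaleC_left cinner_scaleC_right
        cinner_complex_def algebra_simps)
  also have "\<dots> = cinner x x' * cinner y y'"
    by (simp add: suminf_mult l2_sums cinner_l2seq_def)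
  finally show ?thesis .
qed

lemma tensor_vec_total:
  assumes "\<And>x y. cinner (tensor_vec x y) z = 0"
  shows "z = 0"
proof -
  have "l2_nth z n = 0" for n
  proof -
    define y :: "complex l2seq" where "y = Abs_l2seq (\<lambda>m. if m = n then 1 else 0)"
    have y: "l2_nth y = (\<lambda>m. if m = n then 1 else 0)"
      unfolding y_def by (rule Abs_l2seq_inverse) (auto intro!: summable_finite[of "{n}"] split: if_splits)
    have "cinner (tensor_vec (l2_nth z n) y) z
        = (\<Sum>m. if m = n then cinner (l2_nth z n) (l2_nth z n) else 0)"
      by (auto simp: cinner_l2seq_def tensor_vec.rep_eq y cinner_scaleC_left
          intro!: arg_cong[where f = suminf])
    also have "\<dots> = cinner (l2_nth z n) (l2_nth z n)"
      using sums_single[of n "\<lambda>_. cinner (l2_nth z n) (l2_nth z n)"] by (simp add: sums_iff)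
    finally show ?thesis using assms by (simp add: cinner_self)
  qed
  then show ?thesis by transfer auto
qed


section \<open>Bounded operators\<close>

definition bounded_clinear :: "('h :: complex_hilbert \<Rightarrow> 'h) \<Rightarrow> bool" where
  "bounded_clinear f \<longleftrightarrow> bounded_linear f \<and> (\<forall>c x. f (c *\<^sub>C x) = c *\<^sub>C f x)"

typedef (overloaded) 'h bop = "{f :: 'h :: complex_hilbert \<Rightarrow> 'h. bounded_clinear f}"
  morphisms apply_op Abs_bop
  by (rule exI[of _ "\<lambda>x. x"]) (simp add: bounded_clinear_def bounded_linear_ident)

setup_lifting type_definition_bop

declare [[coercion apply_op]]

instantiation bop :: (complex_hilbert) "{complex_vector, ring, monoid_mult}"
begin
lift_definition zero_bop :: "'a bop" is "\<lambda>_. 0"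
  by (simp add: bounded_clinear_def scaleC_zero_right)
lift_definition one_bop :: "'a bop" is "\<lambda>x. x"
  by (simp add: bounded_clinear_def bounded_linear_ident)
lift_definition plus_bop :: "'a bop \<Rightarrow> 'a bop \<Rightarrow> 'a bop" is "\<lambda>f g x. f x + g x"
  by (simp add: bounded_clinear_def bounded_linear_add scaleC_add_right)
lift_definition uminus_bop :: "'a bop \<Rightarrow> 'a bop" is "\<lambda>f x. - f x"
  by (simp add: bounded_clinear_def bounded_linear_minus scaleC_minus_right)
lift_definition minus_bop :: "'a bop \<Rightarrow> 'a bop \<Rightarrow> 'a bop" is "\<lambda>f g x. f x - g x"
  by (simp add: bounded_clinear_def bounded_linear_sub scaleC_diff_right)
lift_definition times_bop :: "'a bop \<Rightarrow> 'a bop \<Rightarrow> 'a bop" is "\<lambda>f g x. f (g x)"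
  by (simp add: bounded_clinear_def bounded_linear_compose)
lift_definition scaleR_bop :: "real \<Rightarrow> 'a bop \<Rightarrow> 'a bop" is "\<lambda>r f x. r *\<^sub>R f x"
  by (simp add: bounded_clinear_def bounded_linear_const_scaleR scaleC_scaleR)
lift_definition scaleC_bop :: "complex \<Rightarrow> 'a bop \<Rightarrow> 'a bop" is "\<lambda>c f x. c *\<^sub>C f x"
proof -
  fix c :: complex and f :: "'a \<Rightarrow> 'a" assume f: "bounded_clinear f"
  have "bounded_linear ((*\<^sub>C) c :: 'a \<Rightarrow> 'a)"
    by (rule bounded_linear_intro[where K = "cmod c"])
      (simp_all add: scaleC_add_right scaleC_scaleR norm_scaleC mult.commute)
  then show "bounded_clinear (\<lambda>x. c *\<^sub>C f x)"
    using f by (simp add: bounded_clinear_def bounded_linear_compose scaleC_scaleC mult.commute)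
qed
instance
proof
  fix a b c :: "'a bop" and r s :: real and z w :: complex
  show "a + b + c = a + (b + c)" by transfer (simp add: add.assoc)
  show "a + b = b + a" by transfer (simp add: add.commute)
  show "0 + a = a" by transfer simp
  show "- a + a = 0" by transfer simp
  show "a - b = a + - b" by transfer simp
  show "r *\<^sub>R (a + b) = r *\<^sub>R a + r *\<^sub>R b" by transfer (simp add: scaleR_add_right)
  show "(r + s) *\<^sub>R a = r *\<^sub>R a + s *\<^sub>R a" by transfer (simp add: scaleR_add_left)
  show "r *\<^sub>R s *\<^sub>R a = (r * s) *\<^sub>R a" by transfer simp
  show "1 *\<^sub>R a = a" by transfer simp
  show "z *\<^sub>C (a + b) = z *\<^sub>C a + z *\<^sub>C b" by transfer (simp add: scaleC_add_right)
  show "(z + w) *\<^sub>C a = z *\<^sub>C a + w *\<^sub>C a" by transfer (simp add: scaleC_add_left)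
  show "z *\<^sub>C w *\<^sub>C a = (z * w) *\<^sub>C a" by transfer (simp add: scaleC_scaleC)
  show "complex_of_real r *\<^sub>C a = r *\<^sub>R a" by transfer (simp add: scaleC_of_real)
  show "a * b * c = a * (b * c)" by transfer simp
  show "(a + b) * c = a * c + b * c" by transfer simp
  show "a * (b + c) = a * b + a * c"
    by transfer (auto simp: bounded_clinear_def fun_eq_iff bounded_linear.linear linear_add)
  show "1 * a = a" by transfer simp
  show "a * 1 = a" by transfer simp
qed
end

definition adj :: "'h :: complex_hilbert bop \<Rightarrow> 'h bop" where
  "adj T = (THE S :: 'h bop. \<forall>x y. cinner (S x) y = cinner x (T y))"

text \<open>The operator $S \otimes T$ on the tensor product of \<open>'h\<close> with $\ell^2$.\<close>

definition tensor_op :: "'h :: complex_hilbert bop \<Rightarrow> complex l2seq bop \<Rightarrow> 'h l2seq bop" where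
  "tensor_op S T = (THE R :: 'h l2seq bop. \<forall>x y. R (tensor_vec x y) = tensor_vec (S x) (T y))"

definition positive_op :: "'h :: complex_hilbert bop \<Rightarrow> bool" where
  "positive_op T \<longleftrightarrow> (\<forall>x. cinner x (T x) \<in> \<real>\<^sub>\<ge>\<^sub>0)"

definition projection :: "'h :: complex_hilbert bop \<Rightarrow> bool" where
  "projection p \<longleftrightarrow> p * p = p \<and> adj p = p"

definition partial_isometry :: "'h :: complex_hilbert bop \<Rightarrow> bool" where
  "partial_isometry w \<longleftrightarrow> projection (adj w * w)"

definition Ad :: "'h :: complex_hilbert bop \<Rightarrow> 'h bop \<Rightarrow> 'h bop" where
  "Ad u T = u * T * adj u"

definition commutant :: "'h :: complex_hilbert bop set \<Rightarrow> 'h bop set" where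
  "commutant N = {T. \<forall>x\<in>N. T * x = x * T}"

text \<open>The $\sigma$-weak topology on the bounded operators is the initial topology for the functionals
  $T \mapsto \sum_n \langle \xi_n, T \eta_n \rangle$ with
  $\sum_n \|\xi_n\|^2, \sum_n \|\eta_n\|^2 < \infty$.\<close>

definition sigma_weak_functional :: "'h :: complex_hilbert l2seq \<Rightarrow> 'h l2seq \<Rightarrow> 'h bop \<Rightarrow> complex"
  where "sigma_weak_functional \<xi> \<eta> T = (\<Sum>n. cinner (l2_nth \<xi> n) (T (l2_nth \<eta> n)))"

definition sigma_weak :: "'h :: complex_hilbert bop topology" where
  "sigma_weak = topology_generated_by
     {sigma_weak_functional \<xi> \<eta> -` U |\<xi> \<eta> U. open U}"


section \<open>Von Neumann algebras\<close>

text \<open>Von Neumann algebras are concrete, but need not contain the identity operator: the unit is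
  then a proper projection, given by \<open>unit_of\<close>. Thus corners and non-unital subalgebras are
  von Neumann algebras on the same Hilbert space.\<close>

definition von_neumann_algebra :: "'h :: complex_hilbert bop set \<Rightarrow> bool" where
  "von_neumann_algebra N \<longleftrightarrow>
     0 \<in> N \<and> (\<forall>x\<in>N. \<forall>y\<in>N. x + y \<in> N \<and> x * y \<in> N) \<and>
     (\<forall>c. \<forall>x\<in>N. c *\<^sub>C x \<in> N) \<and> (\<forall>x\<in>N. adj x \<in> N) \<and>
     closedin sigma_weak N"

definition unit_of :: "'h :: complex_hilbert bop set \<Rightarrow> 'h bop" where
  "unit_of N = (THE p. p \<in> N \<and> (\<forall>x\<in>N. p * x = x \<and> x * p = x))"

definition corner :: "'h :: complex_hilbert bop \<Rightarrow> 'h bop set \<Rightarrow> 'h bop set" where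
  "corner p N = {p * x * p |x. x \<in> N}"

definition vn_generated :: "'h :: complex_hilbert bop set \<Rightarrow> 'h bop set" where
  "vn_generated S = \<Inter>{N. von_neumann_algebra N \<and> S \<subseteq> N}"

definition vn_tensor ::
  "'h :: complex_hilbert bop set \<Rightarrow> complex l2seq bop set \<Rightarrow> 'h l2seq bop set" where
  "vn_tensor N Q = vn_generated {tensor_op x y |x y. x \<in> N \<and> y \<in> Q}"

definition unitaries :: "'h :: complex_hilbert bop set \<Rightarrow> 'h bop set" where
  "unitaries N = {u \<in> N. adj u * u = unit_of N \<and> u * adj u = unit_of N}"

definition minimal_projection :: "'h :: complex_hilbert bop set \<Rightarrow> 'h bop \<Rightarrow> bool" where
  "minimal_projection N p \<longleftrightarrow> p \<in> N \<and> projection p \<and> p \<noteq> 0 \<and>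
     (\<forall>q\<in>N. projection q \<and> p * q = q \<longrightarrow> q = 0 \<or> q = p)"

definition finite_projection :: "'h :: complex_hilbert bop set \<Rightarrow> 'h bop \<Rightarrow> bool" where
  "finite_projection N p \<longleftrightarrow> p \<in> N \<and> projection p \<and>
     (\<forall>v\<in>N. adj v * v = p \<and> p * (v * adj v) = v * adj v \<longrightarrow> v * adj v = p)"

definition type_III :: "'h :: complex_hilbert bop set \<Rightarrow> bool" where
  "type_III N \<longleftrightarrow> (\<forall>p. finite_projection N p \<longrightarrow> p = 0)"

definition sigma_finite :: "'h :: complex_hilbert bop set \<Rightarrow> bool" where
  "sigma_finite N \<longleftrightarrow>
     (\<forall>S\<subseteq>N. (\<forall>p\<in>S. projection p \<and> p \<noteq> 0) \<and> (\<forall>p\<in>S. \<forall>q\<in>S. p \<noteq> q \<longrightarrow> p * q = 0)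
        \<longrightarrow> countable S)"


section \<open>Maps between von Neumann algebras\<close>

text \<open>Maps on a von Neumann algebra are total functions on operators of which only the restriction
  to the algebra matters.\<close>

definition linear_map_on ::
  "'h :: complex_hilbert bop set \<Rightarrow> ('h bop \<Rightarrow> 'b :: complex_vector) \<Rightarrow> bool" where
  "linear_map_on N \<Phi> \<longleftrightarrow>
     (\<forall>x\<in>N. \<forall>y\<in>N. \<Phi> (x + y) = \<Phi> x + \<Phi> y) \<and> (\<forall>c. \<forall>x\<in>N. \<Phi> (c *\<^sub>C x) = c *\<^sub>C \<Phi> x)"

definition normal_on ::
  "'h :: complex_hilbert bop set \<Rightarrow> ('h bop \<Rightarrow> 'k :: complex_hilbert bop) \<Rightarrow> bool" where
  "normal_on N \<Phi> \<longleftrightarrow> continuous_map (subtopology sigma_weak N) sigma_weak \<Phi>"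

definition faithful_normal_state ::
  "'h :: complex_hilbert bop set \<Rightarrow> ('h bop \<Rightarrow> complex) \<Rightarrow> bool" where
  "faithful_normal_state N \<phi> \<longleftrightarrow>
     linear_map_on N \<phi> \<and> (\<forall>x\<in>N. \<phi> (adj x * x) \<in> \<real>\<^sub>\<ge>\<^sub>0) \<and> \<phi> (unit_of N) = 1 \<and>
     (\<forall>x\<in>N. \<phi> (adj x * x) = 0 \<longrightarrow> x = 0) \<and>
     continuous_map (subtopology sigma_weak N) euclidean \<phi>"

definition normal_star_hom ::
  "'h :: complex_hilbert bop set \<Rightarrow> ('h bop \<Rightarrow> 'k :: complex_hilbert bop) \<Rightarrow> bool" where
  "normal_star_hom N \<pi> \<longleftrightarrow>
     linear_map_on N \<pi> \<and> (\<forall>x\<in>N. \<forall>y\<in>N. \<pi> (x * y) = \<pi> x * \<pi> y) \<and>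
     (\<forall>x\<in>N. \<pi> (adj x) = adj (\<pi> x)) \<and> normal_on N \<pi>"

text \<open>A matrix of operators \<open>T i j\<close>, \<open>i, j < n\<close>, acting on the \<open>n\<close>-fold direct sum of
  the Hilbert space, is positive.\<close>

definition positive_matrix :: "nat \<Rightarrow> (nat \<Rightarrow> nat \<Rightarrow> 'h :: complex_hilbert bop) \<Rightarrow> bool" where
  "positive_matrix n T \<longleftrightarrow>
     (\<forall>x :: nat \<Rightarrow> 'h. (\<Sum>i<n. \<Sum>j<n. cinner (x i) (T i j (x j))) \<in> \<real>\<^sub>\<ge>\<^sub>0)"

definition ucp_map :: "'h :: complex_hilbert bop set \<Rightarrow> ('h bop \<Rightarrow> 'h bop) \<Rightarrow> bool" where
  "ucp_map N \<Psi> \<longleftrightarrow>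
     \<Psi> ` N \<subseteq> N \<and> linear_map_on N \<Psi> \<and> \<Psi> (unit_of N) = unit_of N \<and>
     (\<forall>n T. (\<forall>i<n. \<forall>j<n. T i j \<in> N) \<and> positive_matrix n T
        \<longrightarrow> positive_matrix n (\<lambda>i j. \<Psi> (T i j)))"

text \<open>\<open>E\<close> is a faithful normal conditional expectation from \<open>N\<close> onto \<open>A\<close>.\<close>

definition cond_expectation ::
  "'h :: complex_hilbert bop set \<Rightarrow> 'h bop set \<Rightarrow> ('h bop \<Rightarrow> 'h bop) \<Rightarrow> bool" where
  "cond_expectation N A E \<longleftrightarrow>
     E ` N \<subseteq> A \<and> (\<forall>a\<in>A. E a = a) \<and> linear_map_on N E \<and>
     (\<forall>x\<in>N. positive_op x \<longrightarrow> positive_op (E x)) \<and>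
     (\<forall>a\<in>A. \<forall>b\<in>A. \<forall>x\<in>N. E (a * x * b) = a * E x * b) \<and>
     (\<forall>x\<in>N. E (adj x * x) = 0 \<longrightarrow> x = 0) \<and> normal_on N E"

definition with_expectation ::
  "'h :: complex_hilbert bop set \<Rightarrow> 'h bop set \<Rightarrow> bool" where
  "with_expectation A N \<longleftrightarrow> von_neumann_algebra A \<and> A \<subseteq> N \<and>
     (\<exists>E. cond_expectation (corner (unit_of A) N) A E)"


section \<open>Intertwining\<close>

text \<open>Every separable Hilbert space is isomorphic to the range of a projection \<open>p\<close> on
  $\ell^2$, whose algebra of bounded operators is \<open>corner p UNIV\<close>.\<close>

definition intertwines ::
  "'k :: complex_hilbert bop set \<Rightarrow> 'k bop set \<Rightarrow> 'k bop set \<Rightarrow> bool" where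
  "intertwines M A B \<longleftrightarrow>
     (\<exists>p e f \<pi> w.
        projection p \<and> minimal_projection (corner p UNIV) e \<and>
        projection f \<and> f \<in> vn_tensor B (corner p UNIV) \<and>
        normal_star_hom A \<pi> \<and> \<pi> (unit_of A) = f \<and>
        with_expectation (\<pi> ` A) (corner f (vn_tensor B (corner p UNIV))) \<and>
        w \<in> {tensor_op (unit_of A) e * x * f |x. x \<in> vn_tensor M (corner p UNIV)} \<and>
        partial_isometry w \<and> w \<noteq> 0 \<and>
        (\<forall>a\<in>A. w * \<pi> a = tensor_op a e * w))"


section \<open>Standard forms and the basic construction\<close>

text \<open>A standard form in the sense of Haagerup: \<open>J\<close> is the modular conjugation and \<open>P\<close> the
  positive cone.\<close>

definition standard_form ::
  "'h :: complex_hilbert bop set \<Rightarrow> ('h \<Rightarrow> 'h) \<Rightarrow> 'h set \<Rightarrow> bool" where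
  "standard_form N J P \<longleftrightarrow>
     von_neumann_algebra N \<and> 1 \<in> N \<and>
     (\<forall>x y. J (x + y) = J x + J y) \<and> (\<forall>c x. J (c *\<^sub>C x) = cnj c *\<^sub>C J x) \<and>
     (\<forall>x. norm (J x) = norm x) \<and> (\<forall>x. J (J x) = x) \<and>
     P = {x. \<forall>y\<in>P. cinner x y \<in> \<real>\<^sub>\<ge>\<^sub>0} \<and>
     commutant N = {T :: 'h bop. \<exists>S\<in>N. \<forall>x. T x = J (S (J x))} \<and>
     (\<forall>c \<in> N \<inter> commutant N. \<forall>x. adj c x = J (c (J x))) \<and>
     (\<forall>x\<in>P. J x = x) \<and>
     (\<forall>T\<in>N. \<forall>x\<in>P. T (J (T (J x))) \<in> P)"

text \<open>\<open>\<rho>\<close> is the representation of \<open>M\<close> on its standard space $L^2(M)$, the type \<open>'h\<close>.\<close>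

definition standard_representation ::
  "'k :: complex_hilbert bop set \<Rightarrow> ('k bop \<Rightarrow> 'h :: complex_hilbert bop) \<Rightarrow>
   ('h \<Rightarrow> 'h) \<Rightarrow> 'h set \<Rightarrow> bool" where
  "standard_representation M \<rho> J P \<longleftrightarrow>
     normal_star_hom M \<rho> \<and> inj_on \<rho> M \<and> \<rho> (unit_of M) = 1 \<and> standard_form (\<rho> ` M) J P"

definition jones_projection ::
  "'k :: complex_hilbert bop set \<Rightarrow> ('k bop \<Rightarrow> 'h :: complex_hilbert bop) \<Rightarrow> 'h set \<Rightarrow>
   ('k bop \<Rightarrow> 'k bop) \<Rightarrow> 'h bop \<Rightarrow> bool" where
  "jones_projection M \<rho> P E e \<longleftrightarrow>
     (\<exists>\<phi> \<xi>. faithful_normal_state M \<phi> \<and> (\<forall>x\<in>M. \<phi> (E x) = \<phi> x) \<and>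
        \<xi> \<in> P \<and> (\<forall>x\<in>M. \<phi> x = cinner \<xi> (\<rho> x \<xi>)) \<and>
        (\<forall>x\<in>M. e (\<rho> x \<xi>) = \<rho> (E x) \<xi>))"

definition basic_construction ::
  "'k bop set \<Rightarrow> ('k :: complex_hilbert bop \<Rightarrow> 'h :: complex_hilbert bop) \<Rightarrow> 'h bop \<Rightarrow> 'h bop set"
  where "basic_construction M \<rho> e = vn_generated (\<rho> ` M \<union> {e})"

definition convex_combinations_Ad ::
  "'h :: complex_hilbert bop set \<Rightarrow> ('h bop \<Rightarrow> 'h bop) set" where
  "convex_combinations_Ad U =
     {\<Phi>. \<exists>n c u. (\<forall>i<n. 0 \<le> c i \<and> u i \<in> U) \<and> (\<Sum>i<n. c i) = 1 \<and>
           \<Phi> = (\<lambda>T. \<Sum>i<n::nat. c i *\<^sub>R Ad (u i) T)}"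

text \<open>Limits of nets are expressed by proper filters. A net in \<open>C\<close> corresponds to a
  filter \<open>F \<noteq> bot\<close> that eventually lies in \<open>C\<close>.\<close>

definition strongly_tendsto ::
  "('i \<Rightarrow> 'h :: complex_hilbert bop) \<Rightarrow> 'h bop \<Rightarrow> 'i filter \<Rightarrow> bool" where
  "strongly_tendsto f T F \<longleftrightarrow> (\<forall>x. ((\<lambda>i. f i x) \<longlongrightarrow> T x) F)"

definition point_sigma_weak_limit ::
  "'h :: complex_hilbert bop set \<Rightarrow> ('h bop \<Rightarrow> 'h bop) set \<Rightarrow> ('h bop \<Rightarrow> 'h bop) \<Rightarrow> bool" where
  "point_sigma_weak_limit N C \<Psi> \<longleftrightarrow>
     (\<exists>F. F \<noteq> bot \<and> (\<forall>\<^sub>F \<Phi> in F. \<Phi> \<in> C) \<and>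
        (\<forall>T\<in>N. limitin sigma_weak (\<lambda>\<Phi>. \<Phi> T) (\<Psi> T) F))"

end

theory Submission
 imports Defs
begin

text \<open>Statements (2) and (3) both deny the existence of an object, so the equivalences follow
  from a cycle: an intertwiner excludes the ucp map, a vanishing net produces the ucp map, and the
  absence of a vanishing net produces an intertwiner.

  Intertwiner against ucp map (\<open>intertwines_imp_no_ucp\<close>). Since B is of type III,
  isometries in B with orthogonal ranges fold B tensor B(l^2) into B. Hence (1) yields a nonzero y
  in M and an adjoint-preserving map s from A to B with y s(a) = a y
  (\<open>intertwines_imp_element\<close>). The operator \<open>y * e * adj y\<close> commutes with
  A, so every convex combination of the maps Ad(u) fixes it, and so does their limit. A limit that
  annihilates it forces y = 0.

  Vanishing net to ucp map (\<open>ucp_exists\<close>). Conjugation by far members of the net makes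
  the operators \<open>a * e * adj a\<close> small at given vectors. The difficulty is normality on
  M. It suffices that the limit preserves the faithful normal state phi o E_A on M, because absolute
  continuity implies normality (\<open>normal_mapI\<close>). A type III algebra has no normal trace,
  and Ad(u) need not preserve phi on A. \<open>joint_steering\<close> finds one unitary that makes
  the e-part small and at the same time hardly increases phi at one prescribed self-adjoint x in A.
  With x the gradient of the total squared deviation of phi, \<open>descent\<close> drives deviation
  and e-part to zero along convex combinations, and an ultrafilter limit gives the map.

  No vanishing net to intertwiner (\<open>mass_imp_intertwines\<close>). By
  \<open>uniform_mass\<close> some finite subset of M keeps E(b^* u a) away from zero uniformly in
  u. Isometries of B pack this subset into one element a0. Consider the averages of the operators u
  a0 e a0^* u^*. The parallelogram law (\<open>DD_parallelogram\<close>,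
  \<open>DD_dominates\<close>) makes all minimizing sequences converge strongly to one positive S
  (\<open>close_minimizers\<close>), and the mass bound gives S nonzero. That S commutes with a
  unitary v of A needs minimizing sequences that remain minimizing after translation by v. They come
  from \<open>steering\<close>.

  Both steering lemmas rest on two facts about type III algebras. \<open>min_center\<close>: an
  isometry t of A compresses a self-adjoint y to at most c + epsilon with c central and c below y; a
  central c is indifferent to conjugation by unitaries of A. \<open>isometry_approximation\<close>:
  such an isometry, if its range leaves room, is a strong limit of adjoints of unitaries.

  From S to (1). The support of S commutes with A and is carried under e by a partial isometry V of
  the algebra generated by M and e. That algebra, compressed by e, is B e, so V a V^* = pi(a) e with
  pi(a) in B, and V S = e z with z in M and z a = pi(a) z (\<open>intertwiner\<close>). Finally
  \<open>intertwiner_imp_intertwines\<close> cuts z by a central projection of A, inverts E_A(z^* z)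
  there, and obtains the faithful normal expectation onto the image of pi from b -> E_A(z^* b z).

  Throughout, algebras enter through closure under bounded weak limits (\<open>walg\<close>), and
  compactness is supplied by ultrafilters (\<open>ultra_wlim\<close>).\<close>

abbreviation (input) pos :: "'h :: complex_hilbert bop => bool" where "pos == positive_op"
abbreviation (input) lims (infix "---->" 60) where "X ----> L == tendsto X L sequentially"
notation (input) scaleR (infixr ".*" 75)
notation (input) scaleC (infixr ":*" 75)
notation (input) tendsto (infixr "--->" 55)
lemmas assoc = mult.assoc

section \<open>Complex inner products, the Riesz theorem and density\<close>

section \<open>Hilbert space geometry\<close>

lemma scaleC_minus_left:"(- c) :* x=- (c :* (x :: 'a :: complex_vector))"
proof -
 have "(- c) :* x + c :* x=0"
  by (simp add: scaleC_add_left[symmetric] scaleC_zero_left)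
 thus ?thesis by (simp add: add_eq_0_iff2)
qed

lemma scaleC_diff_left:"(c - d) :* x=c :* x - d :* (x :: 'a :: complex_vector)"
 using scaleC_add_left[of c "- d" x] by (simp add: scaleC_minus_left)

lemma scaleC_sum_right:"c :* (SUM i:I. f i)=(SUM i:I. c :* (f i :: 'a :: complex_vector))"
 by (induction I rule: infinite_finite_induct) (auto simp: scaleC_zero_right scaleC_add_right)

lemma cinner_zero_left [simp]:"cinner 0 (x :: 'a :: complex_inner)=0"
 using cinner_add_left[of 0 0 x] by simp

lemma cinner_zero_right [simp]:"cinner (x :: 'a :: complex_inner) 0=0"
 using cinner_add_right[of x 0 0] by simp

lemma cinner_minus_left:"cinner (- x) (y :: 'a :: complex_inner)=- cinner x y"
 using cinner_add_left[of x "- x" y] by (simp add: add_eq_0_iff)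

lemma cinner_minus_right:"cinner x (- y)=- cinner x (y :: 'a :: complex_inner)"
 using cinner_add_right[of x y "- y"] by (simp add: add_eq_0_iff)

lemma cinner_diff_left:"cinner (x - y) z=cinner x z - cinner y (z :: 'a :: complex_inner)"
 using cinner_add_left[of x "- y" z] by (simp add: cinner_minus_left)

lemma cinner_diff_right:"cinner x (y - z)=cinner x y - cinner x (z :: 'a :: complex_inner)"
 using cinner_add_right[of x y "- z"] by (simp add: cinner_minus_right)

lemma cinner_sum_left:"cinner (SUM i:I. f i) y=(SUM i:I. cinner (f i) (y :: 'a :: complex_inner))"
 by (induction I rule: infinite_finite_induct) (auto simp: cinner_add_left)

lemma cinner_sum_right:"cinner y (SUM i:I. f i)=(SUM i:I. cinner y (f i :: 'a :: complex_inner))"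
 by (induction I rule: infinite_finite_induct) (auto simp: cinner_add_right)

lemma cinner_scaleR_left:"cinner (r .* x) y = of_real r * cinner x (y :: 'a :: complex_inner)"
 by (simp add: scaleC_of_real[symmetric] cinner_scaleC_left)

lemma cinner_scaleR_right:"cinner x (r .* y) = of_real r * cinner x (y :: 'a :: complex_inner)"
 by (simp add: scaleC_of_real[symmetric] cinner_scaleC_right)

lemmas cinner_simps = cinner_add_left cinner_add_right cinner_diff_left cinner_diff_right
 cinner_minus_left cinner_minus_right cinner_scaleC_left cinner_scaleC_right
 cinner_scaleR_left cinner_scaleR_right

lemma cinner_self_eq_0:"cinner x x=0\<longleftrightarrow>x=(0 :: 'a :: complex_inner)"
 by (simp add: cinner_self)

lemma cinner_ext:
 assumes "!!z. cinner z x=cinner z (y :: 'a :: complex_inner)" shows "x=y"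
 using assms[of "x - y"] cinner_self_eq_0[of "x - y"] by (simp add: cinner_diff_right)

text \<open>Rotating \<open>y\<close> by a phase makes the inner product real and nonnegative, so
  the real Cauchy-Schwarz inequality applies. This removes the factor 2 of
  \<open>norm_cinner_le\<close>.\<close>

lemma cmod_cinner_le:"cmod (cinner x y)<=norm x * norm (y :: 'a :: complex_inner)"
proof -
 define c where "c=(if cinner x y=0 then 1 else cnj (cinner x y) / cmod (cinner x y))"
 have c:"cmod c=1" by (auto simp: c_def norm_divide)
 have "cinner x (c :* y) = of_real (cmod (cinner x y))"
  by (auto simp: c_def cinner_scaleC_right complex_norm_square[symmetric] mult.commute
    power2_eq_square field_simps simp flip: of_real_mult)
 hence "cmod (cinner x y)=inner x (c :* y)"
  by (metis Re_cinner Re_complex_of_real)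
 also have "...<=norm x * norm (c :* y)" by (rule norm_cauchy_schwarz)
 finally show ?thesis by (simp add: norm_scaleC c)
qed

lemma bounded_bilinear_cinner:"bounded_bilinear (cinner :: 'a :: complex_inner=>'a=>complex)"
 by standard (auto simp: cinner_simps scaleR_conv_of_real intro!: exI[of _ 1] cmod_cinner_le)

lemmas tendsto_cinner [tendsto_intros] = bounded_bilinear.tendsto[OF bounded_bilinear_cinner]

lemma cinner_commute_real:"Re (cinner x y)=Re (cinner y (x :: 'a :: complex_inner))"
 by (simp add: Re_cinner inner_commute)

lemma norm_eq_sqrt_Re_cinner:"norm x=sqrt (Re (cinner x (x :: 'a :: complex_inner)))"
 by (simp add: Re_cinner norm_eq_sqrt_inner)

lemma power2_norm_eq_Re_cinner:"(norm (x :: 'a :: complex_inner))^2=Re (cinner x x)"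
 by (simp add: Re_cinner power2_norm_eq_inner)

lemma Re_cinner_imag:"Re (cinner z (\<i> :* x))=- Im (cinner z (x :: 'a :: complex_inner))"
 by (simp add: cinner_scaleC_right)

text \<open>Near zero a linear term dominates a quadratic one. This is the first-variation step in
  \<open>riesz_on\<close>.\<close>

lemma quadratic_nonneg_linear_zero:
 fixes b c :: real
 assumes "!!s. 0<=s * b + s^2 * c"
 shows "b=0"
proof (rule ccontr)
 assume "b~=0"
 define k where "k=\<bar>c\<bar>+1"
 have k:"0<k" "c<=k" by (auto simp: k_def)
 define s where "s=- b/(2 * k)"
 have "s * b + s^2 * c<=s * b + s^2 * k" using k by (simp add: mult_left_mono)
 also have "...=- (b\<^sup>2/(4 * k))"
  unfolding s_def using k by (simp add: power2_eq_square field_simps)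
 also have "...<0" using \<open>b \<noteq> 0\<close> k by simp
 finally show False using assms[of s] by simp
qed

text \<open>Linearity on a subset: the arguments will be members of an operator algebra, mapped to
  vectors such as \<open>x xi\<close>.\<close>

definition clinear_on :: "'x :: complex_vector set=>('x=>'y :: complex_vector)=>bool" where
 "clinear_on X f\<longleftrightarrow>(ALL x:X. ALL y:X. f (x + y)=f x + f y)&(ALL c. ALL x:X. f (c :* x)=c :* f x)"

definition csubspace :: "'x :: complex_vector set=>bool" where
 "csubspace X\<longleftrightarrow>0:X&(ALL x:X. ALL y:X. x + y:X)&(ALL c. ALL x:X. c :* x:X)"

lemma csubspaceD:
 assumes "csubspace X"
 shows "0:X" "x:X==>y:X==>x + y:X" "x:X==>c :* x:X"
  "x:X==>r .* x:X" "x:X==>y:X==>x - y:X" "x:X==>- x:X"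
proof -
 have sc:"c :* x:X" if "x:X" for c x using assms that by (auto simp: csubspace_def)
 show "0:X" "x:X==>y:X==>x + y:X" "x:X==>c :* x:X"
  using assms by (auto simp: csubspace_def)
 show r:"x:X==>r .* x:X" for x r using sc[of x "of_real r"] by (simp add: scaleC_of_real)
 show m:"x:X==>- x:X" for x using r[of x "-1"] by simp
 show "x:X==>y:X==>x - y:X"
  using m[of y] assms by (metis add_uminus_conv_diff csubspace_def)
qed

lemma csubspace_sum:"csubspace X==>(!!i. i:I==>f i:X)==>(SUM i:I. f i):X"
 by (induction I rule: infinite_finite_induct) (auto intro: csubspaceD)

lemma clinear_onD:
 assumes "clinear_on X f" "csubspace X"
 shows "x:X==>y:X==>f (x + y)=f x + f y" "x:X==>f (c :* x)=c :* f x"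
  "f 0=0" "x:X==>f (r .* x)=r .* f x" "x:X==>y:X==>f (x - y)=f x - f y"
  "x:X==>f (- x)=- f x"
proof -
 have sc:"f (c :* x)=c :* f x" if "x:X" for c x using assms that by (auto simp: clinear_on_def)
 have ad:"f (x + y)=f x + f y" if "x:X" "y:X" for x y using assms that by (auto simp: clinear_on_def)
 show "x:X==>y:X==>f (x + y)=f x + f y" "x:X==>f (c :* x)=c :* f x" 
  by (rule ad sc; assumption)+
 show "f 0=0" using sc[of 0 0] csubspaceD(1)[OF assms(2)] by (simp add: scaleC_zero_left)
 show r:"x:X==>f (r .* x)=r .* f x" for x r
  using sc[of x "of_real r"] by (simp add: scaleC_of_real)
 show m:"x:X==>f (- x)=- f x" for x using r[of x "-1"] by simp
 show "x:X==>y:X==>f (x - y)=f x - f y"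
  using m[of y] ad[of x "- y"] csubspaceD(6)[OF assms(2), of y] by simp
qed

lemma csubspace_UNIV [simp]:"csubspace UNIV" by (simp add: csubspace_def)

lemma norm_add_scaleR_power2:
 fixes p q :: "'a :: real_inner"
 shows "(norm (p + t .* q))^2=(norm p)^2 + t*(2 * inner p q) + t^2*(norm q)^2"
 unfolding power2_norm_eq_inner inner_add_left inner_add_right
 by (simp add: inner_commute[of q p] power2_eq_square)

lemma parallelogram_half:
 fixes p q :: "'a :: real_inner"
 shows "(norm (p - q))^2=2*(norm p)^2+2*(norm q)^2-4*(norm ((1/2) .* (p + q)))^2"
proof -
 have "(norm ((1/2) .* (p + q)))^2=(norm (p + q))^2/4"
  by (simp add: power_divide)
 thus ?thesis
  by (simp add: power2_norm_eq_inner inner_diff_left inner_diff_right inner_add_left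
    inner_add_right inner_commute[of q p])
qed

text \<open>Minimizing \<open>G\<close> over the parameters produces the representing vector: the
  parallelogram law makes near-minimizers Cauchy and the first variation gives the equation. The
  range of \<open>a\<close> need not be closed; the last two conclusions record that
  \<open>z\<close> lies in its closure.\<close>

lemma riesz_on:
 fixes a :: "'x :: complex_vector=>'h :: complex_hilbert" and f :: "'x=>complex"
 assumes X:"csubspace X" and a:"clinear_on X a" and f:"clinear_on X f"
  and bd:"!!x. x:X==>cmod (f x)<=C * norm (a x)" and C:"0<=C"
 shows "EX z. (ALL x:X. cinner z (a x)=f x)&norm z<=C &
      (ALL u. (ALL x:X. cinner u (a x)=0)-->cinner u z=0) &
      (EX s :: nat=>'x. (ALL n. s n:X)&(%n. a (s n))---->z)"
proof -
 define G where "G x=(norm (a x))^2-2*Re (f x)" for x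
 have low:"- C\<^sup>2<=G x" if "x:X" for x
 proof -
  have "Re (f x)<=C * norm (a x)" using bd[OF that] complex_Re_le_cmod[of "f x"] by linarith
  moreover have "0<=(norm (a x)-C)^2" by simp
  ultimately show ?thesis by (simp add: G_def power2_diff algebra_simps)
 qed
 define m where "m=Inf (G ` X)"
 have bb:"bdd_below (G ` X)" using low by (auto intro!: bdd_belowI)
 have m:"m<=G x" if "x:X" for x unfolding m_def using that bb by (intro cInf_lower) auto
 have "EX x:X. G x<m+1/Suc n" for n
 proof -
  have "Inf (G ` X)<m+1/Suc n" by (simp add: m_def)
  thus ?thesis using cInf_lessD[of "G ` X"] csubspaceD(1)[OF X] by auto
 qed
 then obtain s where s:"!!n. s n:X" "!!n. G (s n)<m+1/Suc n" by metis
 have par:"(norm (a x - a y))^2=2*G x+2*G y-4*G ((1/2) .* (x + y))"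
  if "x:X" "y:X" for x y
 proof -
  have "a ((1/2) .* (x + y))=(1/2) .* (a x + a y)" "f ((1/2) .* (x + y))=(1/2) .* (f x + f y)"
   by (simp_all add: clinear_onD(1,4)[OF a X] clinear_onD(1,4)[OF f X] that csubspaceD(2,4)[OF X])
  note e = this
  have "Re (f ((1/2) .* (x + y)))=(Re (f x)+Re (f y))/2" unfolding e by simp
  note r = this
  have gen:"2*A+2*B-4*N=2*(A-2 * p)+2*(B-2 * q)-4*(N-2*((p + q)/2))"
   for A B N p q :: real by (simp add: field_simps)
  show ?thesis unfolding G_def parallelogram_half[of "a x" "a y"] e(1) r by (rule gen)
 qed
 have close:"(norm (a (s n) - a (s k)))^2<=2/Suc n+2/Suc k" for n k
 proof -
  have "(1/2) .* (s n + s k):X" by (simp add: csubspaceD(2,4)[OF X] s(1))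
  have eq:"2 / real (Suc n)=2*(1 / real (Suc n))" "2 / real (Suc k)=2*(1 / real (Suc k))" by simp_all
  from m[OF \<open>(1/2) *\<^sub>R (s n + s k) \<in> X\<close>] show ?thesis
   using par[OF s(1) s(1), of n k] s(2)[of n] s(2)[of k] eq by linarith
 qed
 have "Cauchy (%n. a (s n))"
 proof (rule metric_CauchyI)
  fix e :: real assume e:"0<e"
  obtain N where "4 / e^2<real N" using reals_Archimedean2 by blast
  hence N:"4 / e^2<real (Suc N)" by simp
  have "dist (a (s n)) (a (s k))<e" if "n>=N" "k>=N" for n k
  proof -
   have "2 / real (Suc n)+2 / real (Suc k)<=2 / real (Suc N)+2 / real (Suc N)"
    using that by (intro add_mono divide_left_mono) auto
   also have "...=4 / real (Suc N)" by simp
   also have "...<e^2" using N e by (simp add: field_simps)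
   finally have "(norm (a (s n) - a (s k)))^2<e^2" using close[of n k] by linarith
   thus ?thesis using e by (simp add: dist_norm power2_less_imp_less)
  qed
  thus "EX M. ALL m>=M. ALL n>=M. dist (a (s m)) (a (s n))<e" by blast
 qed
 then obtain z where z:"(%n. a (s n))---->z" by (auto simp: Cauchy_convergent_iff convergent_def)
 have re:"Re (cinner z (a x))=Re (f x)" if x:"x:X" for x
 proof -
  have "0<=t*(2*(Re (cinner z (a x))-Re (f x))) + t^2*(norm (a x))^2" for t
  proof -
   have "- (1/Suc n)<=t*(2*(Re (cinner (a (s n)) (a x))-Re (f x))) + t\<^sup>2*(norm (a x))\<^sup>2" for n
   proof -
    have "s n + t .* x:X" by (simp add: csubspaceD(2,4)[OF X] s(1) x)
    from m[OF this] have "m<=G (s n + t .* x)" .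
    also have "...=G (s n) + t*(2*(Re (cinner (a (s n)) (a x))-Re (f x))) + t^2*(norm (a x))^2"
    proof -
     have "a (s n + t .* x)=a (s n) + t .* a x" "f (s n + t .* x)=f (s n) + t .* f x"
      by (simp_all add: clinear_onD(1,4)[OF a X] clinear_onD(1,4)[OF f X] s(1) x csubspaceD(4)[OF X])
     thus ?thesis
      unfolding G_def Re_cinner by (simp add: norm_add_scaleR_power2 algebra_simps)
    qed
    finally show ?thesis using s(2)[of n] by linarith
   qed
   moreover have "(%n.-(1/Suc n) :: real)---->0"
    using tendsto_minus[OF LIMSEQ_Suc[OF lim_inverse_n']] by simp
   moreover have "(%n. t*(2*(Re (cinner (a (s n)) (a x))-Re (f x))) + t^2*(norm (a x))^2)
    ---->t*(2*(Re (cinner z (a x))-Re (f x))) + t^2*(norm (a x))^2"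
    by (intro tendsto_intros z)
   ultimately show ?thesis using LIMSEQ_le by blast
  qed
  from quadratic_nonneg_linear_zero[OF this] show ?thesis by simp
 qed
 have eq:"cinner z (a x)=f x" if x:"x:X" for x
 proof (rule complex_eqI)
  show "Re (cinner z (a x))=Re (f x)" by (rule re[OF x])
  have "Re (cinner z (a (\<i> :* x)))=Re (f (\<i> :* x))" by (intro re csubspaceD(3)[OF X] x)
  thus "Im (cinner z (a x))=Im (f x)"
   using clinear_onD(2)[OF a X x] clinear_onD(2)[OF f X x] by (simp add: cinner_scaleC_right scaleC_complex_def)
 qed
 have orth:"cinner u z=0" if "ALL x:X. cinner u (a x)=0" for u
 proof -
  have "(%n. cinner u (a (s n)))---->cinner u z" by (intro tendsto_intros z)
  moreover have "cinner u (a (s n))=0" for n using that s(1) by auto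
  ultimately show ?thesis by (simp add: LIMSEQ_const_iff)
 qed
 have "norm z<=C"
 proof -
  have "(%n. C * norm (a (s n)) - cmod (f (s n)))---->C * norm z - cmod (cinner z z)"
   unfolding eq[OF s(1), symmetric] by (intro tendsto_intros z)
  hence "0<=C * norm z - cmod (cinner z z)"
   by (rule tendsto_lowerbound) (use bd s(1) in auto)
  hence "norm z * norm z<=C * norm z" by (simp add: cinner_self power2_eq_square norm_mult)
  thus ?thesis using C by (cases "norm z=0") (auto simp: mult_le_cancel_right)
 qed
 with eq orth z s(1) show ?thesis by blast
qed

text \<open>The Riesz vector of \<open>cinner v\<close> lies in the closure of the range of
  \<open>a\<close>, and totality forces it to equal \<open>v\<close>.\<close>

lemma dense_approximation:
 fixes a :: "'x :: complex_vector=>'h :: complex_hilbert"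
 assumes X:"csubspace X" and a:"clinear_on X a"
  and tot:"!!u. (!!x. x:X==>cinner u (a x)=0)==>u=0" and e:"0<e"
 shows "EX x:X. norm (v - a x)<e"
proof -
 have "EX z. (ALL x:X. cinner z (a x)=cinner v (a x))&norm z<=norm v &
      (ALL u. (ALL x:X. cinner u (a x)=0)-->cinner u z=0) &
      (EX s :: nat=>'x. (ALL n. s n:X)&(%n. a (s n))---->z)"
  by (rule riesz_on[OF X a])
   (use a cmod_cinner_le in "auto simp: clinear_on_def cinner_add_right cinner_scaleC_right scaleC_complex_def")
 then obtain z s where z:"!!x. x:X==>cinner z (a x)=cinner v (a x)" "!!n :: nat. s n:X"
  "(%n. a (s n))---->z" by blast
 have "v - z=0" by (rule tot) (simp add: z(1) cinner_diff_left)
 hence "(%n. a (s n))---->v" using z(3) by simp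
 from tendstoD[OF this e] obtain n where "dist (a (s n)) v<e" by (auto simp: eventually_sequentially)
 thus ?thesis using z(2)[of n] by (intro bexI[of _ "s n"]) (simp_all add: dist_norm norm_minus_commute)
qed

section \<open>Bounds, adjoints and extension of bounded operators\<close>

section \<open>Bounded operators\<close>

lemma bop_eqI:
 fixes S T :: "'h :: complex_hilbert bop"
 shows "(!!x. S x=T x)==>S=T"
 by (metis apply_op_inject ext)

lemma bop_zero_apply [simp]:"(0 :: 'h :: complex_hilbert bop) x=0" by (simp add: zero_bop.rep_eq)
lemma bop_one_apply [simp]:"(1 :: 'h :: complex_hilbert bop) x=x" by (simp add: one_bop.rep_eq)
lemma bop_plus_apply [simp]:"(S+T :: 'h :: complex_hilbert bop) x=S x+T x" by (simp add: plus_bop.rep_eq)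
lemma bop_minus_apply [simp]:"(S-T :: 'h :: complex_hilbert bop) x=S x-T x" by (simp add: minus_bop.rep_eq)
lemma bop_uminus_apply [simp]:"(- T :: 'h :: complex_hilbert bop) x=- T x" by (simp add: uminus_bop.rep_eq)
lemma bop_times_apply [simp]:"(S*T :: 'h :: complex_hilbert bop) x=S (T x)" by (simp add: times_bop.rep_eq)
lemma bop_scaleR_apply [simp]:"(r .* T :: 'h :: complex_hilbert bop) x=r .* T x" by (simp add: scaleR_bop.rep_eq)
lemma bop_scaleC_apply [simp]:"(c :* T :: 'h :: complex_hilbert bop) x=c :* T x" by (simp add: scaleC_bop.rep_eq)
lemma bop_sum_apply:"(SUM i:I. T i :: 'h :: complex_hilbert bop) x=(SUM i:I. T i x)"
 by (induction I rule: infinite_finite_induct) auto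

lemma bop_bounded_linear:"bounded_linear (apply_op (T :: 'h :: complex_hilbert bop))"
 using apply_op[of T] by (simp add: bounded_clinear_def)

lemma bop_add [simp]:"(T :: 'h :: complex_hilbert bop) (x + y)=T x+T y"
 by (rule linear_add[OF bounded_linear.linear[OF bop_bounded_linear]])
lemma bop_diff [simp]:"(T :: 'h :: complex_hilbert bop) (x - y)=T x-T y"
 by (rule linear_diff[OF bounded_linear.linear[OF bop_bounded_linear]])
lemma bop_neg [simp]:"(T :: 'h :: complex_hilbert bop) (- x)=- T x"
 by (rule linear_neg[OF bounded_linear.linear[OF bop_bounded_linear]])
lemma bop_scaleR [simp]:"(T :: 'h :: complex_hilbert bop) (r .* x)=r .* T x"
 by (rule linear_scale[OF bounded_linear.linear[OF bop_bounded_linear]])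
lemma bop_0 [simp]:"(T :: 'h :: complex_hilbert bop) 0=0"
 by (rule linear_0[OF bounded_linear.linear[OF bop_bounded_linear]])
lemma bop_scaleC [simp]:"(T :: 'h :: complex_hilbert bop) (c :* x)=c :* T x"
 using apply_op[of T] by (simp add: bounded_clinear_def)
lemma bop_sum:"(T :: 'h :: complex_hilbert bop) (SUM i:I. f i)=(SUM i:I. T (f i))"
 by (rule linear_sum[OF bounded_linear.linear[OF bop_bounded_linear]])

lemmas tendsto_bop [tendsto_intros] = bounded_linear.tendsto[OF bop_bounded_linear]

text \<open>An upper bound for the operator norm, kept as a relation so that sums, products and
  limits merely propagate constants.\<close>

definition bnd :: "real=>'h :: complex_hilbert bop=>bool" where
 "bnd C T\<longleftrightarrow>0<=C&(ALL x. norm (T x)<=C * norm x)"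

lemma bndI:
 fixes T :: "'h :: complex_hilbert bop"
 shows "0<=C==>(!!x. norm (T x)<=C * norm x)==>bnd C T"
 by (simp add: bnd_def)

lemma bndD:
 fixes T :: "'h :: complex_hilbert bop"
 shows "bnd C T==>norm (T x)<=C * norm x" "bnd C T==>0<=C"
 by (simp_all add: bnd_def)

lemma bnd_ex:"EX C. bnd C T"
 using bounded_linear.nonneg_bounded[OF bop_bounded_linear[of T]] by (auto simp: bnd_def mult.commute)

lemma bnd_mono:"bnd C T==>C<=D==>bnd D T"
 by (auto simp: bnd_def intro: order_trans[OF _ mult_right_mono])

lemma bnd_add:"bnd C S==>bnd D T==>bnd (C+D) (S+T)"
 by (auto simp: bnd_def algebra_simps intro: norm_triangle_le add_mono)

lemma bnd_uminus:"bnd C S==>bnd C (- S)" by (simp add: bnd_def)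

lemma bnd_diff:"bnd C S==>bnd D T==>bnd (C+D) (S-T)"
 using bnd_add[OF _ bnd_uminus, of C S D T] by simp

lemma bnd_mult:"bnd C S==>bnd D T==>bnd (C*D) (S*T)"
 unfolding bnd_def by (auto simp: assoc intro: order_trans[OF _ mult_left_mono])

lemma bnd_scaleC:"bnd C S==>bnd (cmod c*C) (c :* S)"
 unfolding bnd_def by (auto simp: norm_scaleC assoc intro: mult_left_mono)

lemma bnd_scaleR:"bnd C S==>bnd (\<bar>r\<bar>*C) (r .* S)"
 unfolding bnd_def by (auto simp: assoc intro: mult_left_mono)

lemma bnd_0 [simp]:"0<=C==>bnd C 0" by (simp add: bnd_def)
lemma bnd_1 [simp]:"bnd 1 1" by (simp add: bnd_def)

lemma bop_from_fun:
 fixes f :: "'h :: complex_hilbert=>'h"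
 assumes "!!x y. f (x + y)=f x + f y" "!!c x. f (c :* x)=c :* f x" "!!x. norm (f x)<=C * norm x"
 shows "EX T :: 'h bop. ALL x. T x=f x"
proof -
 have "f (r .* x)=r .* f x" for r x using assms(2)[of "of_real r" x] by (simp add: scaleC_of_real)
 hence "bounded_clinear f"
  unfolding bounded_clinear_def
  by (intro conjI allI assms(2) bounded_linear_intro[where K = C])
   (use assms in "auto simp: mult.commute")
 thus ?thesis by (metis Abs_bop_inverse mem_Collect_eq)
qed

text \<open>For each \<open>x\<close> the Riesz vector of the functional \<open>B x\<close> is the
  value of the operator. This turns limits of matrix coefficients into operators.\<close>

lemma bop_from_form:
 fixes B :: "'h :: complex_hilbert=>'h=>complex"
 assumes "!!x y z. B x (y + z)=B x y+B x z" "!!c x y. B x (c :* y)=c*B x y"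
  "!!x y z. B (x + y) z=B x z+B y z" "!!c x y. B (c :* x) y=cnj c*B x y"
  "!!x y. cmod (B x y)<=C * norm x * norm y" "0<=C"
 shows "EX T :: 'h bop. bnd C T&(ALL x y. cinner (T x) y=B x y)"
proof -
 have "EX z. (ALL y. cinner z y=B x y)&norm z<=C * norm x" for x
 proof -
  have "EX z. (ALL y:UNIV. cinner z (id y)=B x y)&norm z<=C * norm x &
    (ALL u. (ALL y:UNIV. cinner u (id y)=0)-->cinner u z=0) &
    (EX s :: nat=>'h. (ALL n. s n:UNIV)&(%n. id (s n))---->z)"
   by (rule riesz_on) (use assms in "auto simp: clinear_on_def scaleC_complex_def assoc")
  thus ?thesis by auto
 qed
 then obtain f where f:"!!x y. cinner (f x) y=B x y" "!!x. norm (f x)<=C * norm x" by metis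
 have ext:"u=v" if "!!y. cinner u y=cinner v y" for u v :: 'h
  by (rule cinner_ext) (metis cinner_commute that)
 have "EX T :: 'h bop. ALL x. T x=f x"
  by (rule bop_from_fun[where C = C])
   (auto intro!: ext simp: f cinner_add_left cinner_scaleC_left assms)
 then obtain T :: "'h bop" where "!!x. T x=f x" by blast
 thus ?thesis using f assms(6) by (intro exI[of _ T]) (simp add: bnd_def)
qed

lemma adj_exists:"EX S :: 'h :: complex_hilbert bop. ALL x y. cinner (S x) y=cinner x ((T :: 'h bop) y)"
proof -
 obtain C where C:"bnd C T" using bnd_ex by blast
 have "cmod (cinner x (T y))<=C * norm x * norm y" for x y
  using cmod_cinner_le[of x "T y"] mult_left_mono[OF bndD(1)[OF C, of y], of "norm x"]
  by (simp add: mult_ac)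
 from bop_from_form[where B = "%x y. cinner x (T y)", OF _ _ _ _ this] show ?thesis
  using bndD(2)[OF C] by (auto simp: cinner_simps)
qed

lemma adj_left:"cinner (adj T x) y=cinner x ((T :: 'a :: complex_hilbert bop) y)"
proof -
 have "ALL x y. cinner (adj T x) y=cinner x (T y)"
  unfolding adj_def
 proof (rule theI')
  obtain S :: "'a bop" where S:"ALL x y. cinner (S x) y=cinner x (T y)" using adj_exists by blast
  show "EX! S :: 'a bop. ALL x y. cinner (S x) y=cinner x (T y)"
  proof (rule ex1I[of _ S], rule S, rule bop_eqI, rule cinner_ext)
   fix S' :: "'a bop" and x z assume "ALL x y. cinner (S' x) y=cinner x (T y)"
   thus "cinner z (S' x)=cinner z (S x)" using S by (metis cinner_commute)
  qed
 qed
 thus ?thesis by blast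
qed

lemma adj_right:"cinner x (adj T y)=cinner ((T :: 'a :: complex_hilbert bop) x) y"
 by (metis adj_left cinner_commute)

lemma adj_eqI:
 fixes S T :: "'h :: complex_hilbert bop"
 assumes "!!x y. cinner (S x) y=cinner x (T y)" shows "adj T=S"
 by (rule bop_eqI, rule cinner_ext) (metis adj_left cinner_commute assms)

lemma adj_adj [simp]:"adj (adj T)=T" by (rule adj_eqI) (simp add: adj_right)
lemma adj_mult [simp]:"adj (S*T)=adj T * adj S" by (rule adj_eqI) (simp add: adj_left)
lemma adj_add [simp]:"adj (S+T)=adj S + adj T" by (rule adj_eqI) (simp add: adj_left cinner_simps)
lemma adj_diff [simp]:"adj (S-T)=adj S - adj T" by (rule adj_eqI) (simp add: adj_left cinner_simps)
lemma adj_uminus [simp]:"adj (- T)=- adj T" by (rule adj_eqI) (simp add: adj_left cinner_simps)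
lemma adj_scaleC [simp]:"adj (c :* T)=cnj c :* adj T" by (rule adj_eqI) (simp add: adj_left cinner_simps)
lemma adj_scaleR [simp]:"adj (r .* T)=r .* adj T" by (rule adj_eqI) (simp add: adj_left cinner_simps)
lemma adj_0 [simp]:"adj 0=0" by (rule adj_eqI) simp
lemma adj_1 [simp]:"adj 1=1" by (rule adj_eqI) simp
lemma adj_power [simp]:"adj (T ^ n)=adj T ^ n"
 by (induction n) (simp_all add: power_commutes)
lemma adj_sum:"adj (SUM i:I. T i)=(SUM i:I. adj (T i))"
 by (induction I rule: infinite_finite_induct) auto

lemma bnd_adj: assumes "bnd C T" shows "bnd C (adj T)"
proof (rule bndI)
 show "0<=C" using assms by (rule bndD)
 fix x
 have "(norm (adj T x))^2=Re (cinner x (T (adj T x)))"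
  by (simp add: power2_norm_eq_Re_cinner adj_left)
 also have "...<=cmod (cinner x (T (adj T x)))" by (rule complex_Re_le_cmod)
 also have "...<=norm x * norm (T (adj T x))" by (rule cmod_cinner_le)
 also have "...<=norm x*(C * norm (adj T x))" by (intro mult_left_mono bndD(1)[OF assms]) auto
 finally have "norm (adj T x) * norm (adj T x)<=(C * norm x) * norm (adj T x)"
  by (simp add: power2_eq_square mult_ac)
 thus "norm (adj T x)<=C * norm x"
  using bndD(2)[OF assms] by (cases "norm (adj T x)=0") (auto simp: mult_le_cancel_right)
qed

lemma bop_mult_scaleC_left [simp]:"(c :* S)*T=c :* (S*T :: 'h :: complex_hilbert bop)"
 by (rule bop_eqI) simp
lemma bop_mult_scaleC_right [simp]:"S*(c :* T)=c :* (S*T :: 'h :: complex_hilbert bop)"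
 by (rule bop_eqI) simp
lemma bop_mult_scaleR_left [simp]:"(c .* S)*T=c .* (S*T :: 'h :: complex_hilbert bop)"
 by (rule bop_eqI) simp
lemma bop_mult_scaleR_right [simp]:"S*(c .* T)=c .* (S*T :: 'h :: complex_hilbert bop)"
 by (rule bop_eqI) simp

text \<open>The map \<open>a x \<mapsto> b x\<close>, extended by continuity and by zero on the orthogonal complement.\<close>

lemma bop_extension:
 fixes a b :: "'x :: complex_vector=>'h :: complex_hilbert"
 assumes X:"csubspace X" and a:"clinear_on X a" and b:"clinear_on X b"
  and bd:"!!x. x:X==>norm (b x)<=C * norm (a x)" and C:"0<=C"
 shows "EX T :: 'h bop. bnd C T&(ALL x:X. T (a x)=b x) &
      (ALL u. (ALL x:X. cinner u (a x)=0)-->T u=0)"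
proof -
 \<comment> \<open>The Riesz vectors assemble to the adjoint of the wanted operator, hence the
   witness \<open>adj S\<close> at the end.\<close>
 have "EX z. (ALL x:X. cinner z (a x)=cinner u (b x))&norm z<=C * norm u &
    (ALL v. (ALL x:X. cinner v (a x)=0)-->cinner v z=0) &
    (EX s :: nat=>'x. (ALL n. s n:X)&(%n. a (s n))---->z)" for u
 proof (rule riesz_on[OF X a])
  show "clinear_on X (%x. cinner u (b x))"
   using b by (auto simp: clinear_on_def cinner_simps scaleC_complex_def)
  fix x assume "x:X"
  thus "cmod (cinner u (b x))<=C * norm u * norm (a x)"
   using cmod_cinner_le[of u "b x"] mult_left_mono[OF bd[of x], of "norm u"] by (simp add: mult_ac)
 qed (use C in auto)
 then obtain g where g:"!!u x. x:X==>cinner (g u) (a x)=cinner u (b x)" "!!u. norm (g u)<=C * norm u"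
  "!!u v. (ALL x:X. cinner v (a x)=0)==>cinner v (g u)=0" by metis
 have uniq:"w=w'" if "!!x. x:X==>cinner w (a x)=cinner w' (a x)"
  "!!v. (ALL x:X. cinner v (a x)=0)==>cinner v (w - w')=0" for w w'
 proof -
  have "cinner (w - w') (w - w')=0" by (rule that(2)) (simp add: cinner_diff_left that(1))
  thus ?thesis by (simp add: cinner_self_eq_0)
 qed
 have "EX S :: 'h bop. ALL x. S x=g x"
 proof (rule bop_from_fun[where C = C])
  fix u v show "g (u + v)=g u + g v"
   by (rule uniq) (simp_all add: cinner_simps g(1) g(3))
 next
  fix c u show "g (c :* u)=c :* g u"
   by (rule uniq) (simp_all add: cinner_simps g(1) g(3))
 qed (rule g(2))
 then obtain S :: "'h bop" where S:"!!x. S x=g x" by blast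
 have "bnd C S" using g(2) C by (auto simp: bnd_def S)
 moreover have "adj S (a x)=b x" if "x:X" for x
  by (rule cinner_ext) (simp add: adj_right S g(1) that)
 moreover have "adj S u=0" if "ALL x:X. cinner u (a x)=0" for u
 proof (rule cinner_ext)
  fix z
  have "cinner u (g z)=0" by (rule g(3)[OF that])
  hence "cinner (g z) u=0" by (subst cinner_commute) simp
  thus "cinner z (adj S u)=cinner z 0" by (simp add: adj_right S)
 qed
 ultimately show ?thesis by (intro exI[of _ "adj S"]) (auto intro: bnd_adj)
qed

section \<open>Order, Cauchy-Schwarz inequalities and monotone limits of positive operators\<close>

section \<open>Positive operators\<close>

abbreviation ple :: "'h :: complex_hilbert bop=>'h bop=>bool" (infix "[=" 50) where
 "S[=T\<equiv>pos (T-S)"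

text \<open>Polarization with \<open>x + y\<close> and \<open>x + i y\<close>: over complex scalars
  the quadratic form determines the operator.\<close>

lemma form_zero_imp_zero:
 fixes T :: "'h :: complex_hilbert bop"
 assumes "!!x. cinner x (T x)=0" shows "T=0"
proof (rule bop_eqI, rule cinner_ext)
 fix y x :: 'h
 have "cinner x (T y) + cinner y (T x)=0"
  using assms[of "x + y"] by (simp add: cinner_simps assms add_ac)
 moreover have "\<i>*(cinner x (T y) - cinner y (T x))=0"
  using assms[of "x+\<i> :* y"] by (simp add: cinner_simps assms algebra_simps)
 ultimately have "2 * cinner x (T y)=0" by (simp add: algebra_simps)
 thus "cinner x (T y)=cinner x ((0 :: 'h bop) y)" by simp
qed

lemma posD:
 fixes T :: "'h :: complex_hilbert bop"
 assumes "pos T"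
 shows "0<=Re (cinner x (T x))" "Im (cinner x (T x))=0"
  "cinner x (T x) = of_real (Re (cinner x (T x)))"
 using assms unfolding positive_op_def by (auto simp: complex_nonneg_Reals_iff complex_eq_iff)

lemma pos_adj:
 fixes T :: "'h :: complex_hilbert bop"
 assumes "pos T" shows "adj T=T"
proof -
 have "adj T-T=0"
 proof (rule form_zero_imp_zero)
  fix x
  have "cinner x (adj T x)=cnj (cinner x (T x))" by (metis adj_right cinner_commute)
  thus "cinner x ((adj T-T) x)=0"
   using posD(2)[OF assms, of x] by (simp add: cinner_simps complex_eq_iff)
 qed
 thus ?thesis by simp
qed

lemma selfadj_Im:"adj T=T==>Im (cinner x (apply_op (T :: 'h :: complex_hilbert bop) x))=0"
proof -
 assume "adj T=T"
 hence "cinner x (T x)=cnj (cinner x (T x))" by (metis adj_left cinner_commute)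
 thus ?thesis by (simp add: complex_eq_iff)
qed

lemma posI:
 fixes T :: "'h :: complex_hilbert bop"
 assumes "adj T=T" "!!x. 0<=Re (cinner x (T x))" shows "pos T"
 using assms unfolding positive_op_def by (simp add: complex_nonneg_Reals_iff selfadj_Im)

lemma pos_0 [simp]:"pos 0" by (simp add: positive_op_def)
lemma pos_1 [simp]:"pos 1" by (intro posI) (auto simp: Re_cinner)
lemma pos_add:"pos S==>pos T==>pos (S+T)"
 by (intro posI) (simp_all add: pos_adj cinner_simps posD(1))
lemma pos_scaleR:"pos S==>0<=r==>pos (r .* S)"
 by (intro posI) (simp_all add: pos_adj cinner_simps posD(1))
lemma pos_conj:"pos T==>pos (adj S*T*S)"
 by (intro posI) (simp_all add: pos_adj assoc adj_right posD(1))
lemma pos_conj': "pos T==>pos (S*T * adj S)"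
 using pos_conj[of T "adj S"] by simp
lemma pos_adj_mult:"pos (adj S*S)"
 using pos_conj[OF pos_1, of S] by simp
lemma pos_mult_adj:"pos (S * adj S)"
 using pos_adj_mult[of "adj S"] by simp
lemma pos_sum:"(!!i. i:I==>pos (T i))==>pos (SUM i:I. T i)"
 by (induction I rule: infinite_finite_induct) (auto intro: pos_add)

lemma ple_refl [simp]:"T[=T" by simp
lemma ple_trans:"S[=T==>T[=U==>S[=U"
 using pos_add[of "T-S" "U-T"] by simp
lemma ple_add:"S[=T==>S'[=T'==>S+S'[=T+T'"
 using pos_add[of "T-S" "T'-S'"] by (simp add: algebra_simps)
lemma ple_scaleR:"S[=T==>0<=r==>r .* S[=r .* T"
 using pos_scaleR[of "T-S" r] by (simp add: algebra_simps)
lemma ple_conj:"S[=T==>adj X*S*X[=adj X*T*X"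
 using pos_conj[of "T-S" X] by (simp add: algebra_simps)
lemma ple_conj': "S[=T==>X*S * adj X[=X*T * adj X"
 using ple_conj[where X = "adj X"] unfolding adj_adj .
lemma positive_ple:"pos S==>S[=T==>pos T"
 using pos_add[of S "T-S"] by simp

lemma ple_Re:"S[=T==>Re (cinner x (apply_op S x))<=Re (cinner x (apply_op T x))"
 using posD(1)[of "T-S" x] by (simp add: cinner_simps)

lemma pleI:"adj S=S==>adj T=T==>(!!x. Re (cinner x (apply_op S x))<=Re (cinner x (apply_op T x)))==>S[=T"
 by (intro posI) (auto simp: cinner_simps)

lemma bnd_adj_mult_le:"bnd C S==>adj S*S[=C^2 .* 1"
 by (intro pleI)
  (auto simp: adj_right adj_left cinner_simps power2_norm_eq_Re_cinner[symmetric] bnd_def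
   power_mult_distrib[symmetric] intro!: power_mono)

lemma Re_cinner_scaleR_one:
 "Re (cinner x (apply_op (r .* 1) x))=r*(norm (x :: 'h :: complex_hilbert))^2"
 by (simp add: cinner_scaleR_right power2_norm_eq_Re_cinner)

lemma Re_cinner_adj_mult:
 "Re (cinner x (apply_op (adj S*S) x))=(norm (apply_op S x))^2"
 by (simp add: adj_right power2_norm_eq_Re_cinner)

lemma le_imp_bnd: assumes "adj S*S[=C^2 .* 1" "0<=C" shows "bnd C S"
proof (rule bndI)
 fix x
 have "(norm (S x))^2<=(C * norm x)^2"
  using ple_Re[OF assms(1), of x] unfolding Re_cinner_scaleR_one Re_cinner_adj_mult power_mult_distrib .
 thus "norm (S x)<=C * norm x" by (rule power2_le_imp_le) (simp add: assms)
qed (rule assms(2))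

text \<open>The discriminant argument in a form shared by positive operators and positive
  functionals; \<open>t\<close> is taken along the conjugate of \<open>b\<close>.\<close>

lemma form_cauchy_schwarz:
 fixes a c :: real and b :: complex
 assumes "!!t. 0<=a+2*Re (t * b)+(cmod t)^2 * c" "0<=a" "0<=c"
 shows "(cmod b)^2<=a * c"
proof -
 have q:"0<=a-2 * s*(cmod b)^2 + s^2*(cmod b)^2 * c" for s :: real
 proof -
  have "(- of_real s * cnj b) * b = of_real (- s*(cmod b)\<^sup>2)"
   by (simp add: complex_norm_square mult.commute mult.left_commute flip: of_real_power)
  hence "Re ((- of_real s * cnj b) * b)=- s*(cmod b)\<^sup>2" by (metis Re_complex_of_real)
  thus ?thesis
   using assms(1)[of "- of_real s * cnj b"] by (simp add: norm_mult power_mult_distrib)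
 qed
 show ?thesis
 proof (cases "c=0")
  case True
  show ?thesis
  proof (rule ccontr)
   assume "~ ?thesis"
   hence b:"0<(cmod b)^2" using True by simp
   have "0<=a-2*((a+1)/(cmod b)^2)*(cmod b)^2" using q[of "(a+1)/(cmod b)^2"] True by simp
   thus False using b assms(2) by simp
  qed
 next
  case False
  hence c:"0<c" using assms(3) by simp
  have "0<=a-2*(1 / c)*(cmod b)^2+(1 / c)^2*(cmod b)^2 * c" by (rule q)
  also have "...=a-(cmod b)^2 / c" using c by (simp add: power2_eq_square field_simps)
  finally show ?thesis using c by (simp add: field_simps)
 qed
qed

lemma pos_cauchy_schwarz:
 fixes T :: "'h :: complex_hilbert bop"
 assumes "pos T"
 shows "(cmod (cinner x (T y)))^2<=Re (cinner x (T x))*Re (cinner y (T y))"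
proof (rule form_cauchy_schwarz)
 fix t :: complex
 have "cinner y (T x)=cnj (cinner x (T y))"
  by (metis adj_left cinner_commute pos_adj[OF assms])
 hence "Re (cinner (x + t :* y) (T (x + t :* y)))
   = Re (cinner x (T x))+2*Re (t * cinner x (T y))+(cmod t)^2*Re (cinner y (T y))"
  using posD(2)[OF assms, of y]
  unfolding cmod_power2 by (simp add: cinner_simps power2_eq_square algebra_simps)
 thus "0<=Re (cinner x (T x))+2*Re (t * cinner x (T y))+(cmod t)^2*Re (cinner y (T y))"
  using posD(1)[OF assms, of "x + t :* y"] by simp
qed (use posD[OF assms] in auto)

text \<open>Cauchy-Schwarz for the form of \<open>T\<close> at the vectors \<open>T x\<close> and
  \<open>x\<close>; in operator terms, T^2 is at most C T.\<close>

lemma positive_norm_sq_le: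
 fixes T :: "'h :: complex_hilbert bop"
 assumes "pos T" "T[=C .* 1"
 shows "(norm (T x))^2<=C*Re (cinner x (T x))"
proof (cases "T x=0")
 case False
 have "((norm (T x))^2)^2=(cmod (cinner (T x) (T x)))^2" by (simp add: cinner_self norm_power)
 also have "...<=Re (cinner (T x) (T (T x)))*Re (cinner x (T x))"
  by (rule pos_cauchy_schwarz[OF assms(1)])
 also have "...<=(C*(norm (T x))^2)*Re (cinner x (T x))"
  using ple_Re[OF assms(2), of "T x"] posD[OF assms(1)]
  by (intro mult_right_mono) (auto simp: cinner_simps power2_norm_eq_Re_cinner)
 finally have "(norm (T x))^2*(norm (T x))^2<=(C*Re (cinner x (T x)))*(norm (T x))^2"
  by (simp add: power2_eq_square mult_ac)
 thus ?thesis using False by (subst (asm) mult_le_cancel_right) simp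
next
 case True
 thus ?thesis by simp
qed

lemma positive_bnd:
 assumes "pos T" "T[=C .* 1" "0<=C" shows "bnd C T"
proof (rule bndI)
 fix x
 have "(norm (T x))^2<=C*Re (cinner x (T x))" by (rule positive_norm_sq_le[OF assms(1,2)])
 also have "...<=C*(C*(norm x)^2)"
  using ple_Re[OF assms(2), of x] unfolding Re_cinner_scaleR_one by (intro mult_left_mono assms(3))
 finally have "(norm (T x))^2<=(C * norm x)^2" by (simp add: power2_eq_square mult_ac)
 thus "norm (T x)<=C * norm x" by (rule power2_le_imp_le) (simp add: assms)
qed (rule assms(3))

lemma bnd_ple: assumes "bnd C T" "adj T=T" shows "T[=C .* 1"
proof (rule pleI)
 fix x
 have "Re (cinner x (T x))<=norm x * norm (T x)"
  using complex_Re_le_cmod cmod_cinner_le order_trans by blast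
 also have "...<=norm x*(C * norm x)" by (intro mult_left_mono bndD(1)[OF assms(1)]) auto
 finally show "Re (cinner x (T x))<=Re (cinner x ((C .* 1 :: 'a bop) x))"
  by (simp add: cinner_simps power2_norm_eq_Re_cinner[symmetric] power2_eq_square mult_ac)
qed (use assms in auto)

lemma positive_zero_vec:
 assumes "pos T" "Re (cinner x (apply_op T x))=0" shows "apply_op T x=0"
proof -
 obtain C where C:"bnd C T" using bnd_ex by blast
 show ?thesis
  using positive_norm_sq_le[OF assms(1) bnd_ple[OF C pos_adj[OF assms(1)]], of x] assms(2) by simp
qed

lemma strong_limit_op:
 fixes T :: "nat=>'h :: complex_hilbert bop"
 assumes "!!n. bnd C (T n)" "!!x. convergent (%n. T n x)"
 shows "EX L. bnd C L&(ALL x. (%n. T n x)---->L x)"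
proof -
 define f where "f x=lim (%n. T n x)" for x
 have f:"(%n. T n x)---->f x" for x
  using assms(2)[of x] by (simp add: f_def convergent_LIMSEQ_iff)
 have nf:"norm (f x)<=C * norm x" for x
  by (rule tendsto_upperbound[OF tendsto_norm[OF f]]) (use bndD(1)[OF assms(1)] in auto)
 have "EX L :: 'h bop. ALL x. L x=f x"
 proof (rule bop_from_fun[OF _ _ nf])
  show "f (x + y)=f x + f y" for x y
   using LIMSEQ_unique[OF f[of "x + y"]] tendsto_add[OF f[of x] f[of y]] by simp
  have "(%n. c :* T n x)---->c :* f x" for c x
  proof -
   have "bounded_linear ((:*) c :: 'h=>'h)"
    by (rule bounded_linear_intro[where K = "cmod c"])
     (simp_all add: scaleC_add_right scaleC_scaleR norm_scaleC mult.commute)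
   from bounded_linear.tendsto[OF this f] show ?thesis .
  qed
  thus "f (c :* x)=c :* f x" for c x
   using LIMSEQ_unique[OF f[of "c :* x"]] by simp
 qed
 then obtain L :: "'h bop" where L:"!!x. L x=f x" by blast
 thus ?thesis using f nf bndD(2)[OF assms(1)] by (intro exI[of _ L]) (simp add: bnd_def)
qed

text \<open>The quadratic forms converge by monotonicity, and \<open>positive_norm_sq_le\<close>
  applied to differences upgrades this to norm convergence on vectors.\<close>

lemma strong_limit_increasing:
 fixes T :: "nat=>'h :: complex_hilbert bop"
 assumes pos:"!!n. pos (T n)" and inc:"!!n. T n[=T (Suc n)" and ub:"!!n. T n[=C .* 1"
  and C:"0<=C"
 shows "EX L. bnd C L&(ALL x. (%n. T n x)---->L x)"
proof (rule strong_limit_op)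
 show "bnd C (T n)" for n by (rule positive_bnd[OF pos ub C])
 fix x
 let ?f = "%n. Re (cinner x (T n x))"
 have mono:"T m[=T n" if "m<=n" for m n
  using that by (induction n rule: dec_induct) (auto intro: ple_trans[OF _ inc])
 have "convergent ?f"
 proof (rule Bseq_monoseq_convergent[OF BseqI'])
  show "norm (?f n)<=C*(norm x)^2" for n
   using posD(1)[OF pos, of x n] ple_Re[OF ub, of x n] by (simp add: cinner_simps power2_norm_eq_Re_cinner)
  show "monoseq ?f" unfolding monoseq_def using ple_Re[OF mono] by blast
 qed
 hence Cf:"Cauchy ?f" by (simp add: Cauchy_convergent_iff)
 have est:"(norm (T m x-T n x))^2<=C*\<bar>?f m - ?f n\<bar>" for m n
 proof -
  have *: "(norm (T n x-T m x))^2<=C*\<bar>?f n - ?f m\<bar>" if "m<=n" for m n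
  proof -
   have "T n-T m[=C .* 1"
    using pos_add[OF ub[of n] pos[of m]] by (simp add: algebra_simps)
   from positive_norm_sq_le[OF mono[OF that] this, of x] 
   have "(norm (T n x-T m x))^2<=C*(?f n - ?f m)" by (simp add: cinner_simps)
   also have "...<=C*\<bar>?f n - ?f m\<bar>" using C by (intro mult_left_mono) auto
   finally show ?thesis .
  qed
  show ?thesis using *[of m n] *[of n m] by (cases "m<=n") (auto simp: norm_minus_commute abs_minus_commute)
 qed
 show "convergent (%n. T n x)"
  unfolding Cauchy_convergent_iff[symmetric]
 proof (rule metric_CauchyI)
  fix e :: real assume e:"0<e"
  hence "0<e^2/(C+1)" using C by simp
  then obtain N where N:"!!m n. m>=N==>n>=N==>\<bar>?f m - ?f n\<bar><e^2/(C+1)"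
   using metric_CauchyD[OF Cf] unfolding dist_real_def by blast
  have "dist (T m x) (T n x)<e" if mn:"m>=N" "n>=N" for m n
  proof -
   have "(norm (T m x-T n x))^2<=C*(e^2/(C+1))"
    using est[of m n] mult_left_mono[OF less_imp_le[OF N[OF mn]] C] by linarith
   also have "...<e^2" using e C by (simp add: field_simps)
   finally show ?thesis using e by (simp add: dist_norm power2_less_imp_less)
  qed
  thus "EX M. ALL m>=M. ALL n>=M. dist (T m x) (T n x)<e" by blast
 qed
qed

lemma pos_limit:
 fixes T :: "'i=>'h :: complex_hilbert bop" and L :: "'h bop"
 assumes "!!x y. ((%n. cinner x (T n y))--->cinner x (L y)) F" "F~=bot" "\<forall>\<^sub>F n in F. pos (T n)"
 shows "pos L"
proof -
 have "cinner x (L x)=complex_of_real (Re (cinner x (L x)))" "0<=Re (cinner x (L x))" for x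
 proof -
  have r:"((%n. Re (cinner x (T n x)))--->Re (cinner x (L x))) F" by (intro tendsto_intros assms(1))
  show "0<=Re (cinner x (L x))"
   by (rule tendsto_lowerbound[OF r eventually_mono[OF assms(3)] assms(2)]) (rule posD(1))
  have "((%n. Im (cinner x (T n x)))--->0) F"
   by (rule tendsto_eventually, rule eventually_mono[OF assms(3)]) (rule posD(2))
  moreover have "((%n. Im (cinner x (T n x)))--->Im (cinner x (L x))) F" by (intro tendsto_intros assms(1))
  ultimately have "Im (cinner x (L x))=0" using tendsto_unique[OF assms(2)] by blast
  thus "cinner x (L x)=complex_of_real (Re (cinner x (L x)))" by (simp add: complex_eq_iff)
 qed
 thus ?thesis unfolding positive_op_def by (metis nonneg_Reals_of_real_iff)
qed

section \<open>Ultrafilters and weak compactness\<close>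

section \<open>Ultrafilters and weak limits\<close>

definition ultra :: "'i filter=>bool" where
 "ultra U\<longleftrightarrow>U~=bot&(ALL P. eventually P U\<or>eventually (%x. ~ P x) U)"

lemma ultraD:"ultra U==>U~=bot" by (simp add: ultra_def)

text \<open>Zorn's lemma for the proper filters finer than \<open>F\<close>: a nonempty chain has
  its infimum as bound, and a minimal proper filter decides every predicate.\<close>

lemma ex_ultra:
 fixes F :: "'i filter"
 assumes "F~=bot" shows "EX U<=F. ultra U"
proof -
 let ?A = "{G. G~=bot&G<=F}"
 have "EX U:?A. ALL G:?A. G<=U-->G=U"
 proof (rule predicate_Zorn)
  show "partial_order_on ?A (relation_of (%x y. y<=x) ?A)"
   by (rule partial_order_on_relation_ofI) auto
  fix C assume C:"C:Chains (relation_of (%x y. y<=x) ?A)"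
  hence CA:"C<=?A" unfolding Chains_def relation_of_def by blast
  have tot:"G<=H\<or>H<=G" if "G:C" "H:C" for G H
   using C that unfolding Chains_def relation_of_def by blast
  show "EX u:?A. ALL a:C. u<=a"
  proof (cases "C={}")
   case True thus ?thesis using assms by auto
  next
   case False
   have "eventually P (Inf C)\<longleftrightarrow>(EX G:C. eventually P G)" for P
    by (rule eventually_Inf_base[OF False]) (use tot in "metis inf.absorb1 inf.absorb2 order_refl")
   hence "Inf C~=bot" using CA unfolding trivial_limit_def by blast
   moreover have "Inf C<=F" using False CA by (metis (no_types, lifting) Inf_lower2 equals0I mem_Collect_eq subset_iff)
   ultimately show ?thesis by (intro bexI[of _ "Inf C"]) (auto intro: Inf_lower)
  qed
 qed
 then obtain U where U:"U~=bot" "U<=F" and max:"!!G. G~=bot==>G<=U==>G=U" by auto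
 have "eventually P U\<or>eventually (%x. ~ P x) U" for P
 proof (rule ccontr)
  assume n:"~ ?thesis"
  let ?G = "inf U (principal {x. P x})"
  have "?G~=bot" using n by (auto simp: trivial_limit_def eventually_inf_principal)
  hence "?G=U" by (rule max) simp
  moreover have "eventually P ?G" by (auto simp: eventually_inf_principal)
  ultimately show False using n by simp
 qed
 thus ?thesis using U by (auto simp: ultra_def)
qed

lemma ultra_limit_bounded:
 fixes f :: "'i=>complex"
 assumes "ultra U" "\<forall>\<^sub>F i in U. cmod (f i)<=C"
 shows "EX l. (f--->l) U"
proof -
 have "filtermap f U~=bot" using assms by (simp add: filtermap_bot_iff ultra_def)
 moreover have "\<forall>\<^sub>F x in filtermap f U. x:cball 0 C"
  using assms(2) by (simp add: eventually_filtermap)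
 ultimately obtain l where l:"inf (nhds l) (filtermap f U)~=bot"
  using compact_cball[of "0 :: complex" C] unfolding compact_filter by (meson)
 have "(f--->l) U"
 proof (rule topological_tendstoI, rule ccontr)
  fix S assume S:"open S" "l:S" "~ (\<forall>\<^sub>F x in U. f x:S)"
  hence "\<forall>\<^sub>F x in U. f x\<notin>S" using assms(1) by (auto simp: ultra_def)
  hence "\<forall>\<^sub>F y in filtermap f U. y\<notin>S" by (simp add: eventually_filtermap)
  moreover have "\<forall>\<^sub>F y in nhds l. y:S" using S(1,2) by (rule eventually_nhds_in_open)
  ultimately have "eventually (%y. False) (inf (nhds l) (filtermap f U))"
   unfolding eventually_inf by blast
  thus False using l by (simp add: trivial_limit_def)
 qed
 thus ?thesis by blast
qed

text \<open>Weak operator convergence along a filter. On bounded nets it already implies sigma-weak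
  convergence (\<open>wlim_limitin_sigma_weak\<close>).\<close>

definition wlim :: "('i=>'h :: complex_hilbert bop)=>'h bop=>'i filter=>bool" where
 "wlim T L F\<longleftrightarrow>(ALL x y. ((%i. cinner x (T i y))--->cinner x (L y)) F)"

text \<open>Compactness of norm-bounded sets in the weak topology: along an ultrafilter every matrix
  coefficient converges, and the limits form a bounded sesquilinear form.\<close>

lemma ultra_wlim:
 fixes T :: "'i=>'h :: complex_hilbert bop"
 assumes "ultra U" "\<forall>\<^sub>F i in U. bnd C (T i)"
 shows "EX L. bnd C L&wlim T L U"
proof -
 have C:"0<=C"
  using eventually_happens'[OF ultraD[OF assms(1)] assms(2)] bndD(2) by blast
 have bd:"\<forall>\<^sub>F i in U. cmod (cinner (T i x) y)<=C * norm x * norm y" for x y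
  using assms(2)
 proof (rule eventually_mono)
  fix i assume i:"bnd C (T i)"
  have "cmod (cinner (T i x) y)<=norm (T i x) * norm y" by (rule cmod_cinner_le)
  also have "...<=C * norm x * norm y" by (intro mult_right_mono bndD(1)[OF i]) auto
  finally show "cmod (cinner (T i x) y)<=C * norm x * norm y" .
 qed
 hence "EX l. ((%i. cinner (T i x) y)--->l) U" for x y
  by (rule ultra_limit_bounded[OF assms(1)])
 then obtain B where B:"!!x y. ((%i. cinner (T i x) y)--->B x y) U" by metis
 note uniq = tendsto_unique[OF ultraD[OF assms(1)]]
 have "EX L :: 'h bop. bnd C L&(ALL x y. cinner (L x) y=B x y)"
 proof (rule bop_from_form[OF _ _ _ _ _ C])
  show "B x (y + z)=B x y+B x z" for x y z
   using uniq[OF B tendsto_add[OF B[of x y] B[of x z], folded cinner_add_right]] .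
  show "B x (c :* y)=c*B x y" for c x y
   using uniq[OF B tendsto_mult[OF tendsto_const B[of x y], folded cinner_scaleC_right]] .
  show "B (x + y) z=B x z+B y z" for x y z
   using uniq[OF B, of "x + y" z] tendsto_add[OF B[of x z] B[of y z], folded cinner_add_left] by simp
  show "B (c :* x) y=cnj c*B x y" for c x y
   using uniq[OF B, of "c :* x" y] tendsto_mult[OF tendsto_const B[of x y], of "cnj c", folded cinner_scaleC_left] by simp
  show "cmod (B x y)<=C * norm x * norm y" for x y
   by (rule tendsto_upperbound[OF tendsto_norm[OF B] bd ultraD[OF assms(1)]])
 qed
 then obtain L :: "'h bop" where L:"bnd C L" "!!x y. cinner (L x) y=B x y" by blast
 have "((%i. cinner x (T i y))--->cinner x (L y)) U" for x y
  using tendsto_cnj[OF B[of y x]] unfolding L(2)[symmetric] by (simp flip: cinner_commute)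
 thus ?thesis using L(1) by (auto simp: wlim_def)
qed

lemma wlim_unique:"wlim T L F==>wlim T L' F==>F~=bot==>L=L'"
 by (rule bop_eqI, rule cinner_ext) (unfold wlim_def, blast intro: tendsto_unique)

lemma wlim_mono:"wlim T L F==>G<=F==>wlim T L G"
 by (auto simp: wlim_def intro: tendsto_mono)

lemma wlim_const:"wlim (%_. T) T F" by (simp add: wlim_def)

lemma wlim_add:"wlim S L F==>wlim T L' F==>wlim (%i. S i+T i) (L+L') F"
 by (auto simp: wlim_def cinner_simps intro: tendsto_add)
lemma wlim_diff:"wlim S L F==>wlim T L' F==>wlim (%i. S i-T i) (L-L') F"
 by (auto simp: wlim_def cinner_simps intro: tendsto_diff)
lemma wlim_scaleC:"wlim S L F==>wlim (%i. c :* S i) (c :* L) F"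
 by (auto simp: wlim_def cinner_simps intro: tendsto_mult)
lemma wlim_mult_left:"wlim S L F==>wlim (%i. A*S i) (A*L) F"
 by (auto simp: wlim_def adj_left[symmetric])
lemma wlim_mult_right:"wlim S L F==>wlim (%i. S i*A) (L*A) F"
 by (auto simp: wlim_def)
lemma wlim_adj:"wlim S L F==>wlim (%i. adj (S i)) (adj L) F"
 unfolding wlim_def
proof (intro allI)
 fix x y assume *: "ALL x y. ((%i. cinner x (S i y))--->cinner x (L y)) F"
 show "((%i. cinner x (adj (S i) y))--->cinner x (adj L y)) F"
  unfolding adj_right using tendsto_cnj[OF *[rule_format, of y x]] by (simp flip: cinner_commute)
qed

lemma strong_imp_wlim:"(!!x. ((%i. apply_op (T i) x)--->apply_op L x) F)==>wlim T L F"
 by (auto simp: wlim_def intro: tendsto_intros)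

lemma wlim_bnd:
 assumes "wlim T L F" "\<forall>\<^sub>F i in F. bnd C (T i)" "F~=bot" shows "bnd C L"
proof -
 obtain U where U:"U<=F" "ultra U" using ex_ultra[OF assms(3)] by blast
 obtain L' where "bnd C L'" "wlim T L' U"
  using ultra_wlim[OF U(2) filter_leD[OF U(1) assms(2)]] by blast
 thus ?thesis using wlim_unique[OF _ wlim_mono[OF assms(1) U(1)] ultraD[OF U(2)]] by metis
qed

section \<open>Amplification by l^2 and the sigma-weak topology\<close>

section \<open>Amplification and the sigma-weak topology\<close>

lemma l2_eqI:"(!!n. l2_nth f n=l2_nth g n)==>f=g"
 by (metis l2_nth_inject ext)

lemmas l2_nth_simps [simp] = plus_l2seq.rep_eq minus_l2seq.rep_eq zero_l2seq.rep_eq uminus_l2seq.rep_eq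
 scaleR_l2seq.rep_eq scaleC_l2seq.rep_eq tensor_vec.rep_eq

lemma l2_nth_sum:"l2_nth (SUM i:I. f i) n=(SUM i:I. l2_nth (f i) n)"
 by (induction I rule: infinite_finite_induct) auto

lift_definition l2_single :: "nat=>'h :: complex_inner=>'h l2seq" is "%m x n. if n=m then x else 0"
 by (rule summable_finite[of "{m}" for m]) auto

lemma l2_nth_single [simp]:"l2_nth (l2_single m x) n=(if n=m then x else 0)"
 by (simp add: l2_single.rep_eq)

lemma cinner_l2_single_left:"cinner (l2_single m x) g=cinner x (l2_nth g m)"
proof -
 have "(%n. cinner (l2_nth (l2_single m x) n) (l2_nth g n))=(%n. if n=m then cinner x (l2_nth g m) else 0)"
  by auto
 thus ?thesis
  unfolding cinner_l2seq_def using sums_single[of m "%_. cinner x (l2_nth g m)"] by (simp add: sums_iff)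
qed

lemma cinner_l2_single_right:"cinner g (l2_single m x)=cinner (l2_nth g m) x"
 by (metis cinner_commute cinner_l2_single_left)

lemma norm_l2_single:"norm (l2_single m x)=norm x"
 by (simp add: norm_eq_sqrt_Re_cinner cinner_l2_single_left)

lemma l2_trunc_tendsto:"(%N. SUM n<N. l2_single n (l2_nth f n))---->f"
proof -
 let ?t = "%N. SUM n<N. l2_single n (l2_nth f n)"
 have nth:"l2_nth (?t N) n=(if n<N then l2_nth f n else 0)" for N n
  unfolding l2_nth_sum l2_nth_single by (subst sum.delta') auto
 have "(norm (?t N - f))\<^sup>2 = (\<Sum>n. (norm (l2_nth f n))\<^sup>2) - (\<Sum>n<N. (norm (l2_nth f n))\<^sup>2)" for N
 proof -
  have "(\<lambda>n. (norm (l2_nth f n))\<^sup>2 - (if n \<in> {..<N} then (norm (l2_nth f n))\<^sup>2 else 0)) sums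
    ((\<Sum>n. (norm (l2_nth f n))\<^sup>2) - (\<Sum>n<N. (norm (l2_nth f n))\<^sup>2))"
   by (intro sums_diff summable_sums l2_nth_summable sums_If_finite_set) simp
  moreover have "(norm (l2_nth (?t N - f) n))^2=(norm (l2_nth f n))^2-(if n:{..<N} then (norm (l2_nth f n))^2 else 0)" for n
   by (simp add: nth)
  ultimately show ?thesis unfolding l2seq_norm_power2 by (simp add: sums_iff)
 qed
 moreover have "(\<lambda>N. (\<Sum>n. (norm (l2_nth f n))\<^sup>2) - (\<Sum>n<N. (norm (l2_nth f n))\<^sup>2)) \<longlonglongrightarrow> 0"
  using tendsto_diff[OF tendsto_const[of "\<Sum>n. (norm (l2_nth f n))^2"] summable_LIMSEQ[OF l2_nth_summable[of f]]] by simp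
 ultimately have "(%N. (norm (?t N - f))^2)---->0" by simp
 from tendsto_real_sqrt[OF this] have "(%N. norm (?t N - f))---->0" by simp
 thus ?thesis by (simp add: LIM_zero_iff tendsto_norm_zero_iff)
qed

lemma bounded_clinear_l2_map:
 fixes T :: "'h :: complex_hilbert bop"
 shows "EX R. (ALL f n. l2_nth (apply_op R f) n=T (l2_nth f n))&(ALL C. bnd C T-->bnd C R)"
proof -
 have sm:"summable (\<lambda>n. (norm (T (l2_nth f n)))\<^sup>2) \<and> (bnd C T \<longrightarrow> (\<Sum>n. (norm (T (l2_nth f n)))\<^sup>2) \<le> (C * norm f)\<^sup>2)" for f C
 proof -
  have le:"(norm (T (l2_nth f n)))^2<=C^2*(norm (l2_nth f n))^2" if "bnd C T" for n C
   using power_mono[OF bndD(1)[OF that, of "l2_nth f n"], of 2] by (simp add: power_mult_distrib)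
  have s:"summable (%n. C^2*(norm (l2_nth f n))^2)" for C by (intro summable_mult l2_nth_summable)
  obtain D where D:"bnd D T" using bnd_ex by blast
  have "summable (%n. (norm (T (l2_nth f n)))^2)"
   by (rule summable_comparison_test'[OF s[of D], of 0]) (use le[OF D] in simp)
  moreover have "(\<Sum>n. (norm (T (l2_nth f n)))\<^sup>2) \<le> (C * norm f)\<^sup>2" if "bnd C T"
  proof -
   have "(\<Sum>n. (norm (T (l2_nth f n)))\<^sup>2) \<le> (\<Sum>n. C\<^sup>2 * (norm (l2_nth f n))\<^sup>2)"
    by (intro suminf_le le[OF that] s calculation)
   thus ?thesis by (simp add: suminf_mult l2_nth_summable l2seq_norm_power2 power_mult_distrib)
  qed
  ultimately show ?thesis by blast
 qed
 define g where "g f=Abs_l2seq (%n. T (l2_nth f n))" for f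
 have g:"l2_nth (g f) n=T (l2_nth f n)" for f n unfolding g_def by (subst Abs_l2seq_inverse) (use sm in auto)
 have ng:"norm (g f)<=C * norm f" if "bnd C T" for C f
  by (rule power2_le_imp_le)
   (use sm[of f C] that bndD(2)[OF that] in \<open>auto simp: l2seq_norm_power2[of "g f"] g\<close>)
 obtain D where D:"bnd D T" using bnd_ex by blast
 have "EX R :: 'h l2seq bop. ALL f. R f=g f"
  by (rule bop_from_fun[OF _ _ ng[OF D]]) (auto intro!: l2_eqI simp: g)
 then obtain R :: "'h l2seq bop" where R:"!!f. R f=g f" by blast
 thus ?thesis using ng by (intro exI[of _ R]) (auto simp: R g bnd_def)
qed

text \<open>The operator T tensor 1. It turns every sigma-weak functional into a single matrix
  coefficient (\<open>sigma_weak_functional_amp\<close>).\<close>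

definition amp :: "'h :: complex_hilbert bop=>'h l2seq bop" where
 "amp T=(SOME R. (ALL f n. l2_nth (apply_op R f) n=T (l2_nth f n))&(ALL C. bnd C T-->bnd C R))"

lemma l2_nth_amp [simp]:"l2_nth (amp T f) n=apply_op T (l2_nth f n)"
 and bnd_amp:"bnd C T==>bnd C (amp T)"
 using someI_ex[OF bounded_clinear_l2_map[of T]] unfolding amp_def by blast+

lemma amp_add:"amp (S+T)=amp S + amp T" by (rule bop_eqI, rule l2_eqI) simp
lemma amp_diff:"amp (S-T)=amp S - amp T" by (rule bop_eqI, rule l2_eqI) simp
lemma amp_mult:"amp (S*T)=amp S * amp T" by (rule bop_eqI, rule l2_eqI) simp
lemma amp_scaleC:"amp (c :* T)=c :* amp T" by (rule bop_eqI, rule l2_eqI) simp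
lemma amp_one:"amp 1=1" by (rule bop_eqI, rule l2_eqI) simp
lemma amp_zero:"amp 0=0" by (rule bop_eqI, rule l2_eqI) simp
lemma amp_adj:"amp (adj T)=adj (amp T)"
proof (rule adj_eqI[symmetric])
 fix x y show "cinner (amp (adj T) x) y=cinner x (amp T y)"
  by (simp add: cinner_l2seq_def adj_left)
qed

lemma sigma_weak_functional_amp:"sigma_weak_functional xi et T=cinner xi (amp T et)"
 by (simp add: sigma_weak_functional_def cinner_l2seq_def)

lemma tendsto_by_approx:
 fixes f :: "'i=>'a :: real_normed_vector"
 assumes "!!e. 0<e==>EX g l'. (g--->l') F&(\<forall>\<^sub>F i in F. norm (f i - g i)<=e)&norm (l - l')<=e"
 shows "(f--->l) F"
proof (rule tendstoI)
 fix e :: real assume e:"0<e"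
 then obtain g l' where g:"(g--->l') F" "\<forall>\<^sub>F i in F. norm (f i - g i)<=e/4" "norm (l - l')<=e/4"
  using assms[of "e/4"] by auto
 have "\<forall>\<^sub>F i in F. dist (g i) l'<e/4" using tendstoD[OF g(1), of "e/4"] e by simp
 with g(2) show "\<forall>\<^sub>F i in F. dist (f i) l<e"
 proof eventually_elim
  case (elim i)
  have "dist (f i) l<=dist (f i) (g i) + dist (g i) l' + dist l' l"
   by (smt (verit) dist_triangle)
  thus ?case using elim g(3) e by (simp add: dist_norm norm_minus_commute)
 qed
qed

text \<open>A finitely supported second vector involves only finitely many coefficients of
  \<open>T i\<close>, and the uniform bound \<open>C\<close> controls the error of truncating
  \<open>y\<close>.\<close>

lemma wlim_amp:
 fixes T :: "'i=>'h :: complex_hilbert bop"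
 assumes "wlim T L F" "\<forall>\<^sub>F i in F. bnd C (T i)"
 shows "wlim (%i. amp (T i)) (amp L) F"
 unfolding wlim_def
proof (intro allI)
 fix x y
 obtain D where D:"bnd D L" using bnd_ex by blast
 show "((%i. cinner x (amp (T i) y))--->cinner x (amp L y)) F"
 proof (cases "F=bot")
  case False
  have C:"0<=C" using eventually_happens'[OF False assms(2)] bndD(2) by blast
  have D0:"0<=D" using bndD(2)[OF D] .
  show ?thesis
  proof (rule tendsto_by_approx)
   fix e :: real assume e:"0<e"
   let ?K = "(C+D) * norm x+1"
   have K:"0<?K" using C D0 by (simp add: add_nonneg_pos)
   have "\<forall>\<^sub>F N in sequentially. norm ((SUM n<N. l2_single n (l2_nth y n)) - y)<e / ?K"
    using tendstoD[OF l2_trunc_tendsto[of y], of "e / ?K"] e K by (simp add: dist_norm)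
   then obtain N where N:"norm ((SUM n<N. l2_single n (l2_nth y n)) - y)<e / ?K"
    by (auto simp: eventually_sequentially)
   define t where "t=(SUM n<N. l2_single n (l2_nth y n))"
   have est:"norm (cinner x (amp S y) - cinner x (amp S t))<=e" if "bnd c S" "c<=C+D" for S c
   proof -
    have "norm (cinner x (amp S y) - cinner x (amp S t))=cmod (cinner x (amp S (y - t)))"
     by (simp add: cinner_simps)
    also have "...<=norm x * norm (amp S (y - t))" by (rule cmod_cinner_le)
    also have "...<=norm x*(c * norm (y - t))"
     by (intro mult_left_mono bndD(1)[OF bnd_amp[OF that(1)]]) auto
    also have "...<=norm x*((C+D)*(e / ?K))"
     using N that C D0 bndD(2)[OF that(1)]
     by (intro mult_left_mono mult_mono) (auto simp: t_def norm_minus_commute)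
    also have "...=((C+D) * norm x / ?K) * e" by simp
    also have "...<=1 * e" using e K by (intro mult_right_mono) (auto simp: divide_le_eq)
    finally show ?thesis by simp
   qed
   show "EX g l'. (g--->l') F&(\<forall>\<^sub>F i in F. norm (cinner x (amp (T i) y) - g i)<=e)
    &norm (cinner x (amp L y) - l')<=e"
   proof (intro exI conjI)
    have *: "cinner x (amp S t)=(SUM n<N. cinner (l2_nth x n) (S (l2_nth y n)))" for S :: "'h bop"
    proof -
     have "amp S (l2_single n v)=l2_single n (S v)" for n v by (rule l2_eqI) simp
     thus ?thesis by (simp add: t_def bop_sum cinner_sum_right cinner_l2_single_right)
    qed
    show "((%i. cinner x (amp (T i) t))--->cinner x (amp L t)) F"
     unfolding * by (intro tendsto_sum) (use assms(1) in "simp add: wlim_def")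
    show "\<forall>\<^sub>F i in F. norm (cinner x (amp (T i) y) - cinner x (amp (T i) t))<=e"
     using assms(2) by eventually_elim (rule est, use D0 in auto)
    show "norm (cinner x (amp L y) - cinner x (amp L t))<=e" by (rule est[OF D]) (use C in auto)
   qed
  qed
 qed simp
qed

lemma topspace_sigma_weak [simp]:"topspace sigma_weak=UNIV"
proof -
 have "(UNIV :: 'a bop set):{sigma_weak_functional xi et -` U |xi et U. open U}"
  by (rule CollectI, rule exI[of _ 0], rule exI[of _ 0], rule exI[of _ UNIV]) simp
 thus ?thesis unfolding sigma_weak_def by (simp add: topology_generated_by_topspace) blast
qed

lemma limitin_sigma_weak:
 assumes "!!xi et. ((%i. sigma_weak_functional xi et (T i))--->sigma_weak_functional xi et L) F"
 shows "limitin sigma_weak T L F"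
 unfolding limitin_def
proof (intro conjI allI impI)
 show "L:topspace sigma_weak" by simp
 fix U assume "openin sigma_weak U&L:U"
 hence U:"generate_topology_on {sigma_weak_functional xi et -` U |xi et U. open U} U" "L:U"
  by (auto simp: sigma_weak_def openin_topology_generated_by_iff)
 thus "\<forall>\<^sub>F i in F. T i:U"
 proof (induction rule: generate_topology_on.induct)
  case (Basis s)
  then obtain xi et U where s:"s=sigma_weak_functional xi et -` U" "open U" by auto
  thus ?case using topological_tendstoD[OF assms[of xi et], of U] Basis by simp
 next
  case (UN K)
  then obtain k where "k:K" "L:k" by auto
  thus ?case using UN.IH[of k] by (auto elim: eventually_mono)
 qed (auto elim: eventually_elim2)
qed

lemma wlim_limitin_sigma_weak:
 assumes "wlim T L F" "\<forall>\<^sub>F i in F. bnd C (T i)"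
 shows "limitin sigma_weak T L F"
 by (rule limitin_sigma_weak)
  (use wlim_amp[OF assms] in "simp add: sigma_weak_functional_amp wlim_def")

lemma continuous_sigma_weak_functional:"continuous_map sigma_weak euclidean (sigma_weak_functional xi et)"
 unfolding continuous_map_def
proof (intro conjI allI impI)
 fix U :: "complex set" assume "openin euclidean U"
 hence "openin sigma_weak (sigma_weak_functional xi et -` U)"
  unfolding sigma_weak_def openin_topology_generated_by_iff by (intro generate_topology_on.Basis) auto
 thus "openin sigma_weak {x:topspace sigma_weak. sigma_weak_functional xi et x:U}"
  by (simp add: vimage_def)
qed simp

lemma normal_on_iff:
 "normal_on N Ph\<longleftrightarrow>(ALL xi et. continuous_map (subtopology sigma_weak N) euclidean (%T. sigma_weak_functional xi et (Ph T)))"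
proof
 assume "normal_on N Ph"
 thus "ALL xi et. continuous_map (subtopology sigma_weak N) euclidean (%T. sigma_weak_functional xi et (Ph T))"
  unfolding normal_on_def using continuous_map_compose[OF _ continuous_sigma_weak_functional] by (auto simp: o_def)
next
 assume *: "ALL xi et. continuous_map (subtopology sigma_weak N) euclidean (%T. sigma_weak_functional xi et (Ph T))"
 show "normal_on N Ph"
  unfolding normal_on_def sigma_weak_def[where 'h = 'b] continuous_on_generated_topo_iff
 proof (intro conjI allI impI)
  fix V assume "V:{sigma_weak_functional xi et -` U |(xi :: 'b l2seq) et U. open U}"
  then obtain xi et :: "'b l2seq" and U where V:"V=sigma_weak_functional xi et -` U" "open U" by auto
  have "openin (subtopology sigma_weak N) {T:topspace (subtopology sigma_weak N). sigma_weak_functional xi et (Ph T):U}"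
   using *[rule_format, of xi et] V(2) unfolding continuous_map_def by (metis open_openin)
  moreover have "{T:topspace (subtopology sigma_weak N). sigma_weak_functional xi et (Ph T):U}=Ph -` V\<inter>topspace (subtopology sigma_weak N)"
   using V by auto
  ultimately show "openin (subtopology sigma_weak N) (Ph -` V\<inter>topspace (subtopology sigma_weak N))" by simp
 next
  have "(\<Union>{sigma_weak_functional xi et -` U |(xi :: 'b l2seq) et U. open U})=UNIV"
   using topspace_sigma_weak unfolding sigma_weak_def topology_generated_by_topspace .
  thus "Ph ` topspace (subtopology sigma_weak N)<=\<Union>{sigma_weak_functional xi et -` U |(xi :: 'b l2seq) et U. open U}"
   by simp
 qed
qed

lemma normal_onI:
 assumes "!!xi et. EX xi' et'. ALL T:N. sigma_weak_functional xi et (Ph T)=sigma_weak_functional xi' et' T"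
 shows "normal_on N Ph"
 unfolding normal_on_iff
proof (intro allI)
 fix xi et
 obtain xi' et' where e:"!!T. T:N==>sigma_weak_functional xi et (Ph T)=sigma_weak_functional xi' et' T"
  using assms[of xi et] by blast
 have "continuous_map (subtopology sigma_weak N) euclidean (sigma_weak_functional xi' et')"
  by (rule continuous_map_from_subtopology[OF continuous_sigma_weak_functional])
 thus "continuous_map (subtopology sigma_weak N) euclidean (%T. sigma_weak_functional xi et (Ph T))"
  by (rule continuous_map_eq) (simp add: e)
qed

lemma continuous_map_tendsto_sigma_weak:
 fixes f :: "'h :: complex_hilbert bop=>complex"
 assumes "continuous_map (subtopology sigma_weak N) euclidean f"
  "limitin sigma_weak T L F" "\<forall>\<^sub>F i in F. T i:N" "L:N"
 shows "((%i. f (T i))--->f L) F"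
proof -
 have "limitin (subtopology sigma_weak N) T L F"
  using assms(2-4) by (simp add: limitin_subtopology)
 from continuous_map_limit[OF assms(1) this] show ?thesis by (simp add: o_def)
qed

section \<open>Unital algebras closed under bounded weak limits\<close>

section \<open>Weakly closed operator algebras\<close>

text \<open>Sigma-weak closedness implies this condition (\<open>von_neumann_wclosed\<close>); it is
  easy to verify for commutants, intersections and images under representations.\<close>

definition wclosed :: "'h :: complex_hilbert bop set=>bool" where
 "wclosed X\<longleftrightarrow>(ALL F C T. F~=bot-->(\<forall>\<^sub>F S in F. S:X&bnd C S)-->wlim (%S. S) T F-->T:X)"

lemma wclosedD:
 assumes "wclosed X" "F~=bot" "\<forall>\<^sub>F i in F. T i:X&bnd C (T i)" "wlim T L F"
 shows "L:X"
proof -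
 have "filtermap T F~=bot" using assms(2) by (simp add: filtermap_bot_iff)
 moreover have "\<forall>\<^sub>F S in filtermap T F. S:X&bnd C S" using assms(3) by (simp add: eventually_filtermap)
 moreover have "wlim (%S. S) L (filtermap T F)"
  using assms(4) by (simp add: wlim_def filterlim_filtermap)
 ultimately show ?thesis using assms(1) unfolding wclosed_def by blast
qed

locale walg =
 fixes N :: "'h :: complex_hilbert bop set"
 assumes w_one:"1:N"
  and w_add:"x:N==>y:N==>x + y:N"
  and w_mult:"x:N==>y:N==>x * y:N"
  and w_scaleC:"x:N==>c :* x:N"
  and w_adj:"x:N==>adj x:N"
  and w_closed:"wclosed N"
begin

lemma w_csubspace:"csubspace N"
 unfolding csubspace_def using w_add w_scaleC w_scaleC[OF w_one, of 0] by (auto simp: scaleC_zero_left)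

lemmas w_zero = csubspaceD(1)[OF w_csubspace]
 and w_scaleR = csubspaceD(4)[OF w_csubspace]
 and w_diff = csubspaceD(5)[OF w_csubspace]
 and w_uminus = csubspaceD(6)[OF w_csubspace]
 and w_sum = csubspace_sum[OF w_csubspace]

lemma w_power:"x:N==>x ^ n:N"
 by (induction n) (auto intro: w_one w_mult)

lemmas w_ins = w_one w_add w_mult w_scaleC w_adj w_zero w_scaleR w_diff w_uminus w_sum w_power

lemma w_limit:
 assumes "!!n. T n:N" "!!n. bnd C (T n)" "!!x. (%n. apply_op (T n) x)---->apply_op L x"
 shows "L:N"
 by (rule wclosedD[OF w_closed sequentially_bot _ strong_imp_wlim[OF assms(3)], of C]) (use assms in auto)

lemma w_ultra_limit:
 assumes "ultra U" "\<forall>\<^sub>F i in U. T i:N" "\<forall>\<^sub>F i in U. bnd C (T i)"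
 shows "EX L:N. bnd C L&wlim T L U"
proof -
 obtain L where L:"bnd C L" "wlim T L U" using ultra_wlim[OF assms(1,3)] by blast
 have "L:N" by (rule wclosedD[OF w_closed ultraD[OF assms(1)] _ L(2), of C]) (use assms in "auto intro: eventually_conj")
 with L show ?thesis by blast
qed

end

lemma von_neumann_wclosed:"von_neumann_algebra N==>wclosed N"
 unfolding wclosed_def
proof (intro allI impI)
 fix F C T assume N:"von_neumann_algebra N" and F:"F~=bot" "\<forall>\<^sub>F S in F. S:N&bnd C S" "wlim (%S. S) T F"
 have "limitin sigma_weak (%S. S) T F"
  by (rule wlim_limitin_sigma_weak[OF F(3), of C]) (use F(2) in "auto elim: eventually_mono")
 thus "T:N"
  by (rule limitin_closedin) (use N F in "auto simp: von_neumann_algebra_def elim: eventually_mono")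
qed

lemma von_neumann_walg:"von_neumann_algebra N==>1:N==>walg N"
 using von_neumann_wclosed[of N] by unfold_locales (auto simp: von_neumann_algebra_def)

text \<open>Later constructions conclude membership in every \<open>walg\<close> that contains their
  data. Applied to a commutant, this says that square roots and kernel projections commute with
  whatever commutes with the data and its adjoint.\<close>

lemma walg_commutant:
 assumes "!!x. x:X==>adj x:X" shows "walg (commutant X)"
proof
 show "1:commutant X" by (simp add: commutant_def)
 show "x + y:commutant X" if "x:commutant X" "y:commutant X" for x y
  using that by (simp add: commutant_def algebra_simps)
 show "x * y:commutant X" if "x:commutant X" "y:commutant X" for x y
  using that by (simp add: commutant_def) (metis assoc)
 show "c :* x:commutant X" if "x:commutant X" for x c
  using that by (simp add: commutant_def)
 show "adj x:commutant X" if "x:commutant X" for x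
  unfolding commutant_def
 proof (rule CollectI, rule ballI)
  fix y assume "y:X"
  hence "x * adj y=adj y * x" using that assms by (auto simp: commutant_def)
  hence "adj (x * adj y)=adj (adj y * x)" by simp
  thus "adj x * y=y * adj x" by simp
 qed
 show "wclosed (commutant X)"
  unfolding wclosed_def
 proof (intro allI impI)
  fix F C T assume F:"F~=bot" "\<forall>\<^sub>F S in F. S:commutant X&bnd C S" "wlim (%S. S) T F"
  have "T * y - y*T=0" if y:"y:X" for y
  proof (rule wlim_unique[OF _ _ F(1)])
   show "wlim (%S. S * y - y*S) (T * y - y*T) F" by (intro wlim_diff wlim_mult_left wlim_mult_right F(3))
   have "\<forall>\<^sub>F S in F. S * y - y*S=0" using F(2) y by (auto simp: commutant_def elim: eventually_mono)
   thus "wlim (%S. S * y - y*S) 0 F"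
    unfolding wlim_def
    by (intro allI tendsto_eventually, elim eventually_mono) (simp only: bop_zero_apply cinner_zero_right)
  qed
  thus "T:commutant X" by (simp add: commutant_def)
 qed
qed

section \<open>Functional calculus without a spectral theorem: roots, kernels, polar parts\<close>

section \<open>Square roots, spectral projections and polar decomposition\<close>

lemma bop_mult_left_commute_power:"(b :: 'h :: complex_hilbert bop) * b ^ n=b ^ n * b"
 by (simp add: power_commutes)

text \<open>Polynomials in \<open>b\<close> with nonnegative real coefficients. They commute, are
  stable under products, and are positive when \<open>b\<close> is; this gives the monotonicity of
  \<open>sqrt_iter\<close>.\<close>

inductive_set pcone :: "'h :: complex_hilbert bop=>'h bop set" for b where
 pcone_0:"0:pcone b"
| pcone_Cons:"X:pcone b==>0<=r==>r .* b ^ k+X:pcone b"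

lemma pcone_power:"0<=r==>r .* b ^ k:pcone b"
 using pcone_Cons[OF pcone_0, of r b k] by simp

lemma pcone_add:"X:pcone b==>Y:pcone b==>X+Y:pcone b"
 by (induction rule: pcone.induct) (auto simp: add.assoc intro: pcone_Cons)

lemma pcone_scaleR:"X:pcone b==>0<=r==>r .* X:pcone b"
 by (induction rule: pcone.induct) (auto simp: scaleR_add_right intro: pcone.intros)

lemma pcone_mult_power:"X:pcone b==>b ^ k*X:pcone b"
proof (induction rule: pcone.induct)
 case (pcone_Cons X r j)
 have "b ^ k*(r .* b ^ j+X)=r .* b ^ (k + j) + b ^ k*X"
  by (simp add: distrib_left power_add)
 thus ?case using pcone.pcone_Cons[OF pcone_Cons.IH pcone_Cons.hyps(2), of "k + j"] by simp
qed (simp add: pcone_0)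

lemma pcone_mult:"X:pcone b==>Y:pcone b==>X*Y:pcone b"
proof (induction rule: pcone.induct)
 case (pcone_Cons X r j)
 thus ?case by (simp add: distrib_right pcone_add pcone_scaleR pcone_mult_power)
qed (simp add: pcone_0)

lemma pcone_commute_power:"X:pcone b==>b ^ k*X=X * b ^ k"
 by (induction rule: pcone.induct) (auto simp: distrib_left distrib_right power_add[symmetric] add.commute)

lemma pcone_commute:"X:pcone b==>Y:pcone b==>X*Y=Y*X"
 by (induction rule: pcone.induct) (auto simp: distrib_left distrib_right pcone_commute_power)

lemma pos_power:
 assumes "pos b" shows "pos (b ^ n)"
proof -
 have a:"adj (b ^ m)=b ^ m" for m using pos_adj[OF assms] by simp
 obtain m where "n=2 * m\<or>n=2 * m+1" by (metis oddE evenE)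
 thus ?thesis
 proof
  assume "n=2 * m"
  hence "b ^ n=adj (b ^ m) * b ^ m" by (simp only: a power_add mult_2)
  thus ?thesis by (simp only: pos_adj_mult)
 next
  assume "n=2 * m+1"
  hence "b ^ n=adj (b ^ m) * b * b ^ m"
   unfolding a by (simp only: assoc power_Suc[symmetric] power_add[symmetric]) (simp add: mult_2)
  thus ?thesis using pos_conj[OF assms] by metis
 qed
qed

lemma pcone_positive:"X:pcone b==>pos b==>pos X"
 by (induction rule: pcone.induct) (auto intro: pos_add pos_scaleR pos_power)

lemma (in walg) pcone_in:"X:pcone b==>b:N==>X:N"
 by (induction rule: pcone.induct) (auto intro: w_ins)

text \<open>A limit c satisfies c = (b + c^2)/2, that is, (1 - c)^2 = 1 - b. With b = 1 - T the
  operator 1 - c is the square root of T.\<close>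

primrec sqrt_iter :: "'h :: complex_hilbert bop=>nat=>'h bop" where
 "sqrt_iter b 0=0"
| "sqrt_iter b (Suc n)=(1/2) .* (b + sqrt_iter b n * sqrt_iter b n)"

lemma sqrt_iter_pcone:"sqrt_iter b n:pcone b"
proof (induction n)
 case (Suc n)
 have "b:pcone b" using pcone_power[of 1 b 1] by simp
 thus ?case using Suc by (auto intro!: pcone_scaleR pcone_add pcone_mult)
qed (simp add: pcone_0)

lemma sqrt_iter_incr:"sqrt_iter b (Suc n) - sqrt_iter b n:pcone b"
proof (induction n)
 case 0
 show ?case using sqrt_iter_pcone[of b 1] by simp
next
 case (Suc n)
 let ?c = "sqrt_iter b"
 have "?c (Suc (Suc n)) - ?c (Suc n)=(1/2) .* (?c (Suc n) * ?c (Suc n) - ?c n * ?c n)"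
  by (simp add: scaleR_diff_right[symmetric] del: scaleR_half_double)
 also have "?c (Suc n) * ?c (Suc n) - ?c n * ?c n=(?c (Suc n) - ?c n)*(?c (Suc n) + ?c n)"
  using pcone_commute[OF sqrt_iter_pcone[of b "Suc n"] sqrt_iter_pcone[of b n]]
  by (simp only: left_diff_distrib distrib_left) simp
 finally show ?case
  using Suc by (auto intro!: pcone_scaleR pcone_mult pcone_add sqrt_iter_pcone simp del: sqrt_iter.simps)
qed

lemma tendsto_strong_mult:
 fixes S T :: "nat=>'h :: complex_hilbert bop"
 assumes "!!n. bnd C (S n)" "!!x. (%n. S n x)---->S' x" "(%n. v n)---->(v' :: 'h)"
 shows "(%n. S n (v n))---->S' v'"
proof -
 have "(%n. S n (v n - v'))---->0"
 proof (rule Lim_null_comparison)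
  show "\<forall>\<^sub>F n in sequentially. norm (S n (v n - v'))<=C * norm (v n - v')"
   using bndD(1)[OF assms(1)] by (simp del: bop_diff)
  show "(%n. C * norm (v n - v'))---->0"
   using tendsto_mult[OF tendsto_const[of C] tendsto_norm_zero[OF LIM_zero[OF assms(3)]]] by simp
 qed
 from tendsto_add[OF this assms(2)[of v']] show ?thesis by simp
qed

lemma positive_bnd1:"pos T==>T[=1==>bnd 1 T"
 by (rule positive_bnd) simp_all

lemma sqrt_exists_contraction:
 fixes T :: "'h :: complex_hilbert bop"
 assumes T:"pos T" "T[=1"
 shows "EX R. pos R&R*R=T&(ALL N. walg N-->T:N-->R:N)"
proof -
 define b where "b=1-T"
 have b:"pos b" "b[=1" using T by (auto simp: b_def)
 let ?c = "sqrt_iter b"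
 have cpos:"pos (?c n)" for n by (rule pcone_positive[OF sqrt_iter_pcone b(1)])
 have c1:"?c n[=1" for n
 proof (induction n)
  case (Suc n)
  have "bnd 1 (?c n)" by (rule positive_bnd1[OF cpos Suc])
  hence "?c n * ?c n[=1" using bnd_adj_mult_le[of 1 "?c n"] pos_adj[OF cpos] by simp
  hence "(1/2) .* (b + ?c n * ?c n)[=(1/2) .* (1+1)"
   using b(2) by (intro ple_scaleR ple_add) auto
  thus ?case by (simp del: scaleR_half_double add: scaleR_half_double[of 1])
 qed simp
 have "EX L. bnd 1 L&(ALL x. (%n. ?c n x)---->apply_op L x)"
  by (rule strong_limit_increasing[OF cpos])
   (use c1 pcone_positive[OF sqrt_iter_incr b(1)] in auto)
 then obtain c where c:"bnd 1 c" "!!x. (%n. ?c n x)---->c x" by blast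
 have cb:"bnd 1 (?c n)" for n by (rule positive_bnd1[OF cpos c1])
 have eq:"c=(1/2) .* (b + c * c)"
 proof (rule bop_eqI)
  fix x
  have "(%n. ?c (Suc n) x)---->((1/2) .* (b + c * c)) x"
   by simp (intro tendsto_intros tendsto_strong_mult[OF cb c(2)] c(2))
  thus "c x=((1/2) .* (b + c * c)) x"
   using LIMSEQ_unique[OF LIMSEQ_Suc[OF c(2)[of x]]] by blast
 qed
 have cc:"c * c=2 .* c - b" using arg_cong[OF eq, of "%x. 2 .* x"] by simp
 have "c[=1"
 proof (rule pos_limit[where F = sequentially and T = "%n. 1 - ?c n"])
  show "(%n. cinner x ((1 - ?c n) y))---->cinner x ((1 - c) y)" for x y
   by simp (intro tendsto_intros c(2))
 qed (use c1 in auto)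
 moreover have "(1 - c)*(1 - c)=T"
  using cc by (simp add: algebra_simps b_def scaleR_2)
 moreover have "1 - c:N" if "walg N" "T:N" for N
 proof -
  interpret walg N by fact
  have "b:N" unfolding b_def by (intro w_ins that)
  hence "c:N" by (intro w_limit[OF pcone_in[OF sqrt_iter_pcone] cb c(2)])
  thus ?thesis by (intro w_ins)
 qed
 ultimately show ?thesis by blast
qed

lemma sqrt_exists:
 fixes T :: "'h :: complex_hilbert bop"
 assumes T:"pos T"
 shows "EX R. pos R&R*R=T&(ALL N. walg N-->T:N-->R:N)"
proof -
 obtain C where C:"bnd C T" using bnd_ex by blast
 define D where "D=C+1"
 have D:"0<D" using bndD(2)[OF C] by (simp add: D_def)
 have "T[=D .* 1" by (rule bnd_ple[OF bnd_mono[OF C] pos_adj[OF T]]) (simp add: D_def)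
 from ple_scaleR[OF this, of "1/D"] have "(1/D) .* T[=1" using D by simp
 then obtain R where R:"pos R" "R*R=(1/D) .* T"
   "!!N. walg N==>(1/D) .* T:N==>R:N"
  using sqrt_exists_contraction[OF pos_scaleR[OF T, of "1/D"]] D by auto
 show ?thesis
 proof (intro exI conjI allI impI)
  show "pos (sqrt D .* R)" using R(1) D by (intro pos_scaleR) auto
  show "(sqrt D .* R)*(sqrt D .* R)=T" using R(2) D by simp
  show "sqrt D .* R:N" if "walg N" "T:N" for N
  proof -
   interpret walg N by fact
   show ?thesis by (intro w_ins R(3) that)
  qed
 qed
qed

lemma projectionD:"projection p==>p * p=p" "projection p==>adj p=p"
 by (simp_all add: projection_def)

lemma projection_positive:"projection p==>pos p"
 using pos_adj_mult[of p] by (simp add: projection_def)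

lemma projection_compl:"projection p==>projection (1 - p)"
 by (simp add: projection_def algebra_simps)

lemma projection_ple_1:"projection p==>p[=1"
 by (rule projection_positive[OF projection_compl])

lemma projection_bnd:"projection p==>bnd 1 p"
 by (intro positive_bnd1 projection_positive projection_ple_1)

lemma projection_norm2:"projection p==>(norm (apply_op p x))^2=Re (cinner x (apply_op p x))"
 by (metis Re_cinner_adj_mult projection_def)

lemma projection_0 [simp]:"projection 0" and projection_1 [simp]:"projection 1"
 by (simp_all add: projection_def)

text \<open>The powers of \<open>1 - a\<close> decrease, and their strong limit P satisfies P (1 -
  a) = P, hence P a = 0. This exhibits the kernel projection inside every algebra containing
  \<open>a\<close>.\<close>

lemma ker_limit_contraction:
 fixes a :: "'h :: complex_hilbert bop"
 assumes a:"pos a" "a[=1"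
 shows "EX P. projection P&a*P=0&(ALL x. a x=0-->apply_op P x=x) &
   (ALL x. (%n. ((1 - a) ^ n) x)---->apply_op P x)&(ALL n. bnd 1 ((1 - a) ^ n)) &
   (ALL N. walg N-->a:N-->P:N)"
proof -
 let ?s = "%n. (1 - a) ^ n"
 have ps:"pos (?s n)" for n by (rule pos_power[OF a(2)])
 have dec:"pos (?s n - ?s (Suc n))" for n
 proof -
  obtain r where r:"pos r" "r * r=a" "!!N. walg N==>a:N==>r:N"
   using sqrt_exists[OF a(1)] by blast
  interpret w: walg "commutant {a}" by (rule walg_commutant) (simp add: pos_adj[OF a(1)])
  have "r:commutant {a}" by (intro r(3) w.walg_axioms) (simp add: commutant_def)
  hence "r*(1 - a)=(1 - a) * r" by (simp add: commutant_def algebra_simps)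
  hence rc:"r * ?s n=?s n * r" by (induction n) (simp_all add: assoc, metis assoc)
  have "?s n - ?s (Suc n)=?s n * a" by (simp add: power_commutes[symmetric] algebra_simps)
  also have "...=adj r * ?s n * r"
   by (metis assoc pos_adj r(1) r(2) rc)
  finally show ?thesis using pos_conj[OF ps] by metis
 qed
 have le1:"?s n[=1" for n
  by (induction n) (use dec in "auto intro: ple_trans simp del: power_Suc")
 have bs:"bnd 1 (?s n)" for n by (rule positive_bnd1[OF ps le1])
 have "EX L. bnd 1 L&(ALL x. (%n. (1 - ?s n) x)---->apply_op L x)"
 proof (rule strong_limit_increasing)
  show "pos (1 - ?s n)" for n by (rule le1)
  show "1 - ?s n[=1 - ?s (Suc n)" for n using dec[of n] by (simp del: power_Suc)
  show "1 - ?s n[=1 .* 1" for n using ps[of n] by simp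
 qed simp
 then obtain L where L:"!!x. (%n. (1 - ?s n) x)---->apply_op L x" by blast
 define P where "P=1-L"
 have lim:"(%n. ?s n x)---->P x" for x
  using tendsto_diff[OF tendsto_const[of x] L[of x]] by (simp add: P_def)
 have Pa:"P*(1 - a)=P"
 proof (rule bop_eqI)
  fix x
  have "(%n. ?s (Suc n) x)---->(P*(1 - a)) x"
   unfolding power_Suc2 bop_times_apply by (rule lim)
  thus "(P*(1 - a)) x=P x" using LIMSEQ_unique[OF _ LIMSEQ_Suc[OF lim]] by blast
 qed
 have adjP:"adj P=P"
 proof (rule adj_eqI)
  fix x y
  have "(%n. cinner (?s n x) y)---->cinner (P x) y" by (intro tendsto_intros lim)
  moreover have "(%n. cinner x (?s n y))---->cinner x (P y)" by (intro tendsto_intros lim)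
  moreover have "cinner (?s n x) y=cinner x (?s n y)" for n
   by (metis adj_left pos_adj[OF ps])
  ultimately show "cinner (P x) y=cinner x (P y)" using LIMSEQ_unique by auto
 qed
 have aP:"a*P=0"
 proof -
  have "P * a=0" using Pa by (simp add: algebra_simps)
  hence "adj (P * a)=0" by simp
  thus ?thesis using adjP pos_adj[OF a(1)] by simp
 qed
 have fix1:"P x=x" if "a x=0" for x
 proof -
  have "?s n x=x" for n by (induction n) (simp_all add: that power_Suc2 del: power_Suc)
  thus ?thesis using LIMSEQ_unique[OF lim[of x]] by simp
 qed
 have "P*P=P"
 proof (rule bop_eqI)
  fix x
  have "a (P x)=0" using aP by (metis bop_times_apply bop_zero_apply)
  thus "(P*P) x=P x" using fix1 by simp
 qed
 hence "projection P" using adjP by (simp add: projection_def)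
 moreover have "P:N" if "walg N" "a:N" for N
 proof -
  interpret walg N by fact
  show ?thesis by (rule w_limit[OF _ bs lim]) (intro w_ins that)
 qed
 ultimately show ?thesis using aP fix1 lim bs by blast
qed

lemma ker_projection:
 fixes T :: "'h :: complex_hilbert bop"
 shows "EX P. projection P&T*P=0&(ALL x. T x=0-->apply_op P x=x) &
   (ALL N. walg N-->T:N-->P:N)"
proof -
 obtain C where C:"bnd C T" using bnd_ex by blast
 define D where "D=C+1"
 have D:"0<D" using bndD(2)[OF C] by (simp add: D_def)
 define a where "a=(1/D^2) .* (adj T*T)"
 have "adj T*T[=D^2 .* 1" by (rule bnd_adj_mult_le[OF bnd_mono[OF C]]) (simp add: D_def)
 from ple_scaleR[OF this, of "1/D^2"] have a1:"a[=1" unfolding a_def using D by simp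
 have "pos a" unfolding a_def by (intro pos_scaleR pos_adj_mult) simp
 from ker_limit_contraction[OF this a1] obtain P where P:"projection P" "a*P=0" "!!x. a x=0==>P x=x"
  "!!N. walg N==>a:N==>P:N" by blast
 have "T (P x)=0" for x
 proof -
  have "a (P x)=0" using P(2) by (metis bop_times_apply bop_zero_apply)
  hence "adj T (T (P x))=0" using D by (simp add: a_def)
  hence "cinner (T (P x)) (T (P x))=0" by (simp flip: adj_right)
  thus ?thesis by (simp add: cinner_self_eq_0)
 qed
 hence "T*P=0" by (intro bop_eqI) simp
 moreover have "P x=x" if "T x=0" for x using that by (intro P(3)) (simp add: a_def)
 moreover have "P:N" if "walg N" "T:N" for N
 proof -
  interpret walg N by fact
  show ?thesis by (rule P(4)[OF that(1)]) (unfold a_def, intro w_ins that(2))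
 qed
 ultimately show ?thesis using P(1) by blast
qed

text \<open>With R the absolute value of T, the projection P onto the kernel of R + T marks the part
  where T is nonpositive. Since (R + T)(R - T) = 0, the operator R - T lives under P, which
  determines R P and T P.\<close>

lemma spectral_cut:
 fixes T :: "'h :: complex_hilbert bop"
 assumes T:"adj T=T"
 shows "EX E. projection E&T*E=E*T&pos (- (T*E))&pos (T*(1-E)) &
   (ALL N. walg N-->T:N-->E:N)"
proof -
 have "pos (T*T)" using pos_adj_mult[of T] T by simp
 then obtain R where R:"pos R" "R*R=T*T" "!!N. walg N==>T*T:N==>R:N"
  using sqrt_exists by blast
 interpret c: walg "commutant {T}" by (rule walg_commutant) (simp add: T)
 have "T:commutant {T}" by (simp add: commutant_def)
 hence "R:commutant {T}" by (intro R(3) c.walg_axioms c.w_mult)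
 hence RT:"R*T=T*R" by (simp add: commutant_def)
 define S where "S=R+T"
 have S:"adj S=S" using T pos_adj[OF R(1)] by (simp add: S_def)
 obtain P where P:"projection P" "S*P=0" "!!x. S x=0==>P x=x"
  "!!N. walg N==>S:N==>P:N" using ker_projection[of S] by blast
 have PS:"P*S=0" using arg_cong[OF P(2), of adj] S projectionD(2)[OF P(1)] by simp
 have Z:"S*(R-T)=0" using RT R(2) by (simp add: S_def algebra_simps)
 have PZ:"P*(R-T)=R-T"
 proof (rule bop_eqI)
  fix x
  have "S ((R-T) x)=0" using Z by (metis bop_times_apply bop_zero_apply)
  hence "P ((R-T) x)=(R-T) x" by (rule P(3))
  thus "(P*(R-T)) x=(R-T) x" by (simp only: bop_times_apply)
 qed
 have ZP:"(R-T)*P=R-T"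
  using arg_cong[OF PZ, of adj] T pos_adj[OF R(1)] projectionD(2)[OF P(1)] by simp
 have s1:"R*P+T*P=0" "P*R+P*T=0"
  using P(2) PS by (simp_all add: S_def distrib_right distrib_left)
 have s2:"R*P-T*P=R-T" "P*R-P*T=R-T"
  using ZP PZ by (simp_all only: left_diff_distrib right_diff_distrib)
 have "2 .* (R*P)=(R*P+T*P)+(R*P-T*P)" by (simp add: scaleR_2)
 hence RP:"2 .* (R*P)=R-T" unfolding s1 s2 by simp
 have "2 .* (T*P)=(R*P+T*P)-(R*P-T*P)" by (simp add: scaleR_2)
 hence TP:"2 .* (T*P)=T-R" unfolding s1 s2 by simp
 have "2 .* (P*T)=(P*R+P*T)-(P*R-P*T)" by (simp add: scaleR_2)
 hence PT:"2 .* (P*T)=T-R" unfolding s1 s2 by simp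
 have half:"X=Y" if "2 .* X=2 .* Y" for X Y :: "'h bop" using that by simp
 have comm:"T*P=P*T" by (rule half) (simp add: TP PT)
 have TPR:"- (T*P)=R*P" by (rule half) (use TP RP in "simp add: scaleR_minus_right")
 have "R*P=P*R" 
 proof -
  have "R*P=- (T*P)" using TPR by simp
  also have "...=P*R" using PS comm by (simp add: S_def algebra_simps add_eq_0_iff2)
  finally show ?thesis .
 qed
 hence "R*P=adj P*R*P" using projectionD[OF P(1)] by (metis assoc)
 hence p1:"pos (- (T*P))" unfolding TPR using pos_conj[OF R(1), of P] by simp
 have "T*(1-P)=R*(1-P)"
 proof -
  have "T-T*P=R-R*P" using s2(1) by (metis diff_diff_eq2 add.commute diff_add_eq diff_eq_eq)
  thus ?thesis by (simp add: right_diff_distrib)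
 qed
 also have "...=adj (1-P)*R*(1-P)"
  using \<open>R * P = P * R\<close> projectionD[OF P(1)] by (simp add: algebra_simps) (metis assoc)
 finally have p2:"pos (T*(1-P))" using pos_conj[OF R(1), of "1-P"] by simp
 have "P:N" if "walg N" "T:N" for N
 proof -
  interpret walg N by fact
  show ?thesis by (rule P(4)[OF that(1)]) (unfold S_def, intro w_ins R(3) that)
 qed
 with P(1) comm p1 p2 show ?thesis by blast
qed

text \<open>The test projection is the spectral projection of the nonpositive part of
  \<open>b\<close>: once \<open>b\<close> vanishes on it, only the positive part remains.\<close>

lemma (in walg) positive_if_tested:
 assumes "b:N" "adj b=b" "!!c. c:N==>pos c==>b * c=c * b==>pos (- (c * b * c))==>c * b * c=0"
 shows "pos b"
proof -
 obtain E where E:"projection E" "b*E=E * b" "pos (- (b*E))" "pos (b*(1-E))" "E:N"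
  using spectral_cut[OF assms(2)] assms(1) walg_axioms by blast
 have "E * b*E=b*E" using E(2) projectionD[OF E(1)] by (metis assoc)
 hence "b*E=0" using assms(3)[OF E(5) projection_positive[OF E(1)] E(2)] E(3) by simp
 thus ?thesis using E(4) by (simp add: algebra_simps)
qed

text \<open>The partial isometry is the strong limit of \<open>T (1 + (1 - |T|) + \<dots> + (1 - |T|)\<^sup>n)\<close> for \<open>|T| \<le> 1\<close>.\<close>

lemma polar_decomposition:
 fixes T :: "'h :: complex_hilbert bop"
 shows "EX V R P. pos R&R*R=adj T*T&T=V*R&adj V*V=1-P&projection P &
   T*P=0&R*P=0&(ALL x. T x=0-->apply_op P x=x) &
   (ALL N. walg N-->T:N-->V:N&R:N&P:N) &
   (ALL a b. T * b=a*T-->R * b=b*R-->V * b=a*V)"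
proof -
 obtain R where R:"pos R" "R*R=adj T*T" "!!N. walg N==>adj T*T:N==>R:N"
  using sqrt_exists[OF pos_adj_mult[of T]] by blast
 obtain C where C:"bnd C R" using bnd_ex by blast
 define D where "D=C+1"
 have D:"0<D" using bndD(2)[OF C] by (simp add: D_def)
 define r where "r=(1/D) .* R"
 define t where "t=(1/D) .* T"
 have "R[=D .* 1" by (rule bnd_ple[OF bnd_mono[OF C] pos_adj[OF R(1)]]) (simp add: D_def)
 from ple_scaleR[OF this, of "1/D"] have r1:"r[=1" unfolding r_def using D by simp
 have rpos:"pos r" unfolding r_def using D by (intro pos_scaleR R(1)) simp
 obtain P where P:"projection P" "r*P=0" "!!x. r x=0==>P x=x"
   "!!x. (%n. ((1 - r) ^ n) x)---->P x" "!!n. bnd 1 ((1 - r) ^ n)"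
   "!!N. walg N==>r:N==>P:N"
  using ker_limit_contraction[OF rpos r1] by blast
 have nT:"norm (t x)=norm (r x)" for x
 proof -
  have "(norm (T x))^2=(norm (R x))^2"
   using Re_cinner_adj_mult[of x T] Re_cinner_adj_mult[of x R] pos_adj[OF R(1)] R(2) by simp
  thus ?thesis by (simp add: t_def r_def)
 qed
 define W where "W n=(SUM k<n. (1 - r) ^ k)" for n
 have rW:"r*W n=1-(1 - r) ^ n" for n
  by (induction n) (simp_all add: W_def algebra_simps)
 have "r*(1 - r) ^ n=(1 - r) ^ n * r" for n
 proof (induction n)
  case (Suc n)
  have "r*(1 - r) ^ Suc n=(1 - r)*(r*(1 - r) ^ n)" by (simp add: algebra_simps)
  thus ?case unfolding Suc by (simp add: assoc)
 qed simp
 hence "r*W n=W n * r" for n by (simp add: W_def sum_distrib_left sum_distrib_right)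
 hence Wr:"W n * r=1-(1 - r) ^ n" for n using rW[of n] by simp
 \<comment> \<open>\<open>t\<close> and \<open>r\<close> have equal norms on vectors, and
   \<open>r * W n\<close> telescopes, so convergence of \<open>t * W n\<close> is inherited from
   that of the powers of \<open>1 - r\<close>.\<close>
 have Wdiff:"norm ((t*W m) x-(t*W n) x)=norm (((1 - r) ^ n) x-((1 - r) ^ m) x)" for m n x
 proof -
  have "norm ((t*W m) x-(t*W n) x)=norm (r (W m x-W n x))" by (simp flip: bop_diff add: nT)
  also have "r (W m x-W n x)=(r*W m) x-(r*W n) x" by simp
  also have "...=((1 - r) ^ n) x-((1 - r) ^ m) x" unfolding rW by simp
  finally show ?thesis .
 qed
 have bW:"bnd 2 (t*W n)" for n
 proof (rule bndI)
  fix x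
  have "norm ((t*W n) x)=norm (((1 - r) ^ 0) x-((1 - r) ^ n) x)"
   using Wdiff[of n x 0] by (simp add: W_def)
  also have "...<=norm x + norm (((1 - r) ^ n) x)" using norm_triangle_ineq4 by force
  also have "...<=2 * norm x" using bndD(1)[OF P(5), of n x] by simp
  finally show "norm ((t*W n) x)<=2 * norm x" .
 qed simp
 have "EX L. bnd 2 L&(ALL x. (%n. (t*W n) x)---->apply_op L x)"
 proof (rule strong_limit_op[OF bW])
  fix x
  have "Cauchy (%n. ((1 - r) ^ n) x)" using P(4) LIMSEQ_imp_Cauchy by blast
  hence "Cauchy (%n. (t*W n) x)"
   unfolding Cauchy_def dist_norm Wdiff by (simp add: norm_minus_commute)
  thus "convergent (%n. (t*W n) x)" by (simp add: Cauchy_convergent_iff)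
 qed
 then obtain V where V:"!!x. (%n. (t*W n) x)---->apply_op V x" by blast
 have nV:"norm (V x)=norm ((1-P) x)" for x
 proof -
  have "norm ((t*W n) x)=norm ((1-(1 - r) ^ n) x)" for n
   using Wdiff[of n x 0] by (simp add: W_def)
  moreover have "(%n. norm ((1-(1 - r) ^ n) x))---->norm ((1-P) x)"
   by simp (intro tendsto_intros P(4))
  ultimately show ?thesis using LIMSEQ_unique[OF tendsto_norm[OF V]] by simp
 qed
 have VV:"adj V*V=1-P"
 proof -
  have "adj V*V-(1-P)=0"
  proof (rule form_zero_imp_zero)
   fix x
   have "cinner x ((adj V*V) x)=cinner (V x) (V x)" by (simp add: adj_right)
   also have "...=cinner ((1-P) x) ((1-P) x)" by (simp only: cinner_self nV)
   also have "...=cinner x ((adj (1-P)*(1-P)) x)" by (simp only: adj_right bop_times_apply)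
   also have "adj (1-P)*(1-P)=1-P" using projection_compl[OF P(1)] by (simp only: projection_def)
   finally show "cinner x ((adj V*V-(1-P)) x)=0" by (simp add: cinner_simps)
  qed
  thus ?thesis by simp
 qed
 have tP:"t*P=0"
 proof (rule bop_eqI)
  fix x have "norm (t (P x))=norm ((r*P) x)" by (simp add: nT)
  thus "(t*P) x=(0 :: 'h bop) x" using P(2) by simp
 qed
 have Vr:"V * r=t"
 proof (rule bop_eqI)
  fix x
  have "(t*W n) (r x)=(t*(1-(1 - r) ^ n)) x" for n
   by (simp only: bop_times_apply Wr[symmetric])
  hence "(%n. (t*(1-(1 - r) ^ n)) x)---->V (r x)" using V[of "r x"] by simp
  moreover have "(%n. (t*(1-(1 - r) ^ n)) x)---->t (x-P x)"
   by simp (intro tendsto_intros P(4))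
  moreover have "t (x-P x)=t x" using tP by (metis bop_diff bop_times_apply bop_zero_apply diff_zero)
  ultimately show "(V * r) x=t x" using LIMSEQ_unique by simp
 qed
 have Dr:"D .* r=R" "D .* t=T" using D by (simp_all add: r_def t_def)
 have "T=V*R" using arg_cong[OF Vr, of "%x. D .* x"] by (simp add: Dr flip: bop_mult_scaleR_right)
 moreover have "T*P=0" "R*P=0" using tP P(2) by (simp_all flip: Dr)
 moreover have "P x=x" if "T x=0" for x
 proof -
  have "norm (r x)=0" unfolding nT[symmetric] using that by (simp add: t_def)
  thus ?thesis by (intro P(3)) simp
 qed
 moreover have "V:N&R:N&P:N" if "walg N" "T:N" for N
 proof -
  interpret walg N by fact
  have RN:"R:N" by (intro R(3) w_ins that)
  hence rN:"r:N" unfolding r_def by (intro w_ins)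
  have "t*W n:N" for n unfolding W_def t_def by (intro w_ins rN that)
  hence "V:N" by (intro w_limit[OF _ bW V])
  thus ?thesis using RN P(6)[OF that(1) rN] by blast
 qed
 moreover have "V * b=a*V" if ab:"T * b=a*T" "R * b=b*R" for a b
 proof (rule bop_eqI)
  fix x
  have "r * b=b * r" "t * b=a * t" using ab by (simp_all add: r_def t_def)
  hence "(1 - r) * b=b*(1 - r)" by (simp add: algebra_simps)
  hence "(1 - r) ^ k * b=b*(1 - r) ^ k" for k
   by (induction k) (simp_all add: assoc, metis assoc)
  hence "W n * b=b*W n" for n by (simp add: W_def sum_distrib_left sum_distrib_right)
  hence "t*W n * b=a*(t*W n)" for n using \<open>t * b = a * t\<close> by (metis assoc)
  hence "(t*W n) (b x)=a ((t*W n) x)" for n by (metis bop_times_apply)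
  hence "(%n. a ((t*W n) x))---->V (b x)" using V[of "b x"] by simp
  moreover have "(%n. a ((t*W n) x))---->a (V x)" by (intro tendsto_intros V)
  ultimately show "(V * b) x=(a*V) x" using LIMSEQ_unique by simp
 qed
 ultimately show ?thesis using R(1,2) VV P(1) by blast
qed

section \<open>Strong sums of orthogonal partial isometries\<close>

section \<open>Partial isometries and orthogonal sums\<close>

lemma partial_isometry_mult:
 assumes "projection (adj w * w)" shows "w * adj w * w=w"
proof -
 let ?q = "adj w * w"
 have q:"?q * ?q=?q" using assms by (simp only: projection_def)
 have "adj (w - w * ?q)*(w - w * ?q)=?q - ?q * ?q - ?q * ?q + ?q * ?q * ?q"
  by (simp add: algebra_simps)
 also have "...=0" by (simp only: q) simp
 finally have z:"adj (w - w * ?q)*(w - w * ?q)=0" .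
 have "w - w * ?q=0"
 proof (rule bop_eqI)
  fix x
  have "(norm ((w - w * ?q) x))^2=0" using Re_cinner_adj_mult[of x "w - w * ?q"] unfolding z by simp
  thus "(w - w * ?q) x=(0 :: 'a bop) x" by (simp del: bop_minus_apply bop_times_apply)
 qed
 thus ?thesis by (simp add: assoc)
qed

lemma adj_mult_self_eq_0:"adj w * w=0==>w=0"
proof (rule bop_eqI)
 fix x assume "adj w * w=0"
 hence "(norm (w x))^2=0" using Re_cinner_adj_mult[of x w] by simp
 thus "w x=(0 :: 'a bop) x" by simp
qed

lemma partial_isometry_range:"projection (adj w * w)==>projection (w * adj w)"
 using partial_isometry_mult[of w] unfolding projection_def by (simp, metis assoc)

lemma projection_sum:
 assumes "finite S" "!!k. k:S==>projection (q k)" "!!j k. j:S==>k:S==>j~=k==>q j * q k=0"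
 shows "projection (SUM k:S. q k)"
proof -
 have "(SUM k:S. q k)*(SUM k:S. q k)=(SUM j:S. SUM k:S. if k=j then q j else 0)"
  unfolding sum_product by (intro sum.cong refl) (use assms in "auto simp: projection_def")
 also have "...=(SUM k:S. q k)" using assms(1) by (intro sum.cong refl) (simp add: sum.delta')
 finally show ?thesis using assms(2) by (simp add: projection_def adj_sum)
qed

lemma orth_sum_norm:
 assumes "finite S" "!!j k. j~=k==>adj (w j) * w k=0"
 shows "(norm (SUM k:S. apply_op (w k) x))^2=(SUM k:S. (norm (apply_op (w k) x))^2)"
proof -
 have "cinner (w j x) (w k x)=0" if "j~=k" for j k
 proof -
  have "cinner (w j x) (w k x)=cinner x ((adj (w j) * w k) x)" by (simp add: adj_right)
  thus ?thesis using assms(2)[OF that] by simp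
 qed
 hence "inner (w j x) (w k x)=(if k=j then (norm (w j x))^2 else 0)" for j k
  by (auto simp: Re_cinner[symmetric] power2_norm_eq_Re_cinner)
 thus ?thesis
  unfolding power2_norm_eq_inner[of "SUM k:S. w k x"] inner_sum_left inner_sum_right
  using assms(1) by (simp add: sum.delta' sum.delta)
qed

text \<open>Orthogonal ranges give Pythagoras for partial sums; orthogonal initial projections bound
  the sum of squares by the square of the norm of \<open>x\<close>.\<close>

lemma orth_sum_aux:
 fixes w :: "nat=>'h :: complex_hilbert bop"
 assumes o1:"!!j k. j~=k==>adj (w j) * w k=0" and o2:"!!j k. j~=k==>w j * adj (w k)=0"
  and p:"!!k. projection (adj (w k) * w k)"
 shows "EX W. (ALL x. (%n. SUM k<n. w k x)---->apply_op W x)&(ALL n. bnd 1 (SUM k<n. w k))"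
proof -
 have q:"projection (SUM k:S. adj (w k) * w k)" if "finite S" for S
 proof (rule projection_sum[OF that p])
  fix j k :: nat assume "j~=k"
  have "adj (w j) * w j*(adj (w k) * w k)=adj (w j)*(w j * adj (w k)) * w k" by (simp only: assoc)
  thus "adj (w j) * w j*(adj (w k) * w k)=0" by (simp add: o2[OF \<open>j \<noteq> k\<close>])
 qed
 have le:"(SUM k:S. (norm (w k x))^2)<=(norm x)^2" if "finite S" for S x
 proof -
  have "(SUM k:S. (norm (w k x))^2)=Re (cinner x ((SUM k:S. adj (w k) * w k) x))"
   by (simp only: bop_sum_apply cinner_sum_right Re_sum Re_cinner_adj_mult)
  also have "...<=Re (cinner x (apply_op 1 x))" by (rule ple_Re[OF projection_ple_1[OF q[OF that]]])
  finally show ?thesis by (simp add: power2_norm_eq_Re_cinner)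
 qed
 have b:"bnd 1 (SUM k<n. w k)" for n
 proof (rule bndI)
  fix x show "norm ((SUM k<n. w k) x)<=1 * norm x"
   unfolding bop_sum_apply mult_1
   by (rule power2_le_imp_le) (simp_all add: orth_sum_norm[OF _ o1] le)
 qed simp
 have "EX L. bnd 1 L&(ALL x. (%n. (SUM k<n. w k) x)---->apply_op L x)"
 proof (rule strong_limit_op[OF b])
  fix x
  let ?s = "%n. SUM k<n. (norm (w k x))^2"
  have "convergent ?s"
   by (rule Bseq_monoseq_convergent[OF BseqI'])
    (use le[of "{..<_}" x] in "auto simp: monoseq_def sum_nonneg intro!: sum_mono2")
  hence C:"Cauchy ?s" by (simp add: Cauchy_convergent_iff)
  have est:"(norm ((SUM k<m. w k) x-(SUM k<n. w k) x))^2=\<bar>?s m - ?s n\<bar>" for m n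
  proof -
   have *: "(norm ((SUM k<n. w k) x-(SUM k<m. w k) x))^2=\<bar>?s n - ?s m\<bar>" if "m<=n" for m n
   proof -
    have d:"(SUM k<n. f k)-(SUM k<m. f k)=(SUM k:{m..<n}. f k)" for f :: "nat=>'b :: ab_group_add"
     using sum_diff_nat_ivl[of 0 m n f] that by (simp add: atLeast0LessThan)
    show ?thesis unfolding bop_sum_apply d by (simp add: orth_sum_norm[OF _ o1] sum_nonneg)
   qed
   show ?thesis using *[of m n] *[of n m] by (cases "m<=n") (auto simp: norm_minus_commute abs_minus_commute)
  qed
  have "Cauchy (%n. (SUM k<n. w k) x)"
  proof (rule metric_CauchyI)
   fix e :: real assume e:"0<e"
   then obtain N where N:"!!m n. m>=N==>n>=N==>\<bar>?s m - ?s n\<bar><e^2"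
    using metric_CauchyD[OF C, of "e^2"] unfolding dist_real_def by (metis zero_less_power)
   have "norm ((SUM k<m. w k) x-(SUM k<n. w k) x)<e" if "m>=N" "n>=N" for m n
    using N[OF that] e unfolding est[symmetric] by (simp add: power2_less_imp_less)
   thus "EX M. ALL m>=M. ALL n>=M. dist ((SUM k<m. w k) x) ((SUM k<n. w k) x)<e"
    unfolding dist_norm by blast
  qed
  thus "convergent (%n. (SUM k<n. w k) x)" by (simp add: Cauchy_convergent_iff)
 qed
 thus ?thesis using b unfolding bop_sum_apply by blast
qed

lemma tendsto_sum_eventually_const:
 fixes f :: "nat=>'a :: real_normed_vector"
 assumes "!!j. j~=k==>f j=0" shows "(%n. SUM j<n. f j)---->f k"
proof -
 have "(%r. if r=k then f r else 0)=f" using assms by auto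
 thus ?thesis using sums_single[of k f] by (simp add: sums_def)
qed

text \<open>The adjoint is not strongly continuous, so the series of adjoints is summed separately
  and identified with \<open>adj W\<close>. All rules about \<open>W\<close> then follow by
  evaluating the two series.\<close>

lemma orth_sum:
 fixes w :: "nat=>'h :: complex_hilbert bop"
 assumes "ALL j k. j~=k-->adj (w j) * w k=0" and "ALL j k. j~=k-->w j * adj (w k)=0"
  and "ALL k. projection (adj (w k) * w k)"
 shows "EX W. (ALL x. (%n. SUM k<n. w k x)---->apply_op W x) &
   (ALL N. walg N-->(ALL k. w k:N)-->W:N) &
   projection (adj W*W)&(ALL k. W*(adj (w k) * w k)=w k)&(ALL k. adj W * w k=adj (w k) * w k) &
   (ALL x. (%n. SUM k<n. (adj (w k) * w k) x)---->apply_op (adj W*W) x) &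
   (ALL a. (ALL k. a * w k=w k)-->a*W=W)&(ALL a b. (ALL k. a * w k=w k * b)-->a*W=W * b) &
   (ALL a. (ALL k. a * w k=0)-->a*W=0)&(ALL a. (ALL k. w k * a=0)-->W * a=0)"
proof -
 have o1:"adj (w j) * w k=0" and o2:"w j * adj (w k)=0" if "j~=k" for j k using assms(1,2) that by simp_all
 have p:"projection (adj (w k) * w k)" for k using assms(3) by simp
 obtain W where W:"!!x. (%n. SUM k<n. w k x)---->apply_op W x" and b:"!!n. bnd 1 (SUM k<n. w k)"
  using orth_sum_aux[of w, OF o1 o2 p] by blast
 have "EX W'. (ALL x. (%n. SUM k<n. adj (w k) x)---->apply_op W' x)&(ALL n. bnd 1 (SUM k<n. adj (w k)))"
  by (rule orth_sum_aux) (auto simp: o1 o2 partial_isometry_range[OF p])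
 then obtain W' where W': "!!x. (%n. SUM k<n. adj (w k) x)---->apply_op W' x" by blast
 have W'eq:"W'=adj W"
 proof (rule adj_eqI[symmetric])
  fix x y
  have "(%n. cinner (SUM k<n. adj (w k) x) y)---->cinner (W' x) y" by (intro tendsto_intros W')
  moreover have "(%n. cinner x (SUM k<n. w k y))---->cinner x (W y)" by (intro tendsto_intros W)
  ultimately show "cinner (W' x) y=cinner x (W y)"
   by (simp add: cinner_sum_left cinner_sum_right adj_left LIMSEQ_unique)
 qed
 have Wq:"W*(adj (w k) * w k)=w k" for k
 proof (rule bop_eqI)
  fix x
  have z:"w j (adj (w k) (w k x))=0" if "j~=k" for j
   using arg_cong[OF o2[OF that], of "%T. apply_op T (w k x)"] by simp
  have "(%n. SUM j<n. w j (adj (w k) (w k x)))---->w k (adj (w k) (w k x))"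
   by (rule tendsto_sum_eventually_const[OF z])
  hence "W (adj (w k) (w k x))=w k (adj (w k) (w k x))" using LIMSEQ_unique[OF W] by blast
  also have "...=w k x" using arg_cong[OF partial_isometry_mult[OF p[of k]], of "%T. apply_op T x"] by simp
  finally show "(W*(adj (w k) * w k)) x=w k x" by simp
 qed
 have Ww:"adj W * w k=adj (w k) * w k" for k
 proof (rule bop_eqI)
  fix x
  have z:"adj (w j) (w k x)=0" if "j~=k" for j
   using arg_cong[OF o1[OF that], of "%T. apply_op T x"] by simp
  have "(%n. SUM j<n. adj (w j) (w k x))---->adj (w k) (w k x)"
   by (rule tendsto_sum_eventually_const[OF z])
  thus "(adj W * w k) x=(adj (w k) * w k) x" using LIMSEQ_unique[OF W'] by (simp add: W'eq)
 qed
 have lim:"(%n. SUM k<n. (adj (w k) * w k) x)---->(adj W*W) x" for x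
 proof -
  have "(%n. adj W (SUM k<n. w k x))---->adj W (W x)" by (intro tendsto_intros W)
  moreover have "adj W (SUM k<n. w k x)=(SUM k<n. (adj (w k) * w k) x)" for n
   unfolding bop_sum by (intro sum.cong refl) (metis Ww bop_times_apply)
  ultimately show ?thesis by simp
 qed
 have gen:"a*W=W * b" if "!!k. a * w k=w k * b" for a b
 proof (rule bop_eqI)
  fix x
  have "(%n. a (SUM k<n. w k x))---->a (W x)" by (intro tendsto_intros W)
  moreover have "a (SUM k<n. w k x)=(SUM k<n. w k (b x))" for n
   unfolding bop_sum by (intro sum.cong refl) (metis that bop_times_apply)
  ultimately show "(a*W) x=(W * b) x" using LIMSEQ_unique[OF W[of "b x"]] by simp
 qed
 have zr:"W * a=0" if "!!k. w k * a=0" for a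
 proof (rule bop_eqI)
  fix x
  have "w k (a x)=0" for k using that[of k] by (metis bop_times_apply bop_zero_apply)
  thus "(W * a) x=(0 :: 'h bop) x" using LIMSEQ_unique[OF W[of "a x"]] by simp
 qed
 have "W*(adj W*W)=W"
 proof (rule bop_eqI)
  fix x
  have "(%n. W (SUM k<n. (adj (w k) * w k) x))---->W ((adj W*W) x)" by (intro tendsto_intros lim)
  moreover have "W (SUM k<n. (adj (w k) * w k) x)=(SUM k<n. w k x)" for n
   unfolding bop_sum by (intro sum.cong refl) (metis Wq bop_times_apply)
  ultimately have "(%n. SUM k<n. w k x)---->W ((adj W*W) x)" by (simp only:)
  hence "W ((adj W*W) x)=W x" by (rule LIMSEQ_unique[OF _ W])
  thus "(W*(adj W*W)) x=W x" by (simp only: bop_times_apply)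
 qed
 hence pr:"projection (adj W*W)" unfolding projection_def by (metis adj_adj adj_mult assoc)
 have inN:"W:N" if "walg N" "ALL k. w k:N" for N
 proof -
  interpret walg N by fact
  show ?thesis
  proof (rule w_limit[where T = "%n. SUM k<n. w k"])
   show "(SUM k<n. w k):N" for n by (intro w_sum) (use that in auto)
  qed (use b W in "simp_all add: bop_sum_apply")
 qed
 show ?thesis
 proof (intro exI[of _ W] conjI allI impI)
  show "a*W=W" if "ALL k. a * w k=w k" for a using gen[of a 1] that by simp
  show "a*W=0" if "ALL k. a * w k=0" for a using gen[of a 0] that by simp
 qed (use W inN pr Wq Ww lim gen zr in simp_all)
qed

text \<open>Padding by zeros lets finite and infinite families alike be summed over
  \<open>nat\<close>.\<close>

lemma countable_enumeration_with_zeros: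
 assumes "countable S"
 shows "EX p :: nat=>'a :: zero. (ALL k. p k:S\<or>p k=0)&S<=range p &
   (ALL j k. j~=k-->p j=0\<or>p k=0\<or>p j~=p k)"
proof -
 define p where "p k=(if k:to_nat_on S ` S then from_nat_into S k else 0)" for k
 have ft:"from_nat_into S (to_nat_on S s)=s" if "s:S" for s
  using that assms by (rule from_nat_into_to_nat_on[rotated])
 have "p k:S\<or>p k=0" for k unfolding p_def using ft by auto
 moreover have "s=p (to_nat_on S s)" if "s:S" for s using that ft by (simp add: p_def)
 moreover have "p j=0\<or>p k=0\<or>p j~=p k" if "j~=k" for j k
  unfolding p_def using ft that by auto
 ultimately show ?thesis by (intro exI[of _ p]) blast
qed

lemma maximal_orthogonal_family:
 fixes Good :: "'h :: complex_hilbert bop set"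
 shows "EX S<=Good. (ALL p:S. ALL q:S. p~=q-->p * q=0) &
  (ALL g:Good. (ALL p:S. p * g=0&g * p=0)-->g:S)"
proof -
 let ?A = "{S. S<=Good&(ALL p:S. ALL q:S. p~=q-->p * q=0)}"
 have "EX M:?A. ALL X:?A. M<=X-->X=M"
 proof (rule subset_Zorn')
  fix C assume C:"subset.chain ?A C"
  have "p * q=0" if "p:\<Union>C" "q:\<Union>C" "p~=q" for p q
  proof -
   obtain X Y where XY:"X:C" "p:X" "Y:C" "q:Y" using \<open>p \<in> \<Union>C\<close> \<open>q \<in> \<Union>C\<close> by blast
   note ch = C[unfolded subset_chain_def]
   have sub:"C<=?A" by (rule conjunct1[OF ch])
   have "ALL X:C. ALL Y:C. X<=Y\<or>Y<=X" by (rule conjunct2[OF ch])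
   hence "X<=Y\<or>Y<=X" using XY by simp
   thus ?thesis
   proof
    assume "X<=Y"
    hence "p:Y" "Y:?A" using XY sub by auto
    thus ?thesis using XY(4) \<open>p \<noteq> q\<close> by simp
   next
    assume "Y<=X"
    hence "q:X" "X:?A" using XY sub by auto
    thus ?thesis using XY(2) \<open>p \<noteq> q\<close> by simp
   qed
  qed
  moreover have "\<Union>C<=Good" using conjunct1[OF C[unfolded subset_chain_def]] by auto
  ultimately show "\<Union>C\<in>?A" by (intro CollectI conjI ballI impI)
 qed
 then obtain S where S:"S:?A" and max': "ALL X:?A. S<=X-->X=S" by (rule bexE)
 have max:"X=S" if "X:?A" "S<=X" for X by (rule max'[rule_format, OF that])
 have "g:S" if "g:Good" "ALL p:S. p * g=0&g * p=0" for g
 proof -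
  have S1:"S<=Good" and S2:"!!p q. p:S==>q:S==>p~=q==>p * q=0" using S by simp_all
  have "insert g S:?A"
  proof (intro CollectI conjI ballI impI)
   show "insert g S<=Good" using S1 that(1) by simp
   fix p q assume "p:insert g S" "q:insert g S" "p~=q"
   thus "p * q=0" using S2[of p q] that(2) by (elim insertE) simp_all
  qed
  from max[OF this] have "insert g S=S" by (simp add: subset_insertI)
  thus ?thesis by (metis insertI1)
 qed
 moreover have "S<=Good" "ALL p:S. ALL q:S. p~=q-->p * q=0" using S by simp_all
 ultimately show ?thesis by (intro exI[of _ S] conjI ballI impI) auto
qed

section \<open>Type III algebras: isometries, central supports, Cuntz pairs, compression to the
  center\<close>

section \<open>Comparison in type III algebras\<close>

locale t3alg = walg N for N :: "'h :: complex_hilbert bop set" +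
 assumes t3:"type_III N" and sf:"sigma_finite N"
begin

text \<open>The two copies \<open>a * adj a\<close> and \<open>b * adj b\<close> of \<open>q\<close>
  are orthogonal and lie under \<open>q\<close>, but need not add up to it; for the unit,
  \<open>cuntz_pair\<close> repairs this.\<close>

definition halvable :: "'h bop=>bool" where
 "halvable q\<longleftrightarrow>(EX a:N. EX b:N. adj a * a=q&adj b * b=q&adj a * b=0&q * a=a&q * b=b)"

text \<open>Hilbert's hotel: the sum q of infinitely many orthogonal copies of \<open>e\<close> is
  equivalent to the sum of the even-numbered copies and to that of the odd-numbered ones.\<close>

lemma halvable_from_sequence:
 fixes x :: "nat=>'h bop"
 assumes xN:"!!n. x n:N" and e:"projection e" "e~=0"
  and x:"!!m n. adj (x m) * x n=(if m=n then e else 0)" and xe:"!!n. x n * e=x n"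
  and r:"!!n. r * x n=x n"
 shows "EX r':N. projection r'&r'~=0&r * r'=r'&halvable r'"
proof -
 have ex:"e * adj (x n)=adj (x n)" for n
  using arg_cong[OF xe[of n], of adj] projectionD(2)[OF e(1)] by simp
 have prod:"x i * adj (x j)*(x k * adj (x l))=(if j=k then x i * adj (x l) else 0)" for i j k l
 proof -
  have "x i * adj (x j)*(x k * adj (x l))=x i*(adj (x j) * x k) * adj (x l)" by (simp only: assoc)
  also have "...=(if j=k then x i*(e * adj (x l)) else 0)" by (simp add: x assoc)
  finally show ?thesis by (simp add: ex)
 qed
 have sum:"EX W:N. projection (adj W*W) &
    (ALL y. (%n. SUM k<n. (x k * adj (x k)) y)---->apply_op (adj W*W) y) &
    (ALL a. (ALL k. a * x (f k)=x (f k))-->a*W=W)&(ALL a. (ALL k. a * x (f k)=0)-->a*W=0)"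
  if f:"inj f" for f :: "nat=>nat"
 proof -
  let ?w = "%k. x (f k) * adj (x k)"
  have ww:"adj (?w k) * ?w k=x k * adj (x k)" for k by (simp add: prod)
  have pr:"projection (x k * adj (x k))" for k by (simp add: projection_def prod)
  have "EX W. (ALL y. (%n. SUM k<n. ?w k y)---->apply_op W y) &
   (ALL N. walg N-->(ALL k. ?w k:N)-->W:N) &
   projection (adj W*W)&(ALL k. W*(adj (?w k) * ?w k)=?w k)&(ALL k. adj W * ?w k=adj (?w k) * ?w k) &
   (ALL y. (%n. SUM k<n. (adj (?w k) * ?w k) y)---->apply_op (adj W*W) y) &
   (ALL a. (ALL k. a * ?w k=?w k)-->a*W=W)&(ALL a b. (ALL k. a * ?w k=?w k * b)-->a*W=W * b) &
   (ALL a. (ALL k. a * ?w k=0)-->a*W=0)&(ALL a. (ALL k. ?w k * a=0)-->W * a=0)"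
   by (rule orth_sum) (simp_all add: prod ww pr inj_eq[OF f])
  then obtain W where W:"ALL N. walg N-->(ALL k. ?w k:N)-->W:N" "projection (adj W*W)"
   "ALL y. (%n. SUM k<n. (adj (?w k) * ?w k) y)---->apply_op (adj W*W) y"
   "ALL a. (ALL k. a * ?w k=?w k)-->a*W=W" "ALL a. (ALL k. a * ?w k=0)-->a*W=0" by blast
  have WN:"W:N" by (rule W(1)[rule_format, OF walg_axioms]) (intro w_ins xN)
  have 1:"a*W=W" if "ALL k. a * x (f k)=x (f k)" for a
   by (rule W(4)[rule_format]) (metis that assoc)
  have 2:"a*W=0" if "ALL k. a * x (f k)=0" for a
   by (rule W(5)[rule_format]) (metis that assoc mult_zero_left)
  show ?thesis using WN W(2) W(3)[unfolded ww] 1 2 by blast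
 qed
 have ia:"inj (%n :: nat. 2 * n)" and ib:"inj (%n :: nat. 2 * n+1)" by (auto intro!: injI)
 obtain a where a:"a:N" "projection (adj a * a)"
   "!!y. (%n. SUM k<n. (x k * adj (x k)) y)---->apply_op (adj a * a) y"
   "!!c. (ALL k. c * x (2 * k)=x (2 * k))==>c * a=a" "!!c. (ALL k. c * x (2 * k)=0)==>c * a=0"
  using sum[OF ia] by blast
 obtain b where b:"b:N"
   "!!y. (%n. SUM k<n. (x k * adj (x k)) y)---->apply_op (adj b * b) y"
   "!!c. (ALL k. c * x (2 * k+1)=x (2 * k+1))==>c * b=b" "!!c. (ALL k. c * x (2 * k+1)=0)==>c * b=0"
  using sum[OF ib] by blast
 define q where "q=adj a * a"
 have bq:"adj b * b=q" unfolding q_def by (rule bop_eqI) (rule LIMSEQ_unique[OF b(2) a(3)])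
 have qx:"q * x n=x n" for n
 proof (rule bop_eqI)
  fix y
  have z:"(x k * adj (x k)) (x n y)=(if k=n then x n y else 0)" for k
  proof -
   have "x k * adj (x k) * x n=(if k=n then x n else 0)" by (simp add: assoc x xe)
   thus ?thesis by (metis bop_times_apply bop_zero_apply)
  qed
  have "(%m. SUM k<m. (x k * adj (x k)) (x n y))---->(x n * adj (x n)) (x n y)"
   by (rule tendsto_sum_eventually_const, simp only: z) simp
  thus "(q * x n) y=x n y"
   unfolding z[of n] q_def bop_times_apply[of _ "x n"] using LIMSEQ_unique[OF a(3)[of "x n y"]] by simp
 qed
 have "adj a * b=0"
 proof (rule b(4), rule allI)
  fix k
  have "adj (x (2 * k+1)) * a=0"
  proof (rule a(5), rule allI)
   fix i :: nat
   have "2 * k+1~=2 * i" by presburger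
   thus "adj (x (2 * k+1)) * x (2 * i)=0" by (simp only: x if_False)
  qed
  hence "adj (adj (x (2 * k+1)) * a)=0" by simp
  thus "adj a * x (2 * k+1)=0" by simp
 qed
 moreover have "q * a=a" "q * b=b" using a(4) b(3) qx by auto
 ultimately have "halvable q" unfolding halvable_def
  by (intro bexI[of _ a] bexI[of _ b] conjI) (use a(1) b(1) bq q_def in simp_all)
 moreover have "r * q=q"
 proof -
  have lim:"(%n. SUM k<n. (x k * adj (x k)) y)---->q y" for y using a(3) by (simp add: q_def)
  show ?thesis
  proof (rule bop_eqI)
   fix y
   have "(%n. r (SUM k<n. (x k * adj (x k)) y))---->r (q y)" by (intro tendsto_intros lim)
   moreover have "r (SUM k<n. (x k * adj (x k)) y)=(SUM k<n. (x k * adj (x k)) y)" for n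
    unfolding bop_sum by (intro sum.cong refl) (metis r bop_times_apply)
   ultimately have "(%n. SUM k<n. (x k * adj (x k)) y)---->r (q y)" by (simp only:)
   hence "r (q y)=q y" by (rule LIMSEQ_unique[OF _ lim])
   thus "(r * q) y=q y" by (simp only: bop_times_apply)
  qed
 qed
 moreover have "q~=0"
 proof
  assume "q=0"
  hence "x 0=0" using qx[of 0] by simp
  thus False using x[of 0 0] e(2) by simp
 qed
 moreover have "q:N" unfolding q_def by (intro w_ins a(1))
 ultimately show ?thesis using a(2) q_def by blast
qed

lemma power_isometry:
 fixes v :: "'h bop"
 assumes "adj v * v=r" "r * v=v" "r * r=r" shows "adj v ^ n * v ^ n * r=r"
proof (induction n)
 case (Suc n)
 have "r * v ^ n * r=v ^ n * r"
  by (cases n) (simp_all add: assms(3) assoc[symmetric] assms(2))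
 hence "adj v ^ n*(adj v * v) * v ^ n * r=adj v ^ n * v ^ n * r"
  unfolding assms(1) by (metis assoc)
 moreover have "adj v ^ Suc n * v ^ Suc n * r=adj v ^ n*(adj v * v) * v ^ n * r"
  by (simp only: power_Suc2[of "adj v"] power_Suc[of v] assoc)
 ultimately show ?case using Suc by simp
qed simp

text \<open>No nonzero projection is finite, so some \<open>v\<close> maps \<open>r\<close> onto a
  proper subprojection. The powers of \<open>v\<close> move the defect \<open>e\<close> to
  infinitely many orthogonal copies, as in the Wold decomposition.\<close>

lemma halvable_below:
 assumes r:"r:N" "projection r" "r~=0"
 shows "EX r':N. projection r'&r'~=0&r * r'=r'&halvable r'"
proof -
 have "~ finite_projection N r" using t3 r(3) by (auto simp: type_III_def)
 then obtain v where v:"v:N" "adj v * v=r" "r*(v * adj v)=v * adj v" "v * adj v~=r"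
  using r unfolding finite_projection_def by blast
 have vr:"v * r=v" using partial_isometry_mult[of v] v(2) r(2) by (simp add: assoc)
 have rv:"r * v=v"
 proof -
  have "r * v=r*(v * adj v) * v" using vr v(2) by (simp add: assoc)
  thus ?thesis using v(3) vr v(2) by (simp add: assoc)
 qed
 define e where "e=r - v * adj v"
 have pv:"projection (v * adj v)" using partial_isometry_range[of v] v(2) r(2) by simp
 have vvr:"v * adj v * r=v * adj v"
  using arg_cong[OF v(3), of adj] projectionD(2)[OF r(2)] by (simp add: assoc)
 have e:"projection e"
  using v(3) vvr projectionD[OF pv] projectionD[OF r(2)] by (simp add: projection_def e_def algebra_simps)
 have e0:"e~=0" using v(4) by (simp add: e_def)
 have re:"r * e=e" using v(3) projectionD[OF r(2)] by (simp add: e_def algebra_simps)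
 have ev:"e * v=0" using rv vr v(2) by (simp add: e_def algebra_simps)
 have ae:"adj e=e" "e * e=e" using e by (simp_all add: projection_def)
 have evn:"e * v ^ Suc n=0" for n by (simp add: assoc[symmetric] ev)
 have van:"adj v ^ Suc n * e=0" for n
  using arg_cong[OF evn[of n], of adj] ae by (simp del: power_Suc)
 have iso:"adj v ^ n * v ^ n * e=e" for n
  using power_isometry[OF v(2) rv projectionD(1)[OF r(2)], of n] re by (metis assoc)
 have key:"adj v ^ m * v ^ (m+Suc k) * e=v ^ Suc k * e" for m k
 proof -
  have "adj v ^ m * v ^ m * r=r" by (rule power_isometry[OF v(2) rv projectionD(1)[OF r(2)]])
  moreover have "r * v ^ Suc k=v ^ Suc k" by (simp add: assoc[symmetric] rv)
  ultimately show ?thesis unfolding power_add by (metis assoc)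
 qed
 show ?thesis
 proof (rule halvable_from_sequence[where x = "%n. v ^ n * e" and e = e])
  show "v ^ n * e:N" for n unfolding e_def by (intro w_ins v(1) r(1))
  show "adj (v ^ m * e)*(v ^ n * e)=(if m=n then e else 0)" for m n
  proof -
   have lt:"adj (v ^ m * e)*(v ^ n * e)=0" if mn:"m<n" for m n
   proof -
    obtain k where "n=Suc (m + k)" using less_imp_Suc_add[OF mn] by blast
    hence k:"n=m+Suc k" by simp
    have "adj (v ^ m * e)*(v ^ n * e)=e*(adj v ^ m * v ^ (m+Suc k) * e)"
     by (simp only: adj_mult adj_power ae k assoc)
    also have "...=0" unfolding key by (simp only: assoc[symmetric] evn mult_zero_left)
    finally show ?thesis .
   qed
   have gt:"adj (v ^ m * e)*(v ^ n * e)=0" if "n<m"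
    using arg_cong[OF lt[OF that], of adj] by simp
   have eq:"adj (v ^ n * e)*(v ^ n * e)=e"
    using iso[of n] by (simp add: ae assoc)
   show ?thesis using lt[of m n] gt eq by (cases m n rule: linorder_cases) auto
  qed
  show "v ^ n * e * e=v ^ n * e" for n by (simp add: assoc ae)
  show "r*(v ^ n * e)=v ^ n * e" for n
  proof (cases n)
   case (Suc k)
   have "r*(v ^ n * e)=(r * v) * v ^ k * e" unfolding Suc by (simp only: power_Suc assoc)
   thus ?thesis unfolding rv Suc by (simp only: power_Suc assoc)
  qed (simp add: re)
 qed (rule e, rule e0)
qed

text \<open>Exhausts a projection by an orthogonal family of projections with a given property.\<close>

lemma exhaustion:
 assumes Good:"!!g. g:Good==>g:N&projection g&g~=0"
 obtains p :: "nat=>'h bop" where "!!k. p k:Good\<or>p k=0" "!!j k. j~=k==>p j * p k=0"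
   "!!g. g:Good==>EX k. p k * g~=0\<or>g * p k~=0"
proof -
 obtain S where S:"S<=Good" "ALL p:S. ALL q:S. p~=q-->p * q=0"
  "ALL g:Good. (ALL p:S. p * g=0&g * p=0)-->g:S"
  using maximal_orthogonal_family[of Good] by blast
 have "S<=N-->(ALL p:S. projection p&p~=0)&(ALL p:S. ALL q:S. p~=q-->p * q=0)-->countable S"
  using sf unfolding sigma_finite_def by (rule spec)
 moreover have "S<=N" "ALL p:S. projection p&p~=0" using S(1) Good by auto
 ultimately have "countable S" using S(2) by simp
 then obtain p :: "nat=>'h bop" where p:"ALL k. p k:S\<or>p k=0" "S<=range p"
   "ALL j k. j~=k-->p j=0\<or>p k=0\<or>p j~=p k"
  using countable_enumeration_with_zeros by metis
 have max:"EX k. p k * g~=0\<or>g * p k~=0" if g:"g:Good" for g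
 proof (rule ccontr)
  assume *: "~ ?thesis"
  hence "ALL s:S. s * g=0&g * s=0" using p(2) by fastforce
  hence "g:S" using S(3) g by blast
  hence "g * g=0" using \<open>\<forall>s\<in>S. s * g = 0 \<and> g * s = 0\<close> by blast
  thus False using Good[OF g] projectionD(1)[of g] by auto
 qed
 have orth:"p j * p k=0" if "j~=k" for j k
  using p(1,3) S(2) that by (metis mult_zero_left mult_zero_right)
 have "p k:Good\<or>p k=0" for k using p(1) S(1) by blast
 thus ?thesis by (rule that[OF _ orth max])
qed

end

context t3alg
begin

lemma orth_sum_in:
 fixes w :: "nat=>'h bop"
 assumes wN:"!!k. w k:N" and o1:"!!j k. j~=k==>adj (w j) * w k=0"
  and o2:"!!j k. j~=k==>w j * adj (w k)=0" and p:"!!k. projection (adj (w k) * w k)"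
 obtains W where "W:N" "projection (adj W*W)"
  "!!k. W*(adj (w k) * w k)=w k" "!!k. adj W * w k=adj (w k) * w k"
  "!!x. (%n. SUM k<n. (adj (w k) * w k) x)---->apply_op (adj W*W) x"
  "!!a b. (!!k. a * w k=w k * b)==>a*W=W * b"
  "!!a. (!!k. a * w k=w k)==>a*W=W"
  "!!a. (!!k. a * w k=0)==>a*W=0" "!!a. (!!k. w k * a=0)==>W * a=0"
  "!!x. (%n. SUM k<n. w k x)---->apply_op W x"
proof -
 have o1': "ALL j k. j~=k-->adj (w j) * w k=0" using o1 by simp
 have o2': "ALL j k. j~=k-->w j * adj (w k)=0" using o2 by simp
 have p': "ALL k. projection (adj (w k) * w k)" using p by simp
 obtain W where W:"(ALL x. (%n. SUM k<n. w k x)---->apply_op W x)" 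
   "(ALL N. walg N-->(ALL k. w k:N)-->W:N)" 
   "projection (adj W*W)" "(ALL k. W*(adj (w k) * w k)=w k)" "(ALL k. adj W * w k=adj (w k) * w k)"
   "(ALL x. (%n. SUM k<n. (adj (w k) * w k) x)---->apply_op (adj W*W) x)"
   "(ALL a. (ALL k. a * w k=w k)-->a*W=W)" "(ALL a b. (ALL k. a * w k=w k * b)-->a*W=W * b)"
   "(ALL a. (ALL k. a * w k=0)-->a*W=0)" "(ALL a. (ALL k. w k * a=0)-->W * a=0)"
  using orth_sum[of w, OF o1' o2' p'] by (elim exE conjE)
 show ?thesis
 proof (rule that[of W])
  show "W:N" using W(2) walg_axioms wN by simp
  show "a*W=W * b" if "!!k. a * w k=w k * b" for a b using W(8) that by simp
  show "a*W=W" if "!!k. a * w k=w k" for a using W(7) that by simp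
  show "a*W=0" if "!!k. a * w k=0" for a using W(9) that by simp
  show "W * a=0" if "!!k. w k * a=0" for a using W(10) that by simp
 qed (use W in simp_all)
qed

lemma projection_of_sum_ge:
 fixes p :: "nat=>'h bop"
 assumes lim:"!!x. (%n. SUM k<n. (p k) x)---->apply_op R x"
  and o:"!!j k. j~=k==>p j * p k=0" and pr:"!!k. projection (p k)"
 shows "R * p k=p k"
proof (rule bop_eqI)
 fix x
 have "p j (p k x)=0" if "j~=k" for j using o[OF that] by (metis bop_times_apply bop_zero_apply)
 hence "(%n. SUM j<n. p j (p k x))---->p k (p k x)" by (rule tendsto_sum_eventually_const)
 hence "p k (p k x)=R (p k x)" by (rule LIMSEQ_unique[OF _ lim])
 moreover have "p k (p k x)=p k x" using projectionD(1)[OF pr] by (metis bop_times_apply)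
 ultimately show "(R * p k) x=p k x" by simp
qed

text \<open>Exhaust \<open>q\<close> by orthogonal halvable projections and glue their halves; a
  nonzero remainder would contain one more by \<open>halvable_below\<close>.\<close>

lemma halving:
 assumes q:"q:N" "projection q"
 shows "halvable q"
proof -
 let ?G = "{g:N. projection g&g~=0&q * g=g&halvable g}"
 obtain p :: "nat=>'h bop" where p:"!!k. p k:?G\<or>p k=0" and o:"!!j k. j~=k==>p j * p k=0"
   and max:"!!g. g:?G==>EX k. p k * g~=0\<or>g * p k~=0"
  by (rule exhaustion[of ?G]) auto
 have ppr:"projection (p k)" for k using p[of k] by auto
 have "halvable 0" unfolding halvable_def by (intro bexI[of _ 0]) (auto intro: w_ins)
 hence "halvable (p k)" for k using p[of k] by auto
 hence "ALL k. EX a b. a:N&b:N&adj a * a=p k&adj b * b=p k&adj a * b=0&p k * a=a&p k * b=b"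
  unfolding halvable_def by blast
 then obtain a b where ab:"!!k. a k:N" "!!k. b k:N" "!!k. adj (a k) * a k=p k" "!!k. adj (b k) * b k=p k"
   "!!k. adj (a k) * b k=0" "!!k. p k * a k=a k" "!!k. p k * b k=b k" by metis
 have o1:"adj (c j) * d k=0" if "j~=k" "!!k. p k * c k=c k" "!!k. p k * d k=d k" for c d :: "nat=>'h bop" and j k
 proof -
  have "adj (c j) * p j=adj (c j)"
   using arg_cong[OF that(2)[of j], of adj] projectionD(2)[OF ppr] by simp
  hence "adj (c j) * d k=adj (c j)*(p j * p k) * d k" using that(3)[of k] by (metis assoc)
  thus ?thesis using o[OF that(1)] by simp
 qed
 have o2:"c j * adj (c k)=0" if "j~=k" "!!k. adj (c k) * c k=p k" for c :: "nat=>'h bop" and j k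
 proof -
  have "c k * p k=c k" for k using partial_isometry_mult[of "c k"] that(2) ppr by (simp add: assoc)
  hence "c j * adj (c k)=c j * p j * adj (c k * p k)" by simp
  also have "...=c j*(p j * p k) * adj (c k)" using projectionD(2)[OF ppr] by (simp add: assoc)
  finally show ?thesis using o[OF that(1)] by simp
 qed
 obtain A where A:"A:N" "projection (adj A*A)" "!!x. (%n. SUM k<n. (adj (a k) * a k) x)---->apply_op (adj A*A) x"
   "!!c. (!!k. c * a k=a k)==>c*A=A" "!!c. (!!k. c * a k=0)==>c*A=0"
  by (rule orth_sum_in[of a]) (use ab o1[OF _ ab(6) ab(6)] o2[OF _ ab(3)] ppr in auto)
 obtain B where B:"B:N" "!!x. (%n. SUM k<n. (adj (b k) * b k) x)---->apply_op (adj B*B) x"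
   "!!c. (!!k. c * b k=b k)==>c*B=B" "!!c. (!!k. c * b k=0)==>c*B=0"
  by (rule orth_sum_in[of b]) (use ab o1[OF _ ab(7) ab(7)] o2[OF _ ab(4)] ppr in auto)
 define R where "R=adj A*A"
 have R:"R:N" "projection R" using A(1,2) by (auto simp: R_def intro: w_ins)
 have limR:"(%n. SUM k<n. (p k) x)---->R x" for x using A(3) by (simp add: R_def ab(3))
 have BB:"adj B*B=R" by (rule bop_eqI, rule LIMSEQ_unique[OF B(2)]) (simp add: ab(4) limR)
 have Rp:"R * p k=p k" for k by (rule projection_of_sum_ge[OF limR o ppr])
 have pR:"p k*R=p k" for k using arg_cong[OF Rp[of k], of adj] projectionD(2)[OF ppr] projectionD(2)[OF R(2)] by simp
 have Ra:"R*A=A" using Rp ab(6) by (intro A(4)) (metis assoc)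
 have Rb:"R*B=B" using Rp ab(7) by (intro B(3)) (metis assoc)
 have AB:"adj A*B=0"
 proof (rule B(4))
  fix k
  have "adj (b k)*A=0"
  proof (rule A(5))
   fix j
   have "adj (b k) * a k=0" using arg_cong[OF ab(5)[of k], of adj] by simp
   thus "adj (b k) * a j=0" using o1[OF _ ab(7) ab(6), of k j] by (cases "k=j") auto
  qed
  from arg_cong[OF this, of adj] show "adj A * b k=0" by simp
 qed
 have qR:"q*R=R"
 proof (rule bop_eqI)
  fix x
  have "q * p k=p k" for k using p[of k] by auto
  hence "q (p k x)=p k x" for k by (metis bop_times_apply)
  hence "q (SUM k<n. p k x)=(SUM k<n. p k x)" for n by (simp add: bop_sum)
  moreover have "(%n. q (SUM k<n. p k x))---->q (R x)" by (intro tendsto_intros limR)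
  ultimately have "(%n. SUM k<n. p k x)---->q (R x)" by (simp only:)
  hence "q (R x)=R x" by (rule LIMSEQ_unique[OF _ limR])
  thus "(q*R) x=R x" by simp
 qed
 have Rq:"R * q=R" using arg_cong[OF qR, of adj] projectionD(2)[OF q(2)] projectionD(2)[OF R(2)] by simp
 have "R=q"
 proof (rule ccontr)
  assume "R~=q"
  hence ne:"q-R~=0" by simp
  have pr:"projection (q-R)"
   using qR Rq projectionD[OF q(2)] projectionD[OF R(2)] by (simp add: projection_def algebra_simps)
  obtain r where r:"r:N" "projection r" "r~=0" "(q-R) * r=r" "halvable r"
   using halvable_below[OF _ pr ne] q(1) R(1) by (blast intro: w_ins)
  have "q * r=r" using r(4) qR projectionD(1)[OF q(2)] by (metis assoc right_diff_distrib mult.commute left_diff_distrib)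
  hence Rr:"R * r=0" using r(4) by (simp add: left_diff_distrib)
  have "p k * r=0" for k using pR Rr by (metis assoc mult_zero_right)
  moreover have "r * p k=0" for k
   using arg_cong[OF \<open>p k * r = 0\<close>, of adj] projectionD(2)[OF ppr] projectionD(2)[OF r(2)] by simp
  ultimately show False using max[of r] r \<open>q * r = r\<close> by auto
 qed
 thus ?thesis unfolding halvable_def
  by (intro bexI[of _ A] bexI[of _ B] conjI) (use A(1) B(1) BB AB Ra Rb R_def in simp_all)
qed

text \<open>The words \<open>b ^ n * a\<close> in the two isometries from \<open>halving\<close>
  have pairwise orthogonal ranges.\<close>

lemma orthogonal_isometries:
 assumes q:"q:N" "projection q"
 obtains s :: "nat=>'h bop" where "!!n. s n:N" "!!m n. adj (s m) * s n=(if m=n then q else 0)"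
  "!!n. q * s n=s n"
proof -
 obtain a b where ab:"a:N" "b:N" "adj a * a=q" "adj b * b=q" "adj a * b=0" "q * a=a" "q * b=b"
  using halving[OF q] unfolding halvable_def by blast
 have ba:"adj b * a=0" using arg_cong[OF ab(5), of adj] by simp
 have aq:"a * q=a" using partial_isometry_mult[of a] ab(3) q(2) by (simp add: assoc)
 let ?s = "%n. b ^ n * a"
 have iso:"adj b ^ n * b ^ n * q=q" for n by (rule power_isometry[OF ab(4,7) projectionD(1)[OF q(2)]])
 have eq:"adj (?s n) * ?s n=q" for n
 proof -
  have "adj (?s n) * ?s n=adj a*(adj b ^ n * b ^ n * q) * a" by (simp add: assoc ab(6))
  thus ?thesis unfolding iso by (simp add: assoc ab(3,6))
 qed
 have lt:"adj (?s m) * ?s n=0" if mn:"m<n" for m n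
 proof -
  obtain k where "n=Suc (m + k)" using less_imp_Suc_add[OF mn] by blast
  hence k:"n=m+Suc k" by simp
  have "b ^ n=b ^ m*(q * b ^ Suc k)" unfolding k power_add power_Suc by (simp add: assoc[symmetric] ab(7)) 
  hence "adj (?s m) * ?s n=adj a*(adj b ^ m * b ^ m * q) * b ^ Suc k * a" by (simp add: assoc)
  also have "...=adj a*(q * b) * b ^ k * a" unfolding iso power_Suc by (simp only: assoc)
  finally show ?thesis by (simp add: ab)
 qed
 have gt:"adj (?s m) * ?s n=0" if "n<m" for m n
  using arg_cong[OF lt[OF that], of adj] by simp
 show ?thesis
 proof (rule that[of ?s])
  show "?s n:N" for n by (intro w_ins ab)
  show "adj (?s m) * ?s n=(if m=n then q else 0)" for m n
   using lt[of m n] gt[of n m] eq by (cases m n rule: linorder_cases) auto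
  show "q * ?s n=?s n" for n
  proof (cases n)
   case (Suc k)
   have "q * ?s n=(q * b) * b ^ k * a" unfolding Suc by (simp only: power_Suc assoc)
   thus ?thesis unfolding ab(7) Suc by (simp only: power_Suc assoc)
  qed (simp add: ab(6))
 qed
qed

text \<open>\<open>z\<close> is the central support of \<open>E\<close>.\<close>

lemma central_support_isometry:
 assumes E:"E:N" "projection E"
 obtains t z where "t:N" "z:N" "projection z" "adj t * t=z" "E * t=t" "E * z=E"
  "!!x. x:N==>z * x=x * z"
proof -
 let ?G = "{g:N. projection g&g~=0&(EX w:N. adj w * w=g&E * w=w)}"
 obtain g :: "nat=>'h bop" where g:"!!k. g k:?G\<or>g k=0" and o:"!!j k. j~=k==>g j * g k=0"
   and max:"!!h. h:?G==>EX k. g k * h~=0\<or>h * g k~=0"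
  by (rule exhaustion[of ?G]) auto
 have gpr:"projection (g k)" for k using g[of k] by auto
 have "EX w:N. adj w * w=g k&E * w=w" for k
 proof (cases "g k=0")
  case True
  thus ?thesis by (intro bexI[of _ 0] w_zero) simp
 next
  case False
  thus ?thesis using g[of k] by simp
 qed
 then obtain w where w:"!!k. w k:N" "!!k. adj (w k) * w k=g k" "!!k. E * w k=w k" by metis
 obtain s :: "nat=>'h bop" where s:"!!n. s n:N" "!!m n. adj (s m) * s n=(if m=n then E else 0)" "!!n. E * s n=s n"
  by (rule orthogonal_isometries[OF E]) (rule that; assumption)
 \<comment> \<open>Each \<open>w k\<close> has its range under \<open>E\<close>, possibly
   overlapping with the others; the orthogonal copies \<open>s k\<close> of \<open>E\<close> inside
   \<open>E\<close> separate them.\<close>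
 let ?t = "%k. s k * w k"
 have tt:"adj (?t j) * ?t k=(if j=k then g k else 0)" for j k
 proof -
  have "adj (?t j) * ?t k=adj (w j)*(adj (s j) * s k) * w k" by (simp add: assoc)
  thus ?thesis by (simp add: s(2) assoc w)
 qed
 have ww:"w j * adj (w k)=0" if "j~=k" for j k
 proof -
  have wg:"w k * g k=w k" for k using partial_isometry_mult[of "w k"] w(2) gpr by (simp add: assoc)
  have "w j * adj (w k)=w j * g j * adj (w k * g k)" by (simp add: wg)
  also have "...=w j*(g j * g k) * adj (w k)" using projectionD(2)[OF gpr] by (simp add: assoc)
  finally show ?thesis by (simp add: o[OF that])
 qed
 obtain t where t:"t:N" "projection (adj t * t)" "!!k. t*(adj (?t k) * ?t k)=?t k"
   "!!x. (%n. SUM k<n. (adj (?t k) * ?t k) x)---->apply_op (adj t * t) x"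
   "!!a. (!!k. a * ?t k=?t k)==>a * t=t"
 proof (rule orth_sum_in[of ?t])
  show "?t k:N" for k by (intro w_ins s w)
  show "adj (?t j) * ?t k=0" if "j~=k" for j k unfolding tt using that by simp
  show "projection (adj (?t k) * ?t k)" for k unfolding tt by (simp add: gpr)
  show "?t j * adj (?t k)=0" if "j~=k" for j k
  proof -
   have "?t j * adj (?t k)=s j*(w j * adj (w k)) * adj (s k)" by (simp add: assoc)
   thus ?thesis by (simp add: ww[OF that])
  qed
 qed blast
 define z where "z=adj t * t"
 have zN:"z:N" unfolding z_def by (intro w_ins t(1))
 have zp:"projection z" using t(2) by (simp add: z_def)
 have Et:"E * t=t" by (rule t(5)) (simp add: assoc[symmetric] s(3))
 have lim:"(%n. SUM k<n. (g k) x)---->z x" for x using t(4)[of x] unfolding tt z_def by simp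
 have zg:"z * g k=g k" for k by (rule projection_of_sum_ge[OF lim o gpr])
 \<comment> \<open>Otherwise the initial projection of the polar part of \<open>?Y\<close> would be
   a good projection orthogonal to all \<open>g k\<close>, against maximality.\<close>
 have key:"E * x*(1 - z)=0" if x:"x:N" for x
 proof (rule ccontr)
  let ?Y = "E * x*(1 - z)"
  assume ne:"?Y~=0"
  have YN:"?Y:N" by (intro w_ins E x zN)
  obtain V R P where V:"?Y=V*R" "adj V*V=1-P" "projection P" "?Y*P=0"
   "!!x. ?Y x=0==>apply_op P x=x" "V:N" "P:N" "R*P=0"
   and int:"!!a b. ?Y * b=a * ?Y==>R * b=b*R==>V * b=a*V"
   using polar_decomposition[of ?Y] walg_axioms YN by (elim exE conjE) blast
  have EV:"E*V=V"
  proof -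
   have "V*1=E*V" by (rule int) (simp_all add: assoc[symmetric] projectionD(1)[OF E(2)])
   thus ?thesis by simp
  qed
  have Pz:"P * z=z"
  proof (rule bop_eqI)
   fix v
   have "(1 - z) * z=0" using projectionD(1)[OF zp] by (simp add: algebra_simps)
   hence "?Y * z=0" by (simp add: assoc)
   hence "?Y (z v)=0" by (metis bop_times_apply bop_zero_apply)
   thus "(P * z) v=z v" using V(5) by (simp only: bop_times_apply)
  qed
  let ?h = "1-P"
  have hp:"projection ?h" by (rule projection_compl[OF V(3)])
  have hN:"?h:N" by (intro w_ins V)
  have h0:"?h~=0"
  proof
   assume "?h=0"
   hence "P=1" by simp
   thus False using V(4) ne by simp
  qed
  have "?h * g k=0" for k
  proof -
   have "P * g k=g k" using Pz zg by (metis assoc)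
   thus ?thesis by (simp add: left_diff_distrib)
  qed
  moreover have "g k * ?h=0" for k
   using arg_cong[OF \<open>?h * g k = 0\<close>, of adj] projectionD(2)[OF gpr] projectionD(2)[OF hp] by simp
  moreover have "?h:?G" using hN hp h0 V(2,6) EV by blast
  ultimately show False using max[of ?h] by blast
 qed
 have zc:"z * x*(1 - z)=0" if x:"x:N" for x
 proof -
  have "z * x*(1 - z)=adj t*(E*(t * x)*(1 - z))"
   using Et by (simp add: z_def assoc) (metis assoc)
  thus ?thesis using key[of "t * x"] x t(1) by (simp add: w_mult)
 qed
 have comm:"z * x=x * z" if x:"x:N" for x
 proof -
  have "z * x=z * x * z" using zc[OF x] by (simp add: right_diff_distrib)
  moreover have "x * z=z * x * z"
  proof -
   have "adj (z * adj x*(1 - z))=0" using zc[OF w_adj[OF x]] by simp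
   hence "(1 - z) * x * z=0" using projectionD(2)[OF zp] by (simp add: assoc)
   thus ?thesis by (simp add: left_diff_distrib)
  qed
  ultimately show ?thesis by simp
 qed
 have "E * z=E" using key[of 1] w_one by (simp add: right_diff_distrib)
 thus ?thesis using that[OF t(1) zN zp _ Et _ comm] z_def by simp
qed

text \<open>A Schroeder-Bernstein argument: \<open>a\<close> shifts the defect \<open>1 - r\<close>
  through orthogonal copies with sum \<open>h\<close>. Using \<open>a\<close> on \<open>h\<close>
  and the identity off \<open>h\<close> misses exactly the defect.\<close>

lemma isometry_onto:
 assumes a:"a:N" "adj a * a=1" and r:"r:N" "projection r" "r * a=a"
 obtains j where "j:N" "adj j * j=1" "j * adj j=r"
proof -
 let ?e = "1 - r"
 have ep:"projection ?e" by (rule projection_compl[OF r(2)])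
 have ae:"adj ?e=?e" by (rule projectionD(2)[OF ep])
 have ee:"?e * ?e=?e" by (rule projectionD(1)[OF ep])
 have ea:"?e * a=0" using r(3) by (simp add: left_diff_distrib)
 have aadj:"adj a * ?e=0" using arg_cong[OF ea, of adj] ae by simp
 have iso:"adj a ^ n * a ^ n=1" for n
  using power_isometry[OF a(2), of n] by simp
 let ?w = "%n. a ^ n * ?e * adj a ^ n"
 have mid:"?e*(adj a ^ m * a ^ n) * ?e=(if m=n then ?e else 0)" for m n
 proof -
  have lt:"?e*(adj a ^ m * a ^ n) * ?e=0" if mn:"m<n" for m n
  proof -
   obtain k where "n=Suc (m + k)" using less_imp_Suc_add[OF mn] by blast
   hence k:"n=m+Suc k" by simp
   have "adj a ^ m * a ^ n=a ^ Suc k" unfolding k power_add using iso[of m] by (metis assoc mult_1)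
   hence "?e*(adj a ^ m * a ^ n) * ?e=(?e * a) * a ^ k * ?e" by (simp only: power_Suc assoc)
   thus ?thesis unfolding ea by simp
  qed
  have gt:"?e*(adj a ^ m * a ^ n) * ?e=0" if "n<m"
   using arg_cong[OF lt[OF that], of adj] ae by (simp add: assoc)
  show ?thesis using lt[of m n] gt by (cases m n rule: linorder_cases) (simp_all add: iso ee)
 qed
 have ww:"?w m * ?w n=(if m=n then ?w n else 0)" for m n
 proof -
  have "?w m * ?w n=a ^ m*(?e*(adj a ^ m * a ^ n) * ?e) * adj a ^ n" by (simp only: assoc)
  thus ?thesis unfolding mid by simp
 qed
 have aw:"adj (?w n)=?w n" for n by (simp only: adj_mult adj_power adj_adj ae assoc)
 obtain h where h:"h:N" "projection (adj h * h)" "!!k. h*(adj (?w k) * ?w k)=?w k"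
   "!!x. (%n. SUM k<n. (adj (?w k) * ?w k) x)---->apply_op (adj h * h) x"
   "!!x. (%n. SUM k<n. ?w k x)---->apply_op h x"
 proof (rule orth_sum_in[of ?w])
  show "?w k:N" for k by (intro w_ins a r)
  show "adj (?w j) * ?w k=0" if "j~=k" for j k unfolding aw ww using that by simp
  show "?w j * adj (?w k)=0" if "j~=k" for j k unfolding aw ww using that by simp
  show "projection (adj (?w k) * ?w k)" for k unfolding aw ww projection_def using aw ww by simp
 qed blast
 have "adj h * h=h"
 proof (rule bop_eqI)
  fix x
  have "(%n. SUM k<n. ?w k x)---->(adj h * h) x" using h(4)[of x] unfolding aw ww by simp
  thus "(adj h * h) x=h x" by (rule LIMSEQ_unique[OF _ h(5)])
 qed
 hence hp:"projection h" using h(2) by simp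
 have he:"h * ?e=?e" using h(3)[of 0] unfolding aw ww by simp
 have eh:"?e * h=?e" using arg_cong[OF he, of adj] ae projectionD(2)[OF hp] by simp
 have aha:"a * h * adj a=h - ?e"
 proof (rule bop_eqI)
  fix x
  have "(%n. a (SUM k<n. ?w k (adj a x)))---->a (h (adj a x))" by (intro tendsto_intros h(5))
  moreover have "a (SUM k<n. ?w k (adj a x))=(SUM k<Suc n. ?w k x) - ?e x" for n
  proof -
   have "a (?w k (adj a x))=?w (Suc k) x" for k
   proof -
    have "a * ?w k * adj a=?w (Suc k)"
     by (simp only: power_Suc[of a] power_Suc2[of "adj a"] assoc)
    thus ?thesis by (metis bop_times_apply)
   qed
   thus ?thesis unfolding bop_sum sum.lessThan_Suc_shift by simp
  qed
  moreover have "(%n. (SUM k<Suc n. ?w k x) - ?e x)---->h x - ?e x"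
   by (intro tendsto_intros LIMSEQ_Suc[OF h(5)])
  ultimately have "a (h (adj a x))=h x - ?e x" by (simp only: LIMSEQ_unique)
  thus "(a * h * adj a) x=(h - ?e) x" by simp
 qed
 have ah:"a * h=h * a"
 proof -
  have "a * h * adj a * a=a * h" using a(2) by (simp add: assoc)
  hence "a * h=h * a - ?e * a" unfolding aha left_diff_distrib by simp
  thus ?thesis unfolding ea by simp
 qed
 define j where "j=a * h+(1 - h)"
 have hh:"h * h=h" "adj h=h" using hp by (simp_all add: projection_def)
 have c1:"(1 - h)*(a * h)=0" unfolding ah by (simp add: left_diff_distrib assoc[symmetric] hh)
 have c2:"adj (a * h)*(1 - h)=0" using arg_cong[OF c1, of adj] hh by simp
 have hhX:"h*(h*X)=h*X" for X by (simp add: assoc[symmetric] hh)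
 have "adj j * j=h*(adj a * a) * h+(1 - h)*(1 - h) + adj (a * h)*(1 - h)+(1 - h)*(a * h)"
  by (simp add: j_def hh algebra_simps)
 also have "...=1" unfolding c1 c2 a(2) by (simp add: hh algebra_simps)
 finally have j1:"adj j * j=1" .
 have c3:"a * h*(1 - h)=0" by (simp add: assoc hh right_diff_distrib)
 have c4:"(1 - h) * adj (a * h)=0" using arg_cong[OF c3, of adj] hh by simp
 have "j * adj j=a * h * h * adj a+(1 - h)*(1 - h) + a * h*(1 - h)+(1 - h) * adj (a * h)"
  by (simp add: j_def hh hhX algebra_simps)
 also have "...=a * h * adj a+(1 - h)" unfolding c3 c4 by (simp add: hh assoc hhX algebra_simps)
 also have "...=r" unfolding aha by simp
 finally have j2:"j * adj j=r" .
 have "j:N" unfolding j_def by (intro w_ins a h)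
 thus ?thesis using that j1 j2 by blast
qed

text \<open>The complement of the range of one isometry contains the range of a second one, so by
  \<open>isometry_onto\<close> it is itself the range of an isometry.\<close>

lemma cuntz_pair:
 obtains a b where "a:N" "b:N" "adj a * a=1" "adj b * b=1" "adj a * b=0" "adj b * a=0"
  "a * adj a + b * adj b=1"
proof -
 obtain s :: "nat=>'h bop" where s:"!!n. s n:N" "!!m n. adj (s m) * s n=(if m=n then 1 else 0)"
  "!!n. 1 * s n=s n"
  by (rule orthogonal_isometries[OF w_one projection_1]) (rule that; assumption)
 let ?a = "s 0"
 have pr:"projection (?a * adj ?a)" by (rule partial_isometry_range) (simp add: s(2))
 have "(1 - ?a * adj ?a) * s 1=s 1" by (simp add: left_diff_distrib assoc s(2))
 moreover have "1 - ?a * adj ?a:N" by (intro w_ins s)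
 moreover have "adj (s 1) * s 1=1" by (simp add: s(2))
 ultimately obtain b where b:"b:N" "adj b * b=1" "b * adj b=1 - ?a * adj ?a"
  using isometry_onto[OF s(1)[of 1] _ _ projection_compl[OF pr]] by metis
 have "adj ?a * b=adj ?a*(b * adj b) * b" using b(2) by (simp add: assoc)
 also have "...=0" unfolding b(3) by (simp add: right_diff_distrib assoc[symmetric] s(2))
 finally have ab:"adj ?a * b=0" .
 have "adj b * ?a=0" using arg_cong[OF ab, of adj] by simp
 thus ?thesis using that[OF s(1)[of 0] b(1) _ b(2) ab] s(2) b(3) by simp
qed

end

lemma pos_antisym:
 assumes "pos T" "pos (- T)" shows "T=0"
proof (rule form_zero_imp_zero)
 fix x
 have "Re (cinner x (T x))=0"
  using posD(1)[OF assms(1), of x] posD(1)[OF assms(2), of x] by (simp add: cinner_simps)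
 thus "cinner x (T x)=0" using posD(2)[OF assms(1), of x] by (simp add: complex_eq_iff)
qed

context t3alg
begin

definition unitary_group :: "'h bop set" where
 "unitary_group={u:N. adj u * u=1&u * adj u=1}"

lemma unitary_groupD:"u:unitary_group==>u:N" "u:unitary_group==>adj u * u=1"
 "u:unitary_group==>u * adj u=1"
 by (simp_all add: unitary_group_def)

lemma unitary_group_adj:"u:unitary_group==>adj u:unitary_group"
 by (simp add: unitary_group_def w_adj)

lemma unitary_group_mult:"u:unitary_group==>v:unitary_group==>u * v:unitary_group"
 unfolding unitary_group_def by (auto intro: w_mult simp: assoc) (metis assoc mult_1)+

text \<open>The projection \<open>c\<close> plays the role of the center-valued minimum of the spectrum of \<open>y\<close>;
  the induction runs over the number of spectral slices of width \<open>e\<close>.\<close>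

lemma min_center_aux:
 fixes e :: real
 assumes y:"y:N" "adj y=y" and e:"0<e"
 shows "z:N==>projection z==>(!!x. x:N==>z * x=x * z) ==>
   pos (z * y - l .* z)==>pos ((l + real n * e) .* z - z * y) ==>
   EX t:N. EX c:N. adj t * t=z&z * t=t&adj c=c&c * z=c&(ALL x:N. c * x=x * c) &
    adj t * y * t[=c + e .* z&c[=z * y"
proof (induction n arbitrary: z l)
 case 0
 have zz:"z * z=z" "adj z=z" using 0(2) by (simp_all add: projection_def)
 \<comment> \<open>No slice is left: on \<open>z\<close> the operator \<open>y\<close> is the scalar
   \<open>l\<close>.\<close>
 have "z * y - l .* z=0"
  by (rule pos_antisym) (use 0(4,5) in simp_all)
 hence zy:"z * y=l .* z" by simp
 show ?case
 proof (rule bexI[of _ z], rule bexI[of _ "l .* z"], intro conjI ballI)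
  have "adj z * y * z=l .* z" using zz zy by simp
  thus "adj z * y * z[=l .* z + e .* z"
   using pos_scaleR[OF projection_positive[OF 0(2)], of e] e by simp
  show "(l .* z) * x=x*(l .* z)" if "x:N" for x using 0(3)[OF that] by simp
 qed (use 0(1) zz zy in "simp_all add: w_scaleR")
next
 case (Suc n)
 note zN = Suc.prems(1) and zp = Suc.prems(2) and zc = Suc.prems(3)
 have zz:"z * z=z" "adj z=z" using zp by (simp_all add: projection_def)
 define m where "m=l + e"
 define T where "T=z * y - m .* z"
 have TN:"T:N" unfolding T_def by (intro w_ins zN y)
 have yz:"z * y=y * z" by (rule zc[OF y(1)])
 have aT:"adj T=T" unfolding T_def using zz y(2) yz by simp
 have Tz:"T * z=T" unfolding T_def by (simp add: left_diff_distrib zz assoc yz[symmetric]) (simp add: assoc[symmetric] zz)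
 obtain E0 where E0:"projection E0" "T*E0=E0*T" "pos (- (T*E0))" "pos (T*(1-E0))" "E0:N"
  using spectral_cut[OF aT] TN walg_axioms by blast
 define E where "E=z*E0"
 have zE0:"z*E0=E0 * z" by (rule zc[OF E0(5)])
 have EN:"E:N" unfolding E_def by (intro w_ins zN E0)
 have E0': "E0*E0=E0" "adj E0=E0" using E0(1) by (simp_all add: projection_def)
 have Ep:"projection E" unfolding projection_def E_def
 proof
  have "z*E0*(z*E0)=z*(E0 * z)*E0" by (simp add: assoc)
  also have "...=(z * z)*(E0*E0)" unfolding zE0[symmetric] by (simp add: assoc)
  finally show "z*E0*(z*E0)=z*E0" by (simp add: zz E0')
  show "adj (z*E0)=z*E0" by (simp add: zz E0' zE0)
 qed
 have zE:"z*E=E" by (simp add: E_def assoc[symmetric] zz)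
 have TE:"T*E=T*E0" unfolding E_def by (simp add: assoc[symmetric] Tz)
 \<comment> \<open>On the central support \<open>z1\<close> of the part of \<open>y\<close> below
   \<open>m\<close>, an isometry into that part settles the matter with \<open>c = l\<close>. On the
   central rest \<open>z - z1\<close> the operator \<open>y\<close> is at least \<open>m\<close>,
   one slice higher, and the induction hypothesis applies.\<close>
 obtain t1 z1 where t1:"t1:N" "z1:N" "projection z1" "adj t1 * t1=z1" "E * t1=t1" "E * z1=E"
  "!!x. x:N==>z1 * x=x * z1"
  by (rule central_support_isometry[OF EN Ep]) (rule that; assumption)
 have zz1:"z1 * z1=z1" "adj z1=z1" using t1(3) by (simp_all add: projection_def)
 have zt1:"z * t1=t1" using zE t1(5) by (metis assoc)
 have z1z:"z1 * z=z1" using zc[OF t1(1)] zt1 t1(4) by (metis assoc)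
 hence zz1': "z * z1=z1" using zc[OF t1(2)] by simp
 have z1t1:"z1 * t1=t1" using t1(7)[OF t1(1)] partial_isometry_mult[of t1] t1(3,4) by (metis assoc)
 have yE:"y*E=T*E + m .* E"
 proof -
  have "T*E=z * y*E - m .* (z*E)" by (simp add: T_def left_diff_distrib)
  also have "z * y*E=y*(z*E)" by (simp add: yz assoc)
  finally show ?thesis by (simp add: zE)
 qed
 have b1:"adj t1 * y * t1[=l .* z1 + e .* z1"
 proof -
  have "adj t1 * y * t1=adj t1*(y*E) * t1" using t1(5) by (simp add: assoc)
  also have "...=adj t1*(T*E0) * t1 + m .* (adj t1*(E * t1))"
   by (simp add: yE TE algebra_simps)
  also have "...=adj t1*(T*E0) * t1 + m .* z1" by (simp add: t1)
  finally have "l .* z1 + e .* z1 - adj t1 * y * t1=adj t1*(- (T*E0)) * t1"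
   by (simp add: m_def scaleR_add_left)
  thus ?thesis using pos_conj[OF E0(3), of t1] by simp
 qed
 have b2:"l .* z1[=z1 * y"
 proof -
  have "adj z1*(z * y - l .* z) * z1=z1 * z*(y * z1) - l .* (z1 * z * z1)"
   by (simp add: zz1 algebra_simps)
  also have "y * z1=z1 * y" using t1(7)[OF y(1)] by simp
  also have "z1 * z*(z1 * y)=z1 * y" by (simp add: z1z assoc[symmetric] zz1)
  also have "z1 * z * z1=z1" by (simp add: z1z zz1)
  finally show ?thesis using pos_conj[OF Suc.prems(4), of z1] by simp
 qed
 define z2 where "z2=z - z1"
 have z2N:"z2:N" unfolding z2_def by (intro w_ins zN t1)
 have z2p:"projection z2" unfolding projection_def z2_def by (simp add: zz zz1 z1z zz1' algebra_simps)
 have zz2:"z2 * z2=z2" "adj z2=z2" using z2p by (simp_all add: projection_def)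
 have z2c:"z2 * x=x * z2" if "x:N" for x
  unfolding z2_def using zc[OF that] t1(7)[OF that] by (simp add: algebra_simps)
 have z21:"z2 * z1=0" "z1 * z2=0" by (simp_all add: z2_def zz1' zz1 z1z algebra_simps)
 have z2z:"z2 * z=z2" "z * z2=z2" by (simp_all add: z2_def zz z1z zz1' algebra_simps)
 have z2T:"z2*T=z2 * y - m .* z2" by (simp add: T_def right_diff_distrib assoc[symmetric] z2z)
 have lower:"pos (z2 * y - m .* z2)"
 proof -
  have "T*E * z1=T*E" by (simp only: assoc t1(6))
  hence "T*E0=T*E * z1" by (simp only: TE)
  also have "...=z1*(T*E)" using t1(7)[OF w_mult[OF TN EN]] by simp
  finally have "z2*(T*E0)=0" by (simp add: assoc[symmetric] z21)
  hence "z2*T=z2*(T*(1-E0))" by (simp add: right_diff_distrib)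
  also have "...=adj z2*(T*(1-E0)) * z2"
   using z2c[of "T*(1-E0)"] TN E0(5) zz2 by (metis assoc w_diff w_mult w_one)
  finally show ?thesis using pos_conj[OF E0(4), of z2] z2T by simp
 qed
 have upper:"pos ((m + real n * e) .* z2 - z2 * y)"
 proof -
  have "adj z2*((l + real (Suc n) * e) .* z - z * y) * z2
    = (l + real (Suc n) * e) .* (z2 * z * z2)-(z2 * z)*(y * z2)" by (simp add: zz2 algebra_simps)
  also have "y * z2=z2 * y" using z2c[OF y(1)] by simp
  also have "(z2 * z)*(z2 * y)=z2 * y" by (simp add: z2z assoc[symmetric] zz2)
  also have "z2 * z * z2=z2" by (simp add: z2z zz2)
  finally have "adj z2*((l + real (Suc n) * e) .* z - z * y) * z2=(l + real (Suc n) * e) .* z2 - z2 * y" .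
  moreover have lm:"l + real (Suc n) * e=m + real n * e" by (simp add: m_def algebra_simps)
  ultimately show ?thesis using pos_conj[OF Suc.prems(5), of z2] by (simp only: lm)
 qed
 obtain t2 c2 where t2:"t2:N" "c2:N" "adj t2 * t2=z2" "z2 * t2=t2" "adj c2=c2" "c2 * z2=c2"
   "!!x. x:N==>c2 * x=x * c2" "adj t2 * y * t2[=c2 + e .* z2" "c2[=z2 * y"
  using Suc.IH[OF z2N z2p z2c lower upper] by blast
 have cross:"adj t1 * x * t2=0" if "x:N" for x
 proof -
  have "adj t1=adj t1 * z1" using arg_cong[OF z1t1, of adj] zz1 by simp
  hence "adj t1 * x * t2=adj t1*(z1 * x)*(z2 * t2)" using t2(4) by (metis assoc)
  also have "...=adj t1 * x*(z1 * z2) * t2" using t1(7)[OF that] by (simp add: assoc)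
  finally show ?thesis by (simp add: z21)
 qed
 have cross': "adj t2 * x * t1=0" if "x:N" for x
  using arg_cong[OF cross[OF w_adj[OF that]], of adj] by (simp add: assoc)
 have c12:"adj t1 * t2=0" "adj t2 * t1=0" using cross[of 1] cross'[of 1] w_one by simp_all
 have zt2:"z * t2=t2" using t2(4) z2z by (metis assoc)
 show ?case
 proof (rule bexI[of _ "t1 + t2"], rule bexI[of _ "l .* z1 + c2"], intro conjI ballI)
  show "adj (t1 + t2)*(t1 + t2)=z" by (simp add: algebra_simps t1(4) t2(3) c12 z2_def)
  show "z*(t1 + t2)=t1 + t2" by (simp add: distrib_left zt1 zt2)
  show "adj (l .* z1 + c2)=l .* z1 + c2" by (simp add: zz1 t2)
  have "c2 * z=c2" using t2(6) z2z by (metis assoc)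
  thus "(l .* z1 + c2) * z=l .* z1 + c2" by (simp add: distrib_right z1z)
  show "(l .* z1 + c2) * x=x*(l .* z1 + c2)" if "x:N" for x
   using t1(7)[OF that] t2(7)[OF that] by (simp add: algebra_simps)
  have "adj (t1 + t2) * y*(t1 + t2)=adj t1 * y * t1 + adj t2 * y * t2"
   by (simp add: algebra_simps cross[OF y(1), unfolded assoc] cross'[OF y(1), unfolded assoc])
  note eq = this
  show "adj (t1 + t2) * y*(t1 + t2)[=l .* z1 + c2 + e .* z"
   unfolding eq using ple_add[OF b1 t2(8)] by (simp add: z2_def algebra_simps)
  show "l .* z1 + c2[=z * y" using ple_add[OF b2 t2(9)] by (simp add: z2_def algebra_simps)
  show "t1 + t2:N" "l .* z1 + c2:N" by (intro w_ins t1 t2)+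
 qed
qed

text \<open>\<open>min_center_aux\<close> starts at \<open>l = - C\<close> with enough slices to
  cover the spectrum. Multiplying the isometry by one member of a Cuntz pair leaves the second
  isometry \<open>a\<close> with orthogonal range, as \<open>isometry_approximation\<close>
  demands.\<close>

lemma min_center:
 fixes e :: real
 assumes y:"y:N" "adj y=y" and e:"0<e"
 obtains t a c where "t:N" "a:N" "c:N" "adj t * t=1" "adj a * a=1" "adj t * a=0"
  "!!x. x:N==>c * x=x * c" "adj t * y * t[=c + e .* 1" "c[=y"
proof -
 obtain C where C:"bnd C y" using bnd_ex by blast
 obtain n :: nat where "2*C / e<real n" using reals_Archimedean2 by blast
 hence n:"2*C<=real n * e" using e by (simp add: field_simps)
 have up:"y[=C .* 1" by (rule bnd_ple[OF C y(2)])
 have lo:"- y[=C .* 1" by (rule bnd_ple[OF bnd_uminus[OF C]]) (simp add: y(2))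
 have "EX t:N. EX c:N. adj t * t=1&1 * t=t&adj c=c&c*1=c&(ALL x:N. c * x=x * c) &
    adj t * y * t[=c + e .* 1&c[=1 * y"
 proof (rule min_center_aux[OF y e, where l = "- C" and n = n])
  show "pos (1 * y-(- C) .* 1)" using lo by (simp add: algebra_simps)
  have "pos ((real n * e-2*C) .* 1 :: 'h bop)" using n by (intro pos_scaleR) auto
  from pos_add[OF this up] show "pos ((- C + real n * e) .* 1-1 * y)"
   by (simp add: algebra_simps scaleR_2 flip: scaleR_scaleR)
 qed (auto intro: w_one)
 then obtain t c where t:"t:N" "c:N" "adj t * t=1" "!!x. x:N==>c * x=x * c"
   "adj t * y * t[=c + e .* 1" "c[=y" by auto
 obtain a b where ab:"a:N" "b:N" "adj a * a=1" "adj b * b=1" "adj a * b=0" "adj b * a=0"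
  "a * adj a + b * adj b=1" by (rule cuntz_pair) (rule that; assumption)
 have tt:"adj t*(t*X)=X" for X by (simp add: assoc[symmetric] t(3))
 show ?thesis
 proof (rule that[of "t * a" "t * b" c])
  have "adj (t * a) * y*(t * a)=adj a*(adj t * y * t) * a" by (simp add: assoc)
  moreover have "adj a*(c + e .* 1) * a=c + e .* 1"
  proof -
   have "adj a * c * a=c*(adj a * a)" using t(4)[OF w_adj[OF ab(1)]] by (metis assoc)
   thus ?thesis by (simp add: algebra_simps ab(3))
  qed
  ultimately show "adj (t * a) * y*(t * a)[=c + e .* 1" using ple_conj[OF t(5), of a] by simp
 qed (use t ab in "auto simp: assoc tt intro: w_ins")
qed

text \<open>For isometries with orthogonal ranges, Bessel's inequality makes the squared norms of
  \<open>adj (s n) x\<close> summable.\<close>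

lemma isometries_to_zero:
 obtains c :: "nat=>'h bop" where "!!n. c n:N" "!!n. adj (c n) * c n=1"
  "!!x. (%n. apply_op (adj (c n)) x)---->0"
proof -
 obtain s :: "nat=>'h bop" where s:"!!n. s n:N" "!!m n. adj (s m) * s n=(if m=n then 1 else 0)"
  "!!n. 1 * s n=s n"
  by (rule orthogonal_isometries[OF w_one projection_1]) (rule that; assumption)
 have "(%n. adj (s n) x)---->0" for x
 proof -
  let ?p = "%k. s k * adj (s k)"
  have pr:"projection (?p k)" for k by (rule partial_isometry_range) (simp add: s(2))
  have o:"?p j * ?p k=0" if "j~=k" for j k
  proof -
   have "?p j * ?p k=s j*(adj (s j) * s k) * adj (s k)" by (simp only: assoc)
   thus ?thesis using that by (simp add: s(2))
  qed
  have le:"(SUM k<n. (norm (adj (s k) x))^2)<=(norm x)^2" for n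
  proof -
   have "(norm (adj (s k) x))^2=Re (cinner x (?p k x))" for k
    using Re_cinner_adj_mult[of x "adj (s k)"] by simp
   hence "(SUM k<n. (norm (adj (s k) x))^2)=Re (cinner x ((SUM k<n. ?p k) x))"
    by (simp only: bop_sum_apply cinner_sum_right Re_sum)
   also have "...<=Re (cinner x (apply_op 1 x))"
    by (intro ple_Re projection_ple_1 projection_sum) (use pr o in auto)
   finally show ?thesis by (simp add: power2_norm_eq_Re_cinner)
  qed
  have "summable (%k. (norm (adj (s k) x))^2)"
   by (rule summableI_nonneg_bounded[where x = "(norm x)^2"]) (use le in auto)
  hence "(%k. (norm (adj (s k) x))^2)---->0" by (rule summable_LIMSEQ_zero)
  from tendsto_real_sqrt[OF this] have "(%k. norm (adj (s k) x))---->0" by simp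
  thus ?thesis by (simp add: tendsto_norm_zero_iff)
 qed
 thus ?thesis using that[of s] s by simp
qed

text \<open>An isometry \<open>t\<close> of infinite codimension is the strong limit of adjoints of unitaries: outside of
  a small projection \<open>c c\<^sup>*\<close> the unitary agrees with \<open>t\<close>, and the Cuntz pair \<open>a\<close>, \<open>b\<close> provides room
  to fill up the range.\<close>

lemma isometry_approximation:
 assumes t:"t:N" "adj t * t=1" and d:"d:N" "adj d * d=1" "adj t * d=0"
 obtains u :: "nat=>'h bop" where "!!n. u n:unitary_group" "!!x. (%n. apply_op (adj (u n)) x)---->apply_op t x"
proof -
 have tp:"projection (t * adj t)" by (rule partial_isometry_range) (simp add: t)
 \<comment> \<open>\<open>d\<close> embeds the whole space into the complement of the range of
   \<open>t\<close>, so an isometry \<open>j\<close> onto that complement exists.\<close>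
 have "(1 - t * adj t) * d=d" by (simp add: left_diff_distrib assoc d)
 then obtain j where j:"j:N" "adj j * j=1" "j * adj j=1 - t * adj t"
  using isometry_onto[OF d(1,2) _ projection_compl[OF tp]] t(1) by (metis w_adj w_diff w_mult w_one)
 have "adj t * j=adj t*(j * adj j) * j" using j(2) by (simp add: assoc)
 also have "...=0" unfolding j(3) by (simp add: right_diff_distrib assoc[symmetric] t)
 finally have tj:"adj t * j=0" .
 have jt:"adj j * t=0" using arg_cong[OF tj, of adj] by simp
 obtain a b where ab:"a:N" "b:N" "adj a * a=1" "adj b * b=1" "adj a * b=0" "adj b * a=0"
  "a * adj a + b * adj b=1" by (rule cuntz_pair) (rule that; assumption)
 obtain c :: "nat=>'h bop" where c:"!!n. c n:N" "!!n. adj (c n) * c n=1" "!!x. (%n. adj (c n) x)---->0"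
  by (rule isometries_to_zero) (rule that; assumption)
 define w where "w n=(t * c n * adj a + j * adj b) * adj (c n)" for n
 define U where "U n=t*(1 - c n * adj (c n)) + w n" for n
 have canc:"adj t*(t*X)=X" "adj j*(j*X)=X" "adj t*(j*X)=0" "adj j*(t*X)=0"
   "adj a*(a*X)=X" "adj b*(b*X)=X" "adj a*(b*X)=0" "adj b*(a*X)=0"
   "adj (c n)*(c n*X)=X" for X n
  by (simp_all add: assoc[symmetric] t j tj jt ab c)
 have UN:"U n:N" for n unfolding U_def w_def by (intro w_ins t c ab j)
 have U1:"adj (U n)*U n=1" for n
 proof -
  have "adj (U n)*U n=1 - c n * adj (c n) + c n*(a * adj a + b * adj b) * adj (c n)"
   by (simp add: U_def w_def algebra_simps canc t j tj jt ab(1-6) c)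
  thus ?thesis by (simp add: ab)
 qed
 have U2:"U n * adj (U n)=1" for n
 proof -
  have "U n * adj (U n)=t * adj t + j * adj j"
   by (simp add: U_def w_def algebra_simps canc t tj jt ab c)
  thus ?thesis by (simp add: j)
 qed
 have lim:"(%n. U n x)---->t x" for x
 proof -
  obtain C1 where C1:"bnd C1 t" using bnd_ex by blast
  have iso:"bnd 1 v" if "adj v * v=1" for v :: "'h bop"
   by (rule le_imp_bnd) (simp_all add: that)
  have tc:"bnd (1*1) (t * c n)" for n by (rule bnd_mult[OF iso[OF t(2)] iso[OF c(2)]])
  have "bnd (1*1*1+1*1+1*1) (t * c n * adj a + j * adj b - t * c n)" for n
   by (rule bnd_diff[OF bnd_add[OF bnd_mult[OF tc bnd_adj[OF iso[OF ab(3)]]]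
      bnd_mult[OF iso[OF j(2)] bnd_adj[OF iso[OF ab(4)]]]] tc])
  hence b3:"bnd 3 (t * c n * adj a + j * adj b - t * c n)" for n by simp
  have "norm (U n x - t x)<=3 * norm (adj (c n) x)" for n
  proof -
   have "U n - t=(t * c n * adj a + j * adj b - t * c n) * adj (c n)"
    by (simp add: U_def w_def algebra_simps)
   hence "U n x - t x=(t * c n * adj a + j * adj b - t * c n) (adj (c n) x)"
    by (metis bop_minus_apply bop_times_apply)
   thus ?thesis using bndD(1)[OF b3, of n "adj (c n) x"] by simp
  qed
  moreover have "(%n. 3 * norm (adj (c n) x))---->0"
   using tendsto_mult[OF tendsto_const[of 3] tendsto_norm_zero[OF c(3)[of x]]] by simp
  ultimately have "(%n. U n x - t x)---->0"
   using Lim_null_comparison[of "%n. U n x - t x" "%n. 3 * norm (adj (c n) x)" sequentially] by simp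
  thus ?thesis by (simp add: LIM_zero_iff)
 qed
 show ?thesis
  by (rule that[of "%n. adj (U n)"]) (simp_all add: unitary_group_def UN U1 U2 w_adj lim)
qed

text \<open>A self-adjoint contraction x is the real part of the unitary x + i sqrt(1 - x^2), so the
  unitaries span the algebra.\<close>

lemma commutes_if_commutes_unitaries:
 assumes S:"!!u. u:unitary_group==>u*S=S * u" and x:"x:N"
 shows "x*S=S * x"
proof -
 have sa1:"x*S=S * x" if x:"x:N" "adj x=x" "bnd 1 x" for x
 proof -
  have "pos (1 - x * x)" using bnd_adj_mult_le[OF x(3)] x(2) by simp
  then obtain r where r:"pos r" "r * r=1 - x * x" "!!M. walg M==>1 - x * x:M==>r:M"
   using sqrt_exists by blast
  have rN:"r:N" by (rule r(3)[OF walg_axioms]) (intro w_ins x)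
  interpret c: walg "commutant {x}" by (rule walg_commutant) (simp add: x)
  have "x:commutant {x}" by (simp add: commutant_def)
  hence "r:commutant {x}" by (intro r(3) c.walg_axioms c.w_ins)
  hence rx:"r * x=x * r" by (simp add: commutant_def)
  let ?u = "x+\<i> :* r"
  have au:"adj ?u=x-\<i> :* r" using x(2) pos_adj[OF r(1)] by (simp add: scaleC_minus_left)
  have ii:"\<i> :* \<i> :* T=- T" for T :: "'h bop" by (simp add: scaleC_scaleC scaleC_minus_left scaleC_one)
  have "adj ?u * ?u=1" "?u * adj ?u=1"
   unfolding au using rx r(2) by (simp_all add: algebra_simps scaleC_add_right scaleC_diff_right scaleC_minus_right ii)
  hence u:"?u:unitary_group" using x rN by (simp add: unitary_group_def w_ins)
  from S[OF u] S[OF unitary_group_adj[OF u]] have "(?u + adj ?u)*S=S*(?u + adj ?u)"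
   by (simp add: distrib_left distrib_right)
  hence "2 .* (x*S)=2 .* (S * x)" unfolding au by (simp add: scaleR_2 algebra_simps)
  thus ?thesis by simp
 qed
 have sa:"x*S=S * x" if x:"x:N" "adj x=x" for x
 proof -
  obtain C where C:"bnd C x" using bnd_ex by blast
  define D where "D=C+1"
  have D:"0<D" using bndD(2)[OF C] by (simp add: D_def)
  have "bnd (\<bar>1/D\<bar>*D) ((1/D) .* x)" by (rule bnd_scaleR[OF bnd_mono[OF C]]) (simp add: D_def)
  hence "bnd 1 ((1/D) .* x)" using D by simp
  hence "((1/D) .* x)*S=S*((1/D) .* x)" using x by (intro sa1) (auto intro: w_ins)
  thus ?thesis using D by simp
 qed
 define a where "a=x + adj x"
 define b where "b=\<i> :* (x - adj x)"
 have a:"a*S=S * a"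
 proof (rule sa)
  show "a:N" unfolding a_def by (intro w_ins x)
  show "adj a=a" by (simp add: a_def add.commute)
 qed
 have b:"b*S=S * b"
 proof (rule sa)
  show "b:N" unfolding b_def by (intro w_ins x)
  show "adj b=b" by (simp add: b_def scaleC_minus_left scaleC_diff_right)
 qed
 have "2 .* x=a-\<i> :* b"
  by (simp add: a_def b_def scaleC_scaleC scaleC_minus_left scaleC_one scaleR_2)
 hence "(2 .* x)*S=S*(2 .* x)" by (simp only: left_diff_distrib right_diff_distrib bop_mult_scaleC_left bop_mult_scaleC_right a b)
 thus ?thesis by simp
qed

end

section \<open>Conditional expectations, the Jones projection and the algebra it generates with
  M\<close>

section \<open>Expectations on the standard space\<close>

lemma ultra_sequentially:"EX U :: nat filter. ultra U&U<=sequentially"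
 using ex_ultra[OF sequentially_bot] by blast

locale expectation =
 fixes M B :: "'h :: complex_hilbert bop set" and E :: "'h bop=>'h bop"
 assumes Mw:"walg M" and Bw:"walg B" and BM:"b:B==>b:M"
  and E_in:"x:M==>E x:B" and E_fix:"b:B==>E b=b"
  and E_add:"x:M==>y:M==>E (x + y)=E x+E y"
  and E_scaleC:"x:M==>E (c :* x)=c :* E x"
  and E_pos:"x:M==>pos x==>pos (E x)"
  and E_bimodule:"a:B==>b:B==>x:M==>E (a * x * b)=a*E x * b"
  and E_faithful:"x:M==>E (adj x * x)=0==>x=0"
begin

sublocale M: walg M by (rule Mw)
sublocale B: walg B by (rule Bw)

lemma E_left:"a:B==>x:M==>E (a * x)=a*E x"
 using E_bimodule[of a 1 x] B.w_one by simp
lemma E_right:"b:B==>x:M==>E (x * b)=E x * b"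
 using E_bimodule[of 1 b x] B.w_one by simp
lemma E_zero:"E 0=0" by (rule E_fix[OF B.w_zero])
lemma E_one:"E 1=1" by (rule E_fix[OF B.w_one])
lemma E_uminus:"x:M==>E (- x)=- E x"
 using E_scaleC[of x "-1"] by (simp add: scaleC_minus_left scaleC_one)
lemma E_diff:"x:M==>y:M==>E (x - y)=E x-E y"
 using E_add[of x "- y"] E_uminus[of y] M.w_uminus[of y] by simp
lemma E_scaleR:"x:M==>E (r .* x)=r .* E x"
 using E_scaleC[of x "of_real r"] by (simp add: scaleC_of_real)

lemma E_mono:"x:M==>y:M==>x[=y==>E x[=E y"
 using E_pos[of "y - x"] by (simp add: E_diff M.w_diff)

lemma E_le_scaleR:"x:M==>x[=r .* 1==>E x[=r .* 1"
 using E_mono[of x "r .* 1"] M.w_ins by (simp add: E_scaleR E_one)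

lemma E_selfadj:
 assumes x:"x:M" "adj x=x" shows "adj (E x)=E x"
proof -
 obtain C where C:"bnd C x" using bnd_ex by blast
 have "pos (C .* 1 - x)" by (rule bnd_ple[OF C x(2)])
 hence "pos (E (C .* 1 - x))" using x by (intro E_pos M.w_ins)
 hence "pos (C .* 1-E x)" using x by (simp add: E_diff E_scaleR E_one M.w_ins)
 from pos_adj[OF this] show ?thesis by simp
qed

lemma E_adj: assumes x:"x:M" shows "E (adj x)=adj (E x)"
proof -
 let ?a = "x + adj x" and ?b = "\<i> :* (x - adj x)"
 have "adj (E ?a)=E ?a" by (rule E_selfadj) (use x in "simp_all add: M.w_ins add.commute")
 hence 1:"adj (E x) + adj (E (adj x))=E x+E (adj x)" using x by (simp add: E_add M.w_adj)
 have "adj (E ?b)=E ?b"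
  by (rule E_selfadj) (use x in "simp_all add: M.w_ins scaleC_minus_left scaleC_diff_right")
 hence "- (\<i> :* (adj (E x) - adj (E (adj x))))=\<i> :* (E x-E (adj x))"
  using x by (simp add: E_scaleC E_diff M.w_ins scaleC_minus_left)
 hence "\<i> :* (\<i> :* (adj (E x) - adj (E (adj x))))=- (\<i> :* (\<i> :* (E x-E (adj x))))"
  by (metis scaleC_minus_right minus_minus)
 hence 2:"- (adj (E x) - adj (E (adj x)))=E x-E (adj x)"
  by (simp add: scaleC_scaleC scaleC_minus_left scaleC_one)
 have "2 .* E (adj x)=(E x+E (adj x))-(E x-E (adj x))" by (simp add: scaleR_2)
 also have "...=2 .* adj (E x)" unfolding 1[symmetric] 2[symmetric] by (simp add: scaleR_2)
 finally show ?thesis by simp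
qed

end

text \<open>Here M already acts on its standard space. The assumption \<open>sep\<close> is totality
  of the orbit of \<open>xi\<close> under the commutant, from which \<open>separating\<close>
  follows.\<close>

locale jones = expectation M B E for M B :: "'h :: complex_hilbert bop set" and E +
 fixes xi :: 'h and e :: "'h bop"
 assumes cyc:"!!u. (!!x. x:M==>cinner u (x xi)=0)==>u=0"
  and sep:"!!u. (!!T. T:commutant M==>cinner u (apply_op T xi)=0)==>u=0"
  and e_apply:"x:M==>e (x xi)=E x xi"
  and phiE:"x:M==>cinner xi (E x xi)=cinner xi (x xi)"
begin

lemma op_eq_on_cyclic:
 fixes S T :: "'h bop"
 assumes "!!x. x:M==>S (x xi)=T (x xi)" shows "S=T"
proof -
 have "adj S v - adj T v=0" for v
  by (rule cyc) (simp add: cinner_diff_left adj_left assms)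
 hence "adj S=adj T" by (intro bop_eqI) simp
 thus ?thesis by (metis adj_adj)
qed

lemma commutant_apply:"T:commutant M==>x:M==>apply_op T (apply_op x v)=apply_op x (apply_op T v)"
 unfolding commutant_def by (metis (mono_tags, lifting) bop_times_apply mem_Collect_eq)

lemma separating: assumes "x:M" "apply_op x xi=0" shows "x=0"
proof -
 have "adj x v=0" for v
 proof (rule sep)
  fix T assume "T:commutant M"
  hence "apply_op x (apply_op T xi)=0" using assms commutant_apply[of T x xi] by simp
  thus "cinner (adj x v) (apply_op T xi)=0" by (simp add: adj_left)
 qed
 hence "adj x=0" by (intro bop_eqI) simp
 thus ?thesis by (metis adj_0 adj_adj)
qed

lemma e_xi:"e xi=xi" using e_apply[OF M.w_one] by (simp add: E_one)

lemma e_projection:"projection e"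
 unfolding projection_def
proof
 show "e * e=e"
  by (rule op_eq_on_cyclic) (simp add: e_apply BM[OF E_in] E_fix[OF E_in])
 show "adj e=e"
 proof (rule op_eq_on_cyclic)
  fix x assume x:"x:M"
  have "adj e (x xi) - e (x xi)=0"
  proof (rule cyc)
   fix y assume y:"y:M"
   have "cinner (adj e (x xi)) (y xi)=cinner xi (adj x (E y xi))" by (simp add: adj_left adj_right e_apply y)
   also have "...=cinner xi (E (adj x*E y) xi)"
    using phiE[of "adj x*E y"] x y by (simp add: M.w_ins BM E_in)
   also have "E (adj x*E y)=E (E (adj x) * y)"
    using x y by (simp add: E_left E_right E_in M.w_ins)
   also have "cinner xi (E (E (adj x) * y) xi)=cinner xi ((E (adj x) * y) xi)"
    by (rule phiE) (use x y in "simp add: M.w_ins BM E_in")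
   also have "...=cinner (e (x xi)) (y xi)" by (simp add: E_adj x adj_right e_apply)
   finally show "cinner (adj e (x xi) - e (x xi)) (y xi)=0" by (simp add: cinner_diff_left)
  qed
  thus "adj e (x xi)=e (x xi)" by simp
 qed
qed

lemma ee:"e * e=e" "adj e=e" and e_bnd:"bnd 1 e"
 using e_projection projection_bnd[OF e_projection] by (simp_all add: projection_def)

lemma e_commute:"b:B==>e * b=b * e"
 by (rule op_eq_on_cyclic) (simp add: e_apply E_left BM e_apply[of "b * _", simplified] M.w_mult)

lemma e_x_e: assumes "x:M" shows "e * x * e=E x * e"
proof (rule op_eq_on_cyclic)
 fix y assume y:"y:M"
 have "e (x (E y xi))=E (x*E y) xi" using e_apply[of "x*E y"] assms y by (simp add: M.w_mult BM E_in)
 also have "...=E x (E y xi)" by (simp add: E_right E_in assms y)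
 finally show "(e * x * e) (y xi)=(E x * e) (y xi)" by (simp add: e_apply y)
qed

lemma e_mult_zero: assumes "x:M" "e * x=0" shows "x=0"
proof -
 have "adj x * e=0" using arg_cong[OF assms(2), of adj] by (simp add: ee)
 hence "adj x xi=0" by (metis bop_times_apply bop_zero_apply e_xi)
 hence "adj x=0" by (rule separating[OF M.w_adj[OF assms(1)]])
 thus ?thesis by (metis adj_0 adj_adj)
qed

lemma mult_e_zero: assumes "x:M" "x * e=0" shows "x=0"
proof -
 have "apply_op x xi=0" using assms(2) by (metis bop_times_apply bop_zero_apply e_xi)
 thus ?thesis by (rule separating[OF assms(1)])
qed

text \<open>If a negative part of \<open>b\<close> survived, compressing by it would give an
  operator of B whose form at \<open>xi\<close> vanishes; \<open>separating\<close> then kills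
  it.\<close>

lemma positive_on_B:
 assumes b:"b:B" "adj b=b" and t:"!!c. c:B==>0<=Re (cinner (c xi) (b (c xi)))"
 shows "pos b"
proof (rule B.positive_if_tested[OF b])
 fix c assume c:"c:B" "pos c" "pos (- (c * b * c))"
 have "Re (cinner xi ((- (c * b * c)) xi))=- Re (cinner (c xi) (b (c xi)))"
  using pos_adj[OF c(2)] by (simp add: cinner_minus_right) (metis adj_right)
 hence "Re (cinner xi ((- (c * b * c)) xi))=0"
  using t[OF c(1)] posD(1)[OF c(3), of xi] by linarith
 from positive_zero_vec[OF c(3) this] have "apply_op (- (c * b * c)) xi=0" .
 hence "- (c * b * c)=0" by (intro separating BM B.w_ins b(1) c(1))
 thus "c * b * c=0" by simp
qed

text \<open>\<open>e\<close> fixes the vectors \<open>c xi\<close> with \<open>c\<close> in B, and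
  these vectors detect the order on B by \<open>positive_on_B\<close>.\<close>

lemma bnd_from_e: assumes b:"b:B" and C:"bnd C (b * e)" shows "bnd C b"
proof (rule le_imp_bnd)
 show "adj b * b[=C^2 .* 1"
 proof (rule positive_on_B)
  fix c assume c:"c:B"
  have "e (c xi)=c xi" using e_apply[OF BM[OF c]] by (simp add: E_fix c)
  hence "norm (b (c xi))<=C * norm (c xi)" using bndD(1)[OF C, of "c xi"] by simp
  hence "(norm (b (c xi)))^2<=C^2*(norm (c xi))^2"
   using power_mono[of "norm (b (c xi))" "C * norm (c xi)" 2] by (simp add: power_mult_distrib)
  thus "0<=Re (cinner (c xi) ((C^2 .* 1 - adj b * b) (c xi)))"
   by (simp add: cinner_simps adj_right power2_norm_eq_Re_cinner)
 qed (use b in "auto intro: B.w_ins")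
qed (use C in "simp add: bnd_def")

text \<open>The closure of the algebra generated by \<open>M\<close> and \<open>e\<close> under bounded weak limits.\<close>

inductive_set alg0 :: "'h bop set" where
 alg0_M:"x:M==>x:alg0"
| alg0_e:"x:M==>y:M==>x * e * y:alg0"
| alg0_add:"S:alg0==>T:alg0==>S+T:alg0"

lemma alg0_scaleC:"S:alg0==>c :* S:alg0"
proof (induction rule: alg0.induct)
 case (alg0_e x y)
 have "c :* (x * e * y)=(c :* x) * e * y" by simp
 thus ?case using alg0.alg0_e[OF M.w_scaleC[OF alg0_e(1)] alg0_e(2)] by metis
qed (auto simp: scaleC_add_right intro: alg0.intros M.w_scaleC)

lemma alg0_adj:"S:alg0==>adj S:alg0"
proof (induction rule: alg0.induct)
 case (alg0_e x y)
 thus ?case using alg0.alg0_e[of "adj y" "adj x"] by (simp add: ee M.w_adj assoc)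
qed (auto intro: alg0.intros M.w_adj)

lemma alg0_mult:"S:alg0==>T:alg0==>S*T:alg0"
proof (induction rule: alg0.induct)
 case (alg0_M x)
 from alg0_M(2,1) show ?case
 proof (induction rule: alg0.induct)
  case (alg0_e y z)
  thus ?case using alg0.alg0_e[of "x * y" z] by (simp add: M.w_mult assoc)
 qed (auto simp: distrib_left intro: alg0.intros M.w_mult)
next
 case (alg0_e x y)
 from alg0_e(3,1,2) show ?case
 proof (induction rule: alg0.induct)
  case (alg0_M z)
  thus ?case using alg0.alg0_e[of x "y * z"] by (simp add: M.w_mult assoc)
 next
  case (alg0_e z w)
  have "x * e * y*(z * e * w)=x*(e*(y * z) * e) * w" by (simp add: assoc)
  also have "e*(y * z) * e=E (y * z) * e" using alg0_e by (intro e_x_e M.w_mult)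
  also have "x*(E (y * z) * e) * w=x*E (y * z) * e * w" by (simp add: assoc)
  finally show ?case using alg0.alg0_e[of "x*E (y * z)" w] alg0_e by (simp add: M.w_mult BM E_in)
 qed (auto simp: distrib_left intro: alg0.intros)
qed (auto simp: distrib_right intro: alg0.intros)

definition clalg :: "'h bop set" where
 "clalg=\<Inter>{X. wclosed X&alg0<=X}"

lemma wclosed_preimage:
 fixes f :: "'h bop=>'h bop"
 assumes X:"wclosed X" and w:"!!F T. wlim (%S. S) T F==>wlim f (f T) F"
  and b:"!!C. EX D. ALL S. bnd C S-->bnd D (f S)"
 shows "wclosed {S. f S:X}"
 unfolding wclosed_def
proof (intro allI impI)
 fix F C T assume F:"F~=bot" "\<forall>\<^sub>F S in F. S:{S. f S:X}&bnd C S" "wlim (%S. S) T F"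
 obtain D where D:"!!S. bnd C S==>bnd D (f S)" using b[of C] by blast
 have "f T:X"
  by (rule wclosedD[OF X F(1) _ w[OF F(3)], where C = D]) (use F(2) D in "auto elim: eventually_mono")
 thus "T:{S. f S:X}" by simp
qed

lemma wclosed_clalg:"wclosed clalg"
proof -
 have "T:X" if F:"F~=bot" "\<forall>\<^sub>F S in F. S:clalg&bnd C S" "wlim (%S. S) T F" and X:"wclosed X" "alg0<=X"
  for F C T X
 proof -
  have "\<forall>\<^sub>F S in F. S:X&bnd C S" using F(2) X by (auto simp: clalg_def elim: eventually_mono)
  thus ?thesis using X F unfolding wclosed_def by blast
 qed
 thus ?thesis unfolding wclosed_def[of clalg] by (auto simp: clalg_def)
qed

lemma alg0_clalg:"alg0<=clalg" by (auto simp: clalg_def)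

lemma clalg_minimal:"wclosed X==>alg0<=X==>clalg<=X" by (auto simp: clalg_def)

lemma wclosed_clalg_preimage:
 assumes "!!S. S:alg0==>f S:clalg" "!!F T. wlim (%S. S) T F==>wlim f (f T) F"
  "!!C. EX D. ALL S. bnd C S-->bnd D (f S)" "S:clalg"
 shows "f S:clalg"
 using clalg_minimal[OF wclosed_preimage[OF wclosed_clalg assms(2,3)]] assms(1,4) by blast

lemma bound_add_left:"EX D. ALL S. bnd C S-->bnd D (S+T)"
 using bnd_ex[of T] bnd_add by metis
lemma bound_mult_left:"EX D. ALL S. bnd C S-->bnd D (S*T)"
 using bnd_ex[of T] bnd_mult by metis
lemma bound_mult_right:"EX D. ALL S. bnd C S-->bnd D (T*S)"
 using bnd_ex[of T] bnd_mult by metis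
lemma bound_scaleC:"EX D. ALL S. bnd C S-->bnd D (c :* S)"
 using bnd_scaleC by metis
lemma bound_adj:"EX D. ALL S. bnd C S-->bnd D (adj S)"
 using bnd_adj by metis

text \<open>Multiplication is only separately continuous, so each operation is extended one argument
  at a time: first with the other argument in \<open>alg0\<close>, then in
  \<open>clalg\<close>.\<close>

lemma clalg_walg:"walg clalg"
proof
 show "1:clalg" using alg0_M[OF M.w_one] alg0_clalg by blast
 have a0:"S+T:clalg" if S:"S:clalg" and T:"T:alg0" for S T
  by (rule wclosed_clalg_preimage[where f = "%S. S+T"])
   (use T S alg0_clalg alg0_add bound_add_left in "auto intro!: wlim_add wlim_const")
 show add:"S+T:clalg" if S:"S:clalg" and T:"T:clalg" for S T
  by (rule wclosed_clalg_preimage[where f = "%T. S+T"])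
   (use T a0[OF S] bound_add_left[of _ S] in "auto intro!: wlim_add wlim_const simp: add.commute[of S]")
 have m0:"S*T:clalg" if S:"S:clalg" and T:"T:alg0" for S T
  by (rule wclosed_clalg_preimage[where f = "%S. S*T"])
   (use T S alg0_clalg alg0_mult bound_mult_left in "auto intro!: wlim_mult_right")
 show "S*T:clalg" if S:"S:clalg" and T:"T:clalg" for S T
  by (rule wclosed_clalg_preimage[where f = "%T. S*T"])
   (use T m0[OF S] bound_mult_right in "auto intro!: wlim_mult_left")
 show "c :* S:clalg" if "S:clalg" for c S
  by (rule wclosed_clalg_preimage[where f = "%S. c :* S"])
   (use that alg0_scaleC alg0_clalg bound_scaleC in "auto intro!: wlim_scaleC")
 show "adj S:clalg" if "S:clalg" for S
  by (rule wclosed_clalg_preimage[where f = adj])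
   (use that alg0_adj alg0_clalg bound_adj in "auto intro!: wlim_adj")
qed (rule wclosed_clalg)

lemma clalg_M:"x:M==>x:clalg" using alg0_M alg0_clalg by blast
lemma clalg_e:"e:clalg" using alg0_e[OF M.w_one M.w_one] alg0_clalg by auto

text \<open>On \<open>alg0\<close> this is computed with \<open>e_x_e\<close>. It survives bounded
  limits because \<open>bnd_from_e\<close> bounds the elements of B, which therefore have an
  ultrafilter limit in B.\<close>

lemma e_clalg_e: assumes "T:clalg" shows "EX b:B. e*T * e=b * e"
proof -
 let ?X = "{T. EX b:B. e*T * e=b * e}"
 have "wclosed ?X"
  unfolding wclosed_def
 proof (intro allI impI)
  fix F C T assume F:"F~=bot" "\<forall>\<^sub>F S in F. S:?X&bnd C S" "wlim (%S. S) T F"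
  obtain U where U:"U<=F" "ultra U" using ex_ultra[OF F(1)] by blast
  define f where "f S=(SOME b. b:B&e*S * e=b * e)" for S
  have f:"f S:B&bnd C (f S)&e*S * e=f S * e" if "S:?X&bnd C S" for S
  proof -
   have "EX b. b:B&e*S * e=b * e" using that by blast
   hence *: "f S:B&e*S * e=f S * e" unfolding f_def by (rule someI_ex)
   have "bnd (1*C*1) (e*S * e)" using that by (intro bnd_mult e_bnd) auto
   hence "bnd C (f S * e)" using * by simp
   thus ?thesis using * bnd_from_e by blast
  qed
  have ev:"\<forall>\<^sub>F S in U. S:?X&bnd C S" using F(2) U(1) by (rule filter_leD[rotated])
  have e1:"\<forall>\<^sub>F S in U. f S:B" and e2:"\<forall>\<^sub>F S in U. bnd C (f S)" and e3:"\<forall>\<^sub>F S in U. e*S * e=f S * e"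
  proof -
   have "\<forall>\<^sub>F S in U. f S:B&bnd C (f S)&e*S * e=f S * e"
    by (rule eventually_mono[OF ev]) (rule f)
   thus "\<forall>\<^sub>F S in U. f S:B" "\<forall>\<^sub>F S in U. bnd C (f S)" "\<forall>\<^sub>F S in U. e*S * e=f S * e"
    by (auto elim: eventually_mono)
  qed
  obtain b where b:"b:B" "wlim f b U" using B.w_ultra_limit[OF U(2) e1 e2] by blast
  have "wlim (%S. e*S * e) (e*T * e) U" by (intro wlim_mult_left wlim_mult_right wlim_mono[OF F(3) U(1)])
  moreover have "wlim (%S. e*S * e) (b * e) U"
   unfolding wlim_def
  proof (intro allI)
   fix x y
   have "((%S. cinner x ((f S * e) y))--->cinner x ((b * e) y)) U"
    using wlim_mult_right[OF b(2), of e] unfolding wlim_def by blast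
   thus "((%S. cinner x ((e*S * e) y))--->cinner x ((b * e) y)) U"
    by (rule Lim_transform_eventually, intro eventually_mono[OF e3]) (simp only:)
  qed
  ultimately have "e*T * e=b * e" using wlim_unique ultraD[OF U(2)] by blast
  thus "T:?X" using b(1) by blast
 qed
 moreover have "alg0<=?X"
 proof
  fix T assume "T:alg0"
  thus "T:?X"
  proof (induction rule: alg0.induct)
   case (alg0_M x) thus ?case using e_x_e E_in by blast
  next
   case (alg0_e x y)
   have eeX:"e*(e*V)=e*V" for V by (simp only: assoc[symmetric] ee)
   have "e*(x * e * y) * e=(e * x * e)*(e * y * e)" by (simp only: assoc eeX)
   also have "...=E x*(e*E y) * e" unfolding e_x_e[OF alg0_e(1)] e_x_e[OF alg0_e(2)] by (simp only: assoc)
   also have "...=E x*E y * e" unfolding e_commute[OF E_in[OF alg0_e(2)]] by (simp only: assoc ee)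
   finally show ?case using alg0_e by (auto intro: B.w_mult E_in)
  next
   case (alg0_add S T)
   then obtain b c where "b:B" "c:B" "e*S * e=b * e" "e*T * e=c * e" by blast
   hence "e*(S+T) * e=(b + c) * e" "b + c:B" by (simp_all add: distrib_left distrib_right B.w_add)
   thus ?case by blast
  qed
 qed
 ultimately show ?thesis using clalg_minimal assms by blast
qed

lemma dense_commutant:"0<r==>EX T:commutant M. norm (v - apply_op T xi)<r"
proof (rule dense_approximation)
 interpret c: walg "commutant M" by (rule walg_commutant) (rule M.w_adj)
 show "csubspace (commutant M)" by (rule c.w_csubspace)
 show "clinear_on (commutant M) (%T. apply_op T xi)" by (simp add: clinear_on_def)
qed (rule sep)

text \<open>An operator of the commutant moves \<open>xi\<close> close to \<open>v\<close> and
  commutes with \<open>X\<close>; the uniform bound \<open>K\<close> absorbs the error.\<close>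

lemma strong_from_xi:
 assumes "0<r" "0<=K"
 shows "EX d>0. ALL X:M. bnd K X-->norm (X xi)<d-->norm (apply_op X v)<r"
proof -
 obtain T where T:"T:commutant M" "norm (v - apply_op T xi)<r/(2*(K+1))"
  using dense_commutant[of "r/(2*(K+1))" v] assms by auto
 obtain C where C:"bnd C T" using bnd_ex by blast
 have C0:"0<=C" by (rule bndD(2)[OF C])
 show ?thesis
 proof (intro exI[of _ "r/(2*(C+1))"] conjI ballI impI)
  fix X assume X:"X:M" "bnd K X" "norm (X xi)<r/(2*(C+1))"
  have "X v=X (v - T xi)+T (X xi)" using commutant_apply[OF T(1) X(1)] by simp
  hence "norm (X v)<=norm (X (v - T xi)) + norm (T (X xi))" using norm_triangle_ineq by metis
  moreover have "norm (X (v - T xi))<=r/2"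
  proof -
   have "norm (X (v - T xi))<=K * norm (v - T xi)" by (rule bndD(1)[OF X(2)])
   also have "...<=(K+1)*(r/(2*(K+1)))" using T(2) assms by (intro mult_mono) auto
   also have "...=r/2" using assms(2) by (simp add: field_simps)
   finally show ?thesis .
  qed
  moreover have "norm (T (X xi))<r/2"
  proof -
   have "norm (T (X xi))<=C * norm (X xi)" by (rule bndD(1)[OF C])
   also have "...<=C*(r/(2*(C+1)))" using X(3) C0 by (intro mult_left_mono) auto
   also have "...<r/2" using C0 assms(1) by (simp add: field_simps)
   finally show ?thesis .
  qed
  ultimately show "norm (apply_op X v)<r" by linarith
 qed (use assms(1) C0 in simp)
qed

end

section \<open>Minimization in the basic construction and the resulting intertwiner\<close>

section \<open>Fixed points by minimization\<close>

text \<open>The assumption \<open>compare\<close> says that, on positive contractions of M, the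
  vector \<open>xi\<close> is controlled by the state obtained by composing its vector state with
  \<open>EA\<close>.\<close>

locale popa = jones M B E xi e + EA: expectation M A EA
 for M B A :: "'h :: complex_hilbert bop set" and E EA xi e +
 assumes At3:"t3alg A" and Bt3:"t3alg B"
  and compare:"0<r==>EX d>0. ALL X:M. pos X-->X[=1-->Re (cinner xi (EA X xi))<d-->norm (X xi)<r"
begin

sublocale TA: t3alg A by (rule At3)
sublocale TB: t3alg B by (rule Bt3)

lemma AM:"a:A==>a:M" by (rule EA.BM)

lemma positive_small:
 assumes r:"0<r" and K:"0<K"
 shows "EX d>0. ALL X:M. pos X-->X[=K .* 1-->Re (cinner xi (EA X xi))<d-->norm (apply_op X v)<r"
proof -
 obtain d1 where d1:"0<d1" "!!X. X:M==>bnd K X==>norm (X xi)<d1==>norm (apply_op X v)<r"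
  using strong_from_xi[of r K v] r K by auto
 obtain d2 where d2:"0<d2" "!!X. X:M==>pos X==>X[=1==>Re (cinner xi (EA X xi))<d2==>norm (X xi)<d1/K"
  using compare[of "d1/K"] d1(1) K by auto
 show ?thesis
 proof (intro exI[of _ "K * d2"] conjI ballI impI)
  fix X assume X:"X:M" "pos X" "X[=K .* 1" "Re (cinner xi (EA X xi))<K * d2"
  have "norm (((1/K) .* X) xi)<d1/K"
  proof (rule d2(2))
   show "(1/K) .* X:M" using X(1) by (rule M.w_scaleR)
   show "pos ((1/K) .* X)" using X(2) K by (intro pos_scaleR) auto
   show "(1/K) .* X[=1" using ple_scaleR[OF X(3), of "1/K"] K by simp
   show "Re (cinner xi (EA ((1/K) .* X) xi))<d2"
    using X(1,4) K by (simp add: EA.E_scaleR cinner_scaleR_right field_simps)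
  qed
  hence "norm (X xi)<d1" using K by (simp add: field_simps)
  thus "norm (apply_op X v)<r" using d1(2) X(1) positive_bnd[OF X(2,3)] K by simp
 qed (use K d2(1) in simp)
qed

text \<open>An isometry t from \<open>min_center\<close> compresses \<open>X\<close> to at most c +
  ?r, with c central and below \<open>X\<close>. As \<open>v\<close> commutes with c, the bound
  holds at \<open>xi\<close> and at \<open>adj v xi\<close> alike, and unitaries approximate t at
  both vectors.\<close>

lemma steering:
 fixes r :: real
 assumes X:"X:A" "pos X" and v:"v:TA.unitary_group" and r:"0<r"
 obtains u where "u:TA.unitary_group" "Re (cinner xi ((u*X * adj u) xi))<=Re (cinner xi (X xi)) + r"
  "Re (cinner xi ((v * u*X * adj u * adj v) xi))<=Re (cinner xi (X xi)) + r"
proof -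
 define k where "k=(norm xi)^2+1"
 have k:"0<k" "(norm xi)^2<=k" by (simp_all add: k_def add_nonneg_pos)
 have r2:"0<r/(2 * k)" (is "0<?r") using r k by simp
 obtain t a c where t:"t:A" "a:A" "c:A" "adj t * t=1" "adj a * a=1" "adj t * a=0"
  "!!x. x:A==>c * x=x * c" "adj t*X * t[=c + ?r .* 1" "c[=X"
  by (rule TA.min_center[OF X(1) pos_adj[OF X(2)] r2]) (rule that; assumption)
 obtain u :: "nat=>'h bop" where u:"!!n. u n:TA.unitary_group"
  "!!x. (%n. apply_op (adj (u n)) x)---->apply_op t x"
  by (rule TA.isometry_approximation[OF t(1,4) t(2,5,6)]) (rule that; assumption)
 have rr:"?r*(norm xi)^2<r"
 proof -
  have "?r*(norm xi)^2<=?r * k" using r2 k by (intro mult_left_mono) auto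
  also have "...=r/2" using k by simp
  finally show ?thesis using r by linarith
 qed
 have lim:"(%n. Re (cinner (adj (u n) w) (X (adj (u n) w))))---->Re (cinner w ((adj t*X * t) w))" for w
  unfolding bop_times_apply adj_right by (intro tendsto_intros u(2))
 have wv:"norm (adj v xi)=norm xi"
  using Re_cinner_adj_mult[of xi "adj v"] TA.unitary_groupD(3)[OF v] by (simp add: power2_norm_eq_Re_cinner[symmetric])
 have bound:"Re (cinner w ((adj t*X * t) w))<Re (cinner xi (X xi)) + r"
  if w:"norm w=norm xi" "Re (cinner w (c w))=Re (cinner xi (c xi))" for w
 proof -
  have "Re (cinner w ((adj t*X * t) w))<=Re (cinner w ((c + ?r .* 1) w))" by (rule ple_Re[OF t(8)])
  also have "...=Re (cinner w (c w)) + ?r*(norm w)^2"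
   by (simp only: bop_plus_apply cinner_add_right plus_complex.simps Re_cinner_scaleR_one)
  also have "...<=Re (cinner xi (X xi)) + ?r*(norm xi)^2" using ple_Re[OF t(9), of xi] w by simp
  also have "...<Re (cinner xi (X xi)) + r" using rr by simp
  finally show ?thesis .
 qed
 have cv:"Re (cinner (adj v xi) (c (adj v xi)))=Re (cinner xi (c xi))"
 proof -
  have "v * c * adj v=c*(v * adj v)" using t(7)[OF TA.unitary_groupD(1)[OF v]] by (metis assoc)
  hence "v * c * adj v=c" by (simp add: TA.unitary_groupD(3)[OF v])
  thus ?thesis unfolding adj_left by (metis bop_times_apply)
 qed
 have 1:"\<forall>\<^sub>F n in sequentially. Re (cinner (adj (u n) xi) (X (adj (u n) xi)))<Re (cinner xi (X xi)) + r"
  by (rule order_tendstoD(2)[OF lim bound]) simp_all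
 have 2:"\<forall>\<^sub>F n in sequentially. Re (cinner (adj (u n) (adj v xi)) (X (adj (u n) (adj v xi))))<Re (cinner xi (X xi)) + r"
  by (rule order_tendstoD(2)[OF lim bound]) (use wv cv in simp_all)
 obtain n where n:"Re (cinner (adj (u n) xi) (X (adj (u n) xi)))<Re (cinner xi (X xi)) + r"
  "Re (cinner (adj (u n) (adj v xi)) (X (adj (u n) (adj v xi))))<Re (cinner xi (X xi)) + r"
  using eventually_happens'[OF sequentially_bot eventually_conj[OF 1 2]] by blast
 show ?thesis
  by (rule that[OF u(1)[of n]]) (use n in "simp_all add: adj_left less_imp_le")
qed

end

text \<open>The element \<open>a0\<close> packs finitely many elements of M into one,
  \<open>dl\<close> is a lower bound for the mass uniform over unitaries, and \<open>s1\<close>,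
  \<open>s2\<close> are isometries of B with orthogonal ranges used to form midpoints.\<close>

locale popa_min = popa M B A E EA xi e for M B A :: "'h :: complex_hilbert bop set" and E EA xi e +
 fixes a0 :: "'h bop" and s1 s2 :: "'h bop" and c0 :: "nat=>'h bop" and n0 :: nat and dl :: real
 assumes a0:"a0:M" and c0:"j<n0==>c0 j:M"
  and d0:"0<dl" "u:TA.unitary_group==>dl<=(SUM j<n0. (norm (E (adj a0 * u * c0 j) xi))^2)"
  and s:"s1:B" "s2:B" "adj s1 * s1=1" "adj s2 * s2=1" "adj s1 * s2=0" "adj s2 * s1=0"
begin

text \<open>Since \<open>e\<close> commutes with \<open>s1\<close> and \<open>s2\<close>, averages
  of operators \<open>y * e * adj y\<close> again have this form with a single \<open>y\<close> in M
  (\<open>kk_mid\<close>).\<close>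

definition mid :: "'h bop=>'h bop=>'h bop" where
 "mid y z=(1 / sqrt 2) .* (y * adj s1 + z * adj s2)"

inductive_set Y :: "'h bop set" where
 Y_base:"a0:Y"
| Y_unitary:"y:Y==>u:TA.unitary_group==>u * y:Y"
| Y_mid:"y:Y==>z:Y==>mid y z:Y"

text \<open>Formally the image of \<open>kk y * kk z\<close> under the operator-valued weight
  sending a e b to a b. Thus \<open>gg y\<close> stands for the image of the square of
  \<open>kk y\<close>, \<open>DD y z\<close> for that of the square of \<open>kk y - kk z\<close>,
  and \<open>qq y\<close> for a squared 2-norm.\<close>

definition bb :: "'h bop=>'h bop=>'h bop" where "bb y z=y*E (adj y * z) * adj z"
definition gg :: "'h bop=>'h bop" where "gg y=bb y y"
definition DD :: "'h bop=>'h bop=>'h bop" where "DD y z=bb y y - bb y z - bb z y + bb z z"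
definition kk :: "'h bop=>'h bop" where "kk y=y * e * adj y"
definition qq :: "'h bop=>real" where "qq y=Re (cinner xi (EA (gg y) xi))"

lemma sB:"s1:M" "s2:M" using s BM by auto

lemma s_canc:"adj s1*(s1*X)=X" "adj s2*(s2*X)=X" "adj s1*(s2*X)=0" "adj s2*(s1*X)=0"
 by (simp_all add: assoc[symmetric] s)

lemma e_s:"e * s1=s1 * e" "e * s2=s2 * e" "e * adj s1=adj s1 * e" "e * adj s2=adj s2 * e"
 using e_commute s B.w_adj by auto

lemma Y_M:"y:Y==>y:M"
proof (induction rule: Y.induct)
 case (Y_unitary y u)
 thus ?case using AM[OF TA.unitary_groupD(1)] by (simp add: M.w_mult)
qed (auto simp: mid_def intro!: a0 M.w_ins sB)

lemma E_expand:
 assumes "x:M" "p:B" "q:B" shows "E (p * x * adj q)=p*E x * adj q"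
 using assms by (simp add: E_bimodule B.w_adj)

lemma mid_mult_adj:"mid y z * adj (mid y z)=(1/2) .* (y * adj y + z * adj z)"
 by (simp add: mid_def algebra_simps s s_canc power2_eq_square[symmetric] power_divide)

lemma kk_mid:"kk (mid y z)=(1/2) .* (kk y + kk z)"
proof -
 have "adj s1*(e*(s1*X))=e*X" "adj s2*(e*(s2*X))=e*X"
  "adj s1*(e*(s2*X))=0" "adj s2*(e*(s1*X))=0" for X
  unfolding assoc[symmetric] e_s[symmetric] by (simp_all add: assoc s_canc s)
 thus ?thesis by (simp add: kk_def mid_def algebra_simps)
qed

lemma gg_mid:
 assumes y:"y:M" and z:"z:M"
 shows "4 .* gg (mid y z)=bb y y + bb y z + bb z y + bb z z"
proof -
 let ?x = "y * adj s1 + z * adj s2"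
 have "adj ?x * ?x=s1*(adj y * y) * adj s1 + s1*(adj y * z) * adj s2 + s2*(adj z * y) * adj s1 + s2*(adj z * z) * adj s2"
  by (simp add: algebra_simps)
 hence Ex:"E (adj ?x * ?x)=s1*E (adj y * y) * adj s1 + s1*E (adj y * z) * adj s2
   + s2*E (adj z * y) * adj s1 + s2*E (adj z * z) * adj s2"
  using y z sB by (simp add: E_add E_expand s M.w_ins)
 have "4 .* gg (mid y z)=?x*E (adj ?x * ?x) * adj ?x"
 proof -
  have "adj ((1 / sqrt 2) .* ?x)*((1 / sqrt 2) .* ?x)=(1/2) .* (adj ?x * ?x)"
   by (simp only: adj_scaleR bop_mult_scaleR_left bop_mult_scaleR_right scaleR_scaleR) simp
  moreover have "adj ?x * ?x:M" by (intro M.w_ins y z sB)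
  ultimately have "E (adj (mid y z) * mid y z)=(1/2) .* E (adj ?x * ?x)" by (simp only: mid_def E_scaleR)
  hence "gg (mid y z)=(1/4) .* (?x*E (adj ?x * ?x) * adj ?x)"
   unfolding gg_def bb_def by (simp only: mid_def adj_scaleR bop_mult_scaleR_left bop_mult_scaleR_right scaleR_scaleR) simp
  thus ?thesis by simp
 qed
 also have "...=bb y y + bb y z + bb z y + bb z z"
  unfolding Ex by (simp add: bb_def algebra_simps s s_canc)
 finally show ?thesis .
qed

lemma DD_parallelogram:
 assumes "y:M" "z:M" shows "DD y z=2 .* gg y+2 .* gg z-4 .* gg (mid y z)"
 unfolding gg_mid[OF assms] by (simp add: DD_def gg_def scaleR_2)

lemma gg_M:"y:M==>gg y:M" by (simp add: gg_def bb_def M.w_ins BM E_in)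

lemma gg_positive:"y:M==>pos (gg y)"
 unfolding gg_def bb_def by (intro pos_conj' E_pos M.w_ins pos_adj_mult)

text \<open>With the row X of y and z and G = E(X^* X), the square of \<open>kk y - kk z\<close> is
  W^* G e W while \<open>DD y z\<close> is W^* G W. Since \<open>e\<close> commutes with G, the
  former is smaller.\<close>

lemma DD_dominates:
 assumes y:"y:M" and z:"z:M"
 shows "adj (kk y - kk z)*(kk y - kk z)[=DD y z" "pos (DD y z)"
proof -
 let ?X = "y * adj s1 + z * adj s2" and ?W = "s1 * adj y - s2 * adj z"
 have XM:"?X:M" by (intro M.w_ins y z sB)
 let ?G = "E (adj ?X * ?X)"
 have "adj ?X * ?X=s1*(adj y * y) * adj s1 + s1*(adj y * z) * adj s2 + s2*(adj z * y) * adj s1 + s2*(adj z * z) * adj s2"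
  by (simp add: algebra_simps)
 hence Ex:"?G=s1*E (adj y * y) * adj s1 + s1*E (adj y * z) * adj s2
   + s2*E (adj z * y) * adj s1 + s2*E (adj z * z) * adj s2"
  using y z sB by (simp add: E_add E_expand s M.w_ins)
 have D:"DD y z=adj ?W * ?G * ?W"
  unfolding Ex by (simp add: DD_def bb_def algebra_simps s s_canc)
 have XX:"adj ?X * ?X:M" by (intro M.w_mult M.w_adj XM)
 have Gpos:"pos ?G" by (rule E_pos[OF XX pos_adj_mult])
 thus "pos (DD y z)" unfolding D by (rule pos_conj)
 have es:"adj s1*(e*(s1*V))=e*V" "adj s2*(e*(s2*V))=e*V"
  "adj s1*(e*(s2*V))=0" "adj s2*(e*(s1*V))=0" for V
  unfolding assoc[symmetric] e_s[symmetric] by (simp_all add: assoc s_canc s)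
 have K:"kk y - kk z=?X * e * ?W"
  by (simp add: kk_def algebra_simps es)
 have GB:"?G:B" by (rule E_in[OF XX])
 have "adj (kk y - kk z)*(kk y - kk z)=adj ?W*(e*(adj ?X * ?X) * e) * ?W"
  unfolding K by (simp only: adj_mult ee assoc)
 also have "e*(adj ?X * ?X) * e=?G * e" by (rule e_x_e[OF XX])
 finally have 1:"adj (kk y - kk z)*(kk y - kk z)=adj ?W*(?G * e) * ?W" .
 have "?G - ?G * e=adj (1 - e) * ?G*(1 - e)"
  using e_commute[OF GB] ee by (simp add: algebra_simps)
 hence "?G * e[=?G" using pos_conj[OF Gpos, of "1 - e"] by simp
 thus "adj (kk y - kk z)*(kk y - kk z)[=DD y z"
  unfolding 1 D by (rule ple_conj)
qed

lemma gg_unitary: assumes y:"y:M" and u:"u:TA.unitary_group" shows "gg (u * y)=u * gg y * adj u"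
proof -
 have "adj (u * y)*(u * y)=adj y * y"
  using TA.unitary_groupD(2)[OF u] by (simp add: assoc) (metis assoc mult_1)
 thus ?thesis unfolding gg_def bb_def by (simp only: adj_mult assoc)
qed

lemma kk_unitary:"kk (u * y)=u * kk y * adj u"
 by (simp add: kk_def assoc)

lemma ex_bound:"EX c>0. ALL y:Y. y * adj y[=c .* 1"
proof -
 obtain C where C:"bnd C (adj a0)" using bnd_ex by blast
 have "a0 * adj a0[=C^2 .* 1" using bnd_adj_mult_le[OF C] by simp
 moreover have "pos ((C^2+1) .* 1-C^2 .* 1 :: 'h bop)" by (simp add: scaleR_add_left)
 ultimately have base:"a0 * adj a0[=(C^2+1) .* 1" by (rule ple_trans)
 have "y * adj y[=(C^2+1) .* 1" if "y:Y" for y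
  using that
 proof (induction rule: Y.induct)
  case (Y_unitary y u)
  have "u*(y * adj y) * adj u[=u*((C^2+1) .* 1) * adj u" by (rule ple_conj'[OF Y_unitary(3)])
  thus ?case by (simp add: assoc TA.unitary_groupD(3)[OF Y_unitary(2)])
 next
  case (Y_mid y z)
  have "(1/2) .* (y * adj y + z * adj z)[=(1/2) .* ((C^2+1) .* 1+(C^2+1) .* 1)"
   by (intro ple_scaleR ple_add Y_mid) simp
  thus ?case unfolding mid_mult_adj by simp
 qed (rule base)
 thus ?thesis by (intro exI[of _ "C^2+1"]) (auto simp: add_nonneg_pos)
qed

text \<open>The mass is affine in \<open>kk y\<close>, so midpoints inherit the bound. Quantifying
  over all \<open>u\<close> lets the induction absorb left translations.\<close>

lemma mass_bound:"y:Y==>u:TA.unitary_group ==>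
  dl<=(SUM j<n0. Re (cinner (c0 j xi) ((u * kk y * adj u) (c0 j xi))))"
proof (induction arbitrary: u rule: Y.induct)
 case Y_base
 have "Re (cinner (c0 j xi) ((u * kk a0 * adj u) (c0 j xi)))=(norm (E (adj a0 * adj u * c0 j) xi))^2" if "j<n0" for j
 proof -
  let ?x = "adj a0 * adj u * c0 j"
  have x:"?x:M" by (intro M.w_ins a0 c0 that AM TA.unitary_groupD(1)[OF Y_base])
  have "u * kk a0 * adj u=adj (e * adj a0 * adj u)*(e * adj a0 * adj u)"
   by (simp add: kk_def ee assoc) (metis ee(1) assoc)
  hence "Re (cinner (c0 j xi) ((u * kk a0 * adj u) (c0 j xi)))=(norm ((e * adj a0 * adj u) (c0 j xi)))^2"
   by (simp only: Re_cinner_adj_mult)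
  also have "(e * adj a0 * adj u) (c0 j xi)=E ?x xi" using e_apply[OF x] by simp
  finally show ?thesis .
 qed
 thus ?case using d0(2)[OF TA.unitary_group_adj[OF Y_base]] by simp
next
 case (Y_unitary y v)
 have "u * kk (v * y) * adj u=(u * v) * kk y * adj (u * v)" by (simp add: kk_unitary assoc)
 thus ?case using Y_unitary.IH[OF TA.unitary_group_mult[OF Y_unitary.prems Y_unitary.hyps(2)]] by simp
next
 case (Y_mid y z)
 have "u * kk (mid y z) * adj u=(1/2) .* (u * kk y * adj u + u * kk z * adj u)"
  by (simp add: kk_mid algebra_simps)
 hence "(SUM j<n0. Re (cinner (c0 j xi) ((u * kk (mid y z) * adj u) (c0 j xi))))
   = (1/2)*((SUM j<n0. Re (cinner (c0 j xi) ((u * kk y * adj u) (c0 j xi))))+(SUM j<n0. Re (cinner (c0 j xi) ((u * kk z * adj u) (c0 j xi)))))"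
  by (simp only: bop_scaleR_apply bop_plus_apply cinner_scaleR_right cinner_add_right sum.distrib[symmetric] sum_distrib_left)
   simp
 thus ?case using Y_mid.IH(1)[OF Y_mid.prems] Y_mid.IH(2)[OF Y_mid.prems] by simp
qed

lemma qq_nonneg:"y:Y==>0<=qq y"
 unfolding qq_def by (intro posD(1) EA.E_pos gg_M gg_positive Y_M)

definition mm :: real where "mm=Inf (qq ` Y)"

lemma mm_le:"y:Y==>mm<=qq y"
 unfolding mm_def by (intro cInf_lower bdd_belowI[where m = 0]) (use qq_nonneg in auto)

lemma near_mm: assumes "0<r" shows "EX y:Y. qq y<mm + r"
proof -
 have "Inf (qq ` Y)<mm + r" using assms by (simp add: mm_def)
 thus ?thesis using cInf_lessD[of "qq ` Y"] Y_base by blast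
qed

text \<open>The parallelogram law, together with the fact that the midpoint cannot lie below the
  infimum \<open>mm\<close>.\<close>

lemma DD_trace:
 assumes "y:Y" "z:Y"
 shows "Re (cinner xi (EA (DD y z) xi))<=2*(qq y - mm)+2*(qq z - mm)"
proof -
 note m = Y_M[OF assms(1)] Y_M[OF assms(2)] Y_M[OF Y_mid[OF assms]]
 have "EA (DD y z)=2 .* EA (gg y)+2 .* EA (gg z)-4 .* EA (gg (mid y z))"
  unfolding DD_parallelogram[OF m(1,2)] using m gg_M by (simp add: EA.E_diff EA.E_add EA.E_scaleR M.w_ins)
 hence "Re (cinner xi (EA (DD y z) xi))=2 * qq y+2 * qq z-4 * qq (mid y z)"
  by (simp add: qq_def cinner_simps)
 thus ?thesis using mm_le[OF Y_mid[OF assms]] by simp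
qed

text \<open>For near-minimizers \<open>DD y z\<close> is small in the composed state by
  \<open>DD_trace\<close>. On bounded positive operators \<open>positive_small\<close> turns this
  into smallness at \<open>v\<close>, and \<open>DD_dominates\<close> passes it to
  \<open>kk y - kk z\<close>.\<close>

lemma close_minimizers:
 fixes r :: real
 assumes r:"0<r"
 shows "EX d>0. ALL y:Y. ALL z:Y. qq y<mm + d-->qq z<mm + d-->norm (kk y v - kk z v)<r"
proof -
 obtain c where c:"0<c" "!!y. y:Y==>y * adj y[=c .* 1" using ex_bound by blast
 have gb:"gg y[=(c * c) .* 1" if y:"y:Y" for y
 proof -
  have "bnd (sqrt c) (adj y)" by (rule le_imp_bnd) (use c y in simp_all)
  hence "bnd (sqrt c) y" using bnd_adj by fastforce
  hence "adj y * y[=c .* 1" using bnd_adj_mult_le[of "sqrt c" y] c(1) by simp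
  hence "E (adj y * y)[=c .* 1" using Y_M[OF y] by (intro E_le_scaleR M.w_ins)
  from ple_conj'[OF this, of y] have "gg y[=c .* (y * adj y)" by (simp add: gg_def bb_def)
  moreover have "c .* (y * adj y)[=c .* (c .* 1)" using c y by (intro ple_scaleR) auto
  ultimately show ?thesis using ple_trans by fastforce
 qed
 have Dle:"DD y z[=(4 * c * c) .* 1" if y:"y:Y" and z:"z:Y" for y z
 proof -
  have "2 .* gg y+2 .* gg z[=2 .* ((c * c) .* 1)+2 .* ((c * c) .* 1)"
   by (intro ple_add ple_scaleR gb y z) simp_all
  also have "2 .* ((c * c) .* 1)+2 .* ((c * c) .* 1)=(4 * c * c) .* (1 :: 'h bop)"
   by (simp flip: scaleR_add_left)
  finally have "2 .* gg y+2 .* gg z[=(4 * c * c) .* 1" .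
  moreover have "DD y z[=2 .* gg y+2 .* gg z"
   unfolding DD_parallelogram[OF Y_M[OF y] Y_M[OF z]]
   using pos_scaleR[OF gg_positive[OF Y_M[OF Y_mid[OF y z]]], of 4] by simp
  ultimately show ?thesis using ple_trans by blast
 qed
 have "0<r^2/(norm v + 1)" using r by (simp add: add_nonneg_pos)
 then obtain d where d:"0<d" "!!X. X:M==>pos X==>X[=(4 * c * c) .* 1 ==>
   Re (cinner xi (EA X xi))<d==>norm (apply_op X v)<r^2/(norm v + 1)"
  using positive_small[of "r^2/(norm v + 1)" "4 * c * c" v] c(1) by auto
 show ?thesis
 proof (intro exI[of _ "d/4"] conjI ballI impI)
  fix y z assume yz:"y:Y" "z:Y" "qq y<mm + d/4" "qq z<mm + d/4"
  have DM:"DD y z:M" using yz by (simp add: DD_def bb_def M.w_ins BM E_in Y_M)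
  have "Re (cinner xi (EA (DD y z) xi))<d" using DD_trace[OF yz(1,2)] yz(3,4) by simp
  from d(2)[OF DM DD_dominates(2)[OF Y_M Y_M] Dle this] yz
  have nd:"norm (DD y z v)<r^2/(norm v + 1)" by simp
  have "(norm ((kk y - kk z) v))^2<=Re (cinner v (DD y z v))"
   using ple_Re[OF DD_dominates(1)[OF Y_M[OF yz(1)] Y_M[OF yz(2)]], of v] by (simp only: Re_cinner_adj_mult)
  also have "...<=norm v * norm (DD y z v)"
   using complex_Re_le_cmod cmod_cinner_le order_trans by blast
  also have "...<=norm v * (r^2/(norm v + 1))" using nd by (intro mult_left_mono) auto
  also have "...<(norm v + 1)*(r^2/(norm v + 1))"
   using r by (intro mult_strict_right_mono) (simp_all add: add_nonneg_pos)
  also have "...=r^2" using norm_ge_zero[of v] by (simp add: add_nonneg_eq_0_iff)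
  finally show "norm (kk y v - kk z v)<r" using r by (simp add: power2_less_imp_less)
 qed (use d(1) in simp)
qed

lemma kk_bnd: assumes "y * adj y[=c .* 1" "0<=c" shows "pos (kk y)" "bnd c (kk y)"
proof -
 show p:"pos (kk y)" unfolding kk_def by (rule pos_conj'[OF projection_positive[OF e_projection]])
 have "kk y[=y * adj y" using ple_conj'[OF projection_ple_1[OF e_projection], of y] by (simp add: kk_def)
 from ple_trans[OF this assms(1)] show "bnd c (kk y)" by (rule positive_bnd[OF p _ assms(2)])
qed

text \<open>Minimizing sequences for the state \<open>\<phi>\<close> and for \<open>(\<phi> + \<phi> \<circ> Ad v) / 2\<close> have the same limit
  because \<open>steering\<close> makes the two infima equal.\<close>

theorem fixed_point:
 obtains S y c where "pos S" "S~=0" "!!a. a:A==>a*S=S * a"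
  "!!n :: nat. y n:M" "0<c" "!!n. y n * adj (y n)[=c .* 1"
  "!!x. (%n. (y n * e * adj (y n)) x)---->apply_op S x"
proof -
 obtain c where c:"0<c" "!!y. y:Y==>y * adj y[=c .* 1" using ex_bound by blast
 have kb:"pos (kk y)" "bnd c (kk y)" if "y:Y" for y using kk_bnd[OF c(2)[OF that]] c(1) by auto
 have "EX y:Y. qq y<mm+1 / real (Suc n)" for n by (rule near_mm) simp
 then obtain y where y:"!!n. y n:Y" "!!n. qq (y n)<mm+1 / real (Suc n)" by metis
 have small:"\<forall>\<^sub>F n in sequentially. 1 / real (Suc n)<d" if "0<d" for d
  using order_tendstoD(2)[OF LIMSEQ_Suc[OF lim_inverse_n'] that] by simp
 have "EX L. bnd c L&(ALL x. (%n. kk (y n) x)---->apply_op L x)"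
 proof (rule strong_limit_op)
  show "bnd c (kk (y n))" for n by (rule kb(2)[OF y(1)])
  fix x
  have "Cauchy (%n. kk (y n) x)"
  proof (rule metric_CauchyI)
   fix r :: real assume "0<r"
   then obtain d where d:"0<d" "!!p q. p:Y==>q:Y==>qq p<mm + d==>qq q<mm + d==>norm (kk p x - kk q x)<r"
    using close_minimizers[of r x] by blast
   obtain n0 where n0:"!!n. n>=n0==>1 / real (Suc n)<d" using small[OF d(1)] by (auto simp: eventually_sequentially)
   have "qq (y n)<mm + d" if "n>=n0" for n using y(2)[of n] n0[OF that] by linarith
   thus "EX N. ALL m>=N. ALL n>=N. dist (kk (y m) x) (kk (y n) x)<r"
    unfolding dist_norm using d(2) y(1) by blast
  qed
  thus "convergent (%n. kk (y n) x)" by (simp add: Cauchy_convergent_iff)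
 qed
 then obtain S where S:"!!x. (%n. kk (y n) x)---->apply_op S x" by blast
 have uniq:"(%n. kk (z n) x)---->S x" if z:"!!n. z n:Y" "!!n. qq (z n)<mm+1 / real (Suc n)" for z x
 proof -
  have "(%n. kk (z n) x - kk (y n) x)---->0"
  proof (rule tendstoI)
   fix r :: real assume "0<r"
   then obtain d where d:"0<d" "!!p q. p:Y==>q:Y==>qq p<mm + d==>qq q<mm + d==>norm (kk p x - kk q x)<r"
    using close_minimizers[of r x] by blast
   show "\<forall>\<^sub>F n in sequentially. dist (kk (z n) x - kk (y n) x) 0<r"
    using small[OF d(1)]
   proof (rule eventually_mono)
    fix n assume "1 / real (Suc n)<d"
    thus "dist (kk (z n) x - kk (y n) x) 0<r"
     using d(2)[OF z(1) y(1), of n n] z(2)[of n] y(2)[of n] by (simp add: dist_norm)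
   qed
  qed
  from tendsto_add[OF this S[of x]] show ?thesis by simp
 qed
 have comm:"v * S=S * v" if v:"v:TA.unitary_group" for v
 proof -
  have near:"EX z:Y. qq z<mm + r&qq (v * z)<mm + r" if r:"0<r" for r :: real
  proof -
   have h:"0<r/2" using r by simp
   obtain y0 where y0:"y0:Y" "qq y0<mm + r/2" using near_mm[OF h] by blast
   have XA:"EA (gg y0):A" by (intro EA.E_in gg_M Y_M y0)
   have Xp:"pos (EA (gg y0))" by (intro EA.E_pos gg_M gg_positive Y_M y0)
   obtain u where u:"u:TA.unitary_group"
    "Re (cinner xi ((u*EA (gg y0) * adj u) xi))<=Re (cinner xi (EA (gg y0) xi)) + r/2"
    "Re (cinner xi ((v * u*EA (gg y0) * adj u * adj v) xi))<=Re (cinner xi (EA (gg y0) xi)) + r/2"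
    by (rule steering[OF XA Xp v h]) (rule that; assumption)
   \<comment> \<open>By the bimodule property of \<open>EA\<close>, left translation of
     \<open>y0\<close> becomes conjugation of the element \<open>EA (gg y0)\<close> of A, to which
     \<open>steering\<close> was applied.\<close>
   have qu:"qq (w * y0)=Re (cinner xi ((w*EA (gg y0) * adj w) xi))" if w:"w:TA.unitary_group" for w
    unfolding qq_def gg_unitary[OF Y_M[OF y0(1)] w]
    by (simp only: EA.E_bimodule[OF TA.unitary_groupD(1)[OF w] TA.unitary_groupD(1)[OF TA.unitary_group_adj[OF w]] gg_M[OF Y_M[OF y0(1)]]])
   have "qq (u * y0)<mm + r"
    using u(2) y0(2) unfolding qu[OF u(1)] qq_def[of y0] by linarith
   moreover have "qq (v * (u * y0))<mm + r"
   proof -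
    have "qq (v * (u * y0))=Re (cinner xi ((v * u*EA (gg y0) * adj u * adj v) xi))"
     using qu[OF TA.unitary_group_mult[OF v u(1)]] by (simp add: assoc)
    thus ?thesis using u(3) y0(2) unfolding qq_def[of y0] by linarith
   qed
   ultimately show ?thesis using Y_unitary[OF y0(1) u(1)] by blast
  qed
  have "EX z:Y. qq z<mm+1 / real (Suc n)&qq (v * z)<mm+1 / real (Suc n)" for n
   by (rule near) simp
  then obtain z where z:"!!n. z n:Y" "!!n. qq (z n)<mm+1 / real (Suc n)" "!!n. qq (v * z n)<mm+1 / real (Suc n)" by metis
  have "v * S * adj v=S"
  proof (rule bop_eqI)
   fix x
   have "(%n. kk (v * z n) x)---->S x" by (rule uniq) (use z Y_unitary v in auto)
   moreover have "(%n. kk (v * z n) x)---->v (S (adj v x))"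
    unfolding kk_unitary bop_times_apply by (intro tendsto_intros uniq z)
   ultimately show "(v * S * adj v) x=S x" using LIMSEQ_unique by fastforce
  qed
  hence "v * S * adj v * v=S * v" by simp
  thus ?thesis using TA.unitary_groupD(2)[OF v] by (simp add: assoc)
 qed
 have Spos:"pos S"
  by (rule pos_limit[where F = sequentially and T = "%n. kk (y n)"])
   (auto intro!: tendsto_intros S always_eventually kb(1) y(1))
 have "S~=0"
 proof
  assume S0:"S=0"
  have one:"1:TA.unitary_group" by (simp add: TA.unitary_group_def EA.B.w_one)
  have "dl<=(SUM j<n0. Re (cinner (c0 j xi) (kk (y n) (c0 j xi))))" for n
   using mass_bound[OF y(1) one] by simp
  moreover have "(%n. SUM j<n0. Re (cinner (c0 j xi) (kk (y n) (c0 j xi))))---->(SUM j<n0. Re (cinner (c0 j xi) (S (c0 j xi))))"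
   by (intro tendsto_intros S)
  ultimately have "dl<=(SUM j<n0. Re (cinner (c0 j xi) (S (c0 j xi))))"
   by (intro tendsto_lowerbound[OF _ _ sequentially_bot]) auto
  thus False using d0(1) by (simp add: S0)
 qed
 show ?thesis
 proof (rule that[of S y c])
  show "a*S=S * a" if "a:A" for a by (rule TA.commutes_if_commutes_unitaries[OF comm that])
  show "(%n. (y n * e * adj (y n)) x)---->apply_op S x" for x using S[of x] by (simp add: kk_def)
 qed (use Spos \<open>S \<noteq> 0\<close> y Y_M c in auto)
qed

end

instance complex_hilbert \<subseteq> banach ..

context popa_min
begin

text \<open>A partial isometry V moves the support of S under \<open>e\<close>. Compressing by
  \<open>e\<close> lands in B e, so \<open>V * a * adj V\<close> defines \<pi>; likewise
  \<open>V * S\<close> has the form \<open>e * z\<close> with z in M, and z inherits the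
  intertwining relation from S commuting with A.\<close>

theorem intertwiner:
 obtains \<pi> V z where "!!a. a:A==>\<pi> a:B" "!!a. a:A==>\<pi> a * e=V * a * adj V" "bnd 1 V"
  "!!a b. a:A==>b:A==>\<pi> (a * b)=\<pi> a*\<pi> b" "z:M" "z~=0" "!!a. a:A==>z * a=\<pi> a * z"
proof -
 interpret C: walg clalg by (rule clalg_walg)
 obtain S y c where S:"pos S" "S~=0" "!!a. a:A==>a*S=S * a"
  and y:"!!n. y n:M" "!!n. y n * adj (y n)[=c .* 1" and c:"0<c"
  and lim:"!!x. (%n. (y n * e * adj (y n)) x)---->apply_op S x"
  by (rule fixed_point) (rule that; assumption)
 have yb:"bnd (sqrt c) (adj (y n))" for n
  by (rule le_imp_bnd) (use y(2)[of n] c in simp_all)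
 have yb': "bnd (sqrt c) (y n)" for n using bnd_adj[OF yb[of n]] by simp
 have kb:"bnd (sqrt c*1 * sqrt c) (y n * e * adj (y n))" for n by (intro bnd_mult yb yb' e_bnd)
 have yC:"y n:clalg" "adj (y n):clalg" for n using y(1) by (auto intro: clalg_M M.w_adj)
 have SC:"S:clalg" by (rule C.w_limit[OF _ kb lim]) (intro C.w_mult yC clalg_e)
 have one:"1:B" "projection (1 :: 'h bop)" by (auto intro: B.w_one)
 obtain t :: "nat=>'h bop" where t:"!!n. t n:B" "!!m n. adj (t m) * t n=(if m=n then 1 else 0)"
  "!!n. 1 * t n=t n"
  by (rule TB.orthogonal_isometries[OF one]) (rule that; assumption)
 have tb:"bnd 1 (t k)" for k by (rule le_imp_bnd) (use t(2)[of k k] in simp_all)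
 \<comment> \<open>The isometries \<open>t k\<close> keep the summands apart, so a vector killed by
   the sum is killed by every \<open>e * adj (y k)\<close> and hence by S; the weights make the
   series converge.\<close>
 define w where "w k=((1/2) ^ k) .* (t k * e * adj (y k))" for k
 have wb:"norm (w k x)<=(1/2) ^ k*(sqrt c * norm x)" for k x
  using bndD(1)[OF bnd_mult[OF bnd_mult[OF tb e_bnd] yb], of k k x] by (simp add: w_def)
 have wC:"w k:clalg" for k
  unfolding w_def by (intro C.w_scaleR C.w_mult clalg_e yC clalg_M BM t(1))
 have sw:"summable (%k. w k x)" for x
  by (rule summable_comparison_test'[OF summable_mult2[OF summable_geometric, where c = "sqrt c * norm x"]])
   (use wb in auto)
 have Tb:"bnd (2 * sqrt c) (SUM k<n. w k)" for n
 proof (rule bndI)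
  fix x
  have "norm ((SUM k<n. w k) x)<=(SUM k<n. (1/2) ^ k*(sqrt c * norm x))"
   unfolding bop_sum_apply by (rule sum_norm_le) (rule wb)
  also have "...=(SUM k<n. (1/2) ^ k)*(sqrt c * norm x)" by (simp add: sum_distrib_right)
  also have "...<=2*(sqrt c * norm x)"
   using sum_le_suminf[OF summable_geometric[of "1/2 :: real"], of "{..<n}"] c
   by (intro mult_right_mono) (auto simp: suminf_geometric)
  finally show "norm ((SUM k<n. w k) x)<=2 * sqrt c * norm x" by simp
 qed (use c in simp)
 have "EX L. bnd (2 * sqrt c) L&(ALL x. (%n. (SUM k<n. w k) x)---->apply_op L x)"
  by (rule strong_limit_op[OF Tb]) (use sw in "simp add: bop_sum_apply summable_iff_convergent")
 then obtain V0 where V0:"!!x. (%n. (SUM k<n. w k) x)---->apply_op V0 x" by blast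
 have V0C:"V0:clalg" by (rule C.w_limit[OF _ Tb V0]) (intro C.w_sum wC)
 have eV0:"e*V0=V0"
 proof (rule bop_eqI)
  fix x
  have ew:"e * w k=w k" for k
  proof -
   have "e*(t k * e * adj (y k))=t k * e * adj (y k)"
    using e_commute[OF t(1)[of k]] ee(1) by (simp flip: assoc; simp add: assoc)
   thus ?thesis by (simp add: w_def)
  qed
  have "e ((SUM k<n. w k) x)=(SUM k<n. w k) x" for n
   unfolding bop_sum_apply bop_sum using ew by (metis (no_types) bop_times_apply)
  hence "(%n. (SUM k<n. w k) x)---->e (V0 x)" using tendsto_bop[OF V0[of x], of e] by simp
  from LIMSEQ_unique[OF this V0[of x]] show "(e*V0) x=V0 x" by simp
 qed
 have kerV0:"S x=0" if x:"V0 x=0" for x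
 proof -
  have ez:"e (adj (y k) x)=0" for k
  proof -
   have tw:"adj (t k) (w j x)=(if j=k then ((1/2) ^ k) .* e (adj (y k) x) else 0)" for j
   proof -
    have "adj (t k) (w j x)=((1/2)^j) .* (adj (t k) * t j) (e (adj (y j) x))" by (simp add: w_def)
    thus ?thesis by (simp add: t(2))
   qed
   have "(%n. SUM j<n. adj (t k) (w j x))---->adj (t k) (w k x)"
    by (rule tendsto_sum_eventually_const) (simp add: tw)
   moreover have "(%n. SUM j<n. adj (t k) (w j x))---->adj (t k) (V0 x)"
    using tendsto_bop[OF V0[of x], of "adj (t k)"] by (simp add: bop_sum_apply bop_sum)
   ultimately have "adj (t k) (w k x)=adj (t k) (V0 x)" by (rule LIMSEQ_unique)
   thus ?thesis by (simp add: x tw)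
  qed
  hence "(%n. 0)---->S x" using lim[of x] by simp
  thus ?thesis using LIMSEQ_const_iff by metis
 qed
 obtain P0 where P0:"projection P0" "S*P0=0" "!!x. S x=0==>P0 x=x"
   "!!N. walg N==>S:N==>P0:N"
  using ker_projection[of S] by blast
 note PP = projectionD[OF P0(1)]
 have P0S:"P0*S=0" using arg_cong[OF P0(2), of adj] PP(2) pos_adj[OF S(1)] by simp
 have P0C:"P0:clalg" by (rule P0(4)[OF clalg_walg SC])
 have P0A:"P0 * a=a*P0" if "a:A" for a
 proof -
  have "P0:commutant A"
   by (rule P0(4)[OF walg_commutant[OF EA.B.w_adj]]) (use S(3) in "auto simp: commutant_def")
  thus ?thesis using that by (auto simp: commutant_def)
 qed
 \<comment> \<open>Cutting by \<open>1 - P0\<close> makes the kernel of Z equal to that of S; its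
   projection \<open>P0\<close> commutes with A.\<close>
 define Z where "Z=V0*(1-P0)"
 have ZC:"Z:clalg" unfolding Z_def by (intro C.w_ins V0C P0C)
 have kerZ:"P0 x=x" if "Z x=0" for x
 proof -
  have "S ((1-P0) x)=0" by (rule kerV0) (use that in "simp add: Z_def")
  hence "P0 ((1-P0) x)=(1-P0) x" by (rule P0(3))
  moreover have "P0 ((1-P0) x)=0"
   using arg_cong[OF PP(1), of "%T. apply_op T x"] by simp
  ultimately show ?thesis by simp
 qed
 obtain V R P where pol:"Z=V*R" "adj V*V=1-P" "projection P" "Z*P=0" "ALL x. Z x=0-->apply_op P x=x"
   "ALL N. walg N-->Z:N-->V:N&R:N&P:N"
   "ALL a b. Z * b=a*Z-->R * b=b*R-->V * b=a*V"
  using polar_decomposition[of Z] by (elim exE conjE) (rule that; assumption)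
 have "P0*P=P"
 proof (rule bop_eqI)
  fix x have "Z (P x)=0" using arg_cong[OF pol(4), of "%T. apply_op T x"] by simp
  thus "(P0*P) x=P x" using kerZ by simp
 qed
 moreover have "P*P0=P0"
 proof (rule bop_eqI)
  fix x have "Z (P0 x)=0" using arg_cong[OF PP(1), of "%T. apply_op T x"] by (simp add: Z_def)
  thus "(P*P0) x=P0 x" using pol(5) by simp
 qed
 ultimately have PP0:"P=P0"
  using projectionD(2)[OF pol(3)] PP(2) by (metis adj_mult)
 have eV:"e*V=V"
  using spec[OF spec[OF pol(7), of e], of 1] eV0 by (simp add: Z_def flip: assoc)
 have Ve:"adj V * e=adj V" using arg_cong[OF eV, of adj] ee(2) by simp
 have VC:"V:clalg" using pol(6) clalg_walg ZC by blast
 have VV:"adj V*V=1-P0" by (simp add: pol(2) PP0)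
 have Vb:"bnd 1 V"
 proof (rule le_imp_bnd)
  have "1 - adj V*V=P0" by (simp add: VV)
  thus "adj V*V[=1^2 .* 1" using projection_positive[OF P0(1)] by simp
 qed simp
 have VP:"V*P0=0"
 proof (rule adj_mult_self_eq_0)
  show "adj (V*P0)*(V*P0)=0" using PP VV
   by (simp add: assoc) (simp add: VV algebra_simps flip: assoc)
 qed
 have "EX b:B. b * e=V * a * adj V" if a:"a:A" for a
 proof -
  have "V * a * adj V:clalg" by (intro C.w_ins VC clalg_M AM a)
  then obtain b where b:"b:B" "e*(V * a * adj V) * e=b * e" using e_clalg_e by blast
  moreover have "e*(V * a * adj V) * e=(e*V) * a*(adj V * e)" by (simp add: assoc)
  ultimately show ?thesis unfolding eV Ve by metis
 qed
 then obtain \<pi> where pi:"!!a. a:A==>\<pi> a:B" "!!a. a:A==>\<pi> a * e=V * a * adj V" by metis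
 have piV:"\<pi> a*(V*X)=V*(a*X)" if a:"a:A" for a X
 proof -
  have "\<pi> a*(V*X)=(\<pi> a * e)*(V*X)" using eV by (simp add: assoc; metis assoc)
  also have "...=V * a*(adj V*V)*X" by (simp add: pi(2)[OF a] assoc)
  also have "...=V * a*X-(V*P0) * a*X"
   unfolding VV using P0A[OF a] by (simp add: algebra_simps; metis assoc)
  finally show ?thesis by (simp add: VP assoc)
 qed
 have mult:"\<pi> (a * b)=\<pi> a*\<pi> b" if ab:"a:A" "b:A" for a b
 proof -
  note abA = EA.B.w_mult[OF ab]
  have "(\<pi> (a * b)-\<pi> a*\<pi> b) * e=V * a * b * adj V-\<pi> a*(V*(b * adj V))"
   using pi(2)[OF abA] pi(2)[OF ab(2)] by (simp add: algebra_simps)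
  also have "...=0" unfolding piV[OF ab(1)] by (simp add: assoc)
  finally show ?thesis using mult_e_zero[of "\<pi> (a * b)-\<pi> a*\<pi> b"] pi(1) ab abA
   by (simp add: BM M.w_diff M.w_mult)
 qed
 \<comment> \<open>Pushing down: \<open>V * y n * e\<close> equals \<open>b n * e\<close> with
   \<open>b n\<close> in B, so \<open>V * (y n * e * adj (y n))\<close> is \<open>e\<close> times
   the element \<open>b n * adj (y n)\<close> of M. These are bounded, and an ultrafilter limit in M
   is \<open>z\<close>.\<close>
 have "EX b:B. b * e=V * y n * e" for n
 proof -
  have "V * y n:clalg" by (intro C.w_ins VC yC)
  then obtain b where b:"b:B" "e*(V * y n) * e=b * e" using e_clalg_e by blast
  thus ?thesis using eV by (metis assoc)
 qed
 then obtain b where b:"!!n. b n:B" "!!n. b n * e=V * y n * e" by metis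
 have bb:"bnd (sqrt c) (b n)" for n
 proof (rule bnd_from_e[OF b(1)])
  show "bnd (sqrt c) (b n * e)" unfolding b(2) using bnd_mult[OF bnd_mult[OF Vb yb'[of n]] e_bnd] by simp
 qed
 obtain U :: "nat filter" where U:"ultra U" "U<=sequentially" using ultra_sequentially by blast
 have zb:"bnd (sqrt c * sqrt c) (b n * adj (y n))" for n by (intro bnd_mult bb yb)
 have zM:"b n * adj (y n):M" for n by (intro M.w_mult M.w_adj BM b(1) y(1))
 have "EX z:M. bnd (sqrt c * sqrt c) z&wlim (%n. b n * adj (y n)) z U"
  by (rule M.w_ultra_limit[OF U(1)]) (rule always_eventually, rule allI, rule zM zb)+
 then obtain z where z:"z:M" "wlim (%n. b n * adj (y n)) z U" by blast
 have ez:"e * z=V*S"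
 proof (rule wlim_unique[OF _ _ ultraD[OF U(1)]])
  show "wlim (%n. e*(b n * adj (y n))) (e * z) U" by (rule wlim_mult_left[OF z(2)])
  have "e*(b n * adj (y n))=V*(y n * e * adj (y n))" for n
   using e_commute[OF b(1)[of n]] b(2)[of n] by (simp flip: assoc)
  moreover have "wlim (%n. V*(y n * e * adj (y n))) (V*S) U"
   by (intro wlim_mult_left wlim_mono[OF strong_imp_wlim[OF lim] U(2)])
  ultimately show "wlim (%n. e*(b n * adj (y n))) (V*S) U" by simp
 qed
 show ?thesis
 proof (rule that[OF pi Vb mult z(1)])
  show "z~=0"
  proof
   assume "z=0"
   hence "adj V*V*S=0" using ez by (simp add: assoc)
   thus False using S(2) P0S by (simp add: VV algebra_simps)
  qed
  fix a assume a:"a:A"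
  have "e*(z * a-\<pi> a * z)=(e * z) * a-\<pi> a*(e * z)"
   using e_commute[OF pi(1)[OF a]] by (simp add: right_diff_distrib; metis assoc)
  also have "...=0" unfolding ez using piV[OF a, of S] S(3)[OF a] by (simp add: assoc)
  finally show "z * a=\<pi> a * z"
   using e_mult_zero[of "z * a-\<pi> a * z"] z(1) a pi(1)[OF a] by (simp add: M.w_ins BM AM)
 qed
qed

end

section \<open>Radon-Nikodym arguments: absolute continuity implies normality\<close>

section \<open>Normality of positive functionals\<close>

lemma amp_scaleR:"amp (r .* S)=r .* amp S" by (rule bop_eqI, rule l2_eqI) simp

lemma pos_amp: assumes "pos x" shows "pos (amp x)"
proof -
 obtain R where R:"pos R" "R*R=x" using sqrt_exists[OF assms] by blast
 have "amp x=adj (amp R) * amp R" using pos_adj[OF R(1)] R(2) by (metis amp_adj amp_mult)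
 thus ?thesis by (simp add: pos_adj_mult)
qed

lemma norm_amp_power2:"(norm (amp x et))^2=Re (cinner et (amp (adj x * x) et))"
 by (simp add: amp_mult amp_adj power2_norm_eq_Re_cinner adj_right)

text \<open>One square summable sequence dominates a square summable sequence of square summable sequences.\<close>

lemma amp_flatten:
 fixes v :: "nat=>'k :: complex_hilbert l2seq"
 assumes s:"summable (%k. (norm (v k))^2)"
 obtains w where "!!x k. norm (amp x (v k))<=norm (amp x w)"
proof -
 define F where "F n=(case prod_decode n of (k,j)=>l2_nth (v k) j)" for n
 have Fe:"F (prod_encode (k,j))=l2_nth (v k) j" for k j by (simp add: F_def)
 have "summable (%n. (norm (F n))^2)"
 proof (rule summableI_nonneg_bounded)
  fix m
  have sub:"prod_decode ` {..<m}<={..<m}\<times>{..<m}"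
  proof
   fix p assume "p:prod_decode ` {..<m}"
   then obtain n where n:"n<m" "p=prod_decode n" by blast
   obtain k j where kj:"p=(k,j)" by (cases p)
   hence "n=prod_encode (k,j)" using n by (metis prod_decode_inverse)
   hence "k<=n" "j<=n" using le_prod_encode_1 le_prod_encode_2 by auto
   thus "p:{..<m}\<times>{..<m}" using n(1) unfolding kj by simp
  qed
  have "(SUM n<m. (norm (F n))^2)=(SUM p:prod_decode ` {..<m}. (norm (l2_nth (v (fst p)) (snd p)))^2)"
   by (subst sum.reindex) (auto intro!: inj_on_subset[OF inj_prod_decode] sum.cong simp: F_def split: prod.splits)
  also have "...<=(SUM p:{..<m}\<times>{..<m}. (norm (l2_nth (v (fst p)) (snd p)))^2)"
   by (rule sum_mono2[OF _ sub]) auto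
  also have "...=(SUM k<m. SUM j<m. (norm (l2_nth (v k) j))^2)"
   by (simp add: sum.cartesian_product case_prod_unfold)
  also have "...<=(SUM k<m. (norm (v k))^2)" by (intro sum_mono sum_norm_l2_nth_le) simp
  also have "\<dots> \<le> (\<Sum>k. (norm (v k))\<^sup>2)" by (rule sum_le_suminf[OF s]) auto
  finally show "(SUM n<m. (norm (F n))^2)<=(\<Sum>k. (norm (v k))^2)" .
 qed simp
 hence F:"l2_nth (Abs_l2seq F)=F" by (intro Abs_l2seq_inverse) simp
 show ?thesis
 proof (rule that)
  fix x k
  have "(norm (amp x (v k)))^2<=(norm (amp x (Abs_l2seq F)))^2"
   unfolding l2seq_norm_power2[of "amp x (v k)"]
  proof (rule suminf_le_const[OF l2_nth_summable])
   fix n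
   have "(SUM j<n. (norm (l2_nth (amp x (v k)) j))^2)=(SUM i:(%j. prod_encode (k,j)) ` {..<n}. (norm (l2_nth (amp x (Abs_l2seq F)) i))^2)"
    by (subst sum.reindex) (auto simp: inj_on_def F Fe)
   also have "...<=(norm (amp x (Abs_l2seq F)))^2" by (rule sum_norm_l2_nth_le) simp
   finally show "(SUM j<n. (norm (l2_nth (amp x (v k)) j))^2)<=(norm (amp x (Abs_l2seq F)))^2" .
  qed
  thus "norm (amp x (v k))<=norm (amp x (Abs_l2seq F))" by (rule power2_le_imp_le) simp
 qed
qed

locale posfun = walg M for M :: "'k :: complex_hilbert bop set" +
 fixes g :: "'k bop=>complex"
 assumes g_add:"x:M==>y:M==>g (x + y)=g x + g y"
  and g_scaleC:"x:M==>g (c :* x)=c * g x"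
  and g_pos:"x \<in> M \<Longrightarrow> g (adj x * x) \<in> \<real>\<^sub>\<ge>\<^sub>0"
begin

lemma g_scaleR:"x:M==>g (r .* x) = of_real r * g x"
 using g_scaleC[of x "of_real r"] by (simp add: scaleC_of_real)

lemma g_diff:"x:M==>y:M==>g (x - y)=g x - g y"
 using g_add[of x "(-1) .* y"] g_scaleR[of y "-1"] w_scaleR[of y "-1"] by simp

lemma g_positive: assumes "x:M" "pos x" shows "0<=Re (g x)" "Im (g x)=0"
proof -
 obtain R where R:"pos R" "R*R=x" "R:M" using sqrt_exists[OF assms(2)] assms(1) walg_axioms by blast
 have "g x \<in> \<real>\<^sub>\<ge>\<^sub>0" using g_pos[OF R(3)] R(2) pos_adj[OF R(1)] by simp
 thus "0<=Re (g x)" "Im (g x)=0" by (simp_all add: complex_nonneg_Reals_iff)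
qed

lemma g_mono:"x:M==>y:M==>x[=y==>Re (g x)<=Re (g y)"
 using g_positive(1)[of "y - x"] w_diff[of y x] g_diff[of y x] by simp

lemma g_selfadj: assumes x:"x:M" "adj x=x" shows "Im (g x)=0"
proof -
 obtain C where C:"bnd C x" using bnd_ex by blast
 have p:"pos (C .* 1 - x)" by (rule bnd_ple[OF C x(2)])
 have "Im (g (C .* 1))=0" by (rule g_positive) (use bndD(2)[OF C] in "auto intro!: pos_scaleR w_scaleR w_one")
 thus ?thesis using g_positive(2)[OF _ p] x(1) by (simp add: w_diff w_scaleR w_one g_diff)
qed

lemma g_adj: assumes x:"x:M" shows "g (adj x)=cnj (g x)"
proof -
 define a where "a=(1/2) :* (x + adj x)"
 define b where "b=(- \<i>/2) :* (x - adj x)"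
 have M:"a:M" "b:M" unfolding a_def b_def by (intro w_ins x)+
 have sa:"adj a=a" by (simp add: a_def add.commute)
 have sb:"adj b=b" by (simp add: b_def scaleC_diff_right scaleC_minus_left)
 have two:"(1/2 :: complex) :* (z + z)=z" for z :: "'k bop"
  using scaleC_add_left[of "1/2" "1/2" z] by (simp add: scaleC_add_right scaleC_one)
 have ib:"\<i> :* b=(1/2) :* (x - adj x)" by (simp add: b_def scaleC_scaleC)
 have "a+\<i> :* b=(1/2) :* ((x + adj x)+(x - adj x))" "a+(- \<i>) :* b=(1/2) :* ((x + adj x)-(x - adj x))"
  by (simp_all only: a_def scaleC_minus_left ib scaleC_add_right scaleC_diff_right) simp
 hence xa:"x=a+\<i> :* b" "adj x=a+(- \<i>) :* b" by (simp_all add: two)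
 have ga:"cnj (g a)=g a" "cnj (g b)=g b" using g_selfadj[OF M(1) sa] g_selfadj[OF M(2) sb] by (simp_all add: complex_eq_iff)
 have "g x=g a+\<i> * g b" by (subst xa(1)) (simp only: g_add g_scaleC M w_scaleC)
 moreover have "g (adj x)=g a+(- \<i>) * g b" by (subst xa(2)) (simp only: g_add g_scaleC M w_scaleC)
 ultimately show ?thesis using ga by simp
qed

lemma g_cauchy_schwarz:
 assumes x:"x:M" and y:"y:M"
 shows "(cmod (g (adj x * y)))^2<=Re (g (adj x * x))*Re (g (adj y * y))"
proof (rule form_cauchy_schwarz)
 have p:"0<=Re (g (adj z * z))" if "z:M" for z using g_pos[OF that] by (simp add: complex_nonneg_Reals_iff)
 show "0<=Re (g (adj x * x))" "0<=Re (g (adj y * y))" by (rule p[OF x], rule p[OF y])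
 fix t
 have e:"adj (x + t :* y)*(x + t :* y)=adj x * x+(t :* (adj x * y)+(cnj t :* (adj y * x)+(cnj t * t) :* (adj y * y)))"
  by (simp add: algebra_simps scaleC_scaleC scaleC_add_right)
 have yx:"g (adj y * x)=cnj (g (adj x * y))" using g_adj[of "adj x * y"] x y by (simp add: w_ins)
 let ?G = "g (adj x * y)"
 have q:"g (adj (x + t :* y)*(x + t :* y))=g (adj x * x)+(t * ?G+(cnj t * cnj ?G+(cnj t * t) * g (adj y * y)))"
  unfolding e using x y by (simp add: g_add g_scaleC w_ins yx)
 have "0<=Re (g (adj (x + t :* y)*(x + t :* y)))" by (intro p w_ins x y)
 hence "0<=Re (g (adj x * x))+(Re (t * ?G)+(Re (cnj t * cnj ?G)+Re ((cnj t * t) * g (adj y * y))))"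
  unfolding q by (simp only: plus_complex.sel)
 moreover have "Re (cnj t * cnj ?G)=Re (t * ?G)" by simp
 moreover have "Re ((cnj t * t) * g (adj y * y))=(cmod t)^2*Re (g (adj y * y))"
 proof -
  have "cnj t * t = of_real ((cmod t)^2)" by (metis complex_norm_square mult.commute of_real_power)
  thus ?thesis by (simp del: of_real_power)
 qed
 ultimately show "0<=Re (g (adj x * x))+2*Re (t * ?G)+(cmod t)^2*Re (g (adj y * y))" by linarith
qed

text \<open>A Radon--Nikodym theorem: the form of \<open>g\<close> is given by a positive operator commuting with the
  amplified algebra, whose square root moves \<open>\<eta>\<close> to the representing vector.\<close>

theorem radon_nikodym:
 assumes dom:"!!x. x:M==>Re (g (adj x * x))<=C*(norm (amp x et))^2" and C:"0<=C"
 obtains et' where "!!x. x:M==>g x=cinner et' (amp x et')"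
proof -
 let ?a = "%x. amp x et"
 have al:"clinear_on M ?a" by (simp add: clinear_on_def amp_add amp_scaleC)
 have bd:"cmod (g (adj y * x))<=C * norm (?a y) * norm (?a x)" if "x:M" "y:M" for x y
 proof (rule power2_le_imp_le)
  have "(cmod (g (adj y * x)))^2<=Re (g (adj y * y))*Re (g (adj x * x))" by (rule g_cauchy_schwarz[OF that(2,1)])
  also have "...<=(C*(norm (?a y))^2)*(C*(norm (?a x))^2)"
   using g_pos[OF that(1)] C by (intro mult_mono dom that) (simp_all add: complex_nonneg_Reals_iff)
  finally show "(cmod (g (adj y * x)))^2<=(C * norm (?a y) * norm (?a x))^2" by (simp add: power_mult_distrib power2_eq_square mult.commute mult.left_commute)
 qed (use C in simp)
 let ?cl = "%z. ALL u. (ALL x:M. cinner u (?a x)=0)-->cinner u z=0"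
 have "ALL y:M. EX z. (ALL x:M. cinner z (?a x)=g (adj y * x))&norm z<=C * norm (?a y)&?cl z"
 proof
  fix y assume y:"y:M"
  have fl:"clinear_on M (%x. g (adj y * x))"
   using y by (simp add: clinear_on_def distrib_left g_add g_scaleC w_ins scaleC_complex_def)
  show "EX z. (ALL x:M. cinner z (?a x)=g (adj y * x))&norm z<=C * norm (?a y)&?cl z"
   using riesz_on[OF w_csubspace al fl bd[OF _ y]] C by auto
 qed
 then obtain z where z:"!!y x. y:M==>x:M==>cinner (z y) (?a x)=g (adj y * x)"
  "!!y. y:M==>norm (z y)<=C * norm (?a y)" "!!y. y:M==>?cl (z y)" by metis
 have uniq:"p=q" if "?cl p" "?cl q" "!!x. x:M==>cinner p (?a x)=cinner q (?a x)" for p q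
 proof -
  have h:"ALL x:M. cinner (p - q) (?a x)=0" using that(3) by (simp add: cinner_simps)
  have "cinner (p - q) p=0" "cinner (p - q) q=0" using that(1,2) h by blast+
  hence "cinner (p - q) (p - q)=0" by (simp add: cinner_diff_right)
  thus ?thesis by (simp add: cinner_self_eq_0)
 qed
 have zl:"clinear_on M z"
  unfolding clinear_on_def
 proof (intro conjI ballI allI)
  fix x y assume xy:"x:M" "y:M"
  show "z (x + y)=z x + z y"
   by (rule uniq) (use xy z(3) in "simp_all add: z(1) cinner_simps w_ins distrib_right g_add")
 next
  fix c x assume x:"x:M"
  show "z (c :* x)=c :* z x"
   by (rule uniq) (use x z(3) in "simp_all add: z(1) cinner_simps w_ins g_scaleC")
 qed
 obtain T :: "'k l2seq bop" where T:"!!x. x:M==>T (?a x)=z x" "!!u. (!!x. x:M==>cinner u (?a x)=0)==>T u=0"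
  using bop_extension[OF w_csubspace al zl z(2) C] by blast
 \<comment> \<open>Every vector splits into a limit of orbit vectors and a remainder orthogonal to
   the orbit. \<open>T\<close> kills the remainder, so its properties need checking on the orbit
   only.\<close>
 have dec:"EX p s. (ALL n. s n:M)&(%n. ?a (s n))---->p&(ALL x:M. cinner (v - p) (?a x)=0)" for v
 proof -
  have fl:"clinear_on M (%x. cinner v (?a x))"
   by (simp add: clinear_on_def amp_add amp_scaleC cinner_simps scaleC_complex_def)
  obtain p s where "ALL x:M. cinner p (?a x)=cinner v (?a x)" "ALL n. s n:M" "(%n. ?a (s n))---->p"
   using riesz_on[OF w_csubspace al fl cmod_cinner_le norm_ge_zero] by (elim exE conjE) (rule that; assumption)
  thus ?thesis by (intro exI[of _ p] exI[of _ s]) (simp add: cinner_simps)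
 qed
 have Tcl:"cinner u (T p)=0" if u:"ALL x:M. cinner u (?a x)=0" and p:"(%n. ?a (s n))---->p" "ALL n. s n:M" for u p s
 proof -
  have "(%n. cinner u (T (?a (s n))))---->cinner u (T p)" by (rule tendsto_cinner[OF tendsto_const tendsto_bop[OF p(1)]])
  moreover have "cinner u (T (?a (s n)))=0" for n using T(1) p(2) z(3) u by simp
  ultimately show ?thesis by (simp add: LIMSEQ_const_iff)
 qed
 have Tpos:"pos T"
  unfolding positive_op_def
 proof
  fix v
  obtain p s where ps:"ALL n. s n:M" "(%n. ?a (s n))---->p" "ALL x:M. cinner (v - p) (?a x)=0" using dec by blast
  have "T v=T p" using T(2)[of "v - p"] ps(3) by simp
  moreover have "cinner v (T p)=cinner p (T p)" using Tcl[OF ps(3,2,1)] by (simp add: cinner_simps)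
  moreover have "cinner p (T p) \<in> \<real>\<^sub>\<ge>\<^sub>0"
  proof (rule closed_sequentially[OF closed_nonneg_Reals_complex])
   show "(%n. cinner (?a (s n)) (T (?a (s n))))---->cinner p (T p)" by (intro tendsto_intros ps)
   fix n
   have "cinner (?a (s n)) (T (?a (s n)))=cnj (g (adj (s n) * s n))"
    using ps(1) z(1) T(1) cinner_commute[of "?a (s n)" "z (s n)"] by simp
   thus "cinner (?a (s n)) (T (?a (s n))):nonneg_Reals" using g_pos[of "s n"] ps(1) by (simp add: complex_nonneg_Reals_iff)
  qed
  ultimately show "cinner v (T v):nonneg_Reals" by simp
 qed
 have Tcomm:"T (amp m v)=amp m (T v)" if m:"m:M" for m v
 proof -
  have orth:"ALL x:M. cinner (amp m u) (?a x)=0" if "m:M" "ALL x:M. cinner u (?a x)=0" for u m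
  proof
   fix x assume x:"x:M"
   have "cinner (amp m u) (?a x)=cinner u (?a (adj m * x))" by (simp add: amp_mult amp_adj adj_right)
   thus "cinner (amp m u) (?a x)=0" using that x by (simp add: w_ins)
  qed
  have one:"T (amp m (?a y))=amp m (T (?a y))" if y:"y:M" for y
  proof -
   have my:"m * y:M" by (intro w_ins m y)
   have "z (m * y)=amp m (z y)"
   proof (rule uniq[OF z(3)[OF my]])
    show "?cl (amp m (z y))"
    proof (intro allI impI)
     fix u assume "ALL x:M. cinner u (?a x)=0"
     hence "cinner (amp (adj m) u) (z y)=0" using z(3)[OF y] orth[OF w_adj[OF m]] by blast
     thus "cinner u (amp m (z y))=0" by (simp add: amp_adj adj_left)
    qed
    fix x assume x:"x:M"
    have "cinner (amp m (z y)) (?a x)=cinner (z y) (?a (adj m * x))" by (simp add: amp_mult amp_adj adj_right)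
    thus "cinner (z (m * y)) (?a x)=cinner (amp m (z y)) (?a x)"
     using z(1)[OF my x] z(1)[OF y, of "adj m * x"] x m by (simp add: w_ins assoc)
   qed
   thus ?thesis using T(1)[OF my] T(1)[OF y] by (simp add: amp_mult)
  qed
  obtain p s where ps:"ALL n. s n:M" "(%n. ?a (s n))---->p" "ALL x:M. cinner (v - p) (?a x)=0" using dec by blast
  have "(%n. T (amp m (?a (s n))))---->T (amp m p)" by (intro tendsto_intros ps)
  moreover have "(%n. T (amp m (?a (s n))))---->amp m (T p)" using ps(1) by (simp add: one) (intro tendsto_intros ps)
  ultimately have "T (amp m p)=amp m (T p)" by (rule LIMSEQ_unique)
  moreover have "T (v - p)=0" by (rule T(2)) (use ps(3) in blast)
  moreover have "T (amp m (v - p))=0" by (rule T(2)) (use orth[OF m ps(3)] in blast)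
  ultimately show ?thesis by simp
 qed
 have Tc:"T:commutant (amp ` M)" unfolding commutant_def by (auto intro!: bop_eqI simp: Tcomm)
 have wc:"walg (commutant (amp ` M))"
  by (rule walg_commutant) (auto simp flip: amp_adj intro: w_adj)
 obtain R where R:"pos R" "R*R=T" "R:commutant (amp ` M)" using sqrt_exists[OF Tpos] Tc wc by blast
 show ?thesis
 proof (rule that[of "R et"])
  fix x assume x:"x:M"
  have Rx:"amp x (R et)=R (amp x et)"
  proof -
   have "R * amp x=amp x*R" using R(3) x by (auto simp: commutant_def)
   thus ?thesis by (metis bop_times_apply)
  qed
  have "cinner (R et) (amp x (R et))=cinner (R (R et)) (amp x et)"
   unfolding Rx using pos_adj[OF R(1)] by (metis adj_left)
  also have "R (R et)=z 1" using R(2) T(1)[OF w_one] by (metis amp_one bop_one_apply bop_times_apply)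
  finally show "g x=cinner (R et) (amp x (R et))" using z(1)[OF w_one x] by simp
 qed
qed

lemma posfun_compress: assumes d:"d:M" shows "posfun M (%z. g (adj d * z * d))"
proof
 fix x y c assume x:"x:M"
 show "g (adj d*(c :* x) * d)=c * g (adj d * x * d)" using g_scaleC[of "adj d * x * d"] d x by (simp add: w_ins)
 show "g (adj d * (adj x * x) * d) \<in> \<real>\<^sub>\<ge>\<^sub>0" using g_pos[of "x * d"] d x by (simp add: w_ins assoc)
 assume y:"y:M"
 show "g (adj d*(x + y) * d)=g (adj d * x * d) + g (adj d * y * d)"
  using g_add[of "adj d * x * d" "adj d * y * d"] d x y by (simp add: w_ins algebra_simps)
qed

end

text \<open>The assumption \<open>test\<close> is absolute continuity of \<open>g\<close> with
  respect to the vector functional of \<open>kp\<close>, formulated for sequences of positive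
  contractions.\<close>

locale normal_test = posfun M g for M :: "'k :: complex_hilbert bop set" and g +
 fixes kp :: "'k l2seq"
 assumes test:"!!X. (!!n. X n:M)==>(!!n. pos (X n))==>(!!n. X n[=1) ==>
   (%n. Re (cinner kp (amp (X n) kp)))---->0==>(%n. Re (g (X n)))---->0"
begin

definition ff :: "'k bop=>real" where "ff x=Re (cinner kp (amp x kp))"

lemma ff_simps:"ff (x + y)=ff x + ff y" "ff (r .* x)=r * ff x" "ff (x - y)=ff x - ff y"
 "ff (adj x * x)=(norm (amp x kp))^2" "ff 0=0"
 by (simp_all add: ff_def amp_add amp_diff amp_scaleR amp_zero cinner_simps norm_amp_power2)

lemma ff_nonneg:"pos x==>0<=ff x"
 unfolding ff_def by (rule posD(1)[OF pos_amp])

definition I01 :: "'k bop set" where "I01={x:M. pos x&x[=1}"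

lemma I01_mid: assumes "x:I01" "y:I01" shows "(1/2) .* (x + y):I01"
proof -
 have "1-(1/2) .* (x + y)=(1/2) .* ((1 - x)+(1 - y))" by (rule bop_eqI) (simp add: algebra_simps flip: scaleR_add_left)
 moreover have "pos ..." using assms by (intro pos_scaleR pos_add) (auto simp: I01_def)
 moreover have "pos ((1/2) .* (x + y))" using assms by (intro pos_scaleR pos_add) (auto simp: I01_def)
 ultimately show ?thesis using assms by (simp add: I01_def w_ins)
qed

text \<open>A Hahn decomposition for \<open>g - C ff\<close>. Weak compactness is not enough, since
  \<open>g\<close> is not yet known to be weakly continuous. Among near-maximizers, elements of
  nearly least norm at \<open>kp\<close> are chosen; by convexity and the parallelogram law their
  vectors at \<open>kp\<close> converge, and \<open>test\<close> then yields convergence of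
  \<open>g\<close>.\<close>

lemma maximizer:
 assumes C:"0<=C"
 shows "EX x0:I01. ALL x:I01. Re (g x)-C * ff x<=Re (g x0)-C * ff x0"
proof -
 define h where "h x=Re (g x)-C * ff x" for x
 have hub:"h x<=Re (g 1)" if "x:I01" for x
 proof -
  have "0<=C * ff x" using that by (intro mult_nonneg_nonneg C ff_nonneg) (simp add: I01_def)
  moreover have "Re (g x)<=Re (g 1)" using that w_one by (intro g_mono) (simp_all add: I01_def)
  ultimately show ?thesis by (simp add: h_def)
 qed
 have I0:"0:I01" by (simp add: I01_def w_zero)
 define s where "s=Sup (h ` I01)"
 have hs:"h x<=s" if "x:I01" for x unfolding s_def using hub that by (intro cSup_upper) (auto intro!: bdd_aboveI2)
 define K where "K j={x:I01. s-1 / real (Suc j)<h x}" for j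
 have hmid:"h ((1/2) .* (x + y))=(h x + h y)/2" if "x:I01" "y:I01" for x y
  using that by (simp add: h_def I01_def g_scaleR g_add ff_simps w_ins field_simps)
 have Kne:"K j~={}" for j
 proof -
  have "s-1 / real (Suc j)<s" by simp
  then obtain x where "x:I01" "s-1 / real (Suc j)<h x"
   unfolding s_def using less_cSupE[of _ "h ` I01"] I0 by (smt (verit, best) empty_iff image_iff)
  thus ?thesis by (auto simp: K_def)
 qed
 have Kmid:"(1/2) .* (x + y):K j" if "x:K j" "y:K j" for x y j
  using that I01_mid by (auto simp: K_def hmid)
 have Kanti:"K k<=K j" if "j<=k" for j k
 proof -
  have "1 / real (Suc k)<=1 / real (Suc j)" using that by (intro divide_left_mono) auto
  thus ?thesis by (auto simp: K_def)
 qed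
 define n where "n x=norm (amp x kp)" for x
 define m where "m j=Inf (n ` K j)" for j
 have bb:"bdd_below (n ` X)" for X by (rule bdd_belowI2[of _ 0]) (simp add: n_def)
 have ml:"m j<=n x" if "x:K j" for x j unfolding m_def by (rule cInf_lower[OF _ bb]) (use that in simp)
 have m0:"0<=m j" for j unfolding m_def by (rule cInf_greatest) (use Kne in "auto simp: n_def")
 have nb:"n x<=norm kp" if "x:I01" for x
  using bndD(1)[OF bnd_amp[OF positive_bnd1[of x]], of kp] that by (simp add: n_def I01_def)
 have mb:"m j<=norm kp" for j
 proof -
  obtain x where "x:K j" using Kne by blast
  thus ?thesis using ml[of x j] nb[of x] by (auto simp: K_def)
 qed
 have minc:"incseq m" unfolding incseq_def m_def using Kanti Kne by (auto intro!: cInf_superset_mono bb)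
 obtain mi where mi:"m---->mi" by (rule incseq_convergent[OF minc]) (use mb in auto)
 have "EX x:K j. n x<m j+1 / real (Suc j)" for j
 proof -
  have "Inf (n ` K j)<m j+1 / real (Suc j)" by (simp add: m_def)
  thus ?thesis using cInf_less_iff[of "n ` K j"] Kne bb by auto
 qed
 then obtain x where x:"!!j. x j:K j" "!!j. n (x j)<m j+1 / real (Suc j)" by metis
 have xI:"x j:I01" for j using x(1)[of j] by (simp add: K_def)
 have xM:"x j:M" "pos (x j)" "x j[=1" "bnd 1 (x j)" for j using xI[of j] positive_bnd1 by (auto simp: I01_def)
 have inv0:"(%j. 1 / real (Suc j))---->0" using LIMSEQ_inverse_real_of_nat by (simp add: inverse_eq_divide)
 have nlim:"(%j. n (x j))---->mi"
 proof (rule tendsto_sandwich[OF _ _ mi])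
  show "\<forall>\<^sub>F j in sequentially. m j<=n (x j)" using ml x(1) by (intro always_eventually allI) blast
  show "\<forall>\<^sub>F j in sequentially. n (x j)<=m j+1 / real (Suc j)" using x(2) by (intro always_eventually allI less_imp_le)
  show "(%j. m j+1 / real (Suc j))---->mi" using tendsto_add[OF mi inv0] by simp
 qed
 have "Cauchy (%j. amp (x j) kp)"
 proof (rule metric_CauchyI)
  fix r :: real assume r:"0<r"
  have ev:"0<r^2/9" using r by simp
  have "\<forall>\<^sub>F j in sequentially. (n (x j))^2<mi^2 + r^2/9"
   by (rule order_tendstoD(2)[OF tendsto_power[OF nlim]]) (use ev in simp)
  moreover have "\<forall>\<^sub>F j in sequentially. mi^2 - r^2/9<(m j)^2"
   by (rule order_tendstoD(1)[OF tendsto_power[OF mi]]) (use ev in simp)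
  ultimately obtain J where J:"!!j. J<=j==>(n (x j))^2<mi^2 + r^2/9" "mi^2 - r^2/9<(m J)^2"
   using eventually_sequentially by (metis (mono_tags, lifting) eventually_conj le_refl)
  have "dist (amp (x j) kp) (amp (x k) kp)<r" if jk:"J<=j" "J<=k" for j k
  proof (rule power2_less_imp_less)
   have mid:"(1/2) .* (x j + x k):K J" using x(1) Kanti jk by (intro Kmid) blast+
   have "(m J)^2<=(n ((1/2) .* (x j + x k)))^2" by (intro power_mono ml mid m0)
   moreover have "(dist (amp (x j) kp) (amp (x k) kp))^2=2*(n (x j))^2+2*(n (x k))^2-4*(n ((1/2) .* (x j + x k)))^2"
    unfolding dist_norm n_def by (subst parallelogram_half) (simp only: amp_add amp_scaleR bop_plus_apply bop_scaleR_apply)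
   ultimately show "(dist (amp (x j) kp) (amp (x k) kp))^2<r^2" using J(1)[OF jk(1)] J(1)[OF jk(2)] J(2) ev by argo
  qed (use r in simp)
  thus "EX J. ALL j>=J. ALL k>=J. dist (amp (x j) kp) (amp (x k) kp)<r" by blast
 qed
 then obtain v where v:"(%j. amp (x j) kp)---->v" using Cauchy_convergent convergent_def by blast
 obtain U :: "nat filter" where U:"ultra U" "U<=sequentially" using ultra_sequentially by blast
 obtain x0 where x0:"x0:M" "wlim x x0 U"
  using w_ultra_limit[OF U(1), of x 1] xM by (auto intro: always_eventually)
 have x0p:"pos x0"
  by (rule pos_limit[where F = U and T = x]) (use x0(2) ultraD[OF U(1)] xM in "auto simp: wlim_def intro: always_eventually")
 have x01:"x0[=1"
  by (rule pos_limit[where F = U and T = "%j. 1 - x j"])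
   (use wlim_diff[OF wlim_const x0(2), of 1] ultraD[OF U(1)] xM in "auto simp: wlim_def intro: always_eventually")
 have x0I:"x0:I01" using x0 x0p x01 by (simp add: I01_def)
 have "amp x0 kp=v"
 proof (rule cinner_ext)
  fix y
  have "wlim (%j. amp (x j)) (amp x0) U" by (rule wlim_amp[OF x0(2)]) (use xM in "auto intro: always_eventually")
  hence "((%j. cinner y (amp (x j) kp))--->cinner y (amp x0 kp)) U" by (simp add: wlim_def)
  moreover have "((%j. cinner y (amp (x j) kp))--->cinner y v) U"
   by (rule tendsto_mono[OF U(2)]) (intro tendsto_intros v)
  ultimately show "cinner y (amp x0 kp)=cinner y v" using tendsto_unique[OF ultraD[OF U(1)]] by blast
 qed
 hence av:"(%j. amp (x j) kp)---->amp x0 kp" using v by simp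
 define d where "d j=x j - x0" for j
 have dM:"d j:M" "bnd 2 (d j)" for j
  using bnd_diff[OF xM(4)[of j] positive_bnd1[OF x0p x01]] xM x0(1) by (auto simp: d_def w_diff)
 have ddM:"adj (d j) * d j:M" for j by (intro w_ins dM)
 \<comment> \<open>\<open>d j\<close> is a difference of two contractions, so a quarter of
   \<open>adj (d j) * d j\<close> is a positive contraction and \<open>test\<close> applies.\<close>
 have "(%j. Re (g ((1/4) .* (adj (d j) * d j))))---->0"
 proof (rule test)
  fix j
  show "(1/4) .* (adj (d j) * d j):M" by (intro w_scaleR ddM)
  show "pos ((1/4) .* (adj (d j) * d j))" by (intro pos_scaleR pos_adj_mult) simp
  show "(1/4) .* (adj (d j) * d j)[=1" using ple_scaleR[OF bnd_adj_mult_le[OF dM(2)], of "1/4" j] by simp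
 next
  have "(%j. norm (amp (x j) kp - amp x0 kp))---->0" using tendsto_norm_zero[OF LIM_zero[OF av]] .
  hence l0:"(%j. (1/4)*(norm (amp (x j) kp - amp x0 kp))\<^sup>2)---->(1/4)*0\<^sup>2"
   by (intro tendsto_mult tendsto_const tendsto_power)
  have eq:"Re (cinner kp (amp ((1/4) .* (adj (d j) * d j)) kp))=(1/4)*(norm (amp (x j) kp - amp x0 kp))\<^sup>2" for j
   unfolding ff_def[symmetric] ff_simps by (simp add: d_def amp_diff)
  show "(%j. Re (cinner kp (amp ((1/4) .* (adj (d j) * d j)) kp)))---->0"
   unfolding eq by (rule tendsto_eq_rhs[OF l0]) simp
 qed
 hence gdd:"(%j. Re (g (adj (d j) * d j)))---->0"
  using tendsto_mult_left[of "%j. Re (g ((1/4) .* (adj (d j) * d j)))" 0 sequentially 4] ddM by (simp add: g_scaleR)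
 have "(%j. g (d j))---->0"
 proof (rule Lim_null_comparison)
  have "(%j. sqrt (Re (g (adj 1*1))*Re (g (adj (d j) * d j))))---->sqrt (Re (g (adj 1*1))*0)" by (intro tendsto_intros gdd)
  thus "(%j. sqrt (Re (g (adj 1*1))*Re (g (adj (d j) * d j))))---->0" by simp
  have "norm (g (d j))<=sqrt (Re (g (adj 1*1))*Re (g (adj (d j) * d j)))" for j
   by (rule real_le_rsqrt) (use g_cauchy_schwarz[OF w_one dM(1)[of j]] in simp)
  thus "\<forall>\<^sub>F j in sequentially. norm (g (d j))<=sqrt (Re (g (adj 1*1))*Re (g (adj (d j) * d j)))" by simp
 qed
 hence "(%j. Re (g (x j))-Re (g x0))---->0"
  using tendsto_Re[of "%j. g (d j)" 0 sequentially] xM x0(1) by (simp add: d_def g_diff)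
 hence gl:"(%j. Re (g (x j)))---->Re (g x0)" by (rule LIM_zero_cancel)
 have fl:"(%j. ff (x j))---->ff x0" unfolding ff_def by (intro tendsto_intros av)
 have hl:"(%j. h (x j))---->h x0" unfolding h_def by (intro tendsto_intros gl fl)
 have "s<=h x0"
 proof (rule tendsto_le[OF sequentially_bot hl])
  show "(%j. s-1 / real (Suc j))---->s" using tendsto_diff[OF tendsto_const inv0, of s] by simp
  show "\<forall>\<^sub>F j in sequentially. s-1 / real (Suc j)<=h (x j)" using x(1) by (auto simp: K_def intro!: always_eventually less_imp_le)
 qed
 thus ?thesis using hs x0I unfolding h_def by (intro bexI[of _ x0]) (auto intro: order_trans)
qed

text \<open>Off the maximizer x0 the functional \<open>g\<close> is dominated by
  \<open>C ff\<close>: with y the root of 1 - x0, a small multiple of y x^* x y may be added to x0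
  without leaving \<open>I01\<close>, and this cannot raise \<open>g - C ff\<close>.\<close>

lemma compression:
 assumes C:"0<C"
 shows "EX x0 y. x0:I01&y:M&pos y&y[=1&y * y=1 - x0&C * ff x0<=Re (g 1) &
   (ALL x:M. Re (g (adj y*(adj x * x) * y))<=C*(norm (amp x (amp y kp)))^2)"
proof -
 obtain x0 where x0:"x0:I01" "!!x. x:I01==>Re (g x)-C * ff x<=Re (g x0)-C * ff x0"
  using maximizer[of C] C by auto
 have x0M:"x0:M" "pos x0" "x0[=1" using x0(1) by (auto simp: I01_def)
 obtain y where y:"pos y" "y * y=1 - x0" "y:M"
  using sqrt_exists[OF x0M(3)] walg_axioms x0M(1) w_diff[OF w_one] by blast
 have ya:"adj y=y" by (rule pos_adj[OF y(1)])
 have yb:"bnd 1 y" by (rule le_imp_bnd) (use y x0M ya in simp_all)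
 have "0:I01" "g 0=0" using g_scaleR[OF w_zero, of 0] by (simp_all add: I01_def w_zero)
 hence "C * ff x0<=Re (g x0)" using x0(2)[of 0] by (simp add: ff_simps)
 also have "...<=Re (g 1)" by (rule g_mono) (use x0M w_one in auto)
 finally have c:"C * ff x0<=Re (g 1)" .
 have "Re (g (adj y*(adj x * x) * y))<=C*(norm (amp x (amp y kp)))^2" if x:"x:M" for x
 proof -
  obtain K0 where K0:"bnd K0 x" using bnd_ex by blast
  define K where "K=K0+1"
  have K:"0<K" "bnd K x" using K0 bndD(2)[OF K0] bnd_mono[OF K0, of K] by (auto simp: K_def)
  define W where "W=adj y*(adj x * x) * y"
  have WM:"W:M" unfolding W_def by (intro w_ins x y)
  have Wp:"pos W" unfolding W_def by (intro pos_conj pos_adj_mult)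
  have "W[=adj y*(K^2 .* 1) * y" unfolding W_def by (rule ple_conj[OF bnd_adj_mult_le[OF K(2)]])
  hence W0:"W[=K^2 .* (1 - x0)" using y(2) ya by simp
  hence W1:"(1/K^2) .* W[=1 - x0" using ple_scaleR[OF W0, of "1/K^2"] K(1) by simp
  have "x0+(1/K^2) .* W:I01"
   using W1 pos_add[OF x0M(2) pos_scaleR[OF Wp, of "1/K^2"]] WM x0M by (simp add: I01_def w_ins diff_diff_eq)
  from x0(2)[OF this] have "(1/K^2)*Re (g W)<=(1/K^2)*(C * ff W)"
   using WM x0M by (simp add: g_add g_scaleR w_ins ff_simps algebra_simps)
  moreover have "0<1/K^2" using K(1) by simp
  ultimately have "Re (g W)<=C * ff W" using mult_le_cancel_left_pos by blast
  moreover have "ff W=(norm (amp x (amp y kp)))^2" using ff_simps(4)[of "x * y"] by (simp add: W_def assoc amp_mult)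
  ultimately show ?thesis by (simp add: W_def)
 qed
 thus ?thesis using x0(1) y c bnd_ple[OF yb ya] by (intro exI[of _ x0] exI[of _ y]) simp
qed

text \<open>As C grows, the bound of \<open>C * ff x0\<close> by \<open>g 1\<close> sends
  \<open>ff x0\<close> to zero, hence \<open>g x0\<close> to zero by \<open>test\<close>; and (1 -
  y)^2 is at most 1 - y^2 = x0.\<close>

lemma near_compression:
 assumes r:"0<r"
 shows "EX y C. y:M&pos y&Re (g ((1 - y)*(1 - y)))<r&0<=C &
   (ALL x:M. Re (g (adj y*(adj x * x) * y))<=C*(norm (amp x (amp y kp)))^2)"
proof -
 have "EX x0 y. x0:I01&y:M&pos y&y[=1&y * y=1 - x0&real (Suc n) * ff x0<=Re (g 1) &
   (ALL x:M. Re (g (adj y*(adj x * x) * y))<=real (Suc n)*(norm (amp x (amp y kp)))^2)" for n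
  by (rule compression) simp
 then obtain X Y where XY:"!!n. X n:I01" "!!n. Y n:M" "!!n. pos (Y n)" "!!n. Y n[=1" "!!n. Y n*Y n=1-X n"
  "!!n. real (Suc n) * ff (X n)<=Re (g 1)" "!!n x. x:M==>Re (g (adj (Y n)*(adj x * x)*Y n))<=real (Suc n)*(norm (amp x (amp (Y n) kp)))^2"
  by metis
 have XM:"X n:M" "pos (X n)" "X n[=1" for n using XY(1)[of n] by (auto simp: I01_def)
 have "(%n. Re (g (X n)))---->0"
 proof (rule test[OF XM])
  have up:"ff (X n)<=Re (g 1) * inverse (real (Suc n))" for n using XY(6)[of n] by (simp add: field_simps)
  have "(%n. ff (X n))---->0"
  proof (rule tendsto_sandwich[OF _ _ tendsto_const])
   show "(%n. Re (g 1) * inverse (real (Suc n)))---->0" using tendsto_mult_left[OF LIMSEQ_inverse_real_of_nat, of "Re (g 1)"] by simp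
  qed (use up ff_nonneg XM in "auto intro!: always_eventually")
  thus "(%n. Re (cinner kp (amp (X n) kp)))---->0" by (simp add: ff_def)
 qed
 hence "\<forall>\<^sub>F n in sequentially. Re (g (X n))<r" using order_tendstoD(2) r by blast
 then obtain n where n:"Re (g (X n))<r" by (meson eventually_happens' sequentially_bot)
 have "(1-Y n)*(1-Y n)[=X n"
 proof -
  have "Y n*Y n[=Y n"
  proof (rule pleI)
   have a:"adj (Y n)=Y n" by (rule pos_adj[OF XY(3)])
   show "adj (Y n*Y n)=Y n*Y n" "adj (Y n)=Y n" by (simp_all add: a)
   fix x
   show "Re (cinner x ((Y n*Y n) x))<=Re (cinner x (Y n x))"
    using positive_norm_sq_le[OF XY(3)[of n], of 1 x] XY(4)[of n] Re_cinner_adj_mult[of x "Y n"] a by simp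
  qed
  hence "pos (2 .* (Y n-Y n*Y n))" by (rule pos_scaleR) simp
  moreover have "X n-(1-Y n)*(1-Y n)=2 .* (Y n-Y n*Y n)"
   using XY(5)[of n] by (simp add: algebra_simps scaleR_2)
  ultimately show ?thesis by simp
 qed
 hence "Re (g ((1-Y n)*(1-Y n)))<=Re (g (X n))" by (intro g_mono w_ins XY XM)
 thus ?thesis using n XY(2,3,7) by (intro exI[of _ "Y n"] exI[of _ "real (Suc n)"]) auto
qed

text \<open>The seminorm of \<open>g\<close> is dominated by a vector because of the telescoping sum of the increments of
  the compressions, each of which is dominated by \<open>\<kappa>\<close>.\<close>

theorem vector_functional:
 obtains kp' where "!!x. x:M==>g x=cinner kp' (amp x kp')"
proof -
 define N where "N x=sqrt (Re (g (adj x * x)))" for x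
 have gp:"0<=Re (g (adj x * x))" if "x:M" for x using g_pos[OF that] by (simp add: complex_nonneg_Reals_iff)
 have Ntri:"N (x + y)<=N x+N y" if xy:"x:M" "y:M" for x y
 proof (unfold N_def, rule real_le_lsqrt)
  have yx:"g (adj y * x)=cnj (g (adj x * y))" using g_adj[of "adj x * y"] xy by (simp add: w_ins)
  have "g (adj (x + y)*(x + y))=g (adj x * x) + g (adj y * y)+(g (adj x * y) + g (adj y * x))"
   using xy by (simp add: algebra_simps g_add w_ins)
  hence "Re (g (adj (x + y)*(x + y)))=Re (g (adj x * x))+Re (g (adj y * y))+2*Re (g (adj x * y))" by (simp add: yx)
  moreover have "cmod (g (adj x * y))<=sqrt (Re (g (adj x * x))*Re (g (adj y * y)))"
   by (rule real_le_rsqrt[OF g_cauchy_schwarz[OF xy]])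
  ultimately show "Re (g (adj (x + y)*(x + y)))<=(sqrt (Re (g (adj x * x))) + sqrt (Re (g (adj y * y))))^2"
   using complex_Re_le_cmod[of "g (adj x * y)"] gp[OF xy(1)] gp[OF xy(2)] by (simp add: power2_sum real_sqrt_mult)
 qed (use gp xy in simp)
 have N_nonneg:"0<=N x" if "x:M" for x unfolding N_def using gp[OF that] by (rule real_sqrt_ge_zero)
 \<comment> \<open>The base 1/8 leaves room: the increments have seminorm at most 2/8^k, so the
   vectors rescaled by 2^k in \<open>v\<close> below remain square summable, while the rescaling
   makes the telescoping sum geometric.\<close>
 define ep :: "nat=>real" where "ep k=((1/8) ^ k)^2" for k
 have "ALL k. EX y C. y:M&pos y&Re (g ((1 - y)*(1 - y)))<ep k&0<=C &
   (ALL x:M. Re (g (adj y*(adj x * x) * y))<=C*(norm (amp x (amp y kp)))^2)"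
  by (intro allI near_compression) (simp add: ep_def)
 then obtain Y C where Y:"!!k. Y k:M" "!!k. pos (Y k)" "!!k. Re (g ((1-Y k)*(1-Y k)))<ep k" "!!k. 0<=C k"
   "!!k x. x:M==>Re (g (adj (Y k)*(adj x * x)*Y k))<=C k*(norm (amp x (amp (Y k) kp)))^2" by metis
 have Ya:"adj (Y k)=Y k" for k by (rule pos_adj[OF Y(2)])
 have NY:"N (1-Y k)<=(1/8) ^ k" for k
 proof -
  have "N (1-Y k)<=sqrt (ep k)" unfolding N_def using Y(3)[of k] by (simp add: Ya)
  also have "...=(1/8) ^ k" unfolding ep_def by (rule real_sqrt_unique) simp_all
  finally show ?thesis .
 qed
 define d where "d k=Y (Suc k)-Y k" for k
 have dM:"d k:M" for k unfolding d_def by (intro w_ins Y)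
 have N0:"N (- x)=N x" for x by (simp add: N_def)
 have Nd:"N (d k)<=2*(1/8) ^ k" for k
 proof -
  have "d k=(1-Y k) +-(1-Y (Suc k))" by (simp add: d_def)
  hence "N (d k)<=N (1-Y k)+N (1-Y (Suc k))" using Ntri[of "1-Y k" "- (1-Y (Suc k))"] N0[of "1-Y (Suc k)"]
   by (simp add: w_ins Y)
  also have "...<=(1/8) ^ k+(1/8) ^ Suc k" by (intro add_mono NY)
  also have "...<=2*(1/8) ^ k" by simp
  finally show ?thesis .
 qed
 have rep:"EX et. ALL x:M. N (x*D)=norm (amp x et)" if D:"D:M" and dom:"!!x. x:M==>N (x*D)<=c * norm (amp x zt)" and c:"0<=c" for D c zt
 proof -
  interpret P: posfun M "%z. g (adj D * z*D)" by (rule posfun_compress[OF D])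
  have NN:"(N (x*D))^2=Re (g (adj D*(adj x * x)*D))" if "x:M" for x
   unfolding N_def using gp[of "x*D"] that D by (simp add: w_ins assoc)
  have dd:"Re (g (adj D*(adj x * x)*D))<=c^2*(norm (amp x zt))^2" if x:"x:M" for x
   unfolding NN[OF x, symmetric] power_mult_distrib[symmetric] by (intro power_mono dom x N_nonneg w_ins D)
  obtain et where e:"!!x. x:M==>g (adj D * x*D)=cinner et (amp x et)"
   by (rule P.radon_nikodym[OF dd zero_le_power2]) ((assumption | (rule that; assumption))+)
  have "N (x*D)=norm (amp x et)" if x:"x:M" for x
  proof (rule power2_eq_imp_eq)
   show "(N (x*D))^2=(norm (amp x et))^2" unfolding NN[OF x] norm_amp_power2 using e[of "adj x * x"] x by (simp add: w_ins)
  qed (intro N_nonneg norm_ge_zero w_ins x D)+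
  thus ?thesis by blast
 qed
 have NYd:"N (x*Y k)<=sqrt (C k) * norm (amp x (amp (Y k) kp))" if x:"x:M" for x k
  unfolding N_def using Y(5)[OF x, of k] Y(4)[of k] by (simp add: real_le_lsqrt real_sqrt_mult power_mult_distrib assoc real_le_rsqrt sqrt_le_D)
 have repd:"EX et. ALL x:M. N (x * d k)=norm (amp x et)" for k
 proof -
  define v where "v i=(if i=(0::nat) then amp (Y (Suc k)) kp else if i=1 then amp (Y k) kp else 0)" for i
  have "summable (%i. (norm (v i))^2)" by (rule summable_finite[of "{0,1}"]) (auto simp: v_def)
  then obtain w where w:"!!x i. norm (amp x (v i))<=norm (amp x w)" by (rule amp_flatten) (rule that)
  show ?thesis
  proof (rule rep[OF dM])
   show "0<=sqrt (C (Suc k)) + sqrt (C k)" using Y(4) by simp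
   fix x assume x:"x:M"
   have "x * d k=x*Y (Suc k) +-(x*Y k)" by (simp add: d_def algebra_simps)
   hence "N (x * d k)<=N (x*Y (Suc k))+N (x*Y k)" using Ntri[of "x*Y (Suc k)" "- (x*Y k)"] N0[of "x*Y k"] x Y(1)
    by (simp add: w_ins)
   also have "...<=sqrt (C (Suc k)) * norm (amp x w) + sqrt (C k) * norm (amp x w)"
   proof (intro add_mono order_trans[OF NYd[OF x]] mult_left_mono)
    show "norm (amp x (amp (Y (Suc k)) kp))<=norm (amp x w)" using w[of x 0] by (simp add: v_def)
    show "norm (amp x (amp (Y k) kp))<=norm (amp x w)" using w[of x 1] by (simp add: v_def)
   qed (use Y(4) in simp_all)
   finally show "N (x * d k)<=(sqrt (C (Suc k)) + sqrt (C k)) * norm (amp x w)" by (simp add: distrib_right)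
  qed
 qed
 then obtain et where et: "!!k x. x:M==>N (x * d k)=norm (amp x (et k))" by metis
 define v where "v k=(if k=0 then amp (Y 0) kp else (2 ^ k) .* et (k-1))" for k
 have "summable (%k. (norm (v (Suc k)))^2)"
 proof (rule summable_comparison_test')
  show "summable (%k. 16*(1/16 :: real) ^ k)" by (intro summable_mult summable_geometric) simp
  fix k
  have "norm (et k)<=2*(1/8) ^ k" using Nd[of k] et[OF w_one, of k] by (simp add: amp_one)
  hence "norm (v (Suc k))<=2 ^ Suc k*(2*(1/8) ^ k)" by (simp add: v_def)
  also have "...=4*(1/4) ^ k" proof -
   have "2 ^ Suc k*(2*(1/8 :: real) ^ k)=4*(2 ^ k*(1/8) ^ k)" by simp
   also have "...=4*(2*(1/8)) ^ k" by (simp only: power_mult_distrib)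
   finally show ?thesis by simp
  qed
  finally have "(norm (v (Suc k)))^2<=(4*(1/4) ^ k)^2" by (intro power_mono) simp_all
  also have "...=16*(1/16) ^ k" by (simp add: power_mult_distrib power2_eq_square power_divide flip: power_mult_distrib)
  finally show "norm ((norm (v (Suc k)))^2)<=16*(1/16) ^ k" by simp
 qed
 hence "summable (%k. (norm (v k))^2)" by (rule summable_Suc_iff[THEN iffD1])
 then obtain w where w:"!!x i. norm (amp x (v i))<=norm (amp x w)" by (rule amp_flatten) (rule that)
 have main:"N x<=(sqrt (C 0)+1) * norm (amp x w)" if x:"x:M" for x
 proof -
  obtain K where K:"bnd K x" using bnd_ex by blast
  have tail:"N (x*(1-Y n))<=K*(1/8) ^ n" for n
  proof -
   have "adj (1-Y n)*(adj x * x)*(1-Y n)[=adj (1-Y n)*(K^2 .* 1)*(1-Y n)"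
    by (rule ple_conj[OF bnd_adj_mult_le[OF K]])
   hence "Re (g (adj (1-Y n)*(adj x * x)*(1-Y n)))<=Re (g (adj (1-Y n)*(K^2 .* 1)*(1-Y n)))"
    by (intro g_mono w_ins x Y)
   also have "...=K^2*Re (g (adj (1-Y n)*(1-Y n)))" using g_scaleR[of "adj (1-Y n)*(1-Y n)" "K^2"] Y(1)
    by (simp add: w_ins del: adj_diff)
   finally have "N (x*(1-Y n))<=K*N (1-Y n)"
    unfolding N_def using bndD(2)[OF K] by (simp add: assoc real_sqrt_mult real_le_lsqrt del: adj_diff) (metis real_sqrt_le_mono real_sqrt_mult real_sqrt_abs abs_of_nonneg)
   also have "...<=K*(1/8) ^ n" by (intro mult_left_mono NY bndD(2)[OF K])
   finally show ?thesis .
  qed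
  have Nn:"N (x*Y n)<=N (x*Y 0)+(SUM k<n. N (x * d k))" for n
  proof (induction n)
   case (Suc n)
   have "x*Y (Suc n)=x*Y n + x * d n" by (simp add: d_def algebra_simps)
   hence "N (x*Y (Suc n))<=N (x*Y n)+N (x * d n)" using Ntri[of "x*Y n" "x * d n"] x Y(1) dM by (simp add: w_ins)
   thus ?case using Suc by simp
  qed simp
  have dk:"N (x * d k)<=(1/2) ^ Suc k * norm (amp x w)" for k
  proof -
   have "2 ^ Suc k*N (x * d k)=norm (amp x (v (Suc k)))" unfolding et[OF x] by (simp add: v_def)
   also have "...<=norm (amp x w)" by (rule w)
   finally show ?thesis by (simp add: field_simps power_divide)
  qed
  have "N x<=(sqrt (C 0)+1) * norm (amp x w)+K*(1/8) ^ n" for n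
  proof -
   have "x=x*Y n + x*(1-Y n)" by (simp add: algebra_simps)
   hence "N x<=N (x*Y n)+N (x*(1-Y n))" using Ntri[of "x*Y n" "x*(1-Y n)"] x Y(1) by (simp add: w_ins)
   also have "...<=(N (x*Y 0)+(SUM k<n. N (x * d k)))+K*(1/8) ^ n" by (intro add_mono Nn tail)
   also have "N (x*Y 0)<=sqrt (C 0) * norm (amp x w)"
   proof (rule order_trans[OF NYd[OF x] mult_left_mono])
    show "norm (amp x (amp (Y 0) kp))<=norm (amp x w)" using w[of x 0] by (simp add: v_def)
   qed (use Y(4) in simp)
   also have "(SUM k<n. N (x * d k))<=(SUM k<n. (1/2) ^ Suc k * norm (amp x w))" by (intro sum_mono dk)
   also have "...=(SUM k<n. (1/2) ^ Suc k) * norm (amp x w)" by (simp add: sum_distrib_right)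
   also have "(SUM k<n. (1/2 :: real) ^ Suc k)<=1"
    using sum_le_suminf[OF sums_summable[OF power_half_series], of "{..<n}"] sums_unique[OF power_half_series] by simp
   finally show ?thesis by (simp add: algebra_simps mult_right_mono)
  qed
  hence "EX m. ALL n>=m. N x<=(sqrt (C 0)+1) * norm (amp x w)+K*(1/8) ^ n" by blast
  moreover have "(%n. (sqrt (C 0)+1) * norm (amp x w)+K*(1/8) ^ n)---->(sqrt (C 0)+1) * norm (amp x w)+K*0"
   by (intro tendsto_intros LIMSEQ_realpow_zero) simp_all
  ultimately show ?thesis using LIMSEQ_le_const by fastforce
 qed
 show ?thesis
 proof (rule radon_nikodym)
  show "0<=(sqrt (C 0)+1)^2" by simp
  fix x assume x:"x:M"
  have "(N x)^2<=((sqrt (C 0)+1) * norm (amp x w))^2" by (intro power_mono main N_nonneg x)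
  thus "Re (g (adj x * x))<=(sqrt (C 0)+1)^2*(norm (amp x w))^2" using gp[OF x] by (simp add: N_def power_mult_distrib)
 qed (rule that)
qed

end

text \<open>Each positive functional given by a vector of the amplified target passes the test, so
  \<open>vector_functional\<close> makes it a vector functional on the source; polarization recovers
  all sigma-weak functionals.\<close>

theorem normal_mapI:
 fixes M :: "'k :: complex_hilbert bop set" and Ph :: "'k bop=>'h :: complex_hilbert bop"
 assumes M:"walg M" and lin:"linear_map_on M Ph" and pos:"!!x. x:M==>pos (Ph (adj x * x))"
  and test:"!!X zt. (!!n. X n:M)==>(!!n. pos (X n))==>(!!n. X n[=1) ==>
   (%n. Re (cinner kp (amp (X n) kp)))---->0==>(%n. Re (cinner zt (Ph (X n) zt)))---->0"
 shows "normal_on M Ph"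
proof -
 interpret M: walg M by (rule M)
 have la:"Ph (x + y)=Ph x+Ph y" if "x:M" "y:M" for x y using lin that by (simp add: linear_map_on_def)
 have lc:"Ph (c :* x)=c :* Ph x" if "x:M" for c x using lin that by (simp add: linear_map_on_def)
 have lr:"Ph (r .* x)=r .* Ph x" if "x:M" for r x using lc[OF that, of "of_real r"] by (simp add: scaleC_of_real)
 have ld:"Ph (x - y)=Ph x-Ph y" if "x:M" "y:M" for x y
  using la[of x "(-1) .* y"] lr[of y "-1"] M.w_scaleR[of y "-1"] that by simp
 have pp:"pos (Ph x)" if x:"x:M" "pos x" for x
 proof -
  obtain R where R:"pos R" "R*R=x" "R:M" using sqrt_exists[OF x(2)] x(1) M by blast
  thus ?thesis using pos[OF R(3)] pos_adj[OF R(1)] by simp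
 qed
 have rep:"EX kp'. ALL x:M. cinner zt (amp (Ph x) zt)=cinner kp' (amp x kp')" for zt
 proof -
  interpret N: normal_test M "%x. cinner zt (amp (Ph x) zt)" kp
  proof (intro normal_test.intro posfun.intro posfun_axioms.intro normal_test_axioms.intro M)
   fix x y c assume x:"x:M"
   show "cinner zt (amp (Ph (c :* x)) zt)=c * cinner zt (amp (Ph x) zt)" by (simp add: lc[OF x] amp_scaleC cinner_simps)
   show "cinner zt (amp (Ph (adj x * x)) zt) \<in> \<real>\<^sub>\<ge>\<^sub>0" using pos_amp[OF pos[OF x]] by (simp add: positive_op_def)
   assume y:"y:M"
   show "cinner zt (amp (Ph (x + y)) zt)=cinner zt (amp (Ph x) zt) + cinner zt (amp (Ph y) zt)"
    by (simp add: la[OF x y] amp_add cinner_simps)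
  next
   fix X assume X:"!!n. X n:M" "!!n. pos (X n)" "!!n. X n[=1" "(%n. Re (cinner kp (amp (X n) kp)))---->0"
   obtain C where C:"bnd C (Ph 1)" using bnd_ex by blast
   have Xp:"pos (Ph (X n))" for n by (rule pp[OF X(1,2)])
   have "Ph (X n)[=C .* 1" for n
   proof (rule ple_trans)
    show "Ph (X n)[=Ph 1" using pp[of "1-X n"] X(1)[of n] X(3)[of n] by (simp add: ld M.w_ins)
    show "Ph 1[=C .* 1" by (rule bnd_ple[OF C pos_adj[OF pp[OF M.w_one pos_1]]])
   qed
   hence Xb:"bnd C (Ph (X n))" for n using positive_bnd[OF Xp] bndD(2)[OF C] by blast
   have "wlim (%n. Ph (X n)) 0 sequentially"
    unfolding wlim_def
   proof (intro allI)
    fix x y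
    have b:"(cmod (cinner x (Ph (X n) y)))^2<=Re (cinner x (Ph (X n) x))*Re (cinner y (Ph (X n) y))" for n
     by (rule pos_cauchy_schwarz[OF Xp])
    have "(%n. sqrt (Re (cinner x (Ph (X n) x))*Re (cinner y (Ph (X n) y))))---->sqrt (0*0)"
     by (intro tendsto_intros test X)
    hence "(%n. cinner x (Ph (X n) y))---->0"
     using real_le_rsqrt[OF b] by (rule_tac Lim_null_comparison[where g = "%n. sqrt (Re (cinner x (Ph (X n) x))*Re (cinner y (Ph (X n) y)))"]) (auto intro: always_eventually)
    thus "(%n. cinner x (Ph (X n) y))---->cinner x (apply_op 0 y)" by simp
   qed
   hence "wlim (%n. amp (Ph (X n))) (amp 0) sequentially" by (rule wlim_amp) (use Xb in "auto intro: always_eventually")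
   hence "(%n. cinner zt (amp (Ph (X n)) zt))---->0" by (simp add: wlim_def amp_zero)
   thus "(%n. Re (cinner zt (amp (Ph (X n)) zt)))---->0" using tendsto_Re by fastforce
  qed
  show ?thesis by (rule N.vector_functional) blast
 qed
 let ?X = "subtopology sigma_weak M"
 have cont:"continuous_map ?X euclidean (%x. cinner zt (amp (Ph x) zt))" for zt
 proof -
  obtain kp' where k:"ALL x:M. cinner zt (amp (Ph x) zt)=cinner kp' (amp x kp')" using rep by blast
  have "continuous_map ?X euclidean (sigma_weak_functional kp' kp')"
   by (rule continuous_map_from_subtopology[OF continuous_sigma_weak_functional])
  thus ?thesis by (rule continuous_map_eq) (simp add: k sigma_weak_functional_amp)
 qed
 have cm:"continuous_map ?X euclidean (%x. c * f x)" if "continuous_map ?X euclidean f" for c :: complex and f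
  using that by (simp add: continuous_map_atin tendsto_mult_left)
 show ?thesis
  unfolding normal_on_iff
 proof (intro allI)
  fix xi et :: "'h l2seq"
  let ?q = "%zt x. cinner zt (amp (Ph x) zt)"
  have pol:"sigma_weak_functional xi et (Ph x)=(1/4)*(?q (xi+et) x - ?q (xi-et) x-\<i> * ?q (xi+\<i> :* et) x+\<i> * ?q (xi-\<i> :* et) x)" for x
   by (simp add: sigma_weak_functional_amp cinner_simps algebra_simps)
  show "continuous_map ?X euclidean (%x. sigma_weak_functional xi et (Ph x))"
   unfolding pol by (intro cm continuous_map_add continuous_map_diff cont)
 qed
qed

section \<open>Normal functionals, faithful representations and standard forms\<close>

section \<open>Normal functionals and faithful representations\<close>

lemma unit_of_walg: assumes "walg N" shows "unit_of N=1"
proof -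
 interpret walg N by (rule assms)
 show ?thesis unfolding unit_of_def
 proof (rule the_equality)
  fix p assume "p:N&(ALL x:N. p * x=x&x * p=x)"
  hence "p*1=1" using w_one by blast
  thus "p=1" by simp
 qed (simp add: w_one)
qed

lemma amp_flatten2:
 fixes v w :: "'k :: complex_hilbert l2seq"
 obtains u where "!!x. norm (amp x v)<=norm (amp x u)" "!!x. norm (amp x w)<=norm (amp x u)"
proof -
 define f where "f i=(if i=(0::nat) then v else if i=1 then w else 0)" for i
 have "summable (%i. (norm (f i))^2)" by (rule summable_finite[of "{0,1}"]) (auto simp: f_def)
 then obtain u where u:"!!x i. norm (amp x (f i))<=norm (amp x u)" by (rule amp_flatten) (rule that)
 show ?thesis by (rule that[of u]) (use u[of _ 0] u[of _ 1] in "simp_all add: f_def")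
qed

text \<open>A basic neighbourhood of zero involves finitely many functionals, each bounded through
  one vector of the amplification; \<open>amp_flatten2\<close> merges the vectors.\<close>

lemma sigma_weak_neighbourhood:
 fixes W :: "'k :: complex_hilbert bop set"
 assumes "openin sigma_weak W" "0:W"
 shows "EX kp d. 0<d&(ALL T. norm (amp T kp)<d-->T:W)"
proof -
 have "generate_topology_on {sigma_weak_functional xi et -` U |xi et U. open U} W"
  using assms(1) unfolding sigma_weak_def openin_topology_generated_by_iff .
 thus ?thesis using assms(2)
 proof (induction rule: generate_topology_on.induct)
  case (Int a b)
  then obtain k1 d1 k2 d2 where k:"0<d1" "!!T. norm (amp T k1)<d1==>T:a" "0<d2" "!!T. norm (amp T k2)<d2==>T:b"
   by blast
  obtain u where u:"!!x. norm (amp x k1)<=norm (amp x u)" "!!x. norm (amp x k2)<=norm (amp x u)"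
   using amp_flatten2[of k1 k2] by metis
  show ?case
  proof (intro exI[of _ u] exI[of _ "min d1 d2"] conjI allI impI)
   fix T assume "norm (amp T u)<min d1 d2"
   thus "T:a\<inter>b" using k(2)[of T] k(4)[of T] u[of T] by auto
  qed (use k in simp)
 next
  case (UN K)
  thus ?case by (meson Union_iff)
 next
  case (Basis s)
  then obtain xi et U where s:"s=sigma_weak_functional xi et -` U" "open U" "sigma_weak_functional xi et 0:U" by blast
  hence "0:U" by (simp add: sigma_weak_functional_amp amp_zero)
  then obtain r where r:"0<r" "!!z. cmod z<r==>z:U" using s(2) open_contains_ball[of U] by (force simp: dist_norm)
  show ?case
  proof (intro exI[of _ et] exI[of _ "r/(norm xi+1)"] conjI allI impI)
   show "0<r/(norm xi+1)" using r by (simp add: add_nonneg_pos)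
   fix T assume T:"norm (amp T et)<r/(norm xi+1)"
   have "cmod (cinner xi (amp T et))<=norm xi * norm (amp T et)" by (rule cmod_cinner_le)
   also have "...<=(norm xi+1) * norm (amp T et)" by (intro mult_right_mono) auto
   also have "...<r" using T by (simp add: pos_less_divide_eq add_nonneg_pos mult.commute)
   finally show "T:s" using r(2) by (simp add: s(1) sigma_weak_functional_amp)
  qed
 qed simp
qed

text \<open>Continuity at zero bounds \<open>g\<close> by a multiple of the seminorm at
  \<open>kp\<close>. A positive contraction X satisfies X^2 at most X, so the hypothesis of
  \<open>vector_functional\<close> holds.\<close>

lemma (in posfun) normal_imp_vector_functional:
 assumes cont:"continuous_map (subtopology sigma_weak M) euclidean g"
 obtains kp where "!!x. x:M==>g x=cinner kp (amp x kp)"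
proof -
 have g0:"g 0=0" using g_scaleC[OF w_zero, of 0] by (simp add: scaleC_zero_left)
 have "openin (subtopology sigma_weak M) {x:M. g x:ball 0 1}"
  using openin_continuous_map_preimage[OF cont, of "ball 0 1"] by simp
 then obtain W where W:"openin sigma_weak W" "{x:M. g x:ball 0 1}=W\<inter>M" by (auto simp: openin_subtopology)
 moreover have "0:{x:M. g x:ball 0 1}" using g0 w_zero by simp
 ultimately have "0:W" by blast
 then obtain kp d where d:"0<d" "!!T. norm (amp T kp)<d==>T:W" using sigma_weak_neighbourhood[OF W(1)] by blast
 have small:"cmod (g x)<1" if "x:M" "norm (amp x kp)<d" for x using d(2)[OF that(2)] that(1) W(2) by auto
 have bound:"cmod (g x)<=norm (amp x kp) / d" if x:"x:M" for x
 proof (rule ccontr)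
  assume "~ ?thesis"
  hence n:"norm (amp x kp) / d<cmod (g x)" by simp
  hence pos:"0<cmod (g x)" using d(1) by (meson divide_nonneg_pos le_less_trans norm_ge_zero)
  have "cmod (g ((1 / cmod (g x)) .* x))<1"
   using n d(1) pos by (intro small w_scaleR x) (simp add: amp_scaleR field_simps)
  thus False using pos by (simp add: g_scaleR[OF x] norm_divide norm_mult)
 qed
 interpret normal_test M g kp
 proof
  fix X assume X:"!!n. X n:M" "!!n. pos (X n)" "!!n. X n[=1" and lim:"(%n. Re (cinner kp (amp (X n) kp)))---->0"
  have b:"(norm (amp (X n) kp))^2<=Re (cinner kp (amp (X n) kp))" for n
  proof -
   have "amp (X n)[=1 .* 1" using pos_amp[OF X(3)[of n]] by (simp add: amp_diff amp_one)
   thus ?thesis using positive_norm_sq_le[OF pos_amp[OF X(2)[of n]], of 1 kp] by simp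
  qed
  have "(%n. sqrt (Re (cinner kp (amp (X n) kp))) / d)---->sqrt 0 / d" by (intro tendsto_intros lim) (use d in simp)
  hence l:"(%n. sqrt (Re (cinner kp (amp (X n) kp))) / d)---->0" by simp
  have "\<bar>Re (g (X n))\<bar><=sqrt (Re (cinner kp (amp (X n) kp))) / d" for n
   using abs_Re_le_cmod[of "g (X n)"] bound[OF X(1)[of n]] divide_right_mono[OF real_le_rsqrt[OF b[of n]], of d] d(1) by linarith
  thus "(%n. Re (g (X n)))---->0" by (rule_tac Lim_null_comparison[OF _ l]) simp
 qed
 show ?thesis by (rule vector_functional) (rule that)
qed

text \<open>A weak ultrafilter limit of counterexamples would be positive and annihilate
  \<open>kp\<close>, hence be zero by \<open>f\<close>, although its value at \<open>kp'\<close>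
  stays at least \<open>r\<close>.\<close>

lemma compare_states:
 assumes M:"walg M" and f:"!!x. x:M==>amp x kp=0==>x=0" and r:"0<r"
 shows "EX d>0. ALL X:M. pos X-->X[=1-->Re (cinner kp (amp X kp))<d-->Re (cinner kp' (amp X kp'))<r"
proof (rule ccontr)
 interpret M: walg M by (rule M)
 assume no:"~ ?thesis"
 have "EX X:M. pos X&X[=1&Re (cinner kp (amp X kp))<1 / real (Suc n)&r<=Re (cinner kp' (amp X kp'))" for n
 proof -
  have "0<1 / real (Suc n)" by simp
  thus ?thesis using no by (meson not_le)
 qed
 then obtain X where X:"!!n. X n:M" "!!n. pos (X n)" "!!n. X n[=1" "!!n. Re (cinner kp (amp (X n) kp))<1 / real (Suc n)"
  "!!n. r<=Re (cinner kp' (amp (X n) kp'))" by metis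
 have Xb:"bnd 1 (X n)" for n by (rule positive_bnd1[OF X(2,3)])
 obtain U :: "nat filter" where U:"ultra U" "U<=sequentially" using ultra_sequentially by blast
 obtain L where L:"L:M" "wlim X L U" using M.w_ultra_limit[OF U(1), of X 1] X(1) Xb by (auto intro: always_eventually)
 have Lp:"pos L"
  by (rule pos_limit[where F = U and T = X]) (use L(2) ultraD[OF U(1)] X(2) in "auto simp: wlim_def intro: always_eventually")
 have aw:"wlim (%n. amp (X n)) (amp L) U" by (rule wlim_amp[OF L(2)]) (use Xb in "auto intro: always_eventually")
 have lim:"((%n. Re (cinner k (amp (X n) k)))--->Re (cinner k (amp L k))) U" for k
  using aw unfolding wlim_def by (intro tendsto_Re) blast
 have "Re (cinner kp (amp L kp))<=0"
 proof (rule tendsto_le[OF ultraD[OF U(1)] _ lim])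
  show "((%n. inverse (real (Suc n)))--->0) U" by (rule tendsto_mono[OF U(2) LIMSEQ_inverse_real_of_nat])
  show "\<forall>\<^sub>F n in U. Re (cinner kp (amp (X n) kp))<=inverse (real (Suc n))"
   using X(4) by (intro always_eventually allI) (simp add: inverse_eq_divide less_imp_le)
 qed
 hence "amp L kp=0" using positive_zero_vec[OF pos_amp[OF Lp], of kp] posD(1)[OF pos_amp[OF Lp], of kp] by linarith
 hence "L=0" by (rule f[OF L(1)])
 moreover have "r<=Re (cinner kp' (amp L kp'))"
  by (rule tendsto_lowerbound[OF lim _ ultraD[OF U(1)]]) (use X(5) in "auto intro: always_eventually")
 ultimately show False using r by (simp add: amp_zero)
qed

lemma normal_wlim:
 assumes n:"normal_on N Ph" and w:"wlim T L F" and e:"\<forall>\<^sub>F i in F. T i:N" and b:"\<forall>\<^sub>F i in F. bnd C (T i)" and L:"L:N"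
 shows "wlim (%i. Ph (T i)) (Ph L) F"
 unfolding wlim_def
proof (intro allI)
 fix x y
 have c:"continuous_map (subtopology sigma_weak N) euclidean (%T. sigma_weak_functional (l2_single 0 x) (l2_single 0 y) (Ph T))"
  using n unfolding normal_on_iff by blast
 have "((%i. sigma_weak_functional (l2_single 0 x) (l2_single 0 y) (Ph (T i)))--->sigma_weak_functional (l2_single 0 x) (l2_single 0 y) (Ph L)) F"
  by (rule continuous_map_tendsto_sigma_weak[OF c wlim_limitin_sigma_weak[OF w b] e L])
 thus "((%i. cinner x (Ph (T i) y))--->cinner x (Ph L y)) F"
  by (simp add: sigma_weak_functional_amp cinner_l2_single_left)
qed

locale star_rep = walg M for M :: "'k :: complex_hilbert bop set" +
 fixes rho :: "'k bop=>'h :: complex_hilbert bop"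
 assumes hom:"normal_star_hom M rho" and inj:"inj_on rho M" and rho_one:"rho 1=1"
begin

lemma rho_add:"x:M==>y:M==>rho (x + y)=rho x+rho y"
 and rho_scaleC:"x:M==>rho (c :* x)=c :* rho x"
 and rho_mult:"x:M==>y:M==>rho (x * y)=rho x*rho y"
 and rho_adj:"x:M==>rho (adj x)=adj (rho x)"
 and rho_normal:"normal_on M rho"
 using hom by (auto simp: normal_star_hom_def linear_map_on_def)

lemma rho_scaleR:"x:M==>rho (r .* x)=r .* rho x"
 using rho_scaleC[of x "of_real r"] by (simp add: scaleC_of_real)

lemma rho_zero:"rho 0=0" using rho_scaleR[OF w_one, of 0] by simp

lemma rho_diff:"x:M==>y:M==>rho (x - y)=rho x-rho y"
 using rho_add[of x "(-1) .* y"] rho_scaleR[of y "-1"] w_scaleR[of y "-1"] by simp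

lemma rho_eq_0:"x:M==>rho x=0==>x=0"
 using inj_onD[OF inj, of x 0] rho_zero w_zero by simp

lemma rho_positive: assumes "x:M" "pos x" shows "pos (rho x)"
proof -
 obtain R where R:"pos R" "R*R=x" "R:M" using sqrt_exists[OF assms(2)] assms(1) walg_axioms by blast
 have "rho x=adj (rho R)*rho R" using R(3) rho_mult[OF R(3,3)] rho_adj[OF R(3)] pos_adj[OF R(1)] R(2) by simp
 thus ?thesis by (simp add: pos_adj_mult)
qed

text \<open>The image of the nonpositive spectral part of \<open>x\<close> is both positive and
  negative, so it vanishes, and \<open>rho\<close> is injective.\<close>

lemma positive_rho: assumes x:"x:M" and p:"pos (rho x)" shows "pos x"
proof -
 have sa:"adj x=x" using pos_adj[OF p] inj_onD[OF inj, of "adj x" x] x by (simp add: rho_adj w_adj)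
 obtain D where D:"projection D" "x*D=D * x" "pos (- (x*D))" "pos (x*(1-D))" "D:M"
  using spectral_cut[OF sa] x walg_axioms by blast
 have xD:"x*D:M" by (intro w_mult x D)
 have "x*D=adj D * x*D" using D(2) projectionD[OF D(1)] by (metis assoc)
 hence "rho (x*D)=adj (rho D)*rho x*rho D" using x D(5) by (simp add: rho_mult rho_adj w_ins)
 hence "pos (rho (x*D))" using pos_conj[OF p] by simp
 moreover have "pos (- rho (x*D))"
  using rho_positive[OF _ D(3)] rho_diff[OF w_zero xD] xD by (simp add: rho_zero w_uminus)
 ultimately have "rho (x*D)=0" by (rule pos_antisym)
 hence "x*D=0" by (rule rho_eq_0[OF xD])
 thus ?thesis using D(4) by (simp add: algebra_simps)
qed

lemma rho_bnd_iff: assumes x:"x:M" shows "bnd C (rho x)\<longleftrightarrow>bnd C x"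
proof (cases "0<=C")
 case True
 have m:"C^2 .* 1 - adj x * x:M" by (intro w_ins x)
 have "rho (C^2 .* 1 - adj x * x)=C^2 .* 1 - adj (rho x)*rho x"
  using x by (simp add: rho_diff rho_scaleR rho_mult rho_adj rho_one w_ins)
 hence "pos (C^2 .* 1 - adj (rho x)*rho x)\<longleftrightarrow>pos (C^2 .* 1 - adj x * x)"
  using rho_positive[OF m] positive_rho[OF m] by auto
 thus ?thesis using True le_imp_bnd bnd_adj_mult_le by metis
qed (simp add: bnd_def)

text \<open>\<open>rho_bnd_iff\<close> carries bounds back, so a bounded net in the image lifts to a
  bounded net; an ultrafilter limit of the lift is mapped by normality to the given limit.\<close>

lemma walg_image: assumes N:"walg N" "N<=M" shows "walg (rho ` N)"
proof -
 interpret N: walg N by (rule N)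
 have NM:"x:M" if "x:N" for x using N(2) that by blast
 show ?thesis
 proof
  show "1:rho ` N" using rho_one N.w_one by force
  show "X+Y:rho ` N" if XY:"X:rho ` N" "Y:rho ` N" for X Y
   using XY NM rho_add N.w_add by (auto simp flip: rho_add)
  show "X*Y:rho ` N" if XY:"X:rho ` N" "Y:rho ` N" for X Y
   using XY NM rho_mult N.w_mult by (auto simp flip: rho_mult)
  show "c :* X:rho ` N" if X:"X:rho ` N" for X c
   using X NM N.w_scaleC by (auto simp flip: rho_scaleC)
  show "adj X:rho ` N" if X:"X:rho ` N" for X
   using X NM N.w_adj by (auto simp flip: rho_adj)
  show "wclosed (rho ` N)"
   unfolding wclosed_def
  proof (intro allI impI)
   fix F C T assume F:"F~=bot" "\<forall>\<^sub>F S in F. S:rho ` N&bnd C S" "wlim (%S. S) T F"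
   obtain U where U:"U<=F" "ultra U" using ex_ultra[OF F(1)] by blast
   have ev:"\<forall>\<^sub>F S in U. S:rho ` N&bnd C S" by (rule filter_leD[OF U(1) F(2)])
   define r where "r S=inv_into N rho S" for S
   have rN:"r S:N" "rho (r S)=S" if "S:rho ` N" for S using that by (auto simp: r_def inv_into_into f_inv_into_f)
   have e1:"\<forall>\<^sub>F S in U. r S:N" by (rule eventually_mono[OF ev]) (use rN in blast)
   have e2:"\<forall>\<^sub>F S in U. bnd C (r S)"
    by (rule eventually_mono[OF ev]) (use rN rho_bnd_iff NM in metis)
   obtain L where L:"L:N" "wlim r L U" using N.w_ultra_limit[OF U(2) e1 e2] by blast
   have w:"wlim (%S. rho (r S)) (rho L) U"
    by (rule normal_wlim[OF rho_normal L(2) _ e2 NM[OF L(1)]]) (rule eventually_mono[OF e1 NM])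
   have "wlim (%S. S) (rho L) U"
    unfolding wlim_def
   proof (intro allI)
    fix x y
    show "((%S. cinner x (apply_op S y))--->cinner x (rho L y)) U"
     by (rule Lim_transform_eventually[OF w[unfolded wlim_def, rule_format]]) (rule eventually_mono[OF ev], use rN in auto)
   qed
   hence "T=rho L" using wlim_unique[OF wlim_mono[OF F(3) U(1)]] ultraD[OF U(2)] by blast
   thus "T:rho ` N" using L(1) by simp
  qed
 qed
qed

lemma t3alg_image: assumes N:"t3alg N" "N<=M" shows "t3alg (rho ` N)"
proof -
 interpret N: t3alg N by (rule N)
 have NM:"x:M" if "x:N" for x using N(2) that by blast
 have eq:"rho x=rho y\<longleftrightarrow>x=y" if "x:N" "y:N" for x y using inj_onD[OF inj, of x y] NM that by auto
 have pr:"projection (rho x)\<longleftrightarrow>projection x" if x:"x:N" for x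
  unfolding projection_def rho_mult[OF NM[OF x] NM[OF x], symmetric] rho_adj[OF NM[OF x], symmetric]
  using eq x N.w_mult N.w_adj by simp
 show ?thesis
 proof (intro t3alg.intro walg_image[OF N.walg_axioms N(2)] t3alg_axioms.intro)
  show "type_III (rho ` N)"
   unfolding type_III_def
  proof (intro allI impI)
   fix p assume fp:"finite_projection (rho ` N) p"
   then obtain q where q:"q:N" "p=rho q" by (auto simp: finite_projection_def)
   have "finite_projection N q"
    unfolding finite_projection_def
   proof (intro conjI ballI impI)
    show "projection q" using fp pr[OF q(1)] q(2) by (simp add: finite_projection_def)
    fix v assume v:"v:N" "adj v * v=q&q*(v * adj v)=v * adj v"
    have h:"adj (rho v)*rho v=rho (adj v * v)" "rho v * adj (rho v)=rho (v * adj v)" "rho q*rho (v * adj v)=rho (q*(v * adj v))"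
     using v(1) q(1) NM by (simp_all add: rho_mult rho_adj w_ins)
    have "rho (v * adj v)=p"
     using fp[unfolded finite_projection_def] v h q imageI[OF v(1), of rho] by metis
    thus "v * adj v=q" using eq[of "v * adj v" q] v(1) q by (simp add: N.w_ins)
   qed (rule q(1))
   hence "q=0" using N.t3 by (simp add: type_III_def)
   thus "p=0" by (simp add: q(2) rho_zero)
  qed
  show "sigma_finite (rho ` N)"
   unfolding sigma_finite_def
  proof (intro allI impI)
   fix S assume S:"S<=rho ` N" "(ALL p:S. projection p&p~=0)&(ALL p:S. ALL q:S. p~=q-->p * q=0)"
   define S' where "S'={x:N. rho x:S}"
   have "countable S'"
   proof (rule N.sf[unfolded sigma_finite_def, rule_format])
    show "S'<=N" by (auto simp: S'_def)
    show "(ALL p:S'. projection p&p~=0)&(ALL p:S'. ALL q:S'. p~=q-->p * q=0)"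
    proof (intro conjI ballI impI)
     fix p assume p:"p:S'"
     show "projection p" using p S(2) pr by (auto simp: S'_def)
     show "p~=0" using p S(2) rho_zero by (auto simp: S'_def)
     fix q assume q:"q:S'" "p~=q"
     have "rho p*rho q=0" using p q S(2) eq by (auto simp: S'_def)
     hence "rho (p * q)=0" using p q NM by (simp add: S'_def rho_mult)
     thus "p * q=0" using p q NM by (auto simp: S'_def intro!: rho_eq_0 w_mult)
    qed
   qed
   moreover have "S=rho ` S'" using S(1) by (auto simp: S'_def)
   ultimately show "countable S" by simp
  qed
 qed
qed

definition img :: "('k bop=>'k bop)=>'h bop=>'h bop" where
 "img F X=rho (F (inv_into M rho X))"

lemma img_rho:"x:M==>img F (rho x)=rho (F x)" by (simp add: img_def inj)

lemma expectation_image: assumes F:"expectation M N F" shows "expectation (rho ` M) (rho ` N) (img F)"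
proof -
 interpret F: expectation M N F by (rule F)
 note FM = F.BM[OF F.E_in]
 show ?thesis
 proof (rule expectation.intro)
  show "walg (rho ` M)" "walg (rho ` N)" using F.BM by (auto intro!: walg_image F.Mw F.Bw)
  show "b:rho ` M" if "b:rho ` N" for b using that F.BM by blast
  show "img F x:rho ` N" if "x:rho ` M" for x using that F.E_in by (auto simp: img_rho)
  show "img F b=b" if "b:rho ` N" for b using that F.BM F.E_fix by (auto simp: img_rho)
  show "img F (x + y)=img F x + img F y" if "x:rho ` M" "y:rho ` M" for x y
   using that by (auto simp: img_rho F.E_add FM rho_add w_add simp flip: rho_add)
  show "img F (c :* x)=c :* img F x" if "x:rho ` M" for x c
   using that by (auto simp: img_rho F.E_scaleC FM w_scaleC simp flip: rho_scaleC)
  show "pos (img F x)" if xp:"x:rho ` M" "pos x" for x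
  proof -
   obtain x' where x': "x':M" "x=rho x'" using xp(1) by blast
   thus ?thesis using xp(2) rho_positive[OF FM F.E_pos[OF _ positive_rho]] by (simp add: img_rho)
  qed
  show "img F (a * x * b)=a * img F x * b" if abx:"a:rho ` N" "b:rho ` N" "x:rho ` M" for a b x
  proof -
   obtain a' b' x' where h:"a':N" "a=rho a'" "b':N" "b=rho b'" "x':M" "x=rho x'" using abx by blast
   have "a * x * b=rho (a' * x' * b')" using h F.BM by (simp add: rho_mult w_ins)
   hence "img F (a * x * b)=rho (F (a' * x' * b'))" using img_rho h F.BM by (simp only: w_mult)
   also have "...=a * img F x * b" using h F.BM FM by (simp add: img_rho w_ins F.E_bimodule rho_mult)
   finally show ?thesis .
  qed
  show "x=0" if x:"x:rho ` M" "img F (adj x * x)=0" for x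
  proof -
   obtain x' where h:"x':M" "x=rho x'" using x(1) by blast
   have "adj x * x=rho (adj x' * x')" using h by (simp add: rho_mult rho_adj w_ins)
   hence "rho (F (adj x' * x'))=0" using x(2) h by (simp add: img_rho w_ins)
   hence "F (adj x' * x')=0" using h by (intro rho_eq_0 FM w_ins) auto
   thus ?thesis using F.E_faithful[OF h(1)] h(2) rho_zero by simp
  qed
 qed
qed

end

text \<open>The projection T onto the closed orbit of \<open>xi\<close> commutes with N, so 1 - T =
  J S J with S in N. As J fixes \<open>xi\<close>, S annihilates it and is zero by \<open>f\<close>;
  thus \<open>xi\<close> is cyclic. Conjugation by J carries cyclicity over to the
  commutant.\<close>

lemma standard_form_cyclic_separating:
 fixes N :: "'h :: complex_hilbert bop set"
 assumes st:"standard_form N J P" and xi:"xi:P" and f:"!!S. S:N==>S xi=0==>S=0"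
 shows "(!!x. x:N==>cinner u (x xi)=0)==>u=0"
  and "(!!T. T:commutant N==>cinner u (apply_op T xi)=0)==>u=0"
proof -
 note sf = st[unfolded standard_form_def]
 interpret N: walg N using sf by (intro von_neumann_walg) auto
 have Jadd:"J (x + y)=J x+J y" and Jsc:"J (c :* x)=cnj c :* J x" and Jn:"norm (J x)=norm x" and JJ:"J (J x)=x" for x y c
  using sf by auto
 have comm:"commutant N={T :: 'h bop. EX S:N. ALL x. T x=J (S (J x))}" using sf by blast
 have Jxi:"J xi=xi" using sf xi by blast
 have J0:"J 0=0" using Jn[of 0] by simp
 have cyc:"u=0" if u:"!!x. x:N==>cinner u (x xi)=0" for u
 proof -
  let ?a = "%x :: 'h bop. x xi"
  have al:"clinear_on N ?a" by (simp add: clinear_on_def)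
  have "EX T :: 'h bop. bnd 1 T&(ALL x:N. T (?a x)=?a x)&(ALL u. (ALL x:N. cinner u (?a x)=0)-->T u=0)"
   by (rule bop_extension[OF N.w_csubspace al al]) simp_all
  then obtain T :: "'h bop" where T:"!!x. x:N==>T (x xi)=x xi" "!!u. ALL x:N. cinner u (x xi)=0==>T u=0" by blast
  have "T (m v)=m (T v)" if m:"m:N" for m v
  proof -
   have fl:"clinear_on N (%x. cinner v (?a x))" by (simp add: clinear_on_def cinner_simps scaleC_complex_def)
   obtain p s where ps:"ALL x:N. cinner p (?a x)=cinner v (?a x)" "ALL n. s n:N" "(%n. ?a (s n))---->p"
    using riesz_on[OF N.w_csubspace al fl cmod_cinner_le norm_ge_zero] by (elim exE conjE) (rule that; assumption)
   have orth:"ALL x:N. cinner (v - p) (?a x)=0" using ps(1) by (simp add: cinner_simps)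
   have "ALL x:N. cinner (m (v - p)) (?a x)=0"
   proof
    fix x assume x:"x:N"
    have "cinner (m (v - p)) (?a x)=cinner (v - p) (?a (adj m * x))" by (simp only: bop_times_apply adj_right)
    thus "cinner (m (v - p)) (?a x)=0" using orth x m N.w_ins by metis
   qed
   hence 1:"T (m (v - p))=0" by (rule T(2))
   have Ts:"T (?a (s n))=?a (s n)" "T (m (?a (s n)))=m (?a (s n))" for n
    using T(1)[of "s n"] T(1)[OF N.w_mult[OF m, of "s n"]] ps(2) by simp_all
   have "(%n. ?a (s n))---->T p" using tendsto_bop[OF ps(3), of T] unfolding Ts .
   hence Tp:"T p=p" by (rule LIMSEQ_unique[OF _ ps(3)])
   have "(%n. m (?a (s n)))---->T (m p)" using tendsto_bop[OF tendsto_bop[OF ps(3)], of T m] unfolding Ts .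
   hence "T (m p)=m p" by (rule LIMSEQ_unique[OF _ tendsto_bop[OF ps(3)]])
   thus ?thesis using 1 T(2)[OF orth] Tp by simp
  qed
  hence "1-T:commutant N" unfolding commutant_def by (auto intro!: bop_eqI)
  then obtain S where S:"S:N" "!!x. (1-T) x=J (S (J x))" unfolding comm by blast
  have "J (S xi)=0" using S(2)[of xi] T(1)[OF N.w_one] Jxi by simp
  hence "S xi=0" using JJ J0 by metis
  hence "S=0" by (rule f[OF S(1)])
  hence "(1-T) u=0" using S(2)[of u] J0 by simp
  moreover have "T u=0" using T(2) u by blast
  ultimately show "u=0" by simp
 qed
 thus "(!!x. x:N==>cinner u (x xi)=0)==>u=0" .
 have JRe:"Re (cinner (J x) (J y))=Re (cinner x y)" for x y
  unfolding Re_cinner dot_norm by (simp add: Jn flip: Jadd)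
 have Jc:"cinner (J x) (J y)=cnj (cinner x y)" for x y
 proof -
  have "J (\<i> :* y)=- (\<i> :* J y)" by (simp add: Jsc scaleC_minus_left)
  hence "Im (cinner (J x) (J y))=- Im (cinner x y)"
   using JRe[of x "\<i> :* y"] by (simp add: Re_cinner_imag cinner_minus_right)
  thus ?thesis using JRe[of x y] by (simp add: complex_eq_iff)
 qed
 assume u:"!!T. T:commutant N==>cinner u (apply_op T xi)=0"
 have "J u=0"
 proof (rule cyc)
  fix S assume S:"S:N"
  obtain C where C:"bnd C S" using bnd_ex by blast
  have "EX T :: 'h bop. ALL x. T x=J (S (J x))"
   by (rule bop_from_fun[where C = C]) (use bndD(1)[OF C] Jn in "simp_all add: Jadd Jsc", metis)
  then obtain T :: "'h bop" where T:"!!x. T x=J (S (J x))" by blast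
  hence "T:commutant N" unfolding comm using S by blast
  hence "cinner u (J (S xi))=0" using u[of T] T[of xi] Jxi by simp
  hence "cnj (cinner (J u) (S xi))=0" using Jc[of "J u" "S xi"] JJ by simp
  thus "cinner (J u) (S xi)=0" by simp
 qed
 thus "u=0" using JJ J0 by metis
qed

text \<open>The pair \<open>phi\<close>, \<open>xi\<close> consists of the state and the vector that
  witness \<open>jones_projection\<close>; \<open>EA\<close> is some expectation onto A.\<close>

locale setting =
 fixes M A B :: "'k :: complex_hilbert bop set" and E EA :: "'k bop=>'k bop"
  and rho :: "'k bop=>'h :: complex_hilbert bop" and J :: "'h=>'h" and P :: "'h set" and e :: "'h bop"
  and phi :: "'k bop=>complex" and xi :: 'h
 assumes vM:"von_neumann_algebra M" "1:M"
  and vA:"von_neumann_algebra A" "A<=M" "1:A" "sigma_finite A" "type_III A" "cond_expectation M A EA"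
  and vB:"von_neumann_algebra B" "B<=M" "1:B" "sigma_finite B" "type_III B" "cond_expectation M B E"
  and std:"standard_representation M rho J P"
  and phi:"faithful_normal_state M phi" "!!x. x:M==>phi (E x)=phi x" "xi:P" "!!x. x:M==>phi x=cinner xi (rho x xi)"
  and e_rho:"!!x. x:M==>e (rho x xi)=rho (E x) xi"
begin

lemma walgs:"walg M" "walg A" "walg B" using vM vA vB von_neumann_walg by auto

lemma expectationI: assumes "cond_expectation M N F" "walg N" "N<=M" shows "expectation M N F"
proof -
 note c = assms(1)[unfolded cond_expectation_def linear_map_on_def]
 show ?thesis by (rule expectation.intro) (use c assms(2,3) walgs(1) in "auto simp: image_subset_iff")
qed

sublocale EK: expectation M B E using expectationI vB walgs by blast
sublocale EAK: expectation M A EA using expectationI vA walgs by blast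
sublocale TAk: t3alg A using walgs vA by (intro t3alg.intro t3alg_axioms.intro)
sublocale TBk: t3alg B using walgs vB by (intro t3alg.intro t3alg_axioms.intro)
sublocale R: star_rep M rho
 using std unit_of_walg[OF walgs(1)] walgs(1)
 by (intro star_rep.intro star_rep_axioms.intro) (auto simp: standard_representation_def)

lemma phi_lin:"x:M==>y:M==>phi (x + y)=phi x+phi y" "x:M==>phi (c :* x)=c*phi x"
 using phi(1) by (auto simp: faithful_normal_state_def linear_map_on_def scaleC_complex_def)

sublocale P: posfun M phi
 by unfold_locales (use phi(1) in "auto simp: phi_lin faithful_normal_state_def")

lemma phi_faithful: assumes "x:M" "phi (adj x * x)=0" shows "x=0"
 using assms phi(1) by (auto simp: faithful_normal_state_def)

lemma phi_norm:"x:M==>phi (adj x * x) = of_real ((norm (rho x xi))^2)"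
 using phi(4)[of "adj x * x"] by (simp add: EK.M.w_ins R.rho_mult R.rho_adj adj_right cinner_self)

lemma rho_separating:"x:M==>rho x xi=0==>x=0"
 using phi_faithful[of x] phi_norm[of x] by simp

lemma phi_vector: obtains kp where "!!x. x:M==>phi x=cinner kp (amp x kp)" "!!x. x:M==>amp x kp=0==>x=0"
proof -
 have "continuous_map (subtopology sigma_weak M) euclidean phi" using phi(1) by (simp add: faithful_normal_state_def)
 then obtain kp where k:"!!x. x:M==>phi x=cinner kp (amp x kp)" by (rule P.normal_imp_vector_functional) (rule that)
 show ?thesis
 proof (rule that[OF k])
  fix x assume x:"x:M" "amp x kp=0"
  hence "phi (adj x * x)=0" using k[of "adj x * x"] by (simp add: EK.M.w_ins amp_mult)
  thus "x=0" by (rule phi_faithful[OF x(1)])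
 qed
qed

lemma EA_M:"x:M==>EA x:M" using EAK.BM EAK.E_in by blast
lemma E_M:"x:M==>E x:M" using EK.BM EK.E_in by blast

lemma psi_faithful: assumes x:"x:M" "phi (EA (adj x * x))=0" shows "x=0"
proof -
 have m:"adj x * x:M" by (intro EK.M.w_ins x)
 obtain R where R:"pos R" "R*R=EA (adj x * x)" "R:M"
  using sqrt_exists[OF EAK.E_pos[OF m pos_adj_mult]] EA_M[OF m] walgs(1) by blast
 have "R=0" using phi_faithful[OF R(3)] pos_adj[OF R(1)] R(2) x(2) by simp
 thus ?thesis using EAK.E_faithful[OF x(1)] R(2) by simp
qed

lemma psi_vector: obtains kp where "!!x. x:M==>phi (EA x)=cinner kp (amp x kp)" "!!x. x:M==>amp x kp=0==>x=0"
proof -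
 interpret S: posfun M "%x. phi (EA x)"
 proof
  fix x y c assume x:"x:M"
  show "phi (EA (c :* x))=c*phi (EA x)" using x by (simp add: EAK.E_scaleC phi_lin EA_M)
  have m:"adj x * x:M" by (intro EK.M.w_ins x)
  show "phi (EA (adj x * x)) \<in> \<real>\<^sub>\<ge>\<^sub>0"
   using P.g_positive[OF EA_M[OF m] EAK.E_pos[OF m pos_adj_mult]] by (simp add: complex_nonneg_Reals_iff)
  assume y:"y:M"
  show "phi (EA (x + y))=phi (EA x)+phi (EA y)" using x y by (simp add: EAK.E_add phi_lin EA_M)
 qed
 have n:"continuous_map (subtopology sigma_weak M) sigma_weak EA"
  using vA(6) by (simp add: cond_expectation_def normal_on_def)
 have "continuous_map (subtopology sigma_weak M) (subtopology sigma_weak M) EA"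
  by (rule continuous_map_into_subtopology[OF n]) (use EA_M in auto)
 moreover have "continuous_map (subtopology sigma_weak M) euclidean phi" using phi(1) by (simp add: faithful_normal_state_def)
 ultimately have "continuous_map (subtopology sigma_weak M) euclidean (phi \<circ> EA)" by (rule continuous_map_compose)
 hence "continuous_map (subtopology sigma_weak M) euclidean (%x. phi (EA x))" by (simp add: comp_def)
 then obtain kp where k:"!!x. x:M==>phi (EA x)=cinner kp (amp x kp)" by (rule S.normal_imp_vector_functional) (rule that)
 show ?thesis
 proof (rule that[OF k])
  fix x assume x:"x:M" "amp x kp=0"
  hence "phi (EA (adj x * x))=0" using k[of "adj x * x"] by (simp add: EK.M.w_ins amp_mult)
  thus "x=0" by (rule psi_faithful[OF x(1)])
 qed
qed

text \<open>Both \<open>phi\<close> and its composition with \<open>EA\<close> are faithful and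
  normal, hence each controls the other on positive contractions by \<open>compare_states\<close>;
  \<open>phi_controls\<close> is the opposite direction.\<close>

lemma psi_controls:
 assumes "0<r" shows "EX d>0. ALL X:M. pos X-->X[=1-->Re (phi (EA X))<d-->Re (phi X)<r"
proof -
 obtain k1 k2 where k:"!!x. x:M==>phi x=cinner k1 (amp x k1)" "!!x. x:M==>phi (EA x)=cinner k2 (amp x k2)"
  "!!x. x:M==>amp x k2=0==>x=0" using phi_vector psi_vector by metis
 have "EX d>0. ALL X:M. pos X-->X[=1-->Re (cinner k2 (amp X k2))<d-->Re (cinner k1 (amp X k1))<r"
  by (rule compare_states[OF walgs(1) _ assms]) (rule k(3))
 thus ?thesis by (simp add: k(1,2) cong: ball_cong)
qed

lemma phi_controls:
 assumes "0<r" shows "EX d>0. ALL X:M. pos X-->X[=1-->Re (phi X)<d-->Re (phi (EA X))<r"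
proof -
 obtain k1 k2 where k:"!!x. x:M==>phi x=cinner k1 (amp x k1)" "!!x. x:M==>phi (EA x)=cinner k2 (amp x k2)"
  "!!x. x:M==>amp x k1=0==>x=0" using phi_vector psi_vector by metis
 have "EX d>0. ALL X:M. pos X-->X[=1-->Re (cinner k1 (amp X k1))<d-->Re (cinner k2 (amp X k2))<r"
  by (rule compare_states[OF walgs(1) _ assms]) (rule k(3))
 thus ?thesis by (simp add: k(1,2) cong: ball_cong)
qed

sublocale H: popa "rho ` M" "rho ` B" "rho ` A" "R.img E" "R.img EA" xi e
proof (intro popa.intro jones.intro jones_axioms.intro popa_axioms.intro)
 show "expectation (rho ` M) (rho ` B) (R.img E)" by (rule R.expectation_image[OF EK.expectation_axioms])
 show "expectation (rho ` M) (rho ` A) (R.img EA)" by (rule R.expectation_image[OF EAK.expectation_axioms])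
 show "t3alg (rho ` A)" "t3alg (rho ` B)" by (rule R.t3alg_image[OF TAk.t3alg_axioms vA(2)], rule R.t3alg_image[OF TBk.t3alg_axioms vB(2)])
 have sf:"standard_form (rho ` M) J P" using std by (simp add: standard_representation_def)
 have f:"S=0" if "S:rho ` M" "S xi=0" for S using that rho_separating R.rho_zero by auto
 show "u=0" if "!!x. x:rho ` M==>cinner u (x xi)=0" for u
  by (rule standard_form_cyclic_separating(1)[OF sf phi(3) f that])
 show "u=0" if "!!T. T:commutant (rho ` M)==>cinner u (apply_op T xi)=0" for u
  by (rule standard_form_cyclic_separating(2)[OF sf phi(3) f that])
 show "e (x xi)=R.img E x xi" if "x:rho ` M" for x using that e_rho by (auto simp: R.img_rho)
 show "cinner xi (R.img E x xi)=cinner xi (x xi)" if xM:"x:rho ` M" for x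
 proof -
  obtain x' where x': "x':M" "x=rho x'" using xM by blast
  show ?thesis using phi(2,4)[OF x'(1)] phi(4)[OF E_M[OF x'(1)]] by (simp add: x' R.img_rho)
 qed
 fix r :: real assume r:"0<r"
 hence "0<r^2" by simp
 then obtain d where d:"0<d" "!!X. X:M==>pos X==>X[=1==>Re (phi (EA X))<d==>Re (phi X)<r^2"
  using psi_controls by blast
 show "EX d>0. ALL X:rho ` M. pos X-->X[=1-->Re (cinner xi (R.img EA X xi))<d-->norm (X xi)<r"
 proof (intro exI[of _ d] conjI ballI impI d(1))
  fix X assume X:"X:rho ` M" "pos X" "X[=1" "Re (cinner xi (R.img EA X xi))<d"
  obtain x where x:"x:M" "X=rho x" using X(1) by blast
  have p:"pos x" using X(2) x R.positive_rho by simp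
  have q:"x[=1" using X(3) x R.positive_rho[of "1 - x"] by (simp add: R.rho_diff R.rho_one EK.M.w_ins)
  have "Re (phi (EA x))<d" using X(4) x phi(4)[OF EA_M[OF x(1)]] by (simp add: R.img_rho)
  hence "Re (phi x)<r^2" using d(2)[OF x(1) p q] by simp
  moreover have "(norm (X xi))^2<=Re (phi x)" using positive_norm_sq_le[OF X(2), of 1 xi] X(3) x phi(4)[OF x(1)] by simp
  ultimately have "(norm (X xi))^2<r^2" by simp
  thus "norm (X xi)<r" using r by (simp add: power_less_imp_less_base)
 qed
qed

end

section \<open>Tensor products with l^2 and the exclusion of the ucp map\<close>

section \<open>Tensor products with the compact operators\<close>

lemma tensor_vec_simps:"tensor_vec x (y + z)=tensor_vec x y + tensor_vec x z"
 "tensor_vec x (c :* y)=c :* tensor_vec x y" "tensor_vec (c :* x) y=c :* tensor_vec x y"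
 "tensor_vec (x + x') y=tensor_vec x y + tensor_vec x' y" "tensor_vec x (y - z)=tensor_vec x y - tensor_vec x z"
 by (auto intro!: l2_eqI simp: scaleC_add_left scaleC_add_right scaleC_complex_def scaleC_scaleC scaleC_diff_left mult.commute)

lemma tensor_vec_sum:"tensor_vec x (SUM i:I. y i)=(SUM i:I. tensor_vec x (y i))"
 by (rule l2_eqI) (induction I rule: infinite_finite_induct, auto simp: scaleC_add_left scaleC_zero_left)

lemma norm_tensor_vec:"norm (tensor_vec x y)=norm x * norm y"
proof (rule power2_eq_imp_eq)
 show "(norm (tensor_vec x y))^2=(norm x * norm y)^2"
  unfolding power2_norm_eq_Re_cinner[of "tensor_vec x y"] cinner_tensor_vec by (simp add: cinner_self power_mult_distrib flip: of_real_power)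
qed simp_all

lemma l2_single_tensor:"tensor_vec x (l2_single j 1)=l2_single j x"
 by (rule l2_eqI) (simp add: scaleC_one scaleC_zero_left)

lemma bop_tensor_eqI:
 fixes R R' :: "'k :: complex_hilbert l2seq bop"
 assumes "!!x y. R (tensor_vec x y)=R' (tensor_vec x y)" shows "R=R'"
proof -
 have "adj (R-R') z=0" for z
 proof (rule tensor_vec_total)
  fix x y show "cinner (tensor_vec x y) (adj (R-R') z)=0" by (simp only: adj_right bop_minus_apply assms) simp
 qed
 hence "adj (R-R')=0" by (intro bop_eqI) simp
 hence "R-R'=0" using adj_adj adj_0 by metis
 thus ?thesis by simp
qed

text \<open>The amplification of \<open>T\<close> is bounded because the Gram forms of \<open>T\<close> and of the square root
  of \<open>c\<^sup>2 - adj T * T\<close> add up to that of a multiple of the identity.\<close>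

lemma tensor_one_ex:
 fixes T :: "complex l2seq bop"
 shows "EX R :: 'k :: complex_hilbert l2seq bop. ALL x y. R (tensor_vec x y)=tensor_vec x (T y)"
proof -
 obtain c where c:"bnd c T" using bnd_ex by blast
 obtain S where S:"pos S" "S*S=c^2 .* 1 - adj T*T" using sqrt_exists[OF bnd_adj_mult_le[OF c]] by blast
 let ?d = "%j. l2_single j (1 :: complex)"
 define G where "G n X zt=(SUM j<n. tensor_vec (l2_nth zt j) (apply_op X (?d j)))" for n X and zt :: "'k l2seq"
 have gram:"cinner (G n T zt) (G n T zt) + cinner (G n S zt) (G n S zt) = of_real (c^2*(SUM j<n. (norm (l2_nth zt j))^2))" for n and zt :: "'k l2seq"
 proof -
  have sum:"cinner (T (?d i)) (T (?d j)) + cinner (S (?d i)) (S (?d j))=(if i=j then of_real (c^2) else 0)" for i j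
  proof -
   have "cinner (T (?d i)) (T (?d j)) + cinner (S (?d i)) (S (?d j))=cinner (?d i) ((adj T*T + adj S*S) (?d j))"
    by (simp add: cinner_add_right adj_right)
   also have "adj T*T + adj S*S=c^2 .* 1" using S(2) pos_adj[OF S(1)] by simp
   finally show ?thesis by (simp add: cinner_scaleR_right cinner_l2_single_left cinner_complex_def)
  qed
  have "cinner (G n T zt) (G n T zt) + cinner (G n S zt) (G n S zt)
   = (SUM j<n. SUM i<n. cinner (l2_nth zt i) (l2_nth zt j)*(cinner (T (?d i)) (T (?d j)) + cinner (S (?d i)) (S (?d j))))"
   unfolding G_def cinner_sum_left cinner_sum_right cinner_tensor_vec by (simp add: sum.distrib distrib_left)
  also have "...=(SUM i<n. cinner (l2_nth zt i) (l2_nth zt i) * of_real (c^2))"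
   unfolding sum by (intro sum.cong refl) (simp add: if_distrib[of "%z. _ * z"] cong: if_cong)
  also have "... = of_real (c^2*(SUM j<n. (norm (l2_nth zt j))^2))"
   by (simp add: cinner_self sum_distrib_left mult.commute)
  finally show ?thesis .
 qed
 have Gb:"norm (G n T zt)<=c * norm zt" for n and zt :: "'k l2seq"
 proof (rule power2_le_imp_le)
  have "(norm (G n T zt))^2+(norm (G n S zt))^2=c^2*(SUM j<n. (norm (l2_nth zt j))^2)"
   using arg_cong[OF gram[of n zt], of Re] unfolding plus_complex.sel power2_norm_eq_Re_cinner[symmetric] by simp
  hence "(norm (G n T zt))^2<=c^2*(SUM j<n. (norm (l2_nth zt j))^2)" using zero_le_power2[of "norm (G n S zt)"] by linarith
  also have "...<=c^2*(norm zt)^2" by (intro mult_left_mono sum_norm_l2_nth_le) simp_all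
  finally show "(norm (G n T zt))^2<=(c * norm zt)^2" by (simp add: power_mult_distrib)
 qed (use bndD(2)[OF c] in simp)
 have "EX F :: 'k l2seq bop. ALL zt. F zt=G n T zt" for n
  by (rule bop_from_fun[where C = c]) (simp_all add: G_def tensor_vec_simps sum.distrib scaleC_sum_right Gb[unfolded G_def])
 then obtain F :: "nat=>'k l2seq bop" where F:"!!n zt. F n zt=G n T zt" by metis
 have Fb:"bnd c (F n)" for n by (rule bndI) (use Gb F bndD(2)[OF c] in auto)
 obtain U :: "nat filter" where U:"ultra U" "U<=sequentially" using ultra_sequentially by blast
 obtain R where R:"wlim F R U" using ultra_wlim[OF U(1), of c F] Fb by (auto intro: always_eventually)
 have "R (tensor_vec x y)=tensor_vec x (T y)" for x y
 proof (rule cinner_ext)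
  fix w
  have tr:"G n T (tensor_vec x y)=tensor_vec x (T (SUM j<n. l2_single j (l2_nth y j)))" for n
  proof -
   have "l2_single j (l2_nth y j)=l2_nth y j :* ?d j" for j by (rule l2_eqI) (simp add: scaleC_complex_def)
   thus ?thesis by (simp add: G_def bop_sum tensor_vec_sum tensor_vec_simps)
  qed
  have b:"norm (tensor_vec x z)<=norm z * norm x" for z by (simp add: norm_tensor_vec mult.commute)
  have "bounded_linear (tensor_vec x)"
   by (rule bounded_linear_intro[OF _ _ b]) (simp_all add: tensor_vec_simps flip: scaleC_of_real)
  from bounded_linear.tendsto[OF this tendsto_bop[OF l2_trunc_tendsto]]
  have lim:"(%n. G n T (tensor_vec x y))---->tensor_vec x (T y)" unfolding tr .
  have "((%n. cinner w (F n (tensor_vec x y)))--->cinner w (tensor_vec x (T y))) U"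
   unfolding F by (rule tendsto_mono[OF U(2) tendsto_cinner[OF tendsto_const lim]])
  moreover have "((%n. cinner w (F n (tensor_vec x y)))--->cinner w (R (tensor_vec x y))) U" using R by (simp add: wlim_def)
  ultimately show "cinner w (R (tensor_vec x y))=cinner w (tensor_vec x (T y))" using tendsto_unique[OF ultraD[OF U(1)]] by blast
 qed
 thus ?thesis by blast
qed

lemma tensor_op_apply:"tensor_op S T (tensor_vec x y)=tensor_vec (apply_op S x) (apply_op T y)"
proof -
 obtain R :: "'a l2seq bop" where R:"!!x y. R (tensor_vec x y)=tensor_vec x (T y)" using tensor_one_ex by blast
 have "(amp S*R) (tensor_vec x y)=tensor_vec (S x) (T y)" for x y by (simp add: R) (rule l2_eqI, simp)
 hence "EX! R :: 'a l2seq bop. ALL x y. R (tensor_vec x y)=tensor_vec (S x) (T y)" by (intro ex1I[of _ "amp S*R"]) (auto intro: bop_tensor_eqI)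
 from theI'[OF this] show ?thesis unfolding tensor_op_def by blast
qed

lemma tensor_op_mult:"tensor_op S T * tensor_op S' T'=tensor_op (S*S') (T*T')"
 by (rule bop_tensor_eqI) (simp add: tensor_op_apply)

lemma amp_tensor:"amp S * tensor_op 1 T=tensor_op S T"
 by (rule bop_tensor_eqI) (simp add: tensor_op_apply, rule l2_eqI, simp)

lemma adj_tensor_op:"adj (tensor_op S T)=tensor_op (adj S) (adj T)"
proof (rule bop_tensor_eqI)
 fix x y
 have "cinner (tensor_vec x' y') (adj (tensor_op S T) (tensor_vec x y) - tensor_op (adj S) (adj T) (tensor_vec x y))=0" for x' y'
  by (simp add: cinner_diff_right adj_right tensor_op_apply cinner_tensor_vec)
 thus "adj (tensor_op S T) (tensor_vec x y)=tensor_op (adj S) (adj T) (tensor_vec x y)"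
  using tensor_vec_total by (metis eq_iff_diff_eq_0)
qed

text \<open>Orthogonal isometries \<open>t j\<close> identify the amplified space with a subspace; \<open>col\<close> is the adjoint of
  this embedding and \<open>cj\<close> the induced map on operators.\<close>

locale cuntz =
 fixes t :: "nat=>'k :: complex_hilbert bop"
 assumes t_orth:"adj (t m) * t n=(if m=n then 1 else 0)"
begin

lemma t_proj:"projection (SUM j<n. t j * adj (t j))"
proof (rule projection_sum)
 show "projection (t k * adj (t k))" for k by (rule partial_isometry_range) (simp add: t_orth)
 show "t j * adj (t j)*(t k * adj (t k))=0" if "j~=k" for j k
  using t_orth[of j k] that by (metis assoc mult_zero_left mult_zero_right)
qed simp

definition col :: "'k=>'k l2seq" where "col v=Abs_l2seq (%j. adj (t j) v)"

lemma col_sum_le:"(SUM j<n. (norm (adj (t j) v))^2)<=(norm v)^2"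
proof -
 have "(SUM j<n. (norm (adj (t j) v))^2)=Re (cinner v ((SUM j<n. t j * adj (t j)) v))"
  by (simp add: bop_sum_apply cinner_sum_right power2_norm_eq_Re_cinner adj_left)
 also have "...<=Re (cinner v (apply_op 1 v))" by (rule ple_Re[OF projection_ple_1[OF t_proj]])
 finally show ?thesis by (simp add: power2_norm_eq_Re_cinner)
qed

lemma l2_nth_col [simp]:"l2_nth (col v) j=adj (t j) v"
proof -
 have "summable (%j. (norm (adj (t j) v))^2)" by (rule summableI_nonneg_bounded[OF _ col_sum_le]) simp
 thus ?thesis unfolding col_def by (subst Abs_l2seq_inverse) auto
qed

lemma norm_col:"norm (col v)<=norm v"
proof (rule power2_le_imp_le)
 show "(norm (col v))^2<=(norm v)^2" unfolding l2seq_norm_power2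
  by (rule suminf_le_const[OF l2_nth_summable]) (use col_sum_le in simp)
qed simp

lemma col_simps:"col (x + y)=col x + col y" "col (c :* x)=c :* col x"
 by (auto intro: l2_eqI)

lemma col_t:"col (t j v)=l2_single j v"
proof (rule l2_eqI)
 fix n have "adj (t n) (t j v)=(adj (t n) * t j) v" by simp
 thus "l2_nth (col (t j v)) n=l2_nth (l2_single j v) n" by (simp add: t_orth)
qed

text \<open>\<open>z\<close> is the Riesz vector of v -> <zt, col v>, and its coordinates are read
  off with \<open>col_t\<close>.\<close>

lemma col_surj: obtains z where "col z=zt" "!!v. cinner z v=cinner zt (col v)"
proof -
 have "EX z. (ALL v:UNIV. cinner z v=cinner zt (col v))&norm z<=norm zt &
   (ALL u. (ALL x:UNIV. cinner u x=0)-->cinner u z=0)&(EX s :: nat=>'k. (ALL n. s n:UNIV)&(%n. s n)---->z)"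
 proof (rule riesz_on[where X = UNIV and a = "%v. v" and f = "%v. cinner zt (col v)" and C = "norm zt"])
  show "cmod (cinner zt (col x))<=norm zt * norm x" for x
   using order_trans[OF cmod_cinner_le mult_left_mono[OF norm_col]] by simp
 qed (simp_all add: clinear_on_def cinner_simps col_simps scaleC_complex_def)
 then obtain z where z:"!!v. cinner z v=cinner zt (col v)" by blast
 have "col z=zt"
 proof (rule l2_eqI, rule cinner_ext)
  fix j v
  have "cinner (adj (t j) z) v=cinner (l2_nth zt j) v" by (simp add: adj_left z col_t cinner_l2_single_right)
  thus "cinner v (l2_nth (col z) j)=cinner v (l2_nth zt j)" by (metis cinner_commute l2_nth_col)
 qed
 thus ?thesis using z by (rule that)
qed

definition cj :: "'k l2seq bop=>'k bop" where
 "cj R=(SOME T. ALL x y. cinner (apply_op T x) y=cinner (R (col x)) (col y))"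

lemma cinner_cj:"cinner (cj R x) y=cinner (R (col x)) (col y)"
proof -
 obtain C where C:"bnd C R" using bnd_ex by blast
 have "EX T :: 'k bop. bnd C T&(ALL x y. cinner (T x) y=cinner (R (col x)) (col y))"
 proof (rule bop_from_form)
  fix x y
  have "cmod (cinner (R (col x)) (col y))<=norm (R (col x)) * norm (col y)" by (rule cmod_cinner_le)
  also have "...<=(C * norm x) * norm y"
   using order_trans[OF bndD(1)[OF C] mult_left_mono[OF norm_col bndD(2)[OF C]]] norm_col bndD(2)[OF C] by (intro mult_mono) auto
  finally show "cmod (cinner (R (col x)) (col y))<=C * norm x * norm y" .
 qed (simp_all add: cinner_simps col_simps bndD(2)[OF C])
 hence "EX T :: 'k bop. ALL x y. cinner (T x) y=cinner (R (col x)) (col y)" by blast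
 from someI_ex[OF this] show ?thesis unfolding cj_def by blast
qed

lemma cinner_cj': "cinner x (cj R y)=cinner (col x) (R (col y))"
 by (metis cinner_cj cinner_commute)

lemma col_cj:"col (cj R x)=R (col x)"
proof -
 obtain z where z:"col z=R (col x)" "!!v. cinner z v=cinner (R (col x)) (col v)" by (rule col_surj[of "R (col x)"]) (rule that; assumption)
 have "cj R x=z" by (rule cinner_ext) (metis z(2) cinner_cj cinner_commute)
 thus ?thesis using z(1) by simp
qed

lemma bop_cinner_eqI:"(!!x y. cinner x (apply_op S y)=cinner x (apply_op T y))==>S=(T :: 'k bop)"
 by (rule bop_eqI, rule cinner_ext)

lemma cj_simps:"cj (R+S)=cj R + cj S" "cj (c :* R)=c :* cj R" "cj (R*S)=cj R * cj S" "cj 0=0" "cj (adj R)=adj (cj R)"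
 by (auto intro!: bop_cinner_eqI simp: cinner_cj' cinner_simps col_cj adj_right cinner_cj)

lemma cj_normal:"normal_on UNIV cj"
proof (rule normal_onI)
 fix xi et :: "'k l2seq"
 have s:"l2_nth (Abs_l2seq (%n. col (l2_nth zt n))) n=col (l2_nth zt n)" for zt n
 proof (subst Abs_l2seq_inverse)
  show "(%n. col (l2_nth zt n)):{f. summable (%n. (norm (f n))^2)}"
   using summable_comparison_test'[OF l2_nth_summable[of zt], of 0 "%n. (norm (col (l2_nth zt n)))^2"] norm_col
   by (simp add: power_mono)
 qed simp
 show "EX xi' et'. ALL T:UNIV. sigma_weak_functional xi et (cj T)=sigma_weak_functional xi' et' T"
  by (intro exI[of _ "Abs_l2seq (%n. col (l2_nth xi n))"] exI[of _ "Abs_l2seq (%n. col (l2_nth et n))"])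
   (simp add: sigma_weak_functional_def s cinner_cj')
qed

lemma cj_preimage: assumes "von_neumann_algebra N" shows "von_neumann_algebra {R. cj R:N}"
proof -
 note N = assms[unfolded von_neumann_algebra_def]
 have "continuous_map sigma_weak sigma_weak cj" using cj_normal by (simp add: normal_on_def)
 hence "closedin sigma_weak {R:topspace sigma_weak. cj R:N}" using N by (intro closedin_continuous_map_preimage) auto
 thus ?thesis using N by (simp add: von_neumann_algebra_def cj_simps)
qed

text \<open>Compressing by the ranges of the first n isometries leaves a finite sum of scalar
  multiples of \<open>t i * x * adj (t j)\<close>; these stay bounded and converge weakly.\<close>

lemma cj_tensor_op:
 assumes N:"walg N" and t:"!!j. t j:N" and x:"x:N"
 shows "cj (tensor_op x q):N"
proof -
 interpret N: walg N by (rule N)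
 let ?R = "tensor_op x q"
 let ?r = "%n. SUM j<n. t j * adj (t j)"
 have entry:"adj (t i) * cj ?R * t j=l2_nth (q (l2_single j 1)) i :* x" for i j
 proof (rule bop_eqI)
  fix v
  have "(adj (t i) * cj ?R * t j) v=l2_nth (col (cj ?R (t j v))) i" by simp
  also have "...=l2_nth (?R (tensor_vec v (l2_single j 1))) i" by (simp only: col_cj col_t l2_single_tensor)
  finally show "(adj (t i) * cj ?R * t j) v=(l2_nth (q (l2_single j 1)) i :* x) v" by (simp add: tensor_op_apply)
 qed
 have "?r n * cj ?R * ?r n=(SUM i<n. SUM j<n. t i*(adj (t i) * cj ?R * t j) * adj (t j))" for n
  by (simp only: sum_distrib_left sum_distrib_right assoc) (rule sum.swap)
 hence sN:"?r n * cj ?R * ?r n:N" for n unfolding entry by (simp add: N.w_ins t x)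
 obtain C where C:"bnd C (cj ?R)" using bnd_ex by blast
 have colr:"col (?r n v)=(SUM j<n. l2_single j (l2_nth (col v) j))" for n v
 proof -
  have "col (SUM j<n. t j (adj (t j) v))=(SUM j<n. col (t j (adj (t j) v)))"
   by (induction n) (auto simp: col_simps intro: l2_eqI)
  thus ?thesis by (simp add: bop_sum_apply col_t)
 qed
 show ?thesis
 proof (rule wclosedD[OF N.w_closed sequentially_bot, of "%n. ?r n * cj ?R * ?r n" "1*C*1"])
  show "\<forall>\<^sub>F n in sequentially. ?r n * cj ?R * ?r n:N&bnd (1*C*1) (?r n * cj ?R * ?r n)"
   by (intro always_eventually allI conjI sN bnd_mult C projection_bnd t_proj)
  show "wlim (%n. ?r n * cj ?R * ?r n) (cj ?R) sequentially"
   unfolding wlim_def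
  proof (intro allI)
   fix v u
   have "cinner v ((?r n * cj ?R * ?r n) u)=cinner (col (?r n v)) (?R (col (?r n u)))" for n
   proof -
    have "cinner v ((?r n * cj ?R * ?r n) u)=cinner v (?r n (cj ?R (?r n u)))" by (simp only: bop_times_apply)
    also have "...=cinner (adj (?r n) v) (cj ?R (?r n u))" by (simp only: adj_left)
    finally show ?thesis by (simp only: projectionD(2)[OF t_proj] cinner_cj')
   qed
   moreover have "(%n. cinner (col (?r n v)) (?R (col (?r n u))))---->cinner (col v) (?R (col u))"
    unfolding colr by (rule tendsto_cinner[OF l2_trunc_tendsto tendsto_bop[OF l2_trunc_tendsto]])
   ultimately show "(%n. cinner v ((?r n * cj ?R * ?r n) u))---->cinner v (cj ?R u)" by (simp add: cinner_cj')
  qed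
 qed
qed

text \<open>The preimage of N under the normal map \<open>cj\<close>, which respects products and
  adjoints, is a von Neumann algebra containing the elementary tensors.\<close>

lemma cj_vn_tensor:
 assumes N:"von_neumann_algebra N" "1:N" and t:"!!j. t j:N" and R:"R:vn_tensor N Q"
 shows "cj R:N"
proof -
 have "{tensor_op x y |x y. x:N&y:Q}<={R. cj R:N}"
  using cj_tensor_op[OF von_neumann_walg[OF N] t] by auto
 hence "vn_tensor N Q<={R. cj R:N}"
  unfolding vn_tensor_def vn_generated_def using cj_preimage[OF N(1)] by blast
 thus ?thesis using R by blast
qed

end

context setting
begin

text \<open>Everything is folded into M and B by \<open>cj\<close>. The range of \<open>w\<close>
  lies under 1 tensor e0, and a rank-one operator q carrying a vector of the range of e0 to the
  first basis vector extracts an element of M from \<open>w\<close>. If all these extractions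
  vanished, so would all coefficients of \<open>w\<close>.\<close>

theorem intertwines_imp_element:
 assumes "intertwines M A B"
 obtains y \<sigma> where "y:M" "y~=0" "!!a. a:A==>\<sigma> a:B" "!!a. a:A==>\<sigma> (adj a)=adj (\<sigma> a)"
  "!!a. a:A==>y*\<sigma> a=a * y"
proof -
 have uA:"unit_of A=1" by (rule unit_of_walg[OF walgs(2)])
 obtain p e0 f \<pi> w where h:"minimal_projection (corner p UNIV) e0" "f:vn_tensor B (corner p UNIV)"
  "normal_star_hom A \<pi>" "with_expectation (\<pi> ` A) (corner f (vn_tensor B (corner p UNIV)))"
  "w:{tensor_op 1 e0 * x * f |x. x:vn_tensor M (corner p UNIV)}" "w~=0" "ALL a:A. w*\<pi> a=tensor_op a e0 * w"
  using assms unfolding intertwines_def uA by (elim exE conjE) (rule that; assumption)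
 obtain t :: "nat=>'k bop" where t:"!!n. t n:B" "!!m n. adj (t m) * t n=(if m=n then 1 else 0)" "!!n. 1 * t n=t n"
  by (rule TBk.orthogonal_isometries[OF vB(3) projection_1]) (rule that; assumption)
 interpret C: cuntz t by (rule cuntz.intro) (rule t(2))
 have tM:"t n:M" for n by (rule EK.BM[OF t(1)])
 have e0:"projection e0" using h(1) by (simp add: minimal_projection_def)
 note ep = projectionD[OF e0]
 have cB:"C.cj R:B" if "R:vn_tensor B (corner p UNIV)" for R by (rule C.cj_vn_tensor[OF vB(1,3) t(1) that])
 have cM:"C.cj R:M" if "R:vn_tensor M (corner p UNIV)" for R by (rule C.cj_vn_tensor[OF vM tM that])
 obtain x where x:"x:vn_tensor M (corner p UNIV)" "w=tensor_op 1 e0 * x * f" using h(5) by blast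
 have one:"C.cj (tensor_op 1 q):M" for q by (rule C.cj_tensor_op[OF walgs(1) tM vM(2)])
 have wM:"C.cj w:M" unfolding x(2) C.cj_simps by (intro EK.M.w_mult one cM x(1) EK.BM cB h(2))
 have piB:"C.cj (\<pi> a):B" if a:"a:A" for a
 proof -
  have "\<pi> a:corner f (vn_tensor B (corner p UNIV))" using h(4) a by (auto simp: with_expectation_def)
  then obtain b where "\<pi> a=f * b * f" "b:vn_tensor B (corner p UNIV)" by (auto simp: corner_def)
  thus ?thesis using cB h(2) by (simp add: C.cj_simps EK.B.w_mult)
 qed
 have pia:"\<pi> (adj a)=adj (\<pi> a)" if "a:A" for a using h(3) that by (simp add: normal_star_hom_def)
 have ew:"tensor_op 1 e0 * w=w" by (simp add: x(2) tensor_op_mult ep assoc[symmetric])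
 have qex:"EX q. ALL z. apply_op q z=cinner \<epsilon> z :* l2_single 0 (1 :: complex)" for \<epsilon> :: "complex l2seq"
  by (rule bop_from_fun[where C = "norm \<epsilon>"])
   (simp_all add: cinner_simps scaleC_add_left scaleC_scaleC norm_scaleC norm_l2_single cmod_cinner_le)
 have "EX y \<epsilon> q. e0 \<epsilon>=\<epsilon>&(ALL z. apply_op q z=cinner \<epsilon> z :* l2_single 0 (1 :: complex))&y=adj (t 0)*C.cj (tensor_op 1 q)*C.cj w&y~=0"
 proof (rule ccontr)
  assume "~ ?thesis"
  hence no:"adj (t 0)*C.cj (tensor_op 1 q)*C.cj w=0" if "e0 \<epsilon>=\<epsilon>" "!!z. apply_op q z=cinner \<epsilon> z :* l2_single 0 (1 :: complex)" for \<epsilon> q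
   using that by blast
  have "w zt=0" for zt
  proof (rule tensor_vec_total)
   fix x y
   define \<epsilon> where "\<epsilon>=e0 y"
   have ee:"e0 \<epsilon>=\<epsilon>" unfolding \<epsilon>_def using ep(1) by (metis bop_times_apply)
   obtain q where q:"!!z. apply_op q z=cinner \<epsilon> z :* l2_single 0 (1 :: complex)" using qex by blast
   have q1:"adj q (l2_single 0 1)=\<epsilon>"
    by (rule cinner_ext) (simp add: adj_right q cinner_scaleC_left cinner_l2_single_left cinner_complex_def flip: cinner_commute)
   obtain v where v:"C.col v=zt" by (rule C.col_surj[of zt]) (rule that)
   have "(adj (t 0)*C.cj (tensor_op 1 q)*C.cj w) v=l2_nth (C.col (C.cj (tensor_op 1 q) (C.cj w v))) 0" by simp
   hence z:"l2_nth (tensor_op 1 q (w zt)) 0=0" using no[OF ee q] by (simp only: C.col_cj v bop_zero_apply)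
   have "cinner (tensor_vec x y) (w zt)=cinner (tensor_vec x y) (tensor_op 1 e0 (w zt))" using ew by (metis bop_times_apply)
   also have "...=cinner (adj (tensor_op 1 e0) (tensor_vec x y)) (w zt)" by (simp only: adj_left)
   also have "...=cinner (tensor_vec x (adj q (l2_single 0 1))) (w zt)" by (simp add: adj_tensor_op tensor_op_apply ep q1 \<epsilon>_def)
   also have "...=cinner (adj (tensor_op 1 q) (tensor_vec x (l2_single 0 1))) (w zt)" by (simp add: adj_tensor_op tensor_op_apply)
   also have "...=cinner (l2_single 0 x) (tensor_op 1 q (w zt))" by (simp only: adj_left l2_single_tensor)
   finally show "cinner (tensor_vec x y) (w zt)=0" by (simp add: cinner_l2_single_left z)
  qed
  hence "w=0" by (intro bop_eqI) simp
  thus False using h(6) by simp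
 qed
 then obtain y \<epsilon> q where y:"e0 \<epsilon>=\<epsilon>" "!!z. apply_op q z=cinner \<epsilon> z :* l2_single 0 (1 :: complex)"
  "y=adj (t 0)*C.cj (tensor_op 1 q)*C.cj w" "y~=0" by blast
 have qe:"q * e0=q"
 proof (rule bop_eqI)
  fix z
  have "cinner \<epsilon> (e0 z)=cinner \<epsilon> z" using y(1) ep(2) by (metis adj_left)
  thus "(q * e0) z=q z" by (simp add: y(2))
 qed
 show ?thesis
 proof (rule that[of y "%a. C.cj (\<pi> a)"])
  show "y:M" unfolding y(3) by (intro EK.M.w_mult EK.M.w_adj tM one wM)
  show "C.cj (\<pi> (adj a))=adj (C.cj (\<pi> a))" if "a:A" for a by (simp add: pia[OF that] C.cj_simps)
  show "y*C.cj (\<pi> a)=a * y" if a:"a:A" for a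
  proof -
   have aq:"adj (t 0)*C.cj (tensor_op a q)=a*(adj (t 0)*C.cj (tensor_op 1 q))"
   proof (rule bop_eqI)
    fix v
    have "(adj (t 0)*C.cj (tensor_op a q)) v=l2_nth (C.col (C.cj (tensor_op a q) v)) 0" by simp
    also have "...=a (l2_nth (C.col (C.cj (tensor_op 1 q) v)) 0)" unfolding C.col_cj amp_tensor[of a q, symmetric] by simp
    finally show "(adj (t 0)*C.cj (tensor_op a q)) v=(a*(adj (t 0)*C.cj (tensor_op 1 q))) v" by simp
   qed
   have "y*C.cj (\<pi> a)=adj (t 0)*C.cj (tensor_op 1 q*(w*\<pi> a))" by (simp add: y(3) C.cj_simps assoc)
   also have "tensor_op 1 q*(w*\<pi> a)=tensor_op a q * w" unfolding bspec[OF h(7) a] by (simp add: tensor_op_mult qe assoc[symmetric])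
   also have "adj (t 0)*C.cj (tensor_op a q * w)=a * y" using aq by (simp add: C.cj_simps y(3) assoc[symmetric])
   finally show ?thesis .
  qed
 qed (use piB y(4) in auto)
qed

lemma convex_combination_fixed:
 assumes "Ph:convex_combinations_Ad (rho ` unitaries A)" and D:"!!a. a:A==>rho a*D=D*rho a"
 shows "Ph D=D"
proof -
 obtain n c u where u:"!!i. i<n==>u i:rho ` unitaries A" "(SUM i<n. c i)=1" "Ph=(%T. SUM i<n::nat. c i .* Ad (u i) T)"
  using assms(1) unfolding convex_combinations_Ad_def by blast
 have "Ad (u i) D=D" if i:"i<n" for i
 proof -
  obtain v where v:"v:A" "v * adj v=1" "u i=rho v" using u(1)[OF i] unit_of_walg[OF walgs(2)] by (auto simp: unitaries_def)
  have vM:"v:M" using v(1) EAK.BM by blast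
  have "Ad (u i) D=D*(rho v * adj (rho v))" unfolding Ad_def v(3) using D[OF v(1)] by (simp add: assoc)
  also have "rho v * adj (rho v)=1" using vM v(2) by (simp add: R.rho_one EK.M.w_adj flip: R.rho_adj R.rho_mult)
  finally show ?thesis by simp
 qed
 hence "Ph D=(SUM i<n. c i) .* D" unfolding u(3) scaleR_sum_left by (intro sum.cong) auto
 thus ?thesis by (simp add: u(2))
qed

theorem intertwines_imp_no_ucp:
 assumes "intertwines M A B"
  and lim:"point_sigma_weak_limit (basic_construction M rho e) (convex_combinations_Ad (rho ` unitaries A)) Ps"
  and zero:"!!a b. a:M==>b:M==>Ps (rho a * e * adj (rho b))=0"
 shows False
proof -
 obtain y \<sigma> where y:"y:M" "y~=0" "!!a. a:A==>\<sigma> a:B" "!!a. a:A==>\<sigma> (adj a)=adj (\<sigma> a)"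
  "!!a. a:A==>y*\<sigma> a=a * y" by (rule intertwines_imp_element[OF assms(1)]) (rule that; assumption)
 define D where "D=rho y * e * adj (rho y)"
 have comm:"rho a*D=D*rho a" if a:"a:A" for a
 proof -
  have M:"a:M" "\<sigma> a:M" "adj y:M" using a y(1,3) EAK.BM EK.BM EK.M.w_adj by auto
  have eB:"e*rho (\<sigma> a)=rho (\<sigma> a) * e" by (rule H.e_commute) (use y(3)[OF a] in blast)
  \<comment> \<open>The relation is used at \<open>adj a\<close>; taking adjoints yields the version
    with \<open>adj y\<close> on the other side of \<open>e\<close>.\<close>
  have "y * adj (\<sigma> a)=adj a * y" using y(5)[of "adj a"] y(4)[OF a] EAK.B.w_adj[OF a] by simp
  hence r:"\<sigma> a * adj y=adj y * a" by (metis adj_adj adj_mult)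
  have "rho a*D=rho (a * y) * e*rho (adj y)" by (simp add: D_def M y(1) R.rho_mult R.rho_adj assoc)
  also have "...=rho y*(rho (\<sigma> a) * e)*rho (adj y)" by (simp add: M y(1) R.rho_mult assoc flip: y(5)[OF a])
  also have "...=rho y * e*rho (\<sigma> a * adj y)" unfolding eB[symmetric] by (simp add: M R.rho_mult assoc)
  also have "...=D*rho a" unfolding r by (simp add: D_def M y(1) R.rho_mult R.rho_adj assoc)
  finally show ?thesis .
 qed
 have "D:basic_construction M rho e"
  unfolding basic_construction_def vn_generated_def
 proof (rule InterI)
  fix N assume "N:{N. von_neumann_algebra N&rho ` M\<union>{e}<=N}"
  thus "D:N" unfolding D_def von_neumann_algebra_def using y(1) by blast
 qed
 then obtain F where F:"F~=bot" "\<forall>\<^sub>F Ph in F. Ph:convex_combinations_Ad (rho ` unitaries A)" "limitin sigma_weak (%Ph. Ph D) (Ps D) F"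
  using lim unfolding point_sigma_weak_limit_def by blast
 have ev:"\<forall>\<^sub>F Ph in F. Ph D=D" by (rule eventually_mono[OF F(2)]) (rule convex_combination_fixed[OF _ comm])
 have "Ps D=D"
 proof (rule bop_eqI, rule cinner_ext)
  fix v x :: 'h
  let ?f = "sigma_weak_functional (l2_single 0 x) (l2_single 0 v)"
  have "((%Ph. ?f (Ph D))--->?f (Ps D)) F"
   by (rule continuous_map_tendsto_sigma_weak[where N = UNIV, OF _ F(3)]) (simp_all add: continuous_sigma_weak_functional)
  moreover have "((%Ph. ?f (Ph D))--->?f D) F" by (rule tendsto_eventually) (rule eventually_mono[OF ev], simp)
  ultimately have "?f (Ps D)=?f D" using tendsto_unique[OF F(1)] by blast
  thus "cinner x (Ps D v)=cinner x (D v)" by (simp add: sigma_weak_functional_amp cinner_l2_single_left)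
 qed
 hence "D=0" using zero[OF y(1,1)] by (simp add: D_def)
 hence "adj (e * adj (rho y))*(e * adj (rho y))=0" using H.ee by (simp add: D_def assoc) (metis assoc)
 hence "e*rho (adj y)=0" using adj_mult_self_eq_0 R.rho_adj[OF y(1)] by metis
 hence "rho (adj y)=0" by (rule H.e_mult_zero[rotated]) (use y(1) EK.M.w_adj in blast)
 hence "adj y=0" using y(1) EK.M.w_adj by (intro R.rho_eq_0) auto
 thus False using y(2) adj_adj adj_0 by metis
qed

end

section \<open>A one-dimensional multiplicity space\<close>

section \<open>The corner of a rank one projection\<close>

lemma normal_compose:
 assumes F:"normal_on N F" and im:"!!x. x:N==>F x:N'" and G:"normal_on N' G"
 shows "normal_on N (%x. G (F x))"
proof -
 have "continuous_map (subtopology sigma_weak N) (subtopology sigma_weak N') F"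
  by (rule continuous_map_into_subtopology) (use F im in "auto simp: normal_on_def")
 from continuous_map_compose[OF this G[unfolded normal_on_def]] show ?thesis by (simp add: normal_on_def comp_def)
qed

lemma normal_conj:"normal_on N (%T. a*T * b)"
proof (rule normal_onI)
 fix xi et
 show "EX xi' et'. ALL T:N. sigma_weak_functional xi et (a*T * b)=sigma_weak_functional xi' et' T"
  by (intro exI[of _ "amp (adj a) xi"] exI[of _ "amp b et"]) (simp add: sigma_weak_functional_amp amp_mult amp_adj adj_left)
qed

lemma normal_on_subset:"normal_on N F==>N'<=N==>normal_on N' F"
 unfolding normal_on_def by (rule continuous_map_from_subtopology_mono)

text \<open>Applied later to a normal idempotent map, this shows that the image of a homomorphism is
  sigma-weakly closed.\<close>

lemma closedin_fixed:
 assumes V:"closedin sigma_weak V" and F:"normal_on V F"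
 shows "closedin sigma_weak {R:V. F R=R}"
proof -
 define f where "f x y=sigma_weak_functional (l2_single 0 x) (l2_single 0 y)" for x y :: 'a
 have fe:"f x y R=cinner x (R y)" for x y R by (simp add: f_def sigma_weak_functional_amp cinner_l2_single_left)
 have c:"closedin sigma_weak {R:V. f x y (F R) - f x y R:{0}}" for x y
 proof -
  have "continuous_map (subtopology sigma_weak V) euclidean (%R. f x y (F R))"
   using F unfolding normal_on_iff f_def by blast
  moreover have "continuous_map (subtopology sigma_weak V) euclidean (f x y)"
   unfolding f_def by (rule continuous_map_from_subtopology[OF continuous_sigma_weak_functional])
  ultimately have "continuous_map (subtopology sigma_weak V) euclidean (%R. f x y (F R) - f x y R)"
   by (rule continuous_map_diff)
  hence "closedin (subtopology sigma_weak V) {R:topspace (subtopology sigma_weak V). f x y (F R) - f x y R:{0}}"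
   by (rule closedin_continuous_map_preimage) simp
  thus ?thesis using closedin_trans_full[OF _ V] by simp
 qed
 have "{R:V. F R=R}=(\<Inter>(x,y)\<in>UNIV. {R:V. f x y (F R) - f x y R:{0}})"
 proof (intro equalityI subsetI)
  fix R assume R:"R:(\<Inter>(x,y)\<in>UNIV. {R:V. f x y (F R) - f x y R:{0}})"
  hence fr:"cinner x (F R y)=cinner x (R y)" for x y by (auto simp: fe)
  have "F R=R" by (rule bop_eqI, rule cinner_ext, rule fr)
  thus "R:{R:V. F R=R}" using R by simp
 qed auto
 moreover have "closedin sigma_weak (\<Inter>(x,y)\<in>UNIV. {R:V. f x y (F R) - f x y R:{0}})"
  by (rule closedin_INT) (use c in auto)
 ultimately show ?thesis by simp
qed

text \<open>The projection onto the first basis vector. Its corner consists of scalars, so tensoring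
  with it merely copies an algebra (\<open>vn_tensor_p0\<close>).\<close>

definition p0 :: "complex l2seq bop" where "p0=(SOME p. ALL z. apply_op p z=l2_nth z 0 :* l2_single 0 1)"

lemma p0_apply:"p0 z=l2_nth z 0 :* l2_single 0 1"
proof -
 have "EX p. ALL z. apply_op p z=l2_nth z 0 :* l2_single 0 (1 :: complex)"
  by (rule bop_from_fun[where C = 1]) (simp_all add: scaleC_add_left scaleC_scaleC scaleC_complex_def norm_scaleC norm_l2_single norm_l2_nth_le)
 from someI_ex[OF this] show ?thesis unfolding p0_def by blast
qed

definition tp :: "'k :: complex_hilbert bop=>'k l2seq bop" where "tp b=tensor_op b p0"

lemma tp_apply:"tp b zt=l2_single 0 (apply_op b (l2_nth zt 0))"
proof -
 obtain C where C:"bnd C b" using bnd_ex by blast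
 have "EX T :: 'a l2seq bop. ALL zt. T zt=l2_single 0 (b (l2_nth zt 0))"
 proof (rule bop_from_fun[where C = C])
  fix x :: "'a l2seq"
  show "norm (l2_single 0 (b (l2_nth x 0)))<=C * norm x"
   unfolding norm_l2_single by (rule order_trans[OF bndD(1)[OF C] mult_left_mono[OF norm_l2_nth_le bndD(2)[OF C]]])
 qed (auto intro!: l2_eqI simp: scaleC_zero_right)
 then obtain T :: "'a l2seq bop" where T:"!!zt. T zt=l2_single 0 (b (l2_nth zt 0))" by blast
 have "tensor_op b p0=T"
  by (rule bop_tensor_eqI, rule l2_eqI) (simp add: T tensor_op_apply p0_apply scaleC_complex_def scaleC_zero_left)
 thus ?thesis by (simp add: tp_def T)
qed

lemma tp_simps:"tp (a + b)=tp a + tp b" "tp (c :* a)=c :* tp a" "tp (a * b)=tp a * tp b" "tp 0=0"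
 by (auto intro!: bop_eqI l2_eqI simp: tp_apply scaleC_zero_right)

lemma cinner_tp:"cinner xi (tp T et)=cinner (l2_nth xi 0) (apply_op T (l2_nth et 0))"
 by (simp add: tp_apply cinner_l2_single_right)

lemma tp_adj:"tp (adj a)=adj (tp a)"
 by (rule sym, rule adj_eqI) (simp add: tp_apply cinner_l2_single_right cinner_l2_single_left adj_left)

definition entry :: "'k :: complex_hilbert l2seq bop=>'k bop" where
 "entry R=(SOME X. ALL v. apply_op X v=l2_nth (apply_op R (l2_single 0 v)) 0)"

lemma entry_apply:"entry R v=l2_nth (apply_op R (l2_single 0 v)) 0"
proof -
 obtain C where C:"bnd C R" using bnd_ex by blast
 have add:"l2_single 0 (x + y)=l2_single 0 x + l2_single 0 y" "l2_single 0 (c :* x)=c :* l2_single 0 x" for x y :: 'a and c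
  by (auto intro: l2_eqI simp: scaleC_zero_right)
 have "EX X. ALL v. apply_op X v=l2_nth (apply_op R (l2_single 0 v)) 0"
 proof (rule bop_from_fun[where C = C])
  show "norm (l2_nth (R (l2_single 0 x)) 0)<=C * norm x" for x
   by (rule order_trans[OF norm_l2_nth_le order_trans[OF bndD(1)[OF C]]]) (simp add: norm_l2_single)
 qed (simp_all add: add)
 from someI_ex[OF this] show ?thesis unfolding entry_def by blast
qed

lemma entry_tp [simp]:"entry (tp b)=b" by (rule bop_eqI) (simp add: entry_apply tp_apply)

lemma entry_simps:"entry (R+S)=entry R + entry S" "entry (c :* R)=c :* entry R"
 "entry (tp a*R * tp b)=a * entry R * b"
 by (auto intro!: bop_eqI simp: entry_apply tp_apply)

lemma tp_entry:"tp 1*R * tp 1=tp (entry R)"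
 by (auto intro!: bop_eqI l2_eqI simp: entry_apply tp_apply)

lemma cinner_entry:"cinner u (entry R v)=cinner (l2_single 0 u) (R (l2_single 0 v))"
 by (simp add: entry_apply cinner_l2_single_left)

lemma entry_positive:"pos R==>pos (entry R)"
 unfolding positive_op_def cinner_entry by blast

lemma tp_positive:"pos b==>pos (tp b)"
 unfolding positive_op_def cinner_tp by blast

lemma tp_normal:"normal_on N tp"
proof (rule normal_onI)
 fix xi et :: "'a l2seq l2seq"
 have s:"l2_nth (Abs_l2seq (%n. l2_nth (l2_nth zt n) 0)) n=l2_nth (l2_nth zt n) 0" for zt :: "'a l2seq l2seq" and n
 proof (subst Abs_l2seq_inverse)
  show "(%n. l2_nth (l2_nth zt n) 0):{f. summable (%n. (norm (f n))^2)}"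
   using summable_comparison_test'[OF l2_nth_summable[of zt], of 0 "%n. (norm (l2_nth (l2_nth zt n) 0))^2"]
   by (simp add: power_mono norm_l2_nth_le)
 qed simp
 show "EX xi' et'. ALL T:N. sigma_weak_functional xi et (tp T)=sigma_weak_functional xi' et' T"
  by (intro exI[of _ "Abs_l2seq (%n. l2_nth (l2_nth xi n) 0)"] exI[of _ "Abs_l2seq (%n. l2_nth (l2_nth et n) 0)"])
   (simp add: sigma_weak_functional_def s cinner_tp)
qed

lemma entry_normal:"normal_on N entry"
proof (rule normal_onI)
 fix xi et :: "'a l2seq"
 have s:"l2_nth (Abs_l2seq (%n. l2_single 0 (l2_nth zt n))) n=l2_single 0 (l2_nth zt n)" for zt :: "'a l2seq" and n
  by (subst Abs_l2seq_inverse) (simp_all add: norm_l2_single l2_nth_summable)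
 show "EX xi' et'. ALL T:N. sigma_weak_functional xi et (entry T)=sigma_weak_functional xi' et' T"
  by (intro exI[of _ "Abs_l2seq (%n. l2_single 0 (l2_nth xi n))"] exI[of _ "Abs_l2seq (%n. l2_single 0 (l2_nth et n))"])
   (simp add: sigma_weak_functional_def s cinner_entry)
qed

lemma von_neumann_tp:
 assumes N:"von_neumann_algebra N" shows "von_neumann_algebra (tp ` N)"
proof -
 note h = N[unfolded von_neumann_algebra_def]
 have c1:"closedin sigma_weak {R:UNIV. tp 1*R * tp 1=R}"
  by (rule closedin_fixed[OF _ normal_conj]) (metis closedin_topspace topspace_sigma_weak)
 have "continuous_map sigma_weak sigma_weak entry" using entry_normal[of UNIV] by (simp add: normal_on_def)
 hence c2:"closedin sigma_weak {R:topspace sigma_weak. entry R:N}" using h by (intro closedin_continuous_map_preimage) auto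
 have "tp ` N={R:UNIV. tp 1*R * tp 1=R}\<inter>{R:topspace sigma_weak. entry R:N}"
  by (auto simp: tp_entry) (metis imageI)
 hence "closedin sigma_weak (tp ` N)" using closedin_Int[OF c1 c2] by simp
 moreover have "0:tp ` N" using h tp_simps(4) by force
 ultimately show ?thesis using h unfolding von_neumann_algebra_def
  by (auto simp flip: tp_simps tp_adj)
qed

lemma corner_p0:"corner p0 UNIV={c :* p0 |c. True}"
proof -
 have e:"p0 * x * p0=l2_nth (x (l2_single 0 1)) 0 :* p0" for x
  by (rule bop_eqI, rule l2_eqI) (simp add: p0_apply scaleC_complex_def)
 have pc:"c :* p0=p0*(c :* 1) * p0" for c
  by (rule bop_eqI, rule l2_eqI) (simp add: p0_apply scaleC_complex_def)
 show ?thesis unfolding corner_def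
 proof (intro set_eqI iffI)
  fix x assume "x:{c :* p0 |c. True}"
  then obtain c where "x=c :* p0" by blast
  hence "x=p0*(c :* 1) * p0" using pc by metis
  thus "x:{p0 * x * p0 |x. x:UNIV}" by blast
 qed (use e in auto)
qed

lemma p0_projection:"projection p0"
 unfolding projection_def
proof
 show "p0 * p0=p0" by (rule bop_eqI, rule l2_eqI) (simp add: p0_apply scaleC_complex_def)
 show "adj p0=p0" by (rule adj_eqI) (simp add: p0_apply cinner_scaleC_left cinner_scaleC_right cinner_l2_single_left cinner_l2_single_right cinner_complex_def)
qed

lemma p0_minimal:"minimal_projection (corner p0 UNIV) p0"
proof -
 have n0:"p0~=0"
 proof
  assume "p0=0"
  hence "l2_nth (p0 (l2_single 0 1)) 0=0" by simp
  thus False by (simp add: p0_apply scaleC_complex_def)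
 qed
 have "q=0\<or>q=p0" if q:"q=c :* p0" "projection q" for q c
 proof -
  have "(c * c) :* p0=c :* p0" using projectionD(1)[OF q(2)] projectionD(1)[OF p0_projection] by (simp add: q(1) scaleC_scaleC)
  hence "(c * c - c) :* p0=0" by (simp add: scaleC_diff_left)
  hence "l2_nth ((c * c - c) :* p0 (l2_single 0 1)) 0=0" by (metis bop_scaleC_apply bop_zero_apply l2_nth_simps(3))
  hence "c * c - c=0" by (simp add: p0_apply scaleC_complex_def)
  hence "c=0\<or>c=1" by (simp add: algebra_simps)
  thus ?thesis using q(1) by (auto simp: scaleC_one scaleC_zero_left)
 qed
 thus ?thesis using n0 p0_projection unfolding minimal_projection_def corner_p0 by (auto intro: exI[of _ 1] simp: scaleC_one)
qed

lemma tensor_scaleC:"tensor_op b (c :* p0)=tp (c :* b)"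
 by (rule bop_tensor_eqI, rule l2_eqI) (simp add: tp_apply tensor_op_apply p0_apply scaleC_complex_def scaleC_scaleC mult.commute scaleC_zero_left)

lemma vn_tensor_p0:
 assumes N:"von_neumann_algebra N" shows "vn_tensor N (corner p0 UNIV)=tp ` N"
proof
 have "{tensor_op x y |x y. x:N&y:corner p0 UNIV}<=tp ` N"
  using N unfolding corner_p0 von_neumann_algebra_def by (auto simp: tensor_scaleC)
 thus "vn_tensor N (corner p0 UNIV)<=tp ` N"
  unfolding vn_tensor_def vn_generated_def using von_neumann_tp[OF N] by blast
 have "p0:corner p0 UNIV" using p0_minimal by (simp add: minimal_projection_def)
 thus "tp ` N<=vn_tensor N (corner p0 UNIV)"
  unfolding vn_tensor_def vn_generated_def tp_def by blast
qed

section \<open>Neumann series and uniqueness of square roots\<close>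

section \<open>Inverses and uniqueness of square roots\<close>

text \<open>By \<open>S'\<close>, S lies in the commutant of R. Then D = R - S satisfies D (R + S) =
  0, so the positive operators D R D and D S D both vanish and D^3 = 0.\<close>

lemma sqrt_unique:
 assumes R:"pos R" and S:"pos S" and eq:"R*R=S*S"
  and S': "!!N. walg N==>S*S:N==>S:N"
 shows "R=S"
proof -
 have "S:commutant {R}"
  by (rule S'[OF walg_commutant]) (use pos_adj[OF R] eq in "auto simp: commutant_def assoc simp flip: eq")
 hence c:"S*R=R*S" by (simp add: commutant_def)
 define D where "D=R-S"
 have Da:"adj D=D" by (simp add: D_def pos_adj R S)
 have "D*(R+S)=0" using c eq by (simp add: D_def algebra_simps)
 hence z:"adj D*R*D + adj D*S*D=0" 
 proof -
  have "adj D*R*D + adj D*S*D=D*(R+S)*D" by (simp add: Da distrib_left distrib_right)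
  thus ?thesis using \<open>D * (R + S) = 0\<close> by simp
 qed
 have "pos (- (adj D*R*D))" using pos_conj[OF S, of D] z by (simp add: add_eq_0_iff)
 hence 1:"adj D*R*D=0" using pos_antisym[OF pos_conj[OF R]] by blast
 hence 2:"adj D*S*D=0" using z by simp
 have "D*D*D=adj D*R*D - adj D*S*D" by (simp add: Da) (simp add: D_def algebra_simps)
 hence D3:"D*D*D=0" using 1 2 by simp
 have "adj (D*D)*(D*D)=0" using D3 Da by (simp add: assoc[symmetric])
 hence "D*D=0" by (rule adj_mult_self_eq_0)
 hence "D=0" using adj_mult_self_eq_0[of D] Da by simp
 thus ?thesis by (simp add: D_def)
qed

text \<open>Neumann series: \<open>1 - h\<close> has norm at most \<open>1 - r\<close>. The series
  also shows that the inverse stays in every algebra containing \<open>h\<close>.\<close>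

lemma inverse_exists:
 fixes h :: "'h :: complex_hilbert bop"
 assumes h:"h[=1" "r .* 1[=h" and r:"0<r" "r<=1"
 shows "EX G. h*G=1&(ALL N. walg N-->h:N-->G:N)"
proof -
 define q where "q=1 - h"
 have qb:"bnd (1 - r) q"
  by (rule positive_bnd) (use h r in "simp_all add: q_def scaleR_left_diff_distrib")
 have qn:"bnd ((1 - r) ^ n) (q ^ n)" for n
  by (induction n) (use qb bnd_mult in "auto")
 have s:"summable (%k. (q ^ k) x)" for x
 proof (rule summable_comparison_test')
  show "summable (%k. (1 - r) ^ k * norm x)" using r by (intro summable_mult2 summable_geometric) simp
  show "norm ((q ^ k) x)<=(1 - r) ^ k * norm x" for k by (rule bndD(1)[OF qn])
 qed
 have Tb:"bnd (1 / r) (SUM k<n. q ^ k)" for n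
 proof (rule bndI)
  fix x
  have "norm ((SUM k<n. q ^ k) x)<=(SUM k<n. (1 - r) ^ k * norm x)"
   unfolding bop_sum_apply by (rule sum_norm_le) (rule bndD(1)[OF qn])
  also have "...=(SUM k<n. (1 - r) ^ k) * norm x" by (simp add: sum_distrib_right)
  also have "...<=(1 / r) * norm x"
   using sum_le_suminf[OF summable_geometric[of "1 - r"], of "{..<n}"] r by (intro mult_right_mono) (auto simp: suminf_geometric)
  finally show "norm ((SUM k<n. q ^ k) x)<=1 / r * norm x" .
 qed (use r in simp)
 have "EX G. bnd (1 / r) G&(ALL x. (%n. (SUM k<n. q ^ k) x)---->apply_op G x)"
  by (rule strong_limit_op[OF Tb]) (use s in "simp add: bop_sum_apply summable_iff_convergent")
 then obtain G where G:"!!x. (%n. (SUM k<n. q ^ k) x)---->apply_op G x" by blast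
 have tel:"h*(SUM k<n. q ^ k)=1 - q ^ n" for n
  by (induction n) (simp_all add: q_def algebra_simps)
 have "h*G=1"
 proof (rule bop_eqI)
  fix x
  have "(%n. h ((SUM k<n. q ^ k) x))---->h (G x)" by (rule tendsto_bop[OF G])
  moreover have "(%n. h ((SUM k<n. q ^ k) x))---->x-0"
  proof -
   have "h ((SUM k<n. q ^ k) x)=x-(q ^ n) x" for n using arg_cong[OF tel[of n], of "%T. apply_op T x"] by simp
   thus ?thesis using tendsto_diff[OF tendsto_const[of x] summable_LIMSEQ_zero[OF s[of x]]] by simp
  qed
  ultimately have "h (G x)=x-0" by (rule LIMSEQ_unique)
  thus "(h*G) x=apply_op 1 x" by simp
 qed
 moreover have "G:N" if N:"walg N" "h:N" for N
 proof -
  interpret N: walg N by (rule N(1))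
  show ?thesis by (rule N.w_limit[OF _ Tb G]) (intro N.w_ins, simp add: q_def N.w_ins N(2))
 qed
 ultimately show ?thesis by blast
qed

section \<open>From uniform mass to an intertwiner with expectation\<close>

section \<open>Building an intertwiner\<close>

context setting
begin

lemma E_bnd: assumes x:"x:M" and C:"bnd C x" shows "bnd C (E x)"
proof -
 have "e*rho x * e=rho (E x) * e" using H.e_x_e[of "rho x"] x by (simp add: R.img_rho)
 moreover have "bnd (1*C*1) (e*rho x * e)" by (intro bnd_mult H.e_bnd) (simp add: R.rho_bnd_iff x C)
 ultimately have "bnd C (rho (E x) * e)" by simp
 hence "bnd C (rho (E x))" by (rule H.bnd_from_e[rotated]) (use EK.E_in[OF x] in blast)
 thus ?thesis by (simp add: R.rho_bnd_iff E_M x)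
qed

text \<open>Smallness at \<open>xi\<close> in the standard representation controls bounded operators
  at vectors of the original space: \<open>compare_states\<close> is applied to
  \<open>adj T * T\<close> scaled into the unit ball.\<close>

lemma strong_from_state:
 assumes r:"0<r" and C:"0<C"
 shows "EX d>0. ALL T:M. bnd C T-->norm (rho T xi)<d-->norm (apply_op T x)<r"
proof -
 obtain kp where k:"!!x. x:M==>phi x=cinner kp (amp x kp)" "!!x. x:M==>amp x kp=0==>x=0" by (rule phi_vector) (rule that; assumption)
 have rc:"0<(r/C)^2" using r C by simp
 have "EX d>0. ALL X:M. pos X-->X[=1-->Re (cinner kp (amp X kp))<d-->Re (cinner (l2_single 0 x) (amp X (l2_single 0 x)))<(r/C)^2"
  by (rule compare_states[OF walgs(1) _ rc]) (rule k(2))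
 then obtain d where d:"0<d" "!!X. X:M==>pos X==>X[=1==>Re (phi X)<d==>Re (cinner x (X x))<(r/C)^2"
  by (auto simp: k(1) cinner_l2_single_left)
 show ?thesis
 proof (intro exI[of _ "C * sqrt d"] conjI ballI impI)
  show "0<C * sqrt d" using C d(1) by simp
  fix T assume T:"T:M" "bnd C T" "norm (rho T xi)<C * sqrt d"
  define X where "X=(1/C^2) .* (adj T*T)"
  have TT:"adj T*T:M" by (intro EK.M.w_ins T)
  have "Re (cinner x (X x))<(r/C)^2"
  proof (rule d(2))
   show "X:M" unfolding X_def by (intro EK.M.w_scaleR TT)
   show "pos X" unfolding X_def by (intro pos_scaleR pos_adj_mult) simp
   show "X[=1" using ple_scaleR[OF bnd_adj_mult_le[OF T(2)], of "1/C^2"] C by (simp add: X_def)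
   have "(norm (rho T xi))^2<(C * sqrt d)^2" using T(3) by (intro power_strict_mono) auto
   hence "(norm (rho T xi))^2<C^2 * d" using d(1) by (simp add: power_mult_distrib)
   moreover have "phi X = of_real ((1/C^2)*(norm (rho T xi))^2)"
    unfolding X_def P.g_scaleR[OF TT] phi_norm[OF T(1)] by (simp only: of_real_mult)
   hence "Re (phi X)=(1/C^2)*(norm (rho T xi))^2" by (simp only: Re_complex_of_real)
   moreover have "(1/C^2)*(C^2 * d)=d" using C by simp
   ultimately show "Re (phi X)<d" using C mult_strict_left_mono[of "(norm (rho T xi))^2" "C^2 * d" "1/C^2"] by simp
  qed
  moreover have "Re (cinner x (X x))=(1/C^2)*(norm (T x))^2"
   using Re_cinner_adj_mult[of x T] by (simp add: X_def cinner_scaleR_right)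
  ultimately have "(norm (T x))^2<r^2" using C by (simp add: power_divide field_simps)
  thus "norm (T x)<r" using r by (simp add: power_less_imp_less_base)
 qed
qed

text \<open>If no finite subset and bound worked, the sets \<open>S (K, d)\<close> of unitaries that
  are d-small on K would generate a proper filter along which \<open>E (adj b * u * a)\<close> tends
  strongly to zero.\<close>

lemma uniform_mass:
 assumes no:"~ (EX F. F~=bot&(\<forall>\<^sub>F u in F. u:unitaries A)&(ALL a:M. ALL b:M. strongly_tendsto (%u. E (adj b * u * a)) 0 F))"
 shows "EX K d. finite K&K<=M&0<d&(ALL u:unitaries A. EX a:K. EX b:K. d<=norm (rho (E (adj b * u * a)) xi))"
proof (rule ccontr)
 assume "~ ?thesis"
 hence ne:"EX u:unitaries A. ALL a:K. ALL b:K. norm (rho (E (adj b * u * a)) xi)<d" if "finite K" "K<=M" "0<d" for K d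
  using that by (meson not_le)
 define S where "S Kd={u:unitaries A. ALL a:fst Kd. ALL b:fst Kd. norm (rho (E (adj b * u * a)) xi)<snd Kd}" for Kd :: "'k bop set\<times>real"
 define I where "I={Kd :: 'k bop set\<times>real. finite (fst Kd)&fst Kd<=M&0<snd Kd}"
 define F where "F=(INF Kd\<in>I. principal (S Kd))"
 have evF:"eventually Q F\<longleftrightarrow>(EX Kd:I. ALL u:S Kd. Q u)" for Q
 proof -
  have "eventually Q F\<longleftrightarrow>(EX Kd:I. eventually Q (principal (S Kd)))"
   unfolding F_def
  proof (rule eventually_INF_base)
   have "({},1):I" by (simp add: I_def)
   thus "I~={}" by blast
   fix a b assume ab:"a:I" "b:I"
   show "EX x:I. principal (S x)<=inf (principal (S a)) (principal (S b))"
    by (rule bexI[of _ "(fst a\<union>fst b,min (snd a) (snd b))"]) (use ab in "auto simp: I_def S_def")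
  qed
  thus ?thesis by (simp add: eventually_principal)
 qed
 have Fb:"F~=bot"
 proof
  assume "F=bot"
  hence "eventually (%_. False) F" by simp
  then obtain Kd where "Kd:I" "S Kd={}" unfolding evF by blast
  thus False using ne[of "fst Kd" "snd Kd"] by (auto simp: I_def S_def)
 qed
 have FU:"\<forall>\<^sub>F u in F. u:unitaries A" unfolding evF by (rule bexI[of _ "({},1)"]) (auto simp: S_def I_def)
 have "strongly_tendsto (%u. E (adj b * u * a)) 0 F" if ab:"a:M" "b:M" for a b
  unfolding strongly_tendsto_def
 proof
  fix x
  obtain Ca Cb where C:"bnd Ca a" "bnd Cb b" using bnd_ex by metis
  define C where "C=Cb*1*Ca+1"
  have Cp:"0<C" using bndD(2)[OF C(1)] bndD(2)[OF C(2)] by (simp add: C_def add_nonneg_pos)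
  have "((%u. E (adj b * u * a) x)--->0) F"
  proof (rule tendstoI)
   fix r :: real assume r:"0<r"
   obtain d where d:"0<d" "!!T. T:M==>bnd C T==>norm (rho T xi)<d==>norm (apply_op T x)<r"
    using strong_from_state[OF r Cp, of x] by blast
   have "norm (E (adj b * u * a) x)<r" if u:"u:S ({a,b},d)" for u
   proof -
    have uA:"u:A" "adj u * u=1" using u unit_of_walg[OF walgs(2)] by (auto simp: S_def unitaries_def)
    have ub:"bnd 1 u" by (rule le_imp_bnd) (use uA in simp_all)
    have m:"adj b * u * a:M" using ab EAK.BM[OF uA(1)] by (intro EK.M.w_ins)
    have "bnd (Cb*1*Ca) (adj b * u * a)" by (intro bnd_mult bnd_adj C ub)
    hence "bnd C (E (adj b * u * a))" by (intro E_bnd m) (simp add: bnd_mono C_def)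
    thus ?thesis using u by (intro d(2) E_M m) (auto simp: S_def)
   qed
   thus "\<forall>\<^sub>F u in F. dist (E (adj b * u * a) x) 0<r"
    unfolding evF by (intro bexI[of _ "({a,b},d)"]) (use ab d(1) in "auto simp: I_def")
  qed
  thus "((%u. E (adj b * u * a) x)--->apply_op 0 x) F" by simp
 qed
 thus False using no Fb FU by blast
qed

lemma state_limit_strong:
 assumes X:"!!n. X n:M" "!!n. pos (X n)" "!!n. X n[=1" and lim:"(%n. Re (phi (X n)))---->0"
 shows "(%n. rho (X n) v)---->0"
proof (rule tendstoI)
 fix r :: real assume r:"0<r"
 obtain d where d:"0<d" "!!T. T:rho ` M==>bnd 1 T==>norm (T xi)<d==>norm (apply_op T v)<r"
  using H.strong_from_xi[OF r, of 1 v] by auto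
 have "\<forall>\<^sub>F n in sequentially. Re (phi (X n))<d^2" by (rule order_tendstoD(2)[OF lim]) (use d(1) in simp)
 thus "\<forall>\<^sub>F n in sequentially. dist (rho (X n) v) 0<r"
 proof (rule eventually_mono)
  fix n assume n:"Re (phi (X n))<d^2"
  have b:"bnd 1 (rho (X n))" using positive_bnd1[OF X(2,3)] X(1) by (simp add: R.rho_bnd_iff)
  have "rho (X n)[=1 .* 1" by (rule bnd_ple[OF b pos_adj[OF R.rho_positive[OF X(1,2)]]])
  hence "(norm (rho (X n) xi))^2<=Re (phi (X n))"
   using positive_norm_sq_le[OF R.rho_positive[OF X(1,2)], of 1 n xi] phi(4)[OF X(1)[of n]] by simp
  hence "(norm (rho (X n) xi))^2<d^2" using n by simp
  hence "norm (rho (X n) xi)<d" using d(1) by (simp add: power_less_imp_less_base)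
  thus "dist (rho (X n) v) 0<r" using d(2)[OF _ b] X(1) by simp
 qed
qed

end

context setting
begin

text \<open>\<open>k = EA (adj y * y)\<close> is central in A; on a central projection
  \<open>z0\<close> it has an inverse \<open>g\<close>. With \<open>y1 = y * z0\<close>, the map b
  -> g EA(y1^* b y1) inverts \<pi> on \<open>z0\<close>, which yields an expectation onto the image.
  It is faithful on the corner of the support \<open>f\<close> of \<open>E (y1 * adj y1)\<close>,
  and the polar part of \<open>adj y1\<close> is the required partial isometry.\<close>

theorem intertwiner_imp_intertwines:
 assumes pB:"!!a. a:A==>\<pi> a:B"
  and padd:"!!a b. a:A==>b:A==>\<pi> (a + b)=\<pi> a+\<pi> b" and psc:"!!c a. a:A==>\<pi> (c :* a)=c :* \<pi> a"
  and pmul:"!!a b. a:A==>b:A==>\<pi> (a * b)=\<pi> a*\<pi> b" and padj:"!!a. a:A==>\<pi> (adj a)=adj (\<pi> a)"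
  and pn:"!!X zt. (!!n. X n:A)==>(!!n. pos (X n))==>(!!n. X n[=1) ==>
   (%n. Re (phi (X n)))---->0==>(%n. \<pi> (X n) zt)---->0"
  and y:"y:M" "y~=0" and ya:"!!a. a:A==>y * a=\<pi> a * y"
 shows "intertwines M A B"
proof -
 note AM = EAK.BM and BM = EK.BM and Mi = EK.M.w_ins and Ai = EAK.B.w_ins and Bi = EK.B.w_ins
 have star:"adj v * \<pi> a=a * adj v" if a:"a:A" and v:"!!a. a:A==>v * a=\<pi> a * v" for v a
 proof -
  have "adj (v * adj a)=adj (\<pi> (adj a) * v)" using v[OF EAK.B.w_adj[OF a]] by simp
  thus ?thesis by (simp add: padj[OF a])
 qed
 have ymid:"adj y * y:M" by (intro Mi y)
 define k where "k=EA (adj y * y)"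
 have kA:"k:A" unfolding k_def by (rule EAK.E_in[OF ymid])
 have kpos:"pos k" unfolding k_def by (rule EAK.E_pos[OF ymid pos_adj_mult])
 have ka:"adj k=k" by (rule pos_adj[OF kpos])
 have kc:"a * k=k * a" if a:"a:A" for a
 proof -
  have "a*(adj y * y)=adj y * y * a" using star[OF a ya] ya[OF a] by (metis assoc)
  thus ?thesis using EAK.E_left[OF a ymid] EAK.E_right[OF a ymid] by (simp add: k_def)
 qed
 have k0:"k~=0" unfolding k_def using EAK.E_faithful[OF y(1)] y(2) by blast
 \<comment> \<open>A nonzero positive \<open>k\<close> exceeds some level \<open>d\<close>; the
   spectral projection \<open>z0\<close> of the part above \<open>d\<close> is then nonzero.\<close>
 have "EX d>0. ~ k[=d .* 1"
 proof (rule ccontr)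
  assume no:"~ ?thesis"
  have "k x=0" for x
  proof (rule positive_zero_vec[OF kpos], rule ccontr)
   let ?R = "Re (cinner x (k x))"
   assume "?R~=0"
   hence Rp:"0<?R" using posD(1)[OF kpos, of x] by simp
   let ?d = "?R/(2*((norm x)^2+1))"
   have np:"0<(norm x)^2+1" by (simp add: add_nonneg_pos)
   hence "k[=?d .* 1" using no Rp by auto
   from ple_Re[OF this, of x] have "?R<=?d*(norm x)^2" by (simp only: Re_cinner_scaleR_one)
   also have "...<=?d*((norm x)^2+1)" using Rp np by (intro mult_left_mono) auto
   also have "...=?R/2" using np by (simp add: field_simps)
   finally show False using Rp by simp
  qed
  hence "k=0" by (intro bop_eqI) simp
  thus False using k0 by simp
 qed
 then obtain d where d:"0<d" "~ k[=d .* 1" by blast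
 obtain C where C:"bnd C k" using bnd_ex by blast
 define c where "c=C + d"
 have c:"0<c" "d<=c" "k[=c .* 1"
  using d(1) bndD(2)[OF C] bnd_ple[OF bnd_mono[OF C, of c] ka] by (simp_all add: c_def)
 have Tsa:"adj (k - d .* 1)=k - d .* 1" by (simp add: ka)
 obtain D where D:"projection D" "pos (- ((k - d .* 1)*D))" "pos ((k - d .* 1)*(1-D))"
  "ALL N. walg N-->k - d .* 1:N-->D:N"
  using spectral_cut[OF Tsa] by (elim exE conjE) (rule that; assumption)
 have cA:"walg (commutant A)" by (rule walg_commutant[OF EAK.B.w_adj])
 have kd:"k - d .* 1:A" "k - d .* 1:commutant A" using kA kc by (auto simp: Ai commutant_def algebra_simps)
 have DA:"D:A" "D:commutant A" using D(4) kd cA walgs(2) by blast+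
 define z0 where "z0=1-D"
 have zA:"z0:A" unfolding z0_def by (intro Ai DA)
 have zc:"z0 * a=a * z0" if "a:A" for a using DA(2) that by (simp add: z0_def commutant_def algebra_simps)
 have zp:"projection z0" unfolding z0_def by (rule projection_compl[OF D(1)])
 note zz = projectionD[OF zp] and DD = projectionD[OF D(1)]
 have zD:"z0*D=0" by (simp add: z0_def DD algebra_simps)
 have z0:"z0~=0"
 proof
  assume "z0=0"
  hence "D=1" by (simp add: z0_def)
  thus False using D(2) d(2) by simp
 qed
 \<comment> \<open>\<open>h\<close> is \<open>k / c\<close> on \<open>z0\<close> and the identity on
   \<open>D\<close>, hence bounded below by \<open>d / c\<close>; dividing its inverse by
   \<open>c\<close> inverts \<open>k\<close> on \<open>z0\<close>.\<close>
 define h where "h=(1/c) .* (k * z0)+D"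
 have kzz:"z0 * k=k * z0" by (rule zc[OF kA])
 have h1:"h[=1"
 proof -
  have zkz:"z0*(k * z0)=k * z0" using kzz zz(1) by (metis assoc)
  have "1 - h=z0-(1/c) .* (k * z0)" by (simp add: h_def z0_def)
  also have "...=(1/c) .* (c .* z0 - k * z0)" using c(1) by (simp add: scaleR_right_diff_distrib)
  also have "c .* z0 - k * z0=adj z0*(c .* 1 - k) * z0"
   by (simp add: zz right_diff_distrib left_diff_distrib assoc zkz)
  finally have "1 - h=(1/c) .* (adj z0*(c .* 1 - k) * z0)" .
  thus ?thesis using c(1) pos_scaleR[OF pos_conj[OF c(3)], of "1/c"] by simp
 qed
 have h2:"(d / c) .* 1[=h"
 proof -
  have "h-(d / c) .* 1=(1/c) .* ((k - d .* 1)*(1-D))+(1 - d / c) .* D"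
   by (simp add: h_def z0_def algebra_simps scaleR_left_diff_distrib)
  moreover have "pos ((1/c) .* ((k - d .* 1)*(1-D))+(1 - d / c) .* D)"
   using c d by (intro pos_add pos_scaleR D(3) projection_positive D(1)) auto
  ultimately show ?thesis by simp
 qed
 obtain G where G:"h*G=1" "!!N. walg N==>h:N==>G:N"
  using inverse_exists[OF h1 h2] c d by auto
 have hA:"h:A" unfolding h_def by (intro Ai kA zA DA)
 have hc:"h:commutant A"
 proof -
  interpret cA: walg "commutant A" by (rule cA)
  have "k:commutant A" "z0:commutant A" using kc zc by (auto simp: commutant_def)
  thus ?thesis unfolding h_def by (intro cA.w_ins DA)
 qed
 have GA:"G:A" "G:commutant A" using G(2) hA hc cA walgs(2) by blast+
 define g where "g=(1/c) .* (z0*G)"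
 have gA:"g:A" unfolding g_def by (intro Ai zA GA)
 have gc:"g * a=a * g" if a:"a:A" for a
 proof -
  have "G * a=a*G" using GA(2) a by (simp add: commutant_def)
  hence "z0*G * a=a*(z0*G)" using zc[OF a] by (metis assoc)
  thus ?thesis by (simp add: g_def)
 qed
 have kg:"k * g=z0"
 proof -
  have "z0 * h=(1/c) .* (k * z0)" using zz zD kzz by (simp add: h_def distrib_left) (metis assoc)
  hence "(1/c) .* (k * z0)*G=z0" using G(1) by (metis assoc mult.right_neutral)
  thus ?thesis by (simp add: g_def assoc)
 qed
 have gk:"g * k=z0" using gc[OF kA] kg by simp
 have zg:"z0 * g=g" using zz by (simp add: g_def) (simp flip: assoc)
 have gpos:"pos g"
 proof -
  have "adj g * k * g=adj (z0 * g)" using kg zz(2) by (simp add: assoc)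
  hence p:"pos (adj g)" using pos_conj[OF kpos, of g] zg by simp
  from pos_adj[OF p] show ?thesis using p by simp
 qed
 define y1 where "y1=y * z0"
 have y1M:"y1:M" unfolding y1_def by (intro Mi y AM zA)
 have y1a:"y1 * a=\<pi> a * y1" if a:"a:A" for a
  using ya[OF a] zc[OF a] unfolding y1_def by (metis assoc)
 have y1s:"adj y1*\<pi> a=a * adj y1" if a:"a:A" for a by (rule star[OF a y1a])
 have mid:"adj y1 * b * y1:M" if "b:M" for b by (intro Mi y1M that)
 have y1z:"y1 * z0=y1" "z0 * adj y1=adj y1" using zz by (simp_all add: y1_def assoc) (simp flip: assoc)
 have EAy1:"EA (adj y1 * y1)=k * z0"
 proof -
  have "adj y1 * y1=z0*(adj y * y) * z0" by (simp add: y1_def zz assoc)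
  hence "EA (adj y1 * y1)=z0 * k * z0" using EAK.E_bimodule[OF zA zA ymid] by (simp add: k_def)
  thus ?thesis using kzz zz(1) by (simp add: assoc)
 qed
 have y10:"y1~=0"
 proof
  assume "y1=0"
  hence "k * z0=0" using EAy1 by (simp add: EAK.E_zero)
  hence "k*(z0 * g)=0" by (simp flip: assoc)
  thus False using zg kg z0 by simp
 qed
 have yyM:"y1 * adj y1:M" by (intro Mi y1M)
 define r0 where "r0=E (y1 * adj y1)"
 have rB:"r0:B" unfolding r0_def by (rule EK.E_in[OF yyM])
 have ra:"adj r0=r0" unfolding r0_def by (intro pos_adj EK.E_pos yyM pos_mult_adj)
 have yyc:"\<pi> a*(y1 * adj y1)=y1 * adj y1*\<pi> a" "\<pi> a*(y1 * adj y1)=y1 * a * adj y1" if a:"a:A" for a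
  using y1a[OF a] y1s[OF a] by (metis assoc)+
 have rc:"\<pi> a * r0=r0*\<pi> a" "\<pi> a * r0=E (y1 * a * adj y1)" if a:"a:A" for a
  using EK.E_left[OF pB[OF a] yyM] EK.E_right[OF pB[OF a] yyM] yyc[OF a] by (simp_all add: r0_def)
 obtain Q where Q:"projection Q" "r0*Q=0" "!!x. r0 x=0==>apply_op Q x=x" "!!N. walg N==>r0:N==>Q:N"
  using ker_projection[of r0] by blast
 note QQ = projectionD[OF Q(1)]
 have cP:"walg (commutant (\<pi> ` A))" by (rule walg_commutant) (use padj EAK.B.w_adj in "auto simp flip: padj")
 define f where "f=1-Q"
 have fp:"projection f" unfolding f_def by (rule projection_compl[OF Q(1)])
 note ff = projectionD[OF fp]
 have fB:"f:B" unfolding f_def by (intro Bi Q(4) walgs rB)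
 have fc:"f*\<pi> a=\<pi> a * f" if a:"a:A" for a
 proof -
  have "r0:commutant (\<pi> ` A)" using rc(1) by (auto simp: commutant_def)
  hence "Q:commutant (\<pi> ` A)" by (rule Q(4)[OF cP])
  thus ?thesis using a by (auto simp: f_def commutant_def algebra_simps)
 qed
 have kerf:"f*T=0" if T:"r0*T=0" for T
 proof (rule bop_eqI)
  fix x
  have "r0 (T x)=0" using arg_cong[OF T, of "%T. apply_op T x"] by simp
  thus "(f*T) x=apply_op 0 x" using Q(3) by (simp add: f_def)
 qed
 have fy:"f * y1=y1" "adj y1 * f=adj y1"
 proof -
  have qM:"Q:B" by (intro Q(4) walgs rB)
  have "E (adj (adj (Q * y1)) * adj (Q * y1))=E (Q*(y1 * adj y1)*Q)" by (simp add: QQ assoc)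
  also have "...=Q*(r0*Q)" unfolding EK.E_bimodule[OF qM qM yyM] r0_def by (simp add: assoc)
  finally have "adj (Q * y1)=0" using EK.E_faithful[of "adj (Q * y1)"] BM[OF qM] y1M Q(2) by (simp add: Mi)
  hence "Q * y1=0" using adj_adj adj_0 by metis
  thus 1:"f * y1=y1" by (simp add: f_def left_diff_distrib)
  show "adj y1 * f=adj y1" using arg_cong[OF 1, of adj] ff by simp
 qed
 \<comment> \<open>Cutting \<pi> by the support \<open>f\<close> makes its unit \<open>f\<close>
   (\<open>p1\<close>) and its kernel exactly the part of A under \<open>1 - z0\<close>
   (\<open>p_z\<close>, \<open>p_inj\<close>).\<close>
 define p where "p a=f*\<pi> a" for a
 have pB': "p a:B" if "a:A" for a unfolding p_def by (intro Bi fB pB that)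
 have p_add:"p (a + b)=p a + p b" and p_mul:"p (a * b)=p a * p b" if "a:A" "b:A" for a b
 proof -
  show "p (a + b)=p a + p b" by (simp add: p_def padd that distrib_left)
  have "p a * p b=f*(\<pi> a * f)*\<pi> b" by (simp add: p_def assoc)
  also have "...=f * f*\<pi> a*\<pi> b" unfolding fc[OF that(1), symmetric] by (simp add: assoc)
  finally show "p (a * b)=p a * p b" by (simp add: p_def pmul that ff assoc)
 qed
 have p_sc:"p (c :* a)=c :* p a" and p_adj:"p (adj a)=adj (p a)" if a:"a:A" for a c
  using fc[OF EAK.B.w_adj[OF a]] by (simp_all add: p_def psc padj a ff)
 have p_pos:"pos (p (adj a * a))" if a:"a:A" for a
  using p_mul[OF EAK.B.w_adj[OF a] a] p_adj[OF a] by (simp add: pos_adj_mult)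
 have p_y:"p a * y1=y1 * a" "adj y1 * p a=a * adj y1" if a:"a:A" for a
  using fc[OF a] fy y1a[OF a] y1s[OF a] unfolding p_def by (metis assoc)+
 have p1:"p 1=f"
 proof -
  have 1:"(1 :: 'k bop):A" by (intro Ai)
  have "r0*(1-\<pi> 1)=0" using rc[OF 1] by (simp add: right_diff_distrib r0_def)
  hence "f*(1-\<pi> 1)=0" by (rule kerf)
  thus ?thesis by (simp add: p_def right_diff_distrib)
 qed
 have p_z:"p (z0 * a)=p a" if a:"a:A" for a
 proof -
  have Da:"D * a:A" by (intro Ai DA a)
  have "y1*D=0" using zD by (simp add: y1_def assoc)
  hence "E (y1*(D * a) * adj y1)=0" by (simp add: EK.E_zero flip: assoc)
  hence "f*\<pi> (D * a)=0" using rc[OF Da] kerf by metis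
  moreover have "a=z0 * a+D * a" by (simp add: z0_def algebra_simps)
  ultimately show ?thesis using p_add[OF EAK.B.w_mult[OF zA a] Da] by (simp add: p_def)
 qed
 have p_inj:"z0 * a=0" if a:"a:A" "p a=0" for a
 proof -
  have "y1 * a=0" using p_y(1)[OF a(1)] a(2) by simp
  hence "EA (adj y1 * y1 * a)=0" by (simp add: assoc EAK.E_zero)
  hence "k * z0 * a=0" using EAK.E_right[OF a(1), of "adj y1 * y1"] EAy1 y1M by (simp add: Mi)
  hence "g * k*(z0 * a)=0" by (simp add: assoc)
  thus ?thesis using zz(1) unfolding gk by (simp flip: assoc)
 qed
 have p_lin:"linear_map_on A p" by (simp add: linear_map_on_def p_add p_sc)
 have p_normal:"normal_on A p"
 proof -
  obtain kp where kk:"!!x. x:M==>phi x=cinner kp (amp x kp)" by (rule phi_vector) (rule that; assumption)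
  show ?thesis
  proof (rule normal_mapI[OF walgs(2) p_lin p_pos])
   fix X zt assume X:"!!n. X n:A" "!!n. pos (X n)" "!!n. X n[=1" and l:"(%n. Re (cinner kp (amp (X n) kp)))---->0"
   have "(%n. \<pi> (X n) zt)---->0" by (rule pn[OF X]) (use l kk AM X(1) in simp)
   hence "(%n. Re (cinner zt (f (\<pi> (X n) zt))))---->Re (cinner zt (f 0))"
    by (intro tendsto_Re tendsto_cinner tendsto_const tendsto_bop)
   thus "(%n. Re (cinner zt (p (X n) zt)))---->0" by (simp add: p_def)
  qed
 qed
 define Pi where "Pi a=tp (p a)" for a
 have Pi:"Pi (a + b)=Pi a+Pi b" "Pi (a * b)=Pi a*Pi b" if "a:A" "b:A" for a b
  using that by (simp_all add: Pi_def p_add p_mul tp_simps)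
 have Pi': "Pi (c :* a)=c :* Pi a" "Pi (adj a)=adj (Pi a)" if "a:A" for a c
  using that by (simp_all add: Pi_def p_sc p_adj tp_simps tp_adj)
 have Pi_normal:"normal_on A Pi" unfolding Pi_def by (rule normal_compose[OF p_normal UNIV_I tp_normal])
 have Pi_hom:"normal_star_hom A Pi" using Pi Pi' Pi_normal by (simp add: normal_star_hom_def linear_map_on_def)
 define m where "m b=g*EA (adj y1 * b * y1)" for b
 have mA:"m b:A" if "b:M" for b unfolding m_def by (intro Ai gA EAK.E_in mid that)
 have m_add:"m (b + b')=m b + m b'" if "b:M" "b':M" for b b'
  using EAK.E_add[OF mid[OF that(1)] mid[OF that(2)]] by (simp add: m_def algebra_simps)
 have m_sc:"m (s :* b)=s :* m b" if "b:M" for b s using EAK.E_scaleC[OF mid[OF that]] by (simp add: m_def)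
 have m_pos:"pos (m b)" if b:"b:M" "pos b" for b
 proof -
  have eA:"EA (adj y1 * b * y1):A" by (intro EAK.E_in mid b)
  obtain S where S:"pos S" "S*S=EA (adj y1 * b * y1)" "S:A"
   using sqrt_exists[OF EAK.E_pos[OF mid[OF b(1)] pos_conj[OF b(2)]]] eA walgs(2) by blast
  have "m b=adj S * g*S" unfolding m_def S(2)[symmetric] pos_adj[OF S(1)] using gc[OF S(3)] by (metis assoc)
  thus ?thesis using pos_conj[OF gpos] by simp
 qed
 have m_bim:"m (p a * b * p a')=a * m b * a'" if h:"a:A" "b:M" "a':A" for a b a'
 proof -
  have "adj y1*(p a * b * p a') * y1=a*(adj y1 * b * y1) * a'" using p_y[OF h(1)] p_y[OF h(3)] by (metis assoc)
  thus ?thesis using EAK.E_bimodule[OF h(1,3) mid[OF h(2)]] gc[OF h(1)] by (simp add: m_def) (metis assoc)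
 qed
 have m_p:"m (p a)=z0 * a" if a:"a:A" for a
 proof -
  have "adj y1 * p a * y1=adj y1 * y1 * a" using p_y(1)[OF a] by (simp add: assoc)
  hence "EA (adj y1 * p a * y1)=k * z0 * a" using EAK.E_right[OF a, of "adj y1 * y1"] EAy1 y1M by (simp add: Mi)
  thus ?thesis using gk zz(1) by (simp add: m_def) (metis assoc)
 qed
 have m_faithful:"b=0" if b:"b:B" "b * f=b" "p (m (adj b * b))=0" for b
 proof -
  have bM:"b:M" by (rule BM[OF b(1)])
  have bb:"adj b * b:M" by (intro Mi bM)
  have "z0 * m (adj b * b)=0" by (rule p_inj[OF mA[OF bb] b(3)])
  hence "m (adj b * b)=0" using zg by (simp add: m_def flip: assoc)
  hence "k * g*EA (adj y1*(adj b * b) * y1)=0" by (simp add: m_def assoc)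
  hence "EA (z0*(adj y1*(adj b * b) * y1))=0" using EAK.E_left[OF zA mid[OF bb]] kg by simp
  hence "EA (adj (b * y1)*(b * y1))=0" using y1z(2) by (simp add: assoc[symmetric])
  hence by0:"b * y1=0" using EAK.E_faithful[of "b * y1"] bM y1M by (simp add: Mi)
  have "b * r0=E (b*(y1 * adj y1))" using EK.E_left[OF b(1) yyM] by (simp add: r0_def)
  hence br:"b * r0=0" using by0 by (simp add: EK.E_zero flip: assoc)
  have "r0 * adj b=0" using arg_cong[OF br, of adj] ra by simp
  hence fb:"f * adj b=0" by (rule kerf)
  have "b * f=0" using arg_cong[OF fb, of adj] ff by simp
  thus ?thesis using b(2) by simp
 qed
 define Et where "Et R=Pi (m (entry R))" for R
 have Et_tp:"Et (tp b)=Pi (m b)" for b by (simp add: Et_def)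
 have m_normal:"normal_on M m"
 proof -
  have 1:"normal_on M EA" using vA(6) by (simp add: cond_expectation_def)
  have 2:"normal_on M (%b. EA (adj y1 * b * y1))" by (rule normal_compose[OF normal_conj mid 1])
  show ?thesis using normal_compose[OF 2 UNIV_I normal_conj[of UNIV g 1]] by (simp add: m_def[abs_def])
 qed
 have Et_normal:"normal_on (tp ` M) Et"
  unfolding Et_def by (rule normal_compose[OF normal_compose[OF entry_normal _ m_normal] _ Pi_normal]) (use mA in auto)
 have Et_Pi:"Et (Pi a)=Pi a" if "a:A" for a
  using Et_tp[of "p a"] m_p[OF that] p_z[OF that] by (simp add: Pi_def)
 have PiM:"Pi ` A<=tp ` M" using pB' BM by (auto simp: Pi_def)
 \<comment> \<open>The image is the fixed-point set of the normal map \<open>Et\<close>, hence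
   closed by \<open>closedin_fixed\<close>.\<close>
 have eqPi:"Pi ` A={R:tp ` M. Et R=R}"
 proof
  show "Pi ` A<={R:tp ` M. Et R=R}" using PiM Et_Pi by auto
  show "{R:tp ` M. Et R=R}<=Pi ` A"
  proof
   fix R assume "R:{R:tp ` M. Et R=R}"
   then obtain b where "b:M" "R=tp b" "Et R=R" by blast
   hence "R=Pi (m b)" "m b:A" using Et_tp mA by auto
   thus "R:Pi ` A" by blast
  qed
 qed
 have vnM:"von_neumann_algebra (tp ` M)" by (rule von_neumann_tp[OF vM(1)])
 have vnPi:"von_neumann_algebra (Pi ` A)"
 proof -
  have cl:"closedin sigma_weak (Pi ` A)"
   unfolding eqPi by (rule closedin_fixed[OF _ Et_normal]) (use vnM in "simp add: von_neumann_algebra_def")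
  have "Pi 0=0" using Pi'(1)[OF EAK.B.w_one, of 0] by (simp add: scaleC_zero_left)
  hence "0:Pi ` A" using EAK.B.w_zero by force
  moreover have "x + x':Pi ` A&x * x':Pi ` A" if "x:Pi ` A" "x':Pi ` A" for x x'
   using that by (auto simp: Ai simp flip: Pi)
  moreover have "c :* x:Pi ` A&adj x:Pi ` A" if "x:Pi ` A" for x c
   using that by (auto simp: Ai simp flip: Pi')
  ultimately show ?thesis using cl by (simp add: von_neumann_algebra_def)
 qed
 have Pi1:"Pi 1=tp f" by (simp add: Pi_def p1)
 have unit:"unit_of (Pi ` A)=tp f"
  unfolding unit_of_def
 proof (rule the_equality)
  have "Pi 1 * x=x&x*Pi 1=x" if "x:Pi ` A" for x using that Pi(2) EAK.B.w_one by (auto simp flip: Pi(2))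
  thus "tp f:Pi ` A&(ALL x:Pi ` A. tp f * x=x&x * tp f=x)" using Pi1 EAK.B.w_one by (metis imageI)
  fix q assume q:"q:Pi ` A&(ALL x:Pi ` A. q * x=x&x * q=x)"
  then obtain a where a:"a:A" "q=Pi a" by blast
  have "q*Pi 1=q" using Pi(2)[OF a(1) EAK.B.w_one] a(2) by simp
  moreover have "q*Pi 1=Pi 1" using q EAK.B.w_one by blast
  ultimately show "q=tp f" using Pi1 by simp
 qed
 let ?W = "vn_tensor B (corner p0 UNIV)"
 have W:"?W=tp ` B" by (rule vn_tensor_p0[OF vB(1)])
 have tff:"tp f * tp f=tp f" by (simp add: ff flip: tp_simps)
 have Nel:"EX b:B. R=tp b&f * b=b&b * f=b" if R:"R:corner (tp f) (corner (tp f) ?W)" for R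
 proof -
  obtain b where b:"b:B" "R=tp f*(tp f * tp b * tp f) * tp f" using R unfolding W unfolding corner_def by blast
  have "R=tp (f * b * f)" unfolding b(2) by (simp add: ff assoc flip: tp_simps) (simp add: ff flip: assoc)
  thus ?thesis using b(1) fB ff(1) by (intro bexI[of _ "f * b * f"]) (simp_all add: Bi assoc, simp flip: assoc)
 qed
 have NM:"corner (tp f) (corner (tp f) ?W)<=tp ` M" using Nel BM by blast
 have Pisub:"Pi ` A<=corner (tp f) ?W"
 proof
  fix x assume "x:Pi ` A"
  then obtain a where a:"a:A" "x=Pi a" by blast
  have "x=Pi 1 * x*Pi 1" using a Pi(2) EAK.B.w_one by (simp flip: Pi(2) add: Ai)
  hence "x=tp f * tp (p a) * tp f" using a by (simp add: Pi1) (simp add: Pi_def)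
  thus "x:corner (tp f) ?W" unfolding W unfolding corner_def using pB'[OF a(1)] by blast
 qed
 have ce:"cond_expectation (corner (tp f) (corner (tp f) ?W)) (Pi ` A) Et"
  unfolding cond_expectation_def
 proof (intro conjI)
  show "Et ` corner (tp f) (corner (tp f) ?W)<=Pi ` A"
  proof
   fix X assume "X:Et ` corner (tp f) (corner (tp f) ?W)"
   then obtain b where "b:B" "X=Et (tp b)" using Nel by blast
   thus "X:Pi ` A" using Et_tp mA BM by auto
  qed
  show "ALL a:Pi ` A. Et a=a" using Et_Pi by blast
  show "linear_map_on (corner (tp f) (corner (tp f) ?W)) Et"
   unfolding linear_map_on_def
  proof (intro conjI ballI allI)
   fix R R' assume "R:corner (tp f) (corner (tp f) ?W)" "R':corner (tp f) (corner (tp f) ?W)"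
   then obtain b b' where "b:M" "R=tp b" "b':M" "R'=tp b'" using NM by blast
   thus "Et (R+R')=Et R+Et R'" by (simp add: Et_def entry_simps m_add Pi mA)
  next
   fix s R assume "R:corner (tp f) (corner (tp f) ?W)"
   then obtain b where "b:M" "R=tp b" using NM by blast
   thus "Et (s :* R)=s :* Et R" by (simp add: Et_def entry_simps m_sc Pi' mA)
  qed
  show "ALL x:corner (tp f) (corner (tp f) ?W). pos x-->pos (Et x)"
  proof (intro ballI impI)
   fix R assume R:"R:corner (tp f) (corner (tp f) ?W)" "pos R"
   then obtain b where b:"b:M" "R=tp b" using NM by blast
   have bp:"pos b" using entry_positive[OF R(2)] b(2) by simp
   obtain S where S:"pos S" "S*S=m b" "S:A" using sqrt_exists[OF m_pos[OF b(1) bp]] mA[OF b(1)] walgs(2) by blast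
   have "pos (p (m b))" using p_pos[OF S(3)] pos_adj[OF S(1)] S(2) by simp
   thus "pos (Et R)" unfolding b(2) Et_tp Pi_def by (rule tp_positive)
  qed
  show "ALL a:Pi ` A. ALL b:Pi ` A. ALL x:corner (tp f) (corner (tp f) ?W). Et (a * x * b)=a*Et x * b"
  proof (intro ballI)
   fix X X' R assume h:"X:Pi ` A" "X':Pi ` A" "R:corner (tp f) (corner (tp f) ?W)"
   then obtain a a' b where b:"a:A" "X=Pi a" "a':A" "X'=Pi a'" "b:M" "R=tp b" using NM by blast
   have "X*R*X'=tp (p a * b * p a')" by (simp add: b Pi_def tp_simps)
   thus "Et (X*R*X')=X*Et R*X'" using m_bim[OF b(1,5,3)] b mA[OF b(5)] by (simp add: Et_tp Pi Ai)
  qed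
  show "ALL x:corner (tp f) (corner (tp f) ?W). Et (adj x * x)=0-->x=0"
  proof (intro ballI impI)
   fix R assume R:"R:corner (tp f) (corner (tp f) ?W)" "Et (adj R*R)=0"
   then obtain b where b:"b:B" "R=tp b" "b * f=b" using Nel by blast
   have "adj R*R=tp (adj b * b)" by (simp add: b(2) tp_simps tp_adj)
   hence "tp (p (m (adj b * b)))=0" using R(2) Et_tp by (simp add: Pi_def)
   hence "entry (tp (p (m (adj b * b))))=entry (tp 0)" by (simp only: tp_simps(4))
   hence "b=0" by (intro m_faithful[OF b(1,3)]) (simp only: entry_tp)
   thus "R=0" by (simp add: b(2) tp_simps)
  qed
  show "normal_on (corner (tp f) (corner (tp f) ?W)) Et" by (rule normal_on_subset[OF Et_normal NM])
 qed
 have we:"with_expectation (Pi ` A) (corner (tp f) ?W)"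
  unfolding with_expectation_def unit using vnPi Pisub ce by blast
 obtain V R P where pol:"pos R" "R*R=adj (adj y1) * adj y1" "adj y1=V*R" "adj V*V=1-P" "projection P"
   "ALL N. walg N-->adj y1:N-->V:N&R:N&P:N"
   "ALL a b. adj y1 * b=a * adj y1-->R * b=b*R-->V * b=a*V"
  using polar_decomposition[of "adj y1"] by (elim exE conjE) (rule that; assumption)
 \<comment> \<open>\<open>polar_decomposition\<close> places \<open>R\<close> in the algebras
   containing \<open>adj y1\<close>, whereas it is \<open>y1 * adj y1\<close> that commutes with
   \<pi>; uniqueness identifies \<open>R\<close> with a root that commutes as well.\<close>
 obtain S where S:"pos S" "S*S=adj (adj y1) * adj y1" "ALL N. walg N-->adj (adj y1) * adj y1:N-->S:N"
  using sqrt_exists[OF pos_adj_mult[of "adj y1"]] by blast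
 have RS:"R=S" by (rule sqrt_unique[OF pol(1) S(1)]) (use S pol(2) in auto)
 have Rc:"R * x=x*R" if x:"adj x:X" "x:X" "!!x. x:X==>adj x:X" "!!x. x:X==>x*(y1 * adj y1)=y1 * adj y1 * x" for x X
 proof -
  have "adj (adj y1) * adj y1:commutant X" using x(4) by (simp add: commutant_def)
  hence "S:commutant X" using S(3) walg_commutant[OF x(3)] by blast
  thus ?thesis using x(2) RS by (simp add: commutant_def)
 qed
 have VM:"V:M" using pol(6) walgs(1) EK.M.w_adj[OF y1M] by blast
 have V0:"V~=0" using pol(3) y10 adj_adj[of y1] by auto
 have Va:"V*\<pi> a=a*V" if a:"a:A" for a
 proof -
  have "R*\<pi> a=\<pi> a*R"
   by (rule Rc[of "\<pi> a" "\<pi> ` A"]) (use a yyc(1) padj EAK.B.w_adj in "auto simp flip: padj")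
  thus ?thesis using pol(7) y1s[OF a] by blast
 qed
 have Vf:"V * f=V"
 proof -
  have "y1 * adj y1 * f=f*(y1 * adj y1)" using fy by (simp add: assoc) (simp add: fy flip: assoc)
  hence "R * f=f*R" by (intro Rc[of f "{f}"]) (use ff in auto)
  hence "V * f=1*V" using pol(7)[rule_format, of f 1] fy(2) by simp
  thus ?thesis by simp
 qed
 have pV:"partial_isometry (tp V)"
 proof -
  have q:"projection (adj V*V)" unfolding pol(4) by (rule projection_compl[OF pol(5)])
  have "adj (tp V) * tp V=tp (adj V*V)" by (simp add: tp_simps tp_adj)
  thus ?thesis using projectionD[OF q] unfolding partial_isometry_def projection_def by (simp add: tp_simps(3)[symmetric] tp_adj[symmetric] del: adj_mult)
 qed
 have t1:"tensor_op (unit_of A) p0=tp 1" by (simp add: tp_def unit_of_walg[OF walgs(2)])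
 show ?thesis
  unfolding intertwines_def
 proof (rule exI[of _ p0], rule exI[of _ p0], rule exI[of _ "tp f"], rule exI[of _ Pi], rule exI[of _ "tp V"], intro conjI ballI)
  show "projection p0" "minimal_projection (corner p0 UNIV) p0" by (rule p0_projection, rule p0_minimal)
  show "projection (tp f)" using ff unfolding projection_def by (simp flip: tp_simps tp_adj)
  show "tp f:?W" unfolding W using fB by blast
  show "normal_star_hom A Pi" by (rule Pi_hom)
  show "Pi (unit_of A)=tp f" by (simp add: unit_of_walg[OF walgs(2)] Pi1)
  show "with_expectation (Pi ` A) (corner (tp f) ?W)" by (rule we)
  have "tp V=tp 1 * tp V * tp f" by (simp add: Vf flip: tp_simps)
  thus "tp V:{tensor_op (unit_of A) p0 * x * tp f |x. x:vn_tensor M (corner p0 UNIV)}"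
   unfolding t1 vn_tensor_p0[OF vM(1)] using VM by blast
  show "partial_isometry (tp V)" by (rule pV)
  show "tp V~=0"
  proof
   assume "tp V=0"
   hence "entry (tp V)=entry (tp 0)" by (simp only: tp_simps(4))
   thus False using V0 by simp
  qed
  fix a assume a:"a:A"
  have "V * p a=a*V" unfolding p_def using Vf Va[OF a] by (metis assoc)
  moreover have "tensor_op a p0 * tp V=tp (a*V)" by (simp add: tp_def tensor_op_mult projectionD(1)[OF p0_projection])
  ultimately show "tp V*Pi a=tensor_op a p0 * tp V" by (simp add: Pi_def flip: tp_simps)
 qed
qed

theorem mass_imp_intertwines:
 assumes no:"~ (EX F. F~=bot&(\<forall>\<^sub>F u in F. u:unitaries A)&(ALL a:M. ALL b:M. strongly_tendsto (%u. E (adj b * u * a)) 0 F))"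
 shows "intertwines M A B"
proof -
 note AM = EAK.BM and BM = EK.BM and Mi = EK.M.w_ins
 obtain K d where K:"finite K" "K<=M" "0<d" "!!u. u:unitaries A==>EX a:K. EX b:K. d<=norm (rho (E (adj b * u * a)) xi)"
  using uniform_mass[OF no] by blast
 obtain f and n :: nat where f:"K=f ` {i. i<n}" using finite_imp_nat_seg_image_inj_on[OF K(1)] by blast
 have fM:"f i:M" if "i<n" for i using that f K(2) by blast
 obtain s :: "nat=>'k bop" where s:"!!n. s n:B" "!!m n. adj (s m) * s n=(if m=n then 1 else 0)" "!!n. 1 * s n=s n"
  by (rule TBk.orthogonal_isometries[OF vB(3) projection_1]) (rule that; assumption)
 \<comment> \<open>One element for the whole finite set: \<open>a0 * s j = f j\<close>. Since
   \<open>adj (s i)\<close> is a contraction of B, the mass at \<open>f i\<close> is at most the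
   mass at \<open>a0\<close>.\<close>
 define a0 where "a0=(SUM i<n. f i * adj (s i))"
 have a0M:"a0:M" unfolding a0_def by (intro EK.M.w_sum) (simp add: fM Mi BM s(1))
 have a0s:"a0 * s j=f j" if j:"j<n" for j
 proof -
  have "a0 * s j=(SUM i<n. f i*(adj (s i) * s j))" by (simp add: a0_def sum_distrib_right assoc)
  also have "...=(SUM i<n. if i=j then f i else 0)" by (intro sum.cong) (auto simp: s(2))
  finally show ?thesis using j by simp
 qed
 have mass:"d^2<=(SUM j<n. (norm (R.img E (adj (rho a0) * u*rho (f j)) xi))^2)" if u:"u:H.TA.unitary_group" for u
 proof -
  obtain v where v:"v:A" "u=rho v" using H.TA.unitary_groupD(1)[OF u] by blast
  have vM:"v:M" by (rule AM[OF v(1)])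
  have "rho (adj v * v)=rho 1" "rho (v * adj v)=rho 1"
   using H.TA.unitary_groupD(2,3)[OF u] vM by (simp_all add: v(2) R.rho_mult R.rho_adj R.rho_one Mi)
  hence "adj v * v=1" "v * adj v=1" using inj_onD[OF R.inj] vM by (simp_all add: Mi)
  hence "v:unitaries A" using v(1) unit_of_walg[OF walgs(2)] by (simp add: unitaries_def)
  then obtain a b where ab:"a:K" "b:K" "d<=norm (rho (E (adj b * v * a)) xi)" using K(4) by blast
  obtain i j where ij:"i<n" "b=f i" "j<n" "a=f j" using ab f by blast
  have M1:"adj a0 * v * f j:M" by (intro Mi a0M vM fM ij)
  have "adj (f i) * v * f j=adj (s i)*(adj a0 * v * f j)" unfolding a0s[OF ij(1), symmetric] by (simp add: assoc)
  hence "E (adj (f i) * v * f j)=adj (s i)*E (adj a0 * v * f j)" using EK.E_left[OF EK.B.w_adj[OF s(1)] M1] by simp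
  hence "rho (E (adj (f i) * v * f j)) xi=rho (adj (s i)) (rho (E (adj a0 * v * f j)) xi)"
   using BM[OF EK.B.w_adj[OF s(1)]] E_M[OF M1] by (simp add: R.rho_mult)
  moreover have "bnd 1 (rho (adj (s i)))"
  proof -
   have "bnd 1 (s i)" by (rule le_imp_bnd) (simp_all add: s(2))
   thus ?thesis using bnd_adj BM[OF EK.B.w_adj[OF s(1)]] by (simp add: R.rho_bnd_iff)
  qed
  ultimately have "norm (rho (E (adj (f i) * v * f j)) xi)<=norm (rho (E (adj a0 * v * f j)) xi)" using bndD(1) by fastforce
  hence "d<=norm (rho (E (adj a0 * v * f j)) xi)" using ab(3) ij by simp
  moreover have "R.img E (adj (rho a0) * u*rho (f j))=rho (E (adj a0 * v * f j))"
   using R.img_rho[OF M1, of E] a0M vM fM[OF ij(3)] by (simp add: v(2) R.rho_mult R.rho_adj Mi)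
  ultimately have "d^2<=(norm (R.img E (adj (rho a0) * u*rho (f j)) xi))^2" using K(3) by (intro power_mono) auto
  also have "...<=(SUM j<n. (norm (R.img E (adj (rho a0) * u*rho (f j)) xi))^2)" using ij(3) by (intro member_le_sum) auto
  finally show ?thesis .
 qed
 have rs:"adj (rho (s i))*rho (s j)=(if i=j then 1 else 0)" for i j
 proof -
  have "adj (rho (s i))*rho (s j)=rho (adj (s i) * s j)" using BM[OF s(1)] by (simp add: R.rho_mult R.rho_adj Mi)
  thus ?thesis by (simp add: s(2) R.rho_one R.rho_zero)
 qed
 interpret Q: popa_min "rho ` M" "rho ` B" "rho ` A" "R.img E" "R.img EA" xi e "rho a0" "rho (s 0)" "rho (s 1)" "%j. rho (f j)" n "d^2"
  by (intro popa_min.intro H.popa_axioms popa_min_axioms.intro) (use a0M fM K(3) mass s(1) rs in auto)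
 obtain \<pi>' V z where pz:"!!a. a:rho ` A==>\<pi>' a:rho ` B" "!!a. a:rho ` A==>\<pi>' a * e=V * a * adj V" "bnd 1 V"
  "!!a b. a:rho ` A==>b:rho ` A==>\<pi>' (a * b)=\<pi>' a*\<pi>' b" "z:rho ` M" "z~=0" "!!a. a:rho ` A==>z * a=\<pi>' a * z"
  by (rule Q.intertwiner) (rule that; assumption)
 have "ALL a:A. EX b:B. rho b=\<pi>' (rho a)" using pz(1) by (metis imageE imageI)
 then obtain \<pi> where pi:"!!a. a:A==>\<pi> a:B" "!!a. a:A==>rho (\<pi> a)=\<pi>' (rho a)" by metis
 obtain y where y:"y:M" "z=rho y" using pz(5) by blast
 have piM:"\<pi> a:M" if "a:A" for a by (rule BM[OF pi(1)[OF that]])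
 have pe:"rho (\<pi> a) * e=V*rho a * adj V" if "a:A" for a using pz(2) pi(2) that by simp
 have eqB:"b=b'" if b:"b:M" "b':M" "rho b * e=rho b' * e" for b b'
 proof -
  have "rho (b - b') * e=0" using b by (simp add: R.rho_diff left_diff_distrib)
  hence "rho (b - b')=0" by (rule H.mult_e_zero[rotated]) (intro imageI EK.M.w_diff b)
  hence "b - b'=0" using b by (intro R.rho_eq_0 Mi)
  thus ?thesis by simp
 qed
 have Ai:"a + b:A" "c :* a:A" "adj a:A" if "a:A" "b:A" for a b c using that by (auto intro: EAK.B.w_ins)
 show ?thesis
 proof (rule intertwiner_imp_intertwines[of \<pi> y])
  fix a assume a:"a:A"
  show "\<pi> a:B" by (rule pi(1)[OF a])
  show "\<pi> (c :* a)=c :* \<pi> a" for c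
   by (rule eqB) (use a piM Ai in "simp_all add: Mi R.rho_scaleC pe AM")
  show "\<pi> (adj a)=adj (\<pi> a)"
  proof (rule eqB)
   have "rho (\<pi> (adj a)) * e=adj (rho (\<pi> a) * e)" using a Ai(3)[OF a a] by (simp add: pe R.rho_adj AM assoc)
   also have "...=e*rho (adj (\<pi> a))" using H.ee(2) by (simp add: R.rho_adj piM[OF a])
   also have "...=rho (adj (\<pi> a)) * e" by (rule H.e_commute) (use EK.B.w_adj[OF pi(1)[OF a]] in blast)
   finally show "rho (\<pi> (adj a)) * e=rho (adj (\<pi> a)) * e" .
  qed (use piM a Ai Mi in auto)
  have "rho (y * a)=rho (\<pi> a * y)" using pz(7)[of "rho a"] a y pi(2)[OF a] by (simp add: R.rho_mult AM piM)
  thus "y * a=\<pi> a * y" by (rule inj_onD[OF R.inj]) (intro EK.M.w_mult y(1) AM piM a)+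
  fix b assume b:"b:A"
  show "\<pi> (a + b)=\<pi> a+\<pi> b"
   by (rule eqB) (use a b piM Ai in "simp_all add: Mi R.rho_add pe AM distrib_left distrib_right")
  have "rho (\<pi> (a * b))=rho (\<pi> a*\<pi> b)"
   using pz(4)[of "rho a" "rho b"] a b pi(2) by (simp add: R.rho_mult AM piM EAK.B.w_mult)
  thus "\<pi> (a * b)=\<pi> a*\<pi> b"
   by (rule inj_onD[OF R.inj]) (intro EK.M.w_mult piM EAK.B.w_mult a b)+
 next
  show "y:M" by (rule y(1))
  show "y~=0" using pz(6) y(2) R.rho_zero by auto
 next
  fix X zt assume X:"!!n. X n:A" "!!n. pos (X n)" "!!n. X n[=1" and l:"(%n. Re (phi (X n)))---->0"
  have XM:"X n:M" for n by (rule AM[OF X(1)])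
  have Xb:"bnd 1 (rho (X n))" for n using positive_bnd1[OF X(2,3)] XM by (simp add: R.rho_bnd_iff)
  have pb:"bnd 1 (\<pi> (X n))" for n
  proof -
   have "bnd (1*1*1) (V*rho (X n) * adj V)" by (intro bnd_mult bnd_adj pz(3) Xb)
   hence "bnd 1 (rho (\<pi> (X n)) * e)" by (simp add: pe X(1))
   hence "bnd 1 (rho (\<pi> (X n)))" by (rule H.bnd_from_e[rotated]) (use pi(1)[OF X(1)] in blast)
   thus ?thesis by (simp add: R.rho_bnd_iff piM[OF X(1)])
  qed
  \<comment> \<open>Because \<open>e\<close> fixes \<open>xi\<close>, the vector
    \<open>rho (\<pi> (X n)) xi\<close> equals \<open>V\<close> applied to
    \<open>rho (X n) (adj V xi)\<close>, so normality of \<pi> is inherited from A.\<close>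
  have st:"(%n. rho (\<pi> (X n)) xi)---->0"
  proof -
   have "(%n. V (rho (X n) (adj V xi)))---->V 0" by (intro tendsto_bop state_limit_strong XM X l)
   moreover have "rho (\<pi> (X n)) xi=V (rho (X n) (adj V xi))" for n
    using arg_cong[OF pe[OF X(1)[of n]], of "%T. apply_op T xi"] by (simp add: H.e_xi)
   ultimately show ?thesis by simp
  qed
  show "(%n. \<pi> (X n) zt)---->0"
  proof (rule tendstoI)
   fix r :: real assume r:"0<r"
   obtain d where d:"0<d" "!!T. T:M==>bnd 1 T==>norm (rho T xi)<d==>norm (apply_op T zt)<r"
    using strong_from_state[OF r zero_less_one, of zt] by blast
   have "\<forall>\<^sub>F n in sequentially. norm (rho (\<pi> (X n)) xi)<d" using tendstoD[OF st d(1)] by simp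
   thus "\<forall>\<^sub>F n in sequentially. dist (\<pi> (X n) zt) 0<r"
    by (rule eventually_mono) (use d(2)[OF piM[OF X(1)] pb] in simp)
  qed
 qed
qed

end

section \<open>From a vanishing net to the ucp map\<close>

section \<open>Convex combinations of inner automorphisms\<close>

lemma sum_nonneg_Reals:"(\<And>i. i \<in> I \<Longrightarrow> f i \<in> \<real>\<^sub>\<ge>\<^sub>0) \<Longrightarrow> sum f I \<in> (\<real>\<^sub>\<ge>\<^sub>0 :: complex set)"
 by (induction I rule: infinite_finite_induct) (auto intro: nonneg_Reals_add_I)

context
 fixes U :: "'h :: complex_hilbert bop set"
 assumes U:"!!u. u:U==>adj u * u=1" "!!u. u:U==>u * adj u=1"
begin

lemma cc_step:
 assumes "Ph:convex_combinations_Ad U" "u:U" "0<=s" "s<=1"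
 shows "(%T. (1 - s) .* Ph T + s .* Ad u T):convex_combinations_Ad U"
proof -
 obtain n c v where h:"ALL i<n. 0<=c i&v i:U" "(SUM i<n. c i)=1" "Ph=(%T. SUM i<n::nat. c i .* Ad (v i) T)"
  using assms(1) unfolding convex_combinations_Ad_def by blast
 have "(SUM i<n. (if i<n then (1 - s) * c i else s))=(1 - s)" using h(2) by (simp flip: sum_distrib_left)
 moreover have "(SUM i<n. (if i<n then (1 - s) * c i else s) .* Ad (if i<n then v i else u) T)=(1 - s) .* Ph T" for T
  unfolding h(3) scaleR_sum_right by (intro sum.cong) auto
 ultimately show ?thesis unfolding convex_combinations_Ad_def mem_Collect_eq
  by (intro exI[of _ "Suc n"] exI[of _ "%i. if i<n then (1 - s) * c i else s"] exI[of _ "%i. if i<n then v i else u"])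
   (use h assms in auto)
qed

lemma cc_single:"u:U==>Ad u:convex_combinations_Ad U"
 unfolding convex_combinations_Ad_def mem_Collect_eq
 by (intro exI[of _ 1] exI[of _ "%_. 1"] exI[of _ "%_. u"]) auto

context
 fixes Ph assumes Ph: "Ph:convex_combinations_Ad U"
begin

lemma cc_linear:"Ph (S+T)=Ph S+Ph T" "Ph (c :* T)=c :* Ph T"
 and cc_one:"Ph 1=1" and cc_positive_matrix:"positive_matrix n X==>positive_matrix n (%i j. Ph (X i j))"
 and cc_in:"walg N==>U<=N==>T:N==>Ph T:N" and cc_bnd:"bnd C T==>bnd C (Ph T)"
 and cc_pos:"pos T==>pos (Ph T)"
proof -
 obtain m a v where h:"!!i. i<m==>0<=a i" "!!i. i<m==>v i:U" "(SUM i<m. a i)=1" "Ph=(%T. SUM i<m::nat. a i .* Ad (v i) T)"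
  using Ph unfolding convex_combinations_Ad_def by blast
 show "Ph (S+T)=Ph S+Ph T" "Ph (c :* T)=c :* Ph T"
  by (simp_all add: h(4) Ad_def algebra_simps sum.distrib scaleC_sum_right scaleC_scaleR scaleR_add_right)
 have "Ph 1=(SUM i<m. a i .* 1)" unfolding h(4) by (intro sum.cong) (auto simp: Ad_def U h(2))
 thus "Ph 1=1" by (simp add: h(3) flip: scaleR_sum_left)
 show "pos T==>pos (Ph T)" unfolding h(4) Ad_def
  by (intro pos_sum pos_scaleR pos_conj') (use h(1) in auto)
 show "Ph T:N" if N:"walg N" "U<=N" "T:N"
 proof -
  interpret walg N by (rule N(1))
  show ?thesis unfolding h(4) Ad_def using h(2) N by (intro w_sum w_scaleR w_mult w_adj) auto
 qed
 show "bnd C (Ph T)" if C:"bnd C T"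
 proof (rule bndI[OF bndD(2)[OF C]])
  fix x
  have b:"bnd 1 (v i)" if "i<m" for i by (rule le_imp_bnd) (simp_all add: U(1)[OF h(2)[OF that]])
  have "norm (Ph T x)<=(SUM i<m. a i*(C * norm x))"
   unfolding h(4) bop_sum_apply
  proof (rule sum_norm_le)
   fix i assume "i:{..<m}"
   hence i:"i<m" by simp
   have "norm ((v i*T * adj (v i)) x)<=(1*C*1) * norm x" by (rule bndD(1)[OF bnd_mult[OF bnd_mult[OF b[OF i] C] bnd_adj[OF b[OF i]]]])
   thus "norm ((a i .* Ad (v i) T) x)<=a i*(C * norm x)" using h(1)[OF i] by (simp add: Ad_def mult_left_mono)
  qed
  also have "...=C * norm x" using h(3) by (simp flip: sum_distrib_right)
  finally show "norm (Ph T x)<=C * norm x" .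
 qed
 show "positive_matrix n (%i j. Ph (X i j))" if X:"positive_matrix n X"
  unfolding positive_matrix_def
 proof
  fix x :: "nat=>'h"
  let ?s = "%k. SUM i<n. SUM j<n. cinner (adj (v k) (x i)) (X i j (adj (v k) (x j)))"
  have "(SUM i<n. SUM j<n. cinner (x i) (Ph (X i j) (x j)))=(SUM i<n. SUM j<n. SUM k<m. of_real (a k) * cinner (adj (v k) (x i)) (X i j (adj (v k) (x j))))"
   by (simp add: h(4) Ad_def bop_sum_apply cinner_sum_right cinner_scaleR_right adj_left)
  also have "...=(SUM i<n. SUM k<m. SUM j<n. of_real (a k) * cinner (adj (v k) (x i)) (X i j (adj (v k) (x j))))"
   by (intro sum.cong refl sum.swap)
  also have "...=(SUM k<m. SUM i<n. SUM j<n. of_real (a k) * cinner (adj (v k) (x i)) (X i j (adj (v k) (x j))))"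
   by (rule sum.swap)
  also have "...=(SUM k<m. of_real (a k) * ?s k)" by (simp add: sum_distrib_left)
  also have "\<dots> \<in> \<real>\<^sub>\<ge>\<^sub>0"
  proof (rule sum_nonneg_Reals)
   fix k assume "k:{..<m}"
   hence "of_real (a k):(nonneg_Reals :: complex set)" using h(1) by simp
   moreover have "?s k:nonneg_Reals" using spec[OF X[unfolded positive_matrix_def], of "%i. adj (v k) (x i)"] .
   ultimately show "of_real (a k) * ?s k:nonneg_Reals" by (rule nonneg_Reals_mult_I)
  qed
  finally show "(SUM i<n. SUM j<n. cinner (x i) (Ph (X i j) (x j))):nonneg_Reals" .
 qed
qed

end

end

lemma von_neumann_generated:"von_neumann_algebra (vn_generated S)"
proof -
 let ?K = "{N. von_neumann_algebra N&S<=N}"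
 have "von_neumann_algebra (UNIV :: 'a bop set)"
  unfolding von_neumann_algebra_def by (auto) (metis closedin_topspace topspace_sigma_weak)
 hence ne:"?K~={}" by blast
 have "closedin sigma_weak (\<Inter>?K)"
  by (rule closedin_Inter[OF ne]) (simp add: von_neumann_algebra_def)
 thus ?thesis unfolding vn_generated_def by (auto simp: von_neumann_algebra_def)
qed

context setting
begin

lemma unitary_image:"H.TA.unitary_group=rho ` unitaries A"
proof -
 have eq:"adj (rho v)*rho v=1\<longleftrightarrow>adj v * v=1" "rho v * adj (rho v)=1\<longleftrightarrow>v * adj v=1" if v:"v:A" for v
 proof -
  have vM:"v:M" by (rule EAK.BM[OF v])
  have "adj (rho v)*rho v=rho (adj v * v)" "rho v * adj (rho v)=rho (v * adj v)" using vM by (simp_all add: R.rho_mult R.rho_adj EK.M.w_ins)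
  thus "adj (rho v)*rho v=1\<longleftrightarrow>adj v * v=1" "rho v * adj (rho v)=1\<longleftrightarrow>v * adj v=1"
   using inj_onD[OF R.inj, of "adj v * v" 1] inj_onD[OF R.inj, of "v * adj v" 1] R.rho_one vM EK.M.w_ins by auto
 qed
 show ?thesis unfolding H.TA.unitary_group_def unitaries_def unit_of_walg[OF walgs(2)] using eq by auto
qed

abbreviation UU where "UU\<equiv>rho ` unitaries A"
abbreviation CC where "CC\<equiv>convex_combinations_Ad UU"

lemma UU:"u:UU==>adj u * u=1" "u:UU==>u * adj u=1" "u:UU==>u:rho ` A"
 using H.TA.unitary_groupD unfolding unitary_image by blast+

lemma one_UU:"1:UU" unfolding unitary_image[symmetric] H.TA.unitary_group_def by (simp add: H.EA.B.w_one)

definition ps :: "'h bop=>real" where "ps T=Re (cinner xi (T xi))"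

lemma ps_simps:"ps (S+T)=ps S + ps T" "ps (r .* T)=r * ps T" "ps (SUM i:I. f i)=(SUM i:I. ps (f i))"
 by (simp_all add: ps_def cinner_simps bop_sum_apply cinner_sum_right)

lemma weight:"Re (cinner y ((a * e * adj a) y))=(norm (e (adj a y)))^2"
proof -
 have "a * e * adj a=adj (e * adj a)*(e * adj a)" using H.ee by (simp add: assoc) (metis assoc)
 thus ?thesis using Re_cinner_adj_mult[of y "e * adj a"] by simp
qed

context
 fixes F :: "'k bop filter"
 assumes Fb:"F~=bot" and FU:"\<forall>\<^sub>F u in F. u:unitaries A"
  and F0:"!!a b. a:M==>b:M==>strongly_tendsto (%u. E (adj b * u * a)) 0 F"
begin

text \<open>Strong convergence on the original space makes \<open>adj (T u) * T u\<close> tend to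
  zero weakly and boundedly, hence in every normal state; \<open>phi\<close> reads off the norm on
  the standard space.\<close>

lemma net_zero_aux:
 assumes a:"a:M" and b:"b:M"
 shows "((%u. rho (E (adj b * u * a)) xi)--->0) F"
proof -
 obtain kp where k:"!!x. x:M==>phi x=cinner kp (amp x kp)" by (rule phi_vector) (rule that; assumption)
 obtain Ca Cb where C:"bnd Ca a" "bnd Cb b" using bnd_ex by metis
 define T where "T u=E (adj b * u * a)" for u
 have ev:"\<forall>\<^sub>F u in F. T u:M&bnd (Cb*1*Ca) (T u)"
 proof (rule eventually_mono[OF FU])
  fix u assume "u:unitaries A"
  hence uA:"u:A" "adj u * u=1" using unit_of_walg[OF walgs(2)] by (auto simp: unitaries_def)
  have ub:"bnd 1 u" by (rule le_imp_bnd) (use uA in simp_all)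
  have m:"adj b * u * a:M" using a b EAK.BM[OF uA(1)] by (intro EK.M.w_ins)
  show "T u:M&bnd (Cb*1*Ca) (T u)" unfolding T_def by (intro conjI E_bnd E_M m bnd_mult bnd_adj C ub)
 qed
 have "wlim (%u. adj (T u)*T u) 0 F"
  unfolding wlim_def
 proof (intro allI)
  fix x y
  have "((%u. cinner (T u x) (T u y))--->cinner (apply_op 0 x) (apply_op 0 y)) F"
   by (intro tendsto_cinner) (use F0[OF a b] in "simp_all add: strongly_tendsto_def T_def")
  thus "((%u. cinner x ((adj (T u)*T u) y))--->cinner x (apply_op 0 y)) F" by (simp add: adj_right)
 qed
 hence "wlim (%u. amp (adj (T u)*T u)) (amp 0) F"
  by (rule wlim_amp[where C = "(Cb*1*Ca)*(Cb*1*Ca)"]) (rule eventually_mono[OF ev], intro bnd_mult bnd_adj, auto)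
 hence "((%u. cinner kp (amp (adj (T u)*T u) kp))--->cinner kp (apply_op 0 kp)) F"
  unfolding wlim_def amp_zero by blast
 from tendsto_Re[OF this] have re:"((%u. Re (cinner kp (amp (adj (T u)*T u) kp)))--->0) F" by simp
 have "((%u. (norm (rho (T u) xi))^2)--->0) F"
 proof (rule Lim_transform_eventually[OF re])
  show "\<forall>\<^sub>F u in F. Re (cinner kp (amp (adj (T u)*T u) kp))=(norm (rho (T u) xi))^2"
  proof (rule eventually_mono[OF ev])
   fix u assume u:"T u:M&bnd (Cb*1*Ca) (T u)"
   hence m:"adj (T u)*T u:M" by (intro EK.M.w_ins) auto
   show "Re (cinner kp (amp (adj (T u)*T u) kp))=(norm (rho (T u) xi))^2"
    unfolding k[OF m, symmetric] using phi_norm[of "T u"] u by (simp only: Re_complex_of_real)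
  qed
 qed
 hence "((%u. sqrt ((norm (rho (T u) xi))^2))--->sqrt 0) F" by (rule tendsto_real_sqrt)
 hence "((%u. norm (rho (T u) xi))--->0) F" by simp
 thus ?thesis unfolding T_def by (rule tendsto_norm_zero_cancel)
qed

text \<open>Vectors \<open>rho b xi\<close> are dense, and on them \<open>e\<close> produces the
  expectation \<open>E\<close> of a product of the net with elements of M.\<close>

lemma net_zero: assumes m:"m:rho ` M" shows "((%u. e (m (rho u zt)))--->0) F"
proof (rule tendsto_by_approx)
 fix r :: real assume r:"0<r"
 obtain m' where m': "m':M" "m=rho m'" using m by blast
 obtain C where C:"bnd C m" using bnd_ex by blast
 have Cp:"0<C+1" using bndD(2)[OF C] by simp
 have "EX x:rho ` M. norm (zt - x xi)<r/(C+1)"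
  by (rule dense_approximation[OF H.M.w_csubspace]) (use H.cyc r Cp in "auto simp: clinear_on_def")
 then obtain b where b:"b:M" "norm (zt-rho b xi)<r/(C+1)" by blast
 have mb:"adj m':M" by (intro EK.M.w_adj m')
 have "((%u. e (m (rho u (rho b xi))))--->0) F"
 proof (rule Lim_transform_eventually[OF net_zero_aux[OF b(1) mb]], rule eventually_mono[OF FU])
  fix u assume "u:unitaries A"
  hence uM:"u:M" using EAK.BM by (auto simp: unitaries_def)
  have mM:"m' * u * b:M" by (intro EK.M.w_ins m' uM b)
  have "e (m (rho u (rho b xi)))=e (rho (m' * u * b) xi)" using m' uM b(1) by (simp add: R.rho_mult EK.M.w_ins)
  thus "rho (E (adj (adj m') * u * b)) xi=e (m (rho u (rho b xi)))" using e_rho[OF mM] by simp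
 qed
 moreover have "\<forall>\<^sub>F u in F. norm (e (m (rho u zt)) - e (m (rho u (rho b xi))))<=r"
 proof (rule eventually_mono[OF FU])
  fix u assume "u:unitaries A"
  hence ub:"bnd 1 (rho u)" by (intro le_imp_bnd) (use UU(1)[of "rho u"] in simp_all)
  have "norm ((e * m*rho u) (zt-rho b xi))<=(1*C*1) * norm (zt-rho b xi)"
   by (rule bndD(1)[OF bnd_mult[OF bnd_mult[OF H.e_bnd C] ub]])
  also have "...<=(C+1)*(r/(C+1))" using b(2) bndD(2)[OF C] by (intro mult_mono) auto
  also have "...=r" using Cp by simp
  finally show "norm (e (m (rho u zt)) - e (m (rho u (rho b xi))))<=r" by simp
 qed
 ultimately show "EX g l'. (g--->l') F&(\<forall>\<^sub>F u in F. norm (e (m (rho u zt)) - g u)<=r)&norm (0 - l')<=r"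
  using r by (intro exI[of _ "%u. e (m (rho u (rho b xi)))"] exI[of _ 0]) simp
qed

text \<open>The isometry t from \<open>min_center\<close> makes \<open>x\<close> nearly minimal, and
  a net unitary w applied before t makes the e-part small. Compression by t w obeys the same central
  bound because c commutes with w; unitaries approximate t w.\<close>

lemma joint_steering:
 assumes x:"x:rho ` A" "adj x=x" and K:"finite K" "K<=rho ` M" and Z:"finite Z" and r:"0<r"
 shows "EX u:UU. ps (Ad u x)<=ps x + r&(SUM zt:Z. Re (cinner zt (Ad u (SUM a:K. a * e * adj a) zt)))<=r"
proof -
 define k where "k=(norm xi)^2+1"
 have k:"0<k" "(norm xi)^2<=k" by (simp_all add: k_def add_nonneg_pos)
 let ?r = "r/(2 * k)"
 have r2:"0<?r" using r k by simp
 obtain t a c where t:"t:rho ` A" "a:rho ` A" "c:rho ` A" "adj t * t=1" "adj a * a=1" "adj t * a=0"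
  "!!x. x:rho ` A==>c * x=x * c" "adj t * x * t[=c + ?r .* 1" "c[=x"
  by (rule H.TA.min_center[OF x r2]) (rule that; assumption)
 have "((%u. SUM zt:Z. SUM b:K. (norm (e ((adj b * t) (rho u zt))))^2)--->(SUM zt:Z. SUM b:K. (norm (0 :: 'h))^2)) F"
  by (intro tendsto_sum tendsto_power tendsto_norm net_zero) (use K t(1) H.AM in "auto intro!: H.M.w_mult H.M.w_adj")
 hence lim:"((%u. SUM zt:Z. SUM b:K. (norm (e ((adj b * t) (rho u zt))))^2)--->0) F" by simp
 obtain u where u:"u:unitaries A" "(SUM zt:Z. SUM b:K. (norm (e ((adj b * t) (rho u zt))))^2)<r"
  using eventually_happens'[OF Fb eventually_conj[OF FU order_tendstoD(2)[OF lim r]]] by blast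
 define w where "w=rho u"
 have w:"w:UU" "w:rho ` A" "adj w * w=1" "w * adj w=1" using UU u(1) by (auto simp: w_def)
 have T:"t * w:rho ` A" "adj (t * w)*(t * w)=1" "adj (t * w) * a=0"
 proof -
  show "t * w:rho ` A" by (intro H.EA.B.w_mult t w)
  have "adj (t * w)*(t * w)=adj w*(adj t * t) * w" by (simp add: assoc)
  thus "adj (t * w)*(t * w)=1" by (simp add: t(4) w)
  show "adj (t * w) * a=0" by (simp add: assoc t(6))
 qed
 obtain v :: "nat=>'h bop" where v:"!!n. v n:H.TA.unitary_group" "!!x. (%n. apply_op (adj (v n)) x)---->apply_op (t * w) x"
  by (rule H.TA.isometry_approximation[OF T(1,2) t(2,5) T(3)]) (rule that; assumption)
 have lim:"(%n. Re (cinner y (Ad (v n) X y)))---->Re (cinner ((t * w) y) (X ((t * w) y)))" for X y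
 proof -
  have "cinner y (Ad (v n) X y)=cinner (adj (v n) y) (X (adj (v n) y))" for n by (simp add: Ad_def adj_left)
  thus ?thesis by (simp only:) (intro tendsto_Re tendsto_cinner tendsto_bop v(2))
 qed
 have wc:"Re (cinner (w xi) (c (w xi)))=Re (cinner xi (c xi))"
 proof -
  have "adj w * c * w=c*(adj w * w)" using t(7)[OF H.EA.B.w_adj[OF w(2)]] by (metis assoc)
  hence "adj w * c * w=c" by (simp add: w)
  thus ?thesis by (metis adj_right bop_times_apply)
 qed
 have wn:"norm (w xi)=norm xi"
  using Re_cinner_adj_mult[of xi w] w(3) by (simp add: power2_norm_eq_Re_cinner[symmetric])
 have "Re (cinner ((t * w) xi) (x ((t * w) xi)))=Re (cinner (w xi) ((adj t * x * t) (w xi)))" by (simp add: adj_right)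
 also have "...<=Re (cinner (w xi) ((c + ?r .* 1) (w xi)))" by (rule ple_Re[OF t(8)])
 also have "...=Re (cinner (w xi) (c (w xi))) + ?r*(norm (w xi))^2"
  by (simp only: bop_plus_apply cinner_add_right plus_complex.simps Re_cinner_scaleR_one)
 also have "...<=ps x + ?r * k" using ple_Re[OF t(9), of xi] wc wn r2 k by (intro add_mono mult_left_mono) (auto simp: ps_def)
 also have "?r * k=r/2" using k by simp
 finally have b1:"Re (cinner ((t * w) xi) (x ((t * w) xi)))<ps x + r" using r by simp
 have b2:"(SUM zt:Z. Re (cinner ((t * w) zt) ((SUM a:K. a * e * adj a) ((t * w) zt))))<r"
 proof -
  have "Re (cinner ((t * w) zt) ((SUM a:K. a * e * adj a) ((t * w) zt)))=(SUM b:K. (norm (e ((adj b * t) (rho u zt))))^2)" for zt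
   unfolding bop_sum_apply cinner_sum_right Re_sum weight by (simp add: w_def)
  thus ?thesis using u(2) by simp
 qed
 have 1:"\<forall>\<^sub>F n in sequentially. Re (cinner xi (Ad (v n) x xi))<ps x + r" by (rule order_tendstoD(2)[OF lim b1])
 have "(%n. SUM zt:Z. Re (cinner zt (Ad (v n) (SUM a:K. a * e * adj a) zt)))---->(SUM zt:Z. Re (cinner ((t * w) zt) ((SUM a:K. a * e * adj a) ((t * w) zt))))"
  by (intro tendsto_sum lim)
 hence 2:"\<forall>\<^sub>F n in sequentially. (SUM zt:Z. Re (cinner zt (Ad (v n) (SUM a:K. a * e * adj a) zt)))<r" by (rule order_tendstoD(2)[OF _ b2])
 obtain n where "Re (cinner xi (Ad (v n) x xi))<ps x + r" "(SUM zt:Z. Re (cinner zt (Ad (v n) (SUM a:K. a * e * adj a) zt)))<r"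
  using eventually_happens'[OF sequentially_bot eventually_conj[OF 1 2]] by blast
 thus ?thesis using v(1)[of n] unfolding unitary_image by (intro bexI[of _ "v n"]) (auto simp: ps_def)
qed

text \<open>The quantity minimized below decreases along \<open>(1 - s) *\<^sub>R \<Phi> + s *\<^sub>R Ad u\<close> when \<open>u\<close> is chosen for the
  gradient \<open>\<Sum>x\<in>S. (ps (\<Phi> x) - ps x) *\<^sub>R x\<close>, so its infimum is zero.\<close>

lemma descent:
 assumes S:"finite S" "S<={x:rho ` A. adj x=x}" and K:"finite K" "K<=rho ` M" and Z:"finite Z" and r:"0<r"
 shows "EX Ph:CC. (SUM x:S. (ps (Ph x) - ps x)^2)+(SUM zt:Z. Re (cinner zt (Ph (SUM a:K. a * e * adj a) zt)))<r"
proof -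
 define dd where "dd=(SUM a:K. a * e * adj a)"
 define om where "om T=(SUM zt:Z. Re (cinner zt (apply_op T zt)))" for T
 have om_simps:"om (X+Y) = om X + om Y" "om (s .* X)=s * om X" for X Y s
  by (simp_all add: om_def cinner_simps sum.distrib sum_distrib_left)
 have ddp:"pos dd" unfolding dd_def
  by (intro pos_sum pos_conj' projection_positive H.e_projection)
 have omp:"0<= om T" if "pos T" for T unfolding om_def by (intro sum_nonneg posD(1)[OF that])
 define Q where "Q Ph=(SUM x:S. (ps (Ph x) - ps x)^2) + om (Ph dd)" for Ph
 have Q0:"0<=Q Ph" if "Ph:CC" for Ph
  unfolding Q_def using omp[OF cc_pos[OF UU(1,2) that ddp]] by (intro add_nonneg_nonneg sum_nonneg) auto
 have C1:"Ad 1:CC" by (rule cc_single[OF UU(1,2) one_UU])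
 define q where "q=Inf (Q ` CC)"
 have qb:"bdd_below (Q ` CC)" by (rule bdd_belowI2[of _ 0]) (rule Q0)
 have ql:"q<=Q Ph" if "Ph:CC" for Ph unfolding q_def by (rule cInf_lower[OF _ qb]) (use that in simp)
 have qn:"EX Ph:CC. Q Ph<z" if "q<z" for z
  using that cInf_less_iff[of "Q ` CC"] C1 qb unfolding q_def by auto
 have "EX \<beta>. ALL u:UU. (ps (Ad u x) - ps x)^2<=\<beta>" for x
 proof -
  obtain C where C:"bnd C x" using bnd_ex by blast
  have pb:"\<bar>ps X\<bar><=C*(norm xi)^2" if "bnd C X" for X
  proof -
   have "\<bar>ps X\<bar><=norm xi * norm (X xi)" unfolding ps_def using abs_Re_le_cmod cmod_cinner_le order_trans by blast
   also have "...<=norm xi*(C * norm xi)" by (intro mult_left_mono bndD(1)[OF that]) simp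
   finally show ?thesis by (simp add: power2_eq_square mult.commute mult.left_commute)
  qed
  have "(ps (Ad u x) - ps x)^2<=(2*(C*(norm xi)^2))^2" if u:"u:UU" for u
  proof -
   have "bnd C (Ad u x)" by (rule cc_bnd[OF UU(1,2) cc_single[OF UU(1,2) u] C])
   hence "\<bar>ps (Ad u x) - ps x\<bar><=2*(C*(norm xi)^2)" using pb[of "Ad u x"] pb[OF C] by linarith
   thus ?thesis by (metis power2_abs power_mono abs_ge_zero)
  qed
  thus ?thesis by blast
 qed
 then obtain \<beta> where be:"!!x u. u:UU==>(ps (Ad u x) - ps x)^2<=\<beta> x" by metis
 define Kc where "Kc=(SUM x:S. \<beta> x)"
 have Kc0:"0<=Kc" unfolding Kc_def by (intro sum_nonneg order_trans[OF zero_le_power2 be[OF one_UU]])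
 \<comment> \<open>One descent step of length \<open>s\<close> with steering tolerance
   \<open>t\<close>: the first-order terms cost at most \<open>4 * s * t\<close> and the
   second-order ones \<open>s^2 * Kc\<close>; dividing by \<open>s\<close> gives the bound.\<close>
 have key:"q<=4 * t + s*Kc" if t:"0<t" and s:"0<s" "s<=1" for t s
 proof -
  have st:"0<s * t" using t s by simp
  obtain Ph where Ph: "Ph:CC" "Q Ph<q + s * t" using qn[of "q + s * t"] st by auto
  define dl where "dl x=ps (Ph x) - ps x" for x
  define X where "X=(SUM x:S. dl x .* x)"
  have XA:"X:rho ` A" unfolding X_def using S by (intro H.EA.B.w_sum H.EA.B.w_scaleR) auto
  have Xa:"adj X=X" unfolding X_def adj_sum using S by (intro sum.cong) auto
  obtain u where u:"u:UU" "ps (Ad u X)<=ps X + t" "om (Ad u dd)<=t"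
   using joint_steering[OF XA Xa K Z t] unfolding om_def dd_def by blast
  define et where "et x=ps (Ad u x) - ps x" for x
  have AdX:"ps (Ad u X)=(SUM x:S. dl x * ps (Ad u x))"
   by (simp add: X_def Ad_def sum_distrib_left sum_distrib_right ps_simps)
  have de:"(SUM x:S. dl x*et x)<=t"
   using u(2) unfolding AdX by (simp add: X_def ps_simps et_def right_diff_distrib sum_subtractf)
  define Ph' where "Ph' T=(1 - s) .* Ph T + s .* Ad u T" for T
  have Ph'C:"Ph':CC" unfolding Ph'_def[abs_def] using s by (intro cc_step UU Ph u) auto
  have "(SUM x:S. (ps (Ph' x) - ps x)^2)=(1 - s)^2*(SUM x:S. (dl x)^2)+2 * s*(1 - s)*(SUM x:S. dl x*et x) + s^2*(SUM x:S. (et x)^2)"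
  proof -
   have "(ps (Ph' x) - ps x)^2=(1 - s)^2*(dl x)^2+2 * s*(1 - s)*(dl x*et x) + s^2*(et x)^2" for x
   proof -
    have "ps (Ph' x)=(1 - s) * ps (Ph x) + s * ps (Ad u x)" by (simp only: Ph'_def ps_simps)
    hence eq:"ps (Ph' x) - ps x=(1 - s)*dl x + s*et x" by (simp add: dl_def et_def algebra_simps)
    show ?thesis unfolding eq by (simp add: power2_eq_square algebra_simps)
   qed
   thus ?thesis by (simp add: sum.distrib sum_distrib_left)
  qed
  also have "...<=(1 - s)*(SUM x:S. (dl x)^2)+2 * s * t + s^2*Kc"
  proof (intro add_mono)
   show "(1 - s)^2*(SUM x:S. (dl x)^2)<=(1 - s)*(SUM x:S. (dl x)^2)"
    using s by (intro mult_right_mono sum_nonneg) (auto simp: power2_eq_square mult_left_le)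
   have "2 * s*(1 - s)*(SUM x:S. dl x*et x)<=2 * s*(1 - s) * t" using s de by (intro mult_left_mono) auto
   also have "...<=2 * s * t" using s t by (simp add: algebra_simps)
   finally show "2 * s*(1 - s)*(SUM x:S. dl x*et x)<=2 * s * t" .
   show "s^2*(SUM x:S. (et x)^2)<=s^2*Kc" unfolding Kc_def et_def by (intro mult_left_mono sum_mono be u) simp
  qed
  finally have 1:"(SUM x:S. (ps (Ph' x) - ps x)^2)<=(1 - s)*(SUM x:S. (dl x)^2)+2 * s * t + s^2*Kc" .
  have 2:"om (Ph' dd)<=(1 - s) * om (Ph dd) + s * t" using u(3) s by (simp add: Ph'_def om_simps)
  have "q<=Q Ph'" by (rule ql[OF Ph'C])
  also have "...<=(1 - s)*Q Ph+3 * s * t + s^2*Kc" using 1 2 by (simp add: Q_def dl_def[symmetric] algebra_simps)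
  also have "(1 - s)*Q Ph<=(1 - s)*(q + s * t)" using s Ph(2) by (intro mult_left_mono) auto
  finally have "s * q<=(1 - s)*(s * t)+3 * s * t + s^2*Kc" by (simp add: algebra_simps)
  also have "(1 - s)*(s * t)<=s * t" using st s by (simp add: mult_left_le_one_le)
  finally have "s * q<=s*(4 * t + s*Kc)" by (simp add: algebra_simps power2_eq_square)
  thus ?thesis using s(1) by (simp add: mult_le_cancel_left_pos)
 qed
 \<comment> \<open>Together with the tolerance \<open>r/16\<close> this step length makes both error
   terms at most \<open>r/4\<close>.\<close>
 define s where "s=min 1 (r/(4*(Kc+1)))"
 have s:"0<s" "s<=1" using r Kc0 by (auto simp: s_def)
 have "s*Kc<=r/(4*(Kc+1))*(Kc+1)" using Kc0 r by (intro mult_mono) (auto simp: s_def)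
 also have "...=r/4"
 proof -
  have "z~=0==>r/(4 * z) * z=r/4" for z by simp
  thus ?thesis using Kc0 by (metis add_nonneg_pos less_irrefl zero_less_one)
 qed
 finally have "q<r" using key[of "r/16" s] s r by simp
 thus ?thesis using qn unfolding Q_def om_def dd_def by blast
qed

text \<open>The sets \<open>G\<close> of combinations that are good for finite data are nonempty by
  \<open>descent\<close> and directed, so they form a filter base; \<open>W\<close> is a finer
  ultrafilter.\<close>

lemma limit_filter:
 obtains W :: "('h bop=>'h bop) filter" where "ultra W" "\<forall>\<^sub>F Ph in W. Ph:CC"
  "!!x. x:rho ` A==>adj x=x==>((%Ph. ps (Ph x))--->ps x) W"
  "!!a zt. a:rho ` M==>((%Ph. Re (cinner zt (apply_op (Ph (a * e * adj a)) zt)))--->0) W"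
proof -
 define G where "G=(%(S,K,Z,r). {Ph:CC. (ALL x:S. \<bar>ps (Ph x) - ps x\<bar><r)&(ALL a:K. ALL zt:Z. Re (cinner zt (apply_op (Ph (a * e * adj a)) zt))<(r :: real))})"
 define I where "I={(S,K,Z,r). finite S&S<={x:rho ` A. adj x=x}&finite K&K<=rho ` M&finite (Z :: 'h set)&0<(r :: real)}"
 define F' where "F'=(INF i\<in>I. principal (G i))"
 have evF:"eventually P F'\<longleftrightarrow>(EX i:I. ALL Ph:G i. P Ph)" for P
 proof -
  have "eventually P F'\<longleftrightarrow>(EX i:I. eventually P (principal (G i)))"
   unfolding F'_def
  proof (rule eventually_INF_base)
   have "({},{},{},1):I" by (simp add: I_def)
   thus "I~={}" by blast
   fix i j assume ij:"i:I" "j:I"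
   obtain S K Z r S' K' Z' r' where h:"i=(S,K,Z,r)" "j=(S',K',Z',r')" by (cases i; cases j) auto
   show "EX k:I. principal (G k)<=inf (principal (G i)) (principal (G j))"
    by (rule bexI[of _ "(S\<union>S',K\<union>K',Z\<union>Z',min r r')"]) (use ij in "auto simp: I_def G_def h")
  qed
  thus ?thesis by (simp add: eventually_principal)
 qed
 have Gne:"G i~={}" if "i:I" for i
 proof -
  obtain S K Z r where h:"i=(S,K,Z,r)" by (cases i) auto
  have i:"finite S" "S<={x:rho ` A. adj x=x}" "finite K" "K<=rho ` M" "finite Z" "0<r" using that by (auto simp: I_def h)
  \<comment> \<open>The deviations enter \<open>descent\<close> squared, so they need
    \<open>r^2\<close>; the e-part needs \<open>r\<close>.\<close>
  have "0<min r (r^2)" using i(6) by simp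
  then obtain Ph where Ph: "Ph:CC" "(SUM x:S. (ps (Ph x) - ps x)^2)+(SUM zt:Z. Re (cinner zt (Ph (SUM a:K. a * e * adj a) zt)))<min r (r^2)"
   using descent[OF i(1-5)] by blast
  have ap:"pos (a * e * adj a)" for a by (intro pos_conj' projection_positive H.e_projection)
  note fp = cc_pos[OF UU(1,2) Ph(1)]
  have dp:"0<=Re (cinner zt (Ph (SUM a:K. a * e * adj a) zt))" for zt by (intro posD(1) fp pos_sum ap)
  have s1:"0<=(SUM x:S. (ps (Ph x) - ps x)^2)" by (intro sum_nonneg) simp
  have s2:"0<=(SUM zt:Z. Re (cinner zt (Ph (SUM a:K. a * e * adj a) zt)))" by (intro sum_nonneg dp)
  have "\<bar>ps (Ph x) - ps x\<bar><r" if x:"x:S" for x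
  proof -
   have "(ps (Ph x) - ps x)^2<=(SUM x:S. (ps (Ph x) - ps x)^2)" by (rule member_le_sum[OF x _ i(1)]) simp
   hence "\<bar>ps (Ph x) - ps x\<bar>^2<r^2" using Ph(2) s2 by simp
   thus ?thesis by (rule power2_less_imp_less) (use i(6) in simp)
  qed
  moreover have "Re (cinner zt (Ph (a * e * adj a) zt))<r" if a:"a:K" and z:"zt:Z" for a zt
  proof -
   have "(SUM a:K. a * e * adj a)=a * e * adj a+(SUM a:K - {a}. a * e * adj a)" by (rule sum.remove[OF i(3) a])
   hence "Ph (SUM a:K. a * e * adj a)=Ph (a * e * adj a)+Ph (SUM a:K - {a}. a * e * adj a)"
    by (simp only: cc_linear[OF UU(1,2) Ph(1)])
   moreover have "0<=Re (cinner zt (Ph (SUM a:K - {a}. a * e * adj a) zt))" by (intro posD(1) fp pos_sum ap)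
   ultimately have "Re (cinner zt (Ph (a * e * adj a) zt))<=Re (cinner zt (Ph (SUM a:K. a * e * adj a) zt))" by (simp add: cinner_add_right)
   also have "...<=(SUM zt:Z. Re (cinner zt (Ph (SUM a:K. a * e * adj a) zt)))" by (rule member_le_sum[OF z dp i(5)])
   finally show ?thesis using Ph(2) s1 by linarith
  qed
  ultimately show ?thesis using Ph(1) unfolding G_def h by blast
 qed
 have "F'~=bot"
 proof
  assume "F'=bot"
  hence "eventually (%_. False) F'" by simp
  thus False unfolding evF using Gne by blast
 qed
 then obtain W where W:"W<=F'" "ultra W" using ex_ultra by blast
 have ev:"eventually P W" if "i:I" "!!Ph. Ph:G i==>P Ph" for P i
  by (rule filter_leD[OF W(1)]) (use evF that in blast)
 have ap:"pos (a * e * adj a)" for a by (intro pos_conj' projection_positive H.e_projection)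
 show ?thesis
 proof (rule that[OF W(2)])
  show "\<forall>\<^sub>F Ph in W. Ph:CC" by (rule ev[of "({},{},{},1)"]) (auto simp: I_def G_def)
  show "((%Ph. ps (Ph x))--->ps x) W" if "x:rho ` A" "adj x=x" for x
  proof (rule tendstoI)
   fix r :: real assume "0<r"
   thus "\<forall>\<^sub>F Ph in W. dist (ps (Ph x)) (ps x)<r"
    by (intro ev[of "({x},{},{},r)"]) (use that in "auto simp: I_def G_def dist_real_def")
  qed
  show "((%Ph. Re (cinner zt (apply_op (Ph (a * e * adj a)) zt)))--->0) W" if a:"a:rho ` M" for a zt
  proof (rule tendstoI)
   fix r :: real assume r:"0<r"
   show "\<forall>\<^sub>F Ph in W. dist (Re (cinner zt (apply_op (Ph (a * e * adj a)) zt))) 0<r"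
   proof (rule ev[of "({},{a},{zt},r)"])
    fix Ph assume "Ph:G ({},{a},{zt},r)"
    hence h:"Ph:CC" "Re (cinner zt (apply_op (Ph (a * e * adj a)) zt))<r" by (auto simp: G_def)
    thus "dist (Re (cinner zt (apply_op (Ph (a * e * adj a)) zt))) 0<r"
     using posD(1)[OF cc_pos[OF UU(1,2) h(1) ap], of zt] by (simp add: dist_real_def)
   qed (use a r in "simp add: I_def")
  qed
 qed
qed

text \<open>The pointwise weak limit along \<open>W\<close> exists by boundedness and inherits
  complete positivity. It maps M into itself, preserves the composition of \<open>phi\<close> with
  \<open>EA\<close> there, and annihilates the operators \<open>a * e * adj a\<close>.\<close>

theorem ucp_exists:
 "EX Ps. ucp_map (basic_construction M rho e) Ps &
   point_sigma_weak_limit (basic_construction M rho e) (convex_combinations_Ad (rho ` unitaries A)) Ps &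
   normal_on (rho ` M) Ps&(ALL a:M. ALL b:M. Ps (rho a * e * adj (rho b))=0)"
proof -
 let ?N = "basic_construction M rho e"
 have vN:"von_neumann_algebra ?N" unfolding basic_construction_def by (rule von_neumann_generated)
 have sub:"rho ` M<=?N" "e:?N" unfolding basic_construction_def vn_generated_def by blast+
 interpret N: walg ?N by (rule von_neumann_walg[OF vN]) (use sub H.M.w_one in blast)
 have UN:"UU<=?N" "UU<=rho ` M" using UU(3) sub EAK.BM by blast+
 obtain W where W:"ultra W" "\<forall>\<^sub>F Ph in W. Ph:CC"
  "!!x. x:rho ` A==>adj x=x==>((%Ph. ps (Ph x))--->ps x) W"
  "!!a zt. a:rho ` M==>((%Ph. Re (cinner zt (apply_op (Ph (a * e * adj a)) zt)))--->0) W"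
  by (rule limit_filter) (rule that; assumption)
 note Wb = ultraD[OF W(1)]
 have evb:"\<forall>\<^sub>F Ph in W. bnd C (Ph T)" if C:"bnd C T" for C T
  by (rule eventually_mono[OF W(2)]) (rule cc_bnd[OF UU(1,2) _ C])
 have "ALL T. EX L. wlim (%Ph. Ph T) L W"
 proof
  fix T :: "'h bop"
  obtain C where C:"bnd C T" using bnd_ex by blast
  show "EX L. wlim (%Ph. Ph T) L W" using ultra_wlim[OF W(1) evb[OF C]] by blast
 qed
 then obtain Ps where Ps: "!!T. wlim (%Ph. Ph T) (Ps T) W" by metis
 have cong:"wlim f L W" if "wlim g L W" "!!Ph. Ph:CC==>f Ph=g Ph" for f g :: "('h bop=>'h bop)=>'h bop" and L
  unfolding wlim_def
 proof (intro allI)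
  fix x y
  show "((%Ph. cinner x (f Ph y))--->cinner x (L y)) W"
   by (rule Lim_transform_eventually[OF that(1)[unfolded wlim_def, rule_format]]) (rule eventually_mono[OF W(2)], simp add: that(2))
 qed
 have inN:"Ps T:N'" if N': "walg N'" "UU<=N'" "T:N'" for N' T
 proof -
  obtain C where C:"bnd C T" using bnd_ex by blast
  show ?thesis
  proof (rule wclosedD[OF walg.w_closed[OF N'(1)] Wb _ Ps])
   show "\<forall>\<^sub>F Ph in W. Ph T:N'&bnd C (Ph T)"
    by (rule eventually_mono[OF W(2)]) (use cc_in[OF UU(1,2) _ N'] cc_bnd[OF UU(1,2) _ C] in blast)
  qed
 qed
 have add:"Ps (S+T)=Ps S+Ps T" for S T
  by (rule wlim_unique[OF Ps _ Wb], rule cong[OF wlim_add[OF Ps Ps]]) (rule cc_linear(1)[OF UU(1,2)])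
 have sc:"Ps (c :* T)=c :* Ps T" for c T
  by (rule wlim_unique[OF Ps _ Wb], rule cong[OF wlim_scaleC[OF Ps]]) (rule cc_linear(2)[OF UU(1,2)])
 have one:"Ps 1=1"
  by (rule wlim_unique[OF Ps _ Wb], rule cong[OF wlim_const]) (rule cc_one[OF UU(1,2)])
 have lin:"linear_map_on X Ps" for X by (simp add: linear_map_on_def add sc)
 have mat:"positive_matrix n (%i j. Ps (X i j))" if X:"positive_matrix n X" for n X
  unfolding positive_matrix_def
 proof
  fix x :: "nat=>'h"
  have "((%Ph. SUM i<n. SUM j<n. cinner (x i) (apply_op (Ph (X i j)) (x j)))--->(SUM i<n. SUM j<n. cinner (x i) (apply_op (Ps (X i j)) (x j)))) W"
   by (intro tendsto_sum) (use Ps in "simp add: wlim_def")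
  hence l:"((%Ph. SUM i<n. SUM j<n. cinner (x i) (apply_op (Ph (X i j)) (x j)))--->(SUM i<n. SUM j<n. cinner (x i) (apply_op (Ps (X i j)) (x j)))) W" .
  have ev:"\<forall>\<^sub>F Ph in W. (\<Sum>i<n. \<Sum>j<n. cinner (x i) (apply_op (Ph (X i j)) (x j))) \<in> \<real>\<^sub>\<ge>\<^sub>0"
   by (rule eventually_mono[OF W(2)]) (use cc_positive_matrix[OF UU(1,2) _ X] in "simp add: positive_matrix_def")
  show "(SUM i<n. SUM j<n. cinner (x i) (apply_op (Ps (X i j)) (x j))):nonneg_Reals"
   by (rule Lim_in_closed_set[OF closed_nonneg_Reals_complex ev Wb l])
 qed
 have pos:"pos (Ps T)" if T:"pos T" for T
  by (rule pos_limit[where F = W and T = "%Ph. Ph T"])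
   (use Ps[of T] Wb in "simp_all add: wlim_def", rule eventually_mono[OF W(2)], rule cc_pos[OF UU(1,2) _ T])
 have ucp:"ucp_map ?N Ps"
  unfolding ucp_map_def unit_of_walg[OF N.walg_axioms]
  using inN[OF N.walg_axioms UN(1)] lin one mat by auto
 have lim:"point_sigma_weak_limit ?N CC Ps"
  unfolding point_sigma_weak_limit_def
 proof (intro exI[of _ W] conjI ballI Wb W(2))
  fix T :: "'h bop"
  obtain C where C:"bnd C T" using bnd_ex by blast
  show "limitin sigma_weak (%Ph. Ph T) (Ps T) W" by (rule wlim_limitin_sigma_weak[OF Ps evb[OF C]])
 qed
 have diag:"Ps (a * e * adj a)=0" if a:"a:rho ` M" for a
 proof (rule form_zero_imp_zero)
  fix x
  have "((%Ph. Re (cinner x (apply_op (Ph (a * e * adj a)) x)))--->Re (cinner x (apply_op (Ps (a * e * adj a)) x))) W"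
   using Ps[of "a * e * adj a"] by (intro tendsto_Re) (simp add: wlim_def)
  hence "Re (cinner x (apply_op (Ps (a * e * adj a)) x))=0" using W(4)[OF a] tendsto_unique[OF Wb] by blast
  moreover have "pos (Ps (a * e * adj a))" by (intro pos pos_conj' projection_positive H.e_projection)
  ultimately show "cinner x (apply_op (Ps (a * e * adj a)) x)=0" using posD(2) by (simp add: complex_eq_iff)
 qed
 have zero:"Ps (a * e * adj b)=0" if ab:"a:rho ` M" "b:rho ` M" for a b
 proof -
  \<comment> \<open>Polarization: expanding \<open>?q\<close> at \<open>c = 1\<close> and at the
    imaginary unit separates the two mixed terms.\<close>
  let ?q = "%c. (a + c :* b) * e * adj (a + c :* b)"
  have qz:"Ps (?q c)=0" for c by (intro diag H.M.w_add H.M.w_scaleC ab)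
  have e1:"?q c=a * e * adj a+(cnj c :* (a * e * adj b)+(c :* (b * e * adj a)+(c * cnj c) :* (b * e * adj b)))" for c
   by (simp add: algebra_simps scaleC_scaleC scaleC_add_right)
  have "cnj c :* Ps (a * e * adj b) + c :* Ps (b * e * adj a)=0" for c
   using qz[of c] unfolding e1 by (simp only: add sc diag ab) (simp add: scaleC_zero_right)
  from this[of 1] this[of \<i>] have "Ps (a * e * adj b)+Ps (b * e * adj a)=0" "- \<i> :* Ps (a * e * adj b)+\<i> :* Ps (b * e * adj a)=0"
   by (simp_all add: scaleC_one)
  hence h:"Ps (a * e * adj b)+Ps (b * e * adj a)=0"
   "\<i> :* (- \<i> :* Ps (a * e * adj b)+\<i> :* Ps (b * e * adj a))=0" by (simp_all add: scaleC_zero_right)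
  have "Ps (a * e * adj b)=Ps (b * e * adj a)"
   using h(2) by (simp add: scaleC_add_right scaleC_diff_right scaleC_scaleC scaleC_one scaleC_minus_left)
  hence "2 .* Ps (a * e * adj b)=0" using h(1) by (simp add: scaleR_2)
  thus ?thesis by simp
 qed
 have UM:"Ps X:rho ` M" if "X:rho ` M" for X by (rule inN[OF H.M.walg_axioms UN(2) that])
 \<comment> \<open>Conjugation by unitaries of A commutes with \<open>EA\<close>. The composed state
   at \<open>Ph x\<close> is therefore \<open>phi\<close> at \<open>Ph\<close> of
   \<open>EA x\<close>, which converges to its initial value by the choice of
   \<open>W\<close>.\<close>
 have invariant:"Re (phi (EA y))=Re (phi (EA x))" if x:"x:M" "adj x=x" and y:"y:M" "Ps (rho x)=rho y" for x y
 proof -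
  obtain C where C:"bnd C x" using bnd_ex by blast
  obtain kp where k:"!!x. x:M==>phi (EA x)=cinner kp (amp x kp)" by (rule psi_vector) (rule that; assumption)
  have "ALL Ph. EX z. Ph:CC-->z:M&rho z=Ph (rho x)"
  proof
   fix Ph
   have "Ph (rho x):rho ` M" if "Ph:CC" by (rule cc_in[OF UU(1,2) that H.M.walg_axioms UN(2) imageI[OF x(1)]])
   thus "EX z. Ph:CC-->z:M&rho z=Ph (rho x)" by (metis imageE)
  qed
  then obtain z where z:"!!Ph. Ph:CC==>z Ph:M" "!!Ph. Ph:CC==>rho (z Ph)=Ph (rho x)" by metis
  have zb:"bnd C (z Ph)" if "Ph:CC" for Ph
   using cc_bnd[OF UU(1,2) that, of C "rho x"] R.rho_bnd_iff[OF x(1)] R.rho_bnd_iff[OF z(1)[OF that]] z(2)[OF that] C by simp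
  have e1:"\<forall>\<^sub>F Ph in W. z Ph:M" "\<forall>\<^sub>F Ph in W. bnd C (z Ph)" by (rule eventually_mono[OF W(2)], erule z zb)+
  obtain L where L:"L:M" "wlim z L W" using EK.M.w_ultra_limit[OF W(1) e1] by blast
  have "wlim (%Ph. rho (z Ph)) (rho L) W" by (rule normal_wlim[OF R.rho_normal L(2) e1 L(1)])
  hence "wlim (%Ph. Ph (rho x)) (rho L) W" by (rule cong) (simp add: z)
  hence "rho L=rho y" using wlim_unique[OF _ Ps Wb] y(2) by metis
  hence Ly:"L=y" using inj_onD[OF R.inj] L(1) y(1) by blast
  have "wlim (%Ph. amp (z Ph)) (amp y) W" using wlim_amp[OF L(2) e1(2)] Ly by simp
  hence "((%Ph. Re (cinner kp (amp (z Ph) kp)))--->Re (phi (EA y))) W" unfolding k[OF y(1)] by (intro tendsto_Re) (simp add: wlim_def)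
  moreover have "((%Ph. Re (cinner kp (amp (z Ph) kp)))--->Re (phi (EA x))) W"
  proof (rule Lim_transform_eventually[OF _ eventually_mono[OF W(2)]])
   have xa:"adj (rho (EA x))=rho (EA x)" using R.rho_adj[OF EA_M[OF x(1)]] EAK.E_adj[OF x(1)] x(2) by simp
   have "((%Ph. ps (Ph (rho (EA x))))--->ps (rho (EA x))) W" by (rule W(3)[OF _ xa]) (use EAK.E_in[OF x(1)] in blast)
   thus "((%Ph. ps (Ph (rho (EA x))))--->Re (phi (EA x))) W" by (simp add: ps_def phi(4)[OF EA_M[OF x(1)]])
   fix Ph assume Ph: "Ph:CC"
   obtain n c u where h:"ALL i<n. 0<=c i&u i:UU" "Ph=(%T. SUM i<n::nat. c i .* Ad (u i) T)"
    using Ph unfolding convex_combinations_Ad_def by blast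
   have "ALL i. EX v. i<n-->v:A&u i=rho v" using h(1) UU(3) by blast
   then obtain v where v:"!!i. i<n==>v i:A" "!!i. i<n==>u i=rho (v i)" by metis
   have "EA (v i * x * adj (v i))=v i*EA x * adj (v i)" if "i<n" for i by (rule EAK.E_bimodule[OF v(1)[OF that] EAK.B.w_adj[OF v(1)[OF that]] x(1)])
   have rA:"rho (v i*X * adj (v i))=Ad (u i) (rho X)" if "i<n" "X:M" for i X
    using v(1)[OF that(1)] EAK.BM that(2) by (simp add: Ad_def v(2)[OF that(1)] R.rho_mult R.rho_adj EK.M.w_ins)
   have vM:"v i*X * adj (v i):M" if "i<n" "X:M" for i X using v(1)[OF that(1)] EAK.BM that(2) by (simp add: EK.M.w_ins)
   have sumM:"(SUM i<n. c i .* (v i*X * adj (v i))):M" if "X:M" for X by (intro EK.M.w_sum EK.M.w_scaleR vM that) simp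
   have rs:"rho (SUM i<m. c i .* (v i*X * adj (v i)))=(SUM i<m. c i .* Ad (u i) (rho X))" if "m<=n" "X:M" for m X
    using that(1)
   proof (induction m)
    case (Suc m)
    have "(SUM i<m. c i .* (v i*X * adj (v i))):M" by (intro EK.M.w_sum EK.M.w_scaleR vM that(2)) (use Suc.prems in simp)
    thus ?case using Suc vM[of m X] that(2) by (simp add: R.rho_add R.rho_scaleR rA EK.M.w_scaleR)
   qed (simp add: R.rho_zero)
   have zeq:"z Ph=(SUM i<n. c i .* (v i * x * adj (v i)))"
    by (rule inj_onD[OF R.inj _ z(1)[OF Ph] sumM[OF x(1)]]) (use z(2)[OF Ph] rs[OF order_refl x(1)] fun_cong[OF h(2), of "rho x"] in simp)
   have Esum:"EA (SUM i<m. c i .* (v i * x * adj (v i)))=(SUM i<m. c i .* (v i*EA x * adj (v i)))" if "m<=n" for m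
    using that
   proof (induction m)
    case (Suc m)
    have "(SUM i<m. c i .* (v i * x * adj (v i))):M" by (intro EK.M.w_sum EK.M.w_scaleR vM x) (use Suc.prems in simp)
    moreover have "EA (v m * x * adj (v m))=v m*EA x * adj (v m)"
     using Suc.prems v(1)[of m] by (intro EAK.E_bimodule x EAK.B.w_adj) auto
    ultimately show ?case using Suc vM[of m x] x(1) by (simp add: EAK.E_add EAK.E_scaleR EK.M.w_scaleR)
   qed (simp add: EAK.E_zero)
   have "EA (z Ph)=(SUM i<n. c i .* (v i*EA x * adj (v i)))" unfolding zeq by (rule Esum) simp
   hence "rho (EA (z Ph))=Ph (rho (EA x))" using rs[OF order_refl EA_M[OF x(1)]] by (simp only: h(2))
   thus "ps (Ph (rho (EA x)))=Re (cinner kp (amp (z Ph) kp))"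
    unfolding k[OF z(1)[OF Ph], symmetric] phi(4)[OF EA_M[OF z(1)[OF Ph]]] by (simp add: ps_def)
  qed
  ultimately show ?thesis using tendsto_unique[OF Wb] by blast
 qed
 have normal:"normal_on (rho ` M) Ps"
 proof (rule normal_mapI[where kp = "l2_single 0 xi", OF H.M.walg_axioms lin pos[OF pos_adj_mult]])
  fix X zt assume X:"!!n. X n:rho ` M" "!!n. pos (X n)" "!!n. X n[=1"
   and l:"(%n. Re (cinner (l2_single 0 xi) (amp (X n) (l2_single 0 xi))))---->0"
  have "ALL n. EX z. z:M&X n=rho z" using X(1) by blast
  then obtain x where x:"!!n. x n:M" "!!n. X n=rho (x n)" by metis
  have xp:"pos (x n)" "x n[=1" for n
   using X(2,3)[of n] R.positive_rho[OF x(1)] R.positive_rho[of "1 - x n"] x by (simp_all add: R.rho_diff R.rho_one EK.M.w_ins)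
  have "ALL n. EX z. z:M&Ps (X n)=rho z" using UM[OF X(1)] by blast
  then obtain y where y:"!!n. y n:M" "!!n. Ps (X n)=rho (y n)" by metis
  have PX:"pos (Ps (X n))" "Ps (X n)[=1" for n
  proof -
   show "pos (Ps (X n))" by (rule pos[OF X(2)])
   have "Ps (1-X n)+Ps (X n)=1" using one by (simp flip: add)
   hence "1-Ps (X n)=Ps (1-X n)" by (simp add: algebra_simps)
   thus "Ps (X n)[=1" using pos[OF X(3)[of n]] by simp
  qed
  have yp:"pos (y n)" "y n[=1" for n
   using PX[of n] R.positive_rho[OF y(1)] R.positive_rho[of "1 - y n"] y by (simp_all add: R.rho_diff R.rho_one EK.M.w_ins)
  have control:"(%n. f' (s n))---->0"
   if lim:"(%n. f (s n))---->0" and s:"!!n. s n:M" "!!n. pos (s n)" "!!n. s n[=1"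
    and c:"!!r. 0<r==>EX d>0. ALL X:M. pos X-->X[=1-->f X<d-->f' X<r" and nn:"!!n. 0<=f' (s n)"
   for f f' :: "'k bop=>real" and s
  proof (rule tendstoI)
   fix r :: real assume "0<r"
   then obtain d where d:"0<d" "!!X. X:M==>pos X==>X[=1==>f X<d==>f' X<r" using c by blast
   show "\<forall>\<^sub>F n in sequentially. dist (f' (s n)) 0<r"
    by (rule eventually_mono[OF order_tendstoD(2)[OF lim d(1)]]) (use d(2)[OF s] nn in "simp add: dist_real_def")
  qed
  have nn:"0<=Re (phi (EA s))" "0<=Re (phi s)" if "s:M" "pos s" for s
   using P.g_positive(1) that EA_M EAK.E_pos by auto
  \<comment> \<open>Smallness passes from \<open>phi\<close> to its composition with
    \<open>EA\<close>, is carried over to the images under \<open>Ps\<close> by invariance, and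
    passes back to \<open>phi\<close>.\<close>
  have "(%n. Re (phi (x n)))---->0" using l by (simp add: cinner_l2_single_left phi(4)[OF x(1)] x(2))
  hence "(%n. Re (phi (EA (x n))))---->0" by (rule control[OF _ x(1) xp phi_controls nn(1)[OF x(1) xp(1)]])
  moreover have "Re (phi (EA (y n)))=Re (phi (EA (x n)))" for n
   using invariant[OF x(1) pos_adj[OF xp(1)] y(1)] y(2) x(2) by simp
  ultimately have "(%n. Re (phi (EA (y n))))---->0" by simp
  hence "(%n. Re (phi (y n)))---->0" by (rule control[OF _ y(1) yp psi_controls nn(2)[OF y(1) yp(1)]])
  hence "(%n. rho (y n) zt)---->0" by (rule state_limit_strong[OF y(1) yp])
  hence "(%n. Re (cinner zt (rho (y n) zt)))---->Re (cinner zt 0)" by (intro tendsto_Re tendsto_cinner tendsto_const)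
  thus "(%n. Re (cinner zt (Ps (X n) zt)))---->0" by (simp add: y(2))
 qed
 show ?thesis using ucp lim normal zero by blast
qed

end

end

theorem theoremC:
  fixes M A B :: "'k :: complex_hilbert bop set"
    and E :: "'k bop \<Rightarrow> 'k bop"
    and \<rho> :: "'k bop \<Rightarrow> 'h :: complex_hilbert bop"
    and J :: "'h \<Rightarrow> 'h" and P :: "'h set"
    and e :: "'h bop"
  assumes "von_neumann_algebra M" "1 \<in> M" "sigma_finite M"
    and "with_expectation A M" "1 \<in> A" "sigma_finite A" "type_III A"
    and "with_expectation B M" "1 \<in> B" "sigma_finite B" "type_III B"
    and "cond_expectation M B E"
    and "standard_representation M \<rho> J P"
    and "jones_projection M \<rho> P E e"
  shows "(intertwines M A B \<longleftrightarrow>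
            \<not> (\<exists>F. F \<noteq> bot \<and> (\<forall>\<^sub>F u in F. u \<in> unitaries A) \<and>
               (\<forall>a\<in>M. \<forall>b\<in>M. strongly_tendsto (\<lambda>u. E (adj b * u * a)) 0 F)))
       \<and> (intertwines M A B \<longleftrightarrow>
            \<not> (\<exists>\<Psi>. ucp_map (basic_construction M \<rho> e) \<Psi> \<and>
               point_sigma_weak_limit (basic_construction M \<rho> e)
                 (convex_combinations_Ad (\<rho> ` unitaries A)) \<Psi> \<and>
               normal_on (\<rho> ` M) \<Psi> \<and>
               (\<forall>a\<in>M. \<forall>b\<in>M. \<Psi> (\<rho> a * e * adj (\<rho> b)) = 0)))"
proof -
 have vA:"von_neumann_algebra A" "A<=M" and vB:"von_neumann_algebra B" "B<=M" using assms(4,8) by (auto simp: with_expectation_def)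
 have uA:"unit_of A=1" by (rule unit_of_walg[OF von_neumann_walg[OF vA(1) assms(5)]])
 have "corner 1 M=M" by (auto simp: corner_def)
 then obtain EA where EA:"cond_expectation M A EA" using assms(4) uA by (auto simp: with_expectation_def)
 obtain phi xi where phi:"faithful_normal_state M phi" "ALL x:M. phi (E x)=phi x" "xi:P" "ALL x:M. phi x=cinner xi (\<rho> x xi)"
   "ALL x:M. e (\<rho> x xi)=\<rho> (E x) xi"
  using assms(14) unfolding jones_projection_def by blast
 interpret S: setting M A B E EA \<rho> J P e phi xi
  by (rule setting.intro) (use assms vA vB EA phi in simp_all)
 let ?N2 = "EX F. F~=bot&(\<forall>\<^sub>F u in F. u:unitaries A)&(ALL a:M. ALL b:M. strongly_tendsto (%u. E (adj b * u * a)) 0 F)"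
 let ?N3 = "EX Ps. ucp_map (basic_construction M \<rho> e) Ps &
   point_sigma_weak_limit (basic_construction M \<rho> e) (convex_combinations_Ad (\<rho> ` unitaries A)) Ps &
   normal_on (\<rho> ` M) Ps&(ALL a:M. ALL b:M. Ps (\<rho> a * e * adj (\<rho> b))=0)"
 have 1:"~ ?N3" if "intertwines M A B" using S.intertwines_imp_no_ucp[OF that] by blast
 have 2: ?N3 if n2: ?N2
 proof -
  obtain F where F:"F~=bot" "\<forall>\<^sub>F u in F. u:unitaries A" "ALL a:M. ALL b:M. strongly_tendsto (%u. E (adj b * u * a)) 0 F"
   using n2 by blast
  show ?thesis by (rule S.ucp_exists[OF F(1,2) bspec[OF bspec[OF F(3)]]])
 qed
 have 3:"intertwines M A B" if "~ ?N2" by (rule S.mass_imp_intertwines[OF that])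
 show ?thesis using 1 2 3 by blast
qed

end
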